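(* Let $(G,\varepsilon_G)$ be a graded topological group and let $(U,\mathcal H)$ be an antiunitary representation of $(G,\varepsilon_G)$ on a complex Hilbert space $\mathcal H$. Then the map $$\mathcal V_U:\mathrm{Hom}_{\rm gr}(\mathbb R^\times,G)\to\mathrm{Stand}(\mathcal H),\qquad \gamma\mapsto\mathcal V(U\circ\gamma),$$ is a morphism of dilation spaces.
   Context: A graded topological group is a topological group $G$ with a continuous surjective homomorphism $\varepsilon_G:G\to\{\pm1\}$. $\mathbb R^\times$ is graded by the sign. $\mathrm{AU}(\mathcal H)$ is the group of unitary and antiunitary operators with the strong operator topology, graded by $\varepsilon=1$ on unitaries and $-1$ on antiunitaries. For graded topological groups, $\mathrm{Hom}_{\rm gr}(G,H)$ is the set of continuous homomorphisms $\varphi$ with $\varepsilon_H\circ\varphi=\varepsilon_G$. An antiunitary representation of $(G,\varepsilon_G)$ is an element $U\in\mathrm{Hom}_{\rm gr}(G,\mathrm{AU}(\mathcal H))$. A dilation space is a set $M$ with operations $x\bullet_r y=:r_x(y)$, $r\in\mathbb R^\times$, satisfying $r_x(x)=x$, $r_x\circ s_x=(rs)_x$ and $r_x(y\bullet_s z)=r_x(y)\bullet_s r_x(z)$. A morphism $f$ satisfies $f(x\bullet_r y)=f(x)\bullet_r f(y)$ for all $r\in\mathbb R^\times$. Dilation structure on $\mathrm{Hom}_{\rm gr}(\mathbb R^\times,G)$: $(\gamma\bullet_r\eta)(s)=\gamma(r)\eta(s)\gamma(r)^{-1}$. A standard subspace is a closed real subspace $V\subseteq\mathcal H$ with $V\cap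 iV=\{0\}$ and $V+iV$ dense; $\mathrm{Stand}(\mathcal H)$ is the set of these. The closed antilinear operator $S(v+iw)=v-iw$ on $V+iV$ has polar decomposition $S=J_V\Delta_V^{1/2}$ with $\Delta_V=S^*S$ and $J_V$ an antiunitary involution with $J_V\Delta_VJ_V=\Delta_V^{-1}$. Dilation structure on $\mathrm{Stand}(\mathcal H)$: $V_1\bullet_{-1}V_2=J_{V_1}J_{V_2}V_2$, $V_1\bullet_{e^t}V_2=\Delta_{V_1}^{-it/2\pi}V_2$, and $V_1\bullet_{-e^t}V_2=V_1\bullet_{-1}(V_1\bullet_{e^t}V_2)$ for $t\in\mathbb R$. The bijection $\mathcal V:\mathrm{Hom}_{\rm gr}(\mathbb R^\times,\mathrm{AU}(\mathcal H))\to\mathrm{Stand}(\mathcal H)$ is $\mathcal V(\eta)=\mathrm{Fix}(J\Delta^{1/2})$, where $J=\eta(-1)$ and $\Delta$ is the positive selfadjoint operator determined by $\eta(e^t)=\Delta^{-it/2\pi}$ for all $t\in\mathbb R$. *)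

theory Defs
  imports "HOL-Analysis.Analysis" "HOL-Algebra.Group"
begin

section \<open>Graded topological groups\<close>

record 'a graded_top_group = "'a monoid" +
  topol :: "'a topology"
  grade :: "'a \<Rightarrow> int"

locale graded_topological_group = group G for G :: "('a, 'b) graded_top_group_scheme" (structure) +
  assumes topspace_topol: "topspace (topol G) = carrier G"
    and continuous_mult:
      "continuous_map (prod_topology (topol G) (topol G)) (topol G) (\<lambda>(x, y). x \<otimes> y)"
    and continuous_inv: "continuous_map (topol G) (topol G) (\<lambda>x. inv x)"
    and continuous_grade: "continuous_map (topol G) (discrete_topology {1, -1}) (grade G)"
    and grade_mult: "x \<in> carrier G \<Longrightarrow> y \<in> carrier G \<Longrightarrow> grade G (x \<otimes> y) = grade G x * grade G y"
    and grade_surj: "grade G ` carrier G = {1, -1}"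

text \<open>Homomorphisms are taken extensional on the carrier, so that two elements of
  \<open>Hom_gr G H\<close> are equal iff they agree on \<open>carrier G\<close>.\<close>

definition Hom_gr ::
    "('a, 'c) graded_top_group_scheme \<Rightarrow> ('b, 'd) graded_top_group_scheme \<Rightarrow> ('a \<Rightarrow> 'b) set" where
  "Hom_gr G H = {\<phi> \<in> hom G H \<inter> extensional (carrier G).
     continuous_map (topol G) (topol H) \<phi> \<and> (\<forall>g \<in> carrier G. grade H (\<phi> g) = grade G g)}"

definition Rx :: "real graded_top_group" where
  "Rx = \<lparr>carrier = UNIV - {0}, mult = (*), one = 1,
         topol = top_of_set (UNIV - {0}), grade = (\<lambda>r. if r > 0 then 1 else -1)\<rparr>"


section \<open>Dilation spaces\<close>

text \<open>\<open>dil x r y\<close> is \<open>x \<bullet>\<^sub>r y = r\<^sub>x(y)\<close>; its values for \<open>r = 0\<close> are irrelevant.\<close>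

locale dilation_space =
  fixes M :: "'m set" and dil :: "'m \<Rightarrow> real \<Rightarrow> 'm \<Rightarrow> 'm"
  assumes dil_closed: "x \<in> M \<Longrightarrow> y \<in> M \<Longrightarrow> r \<noteq> 0 \<Longrightarrow> dil x r y \<in> M"
    and dil_self: "x \<in> M \<Longrightarrow> r \<noteq> 0 \<Longrightarrow> dil x r x = x"
    and dil_comp: "x \<in> M \<Longrightarrow> y \<in> M \<Longrightarrow> r \<noteq> 0 \<Longrightarrow> s \<noteq> 0 \<Longrightarrow>
      dil x r (dil x s y) = dil x (r * s) y"
    and dil_distrib: "x \<in> M \<Longrightarrow> y \<in> M \<Longrightarrow> z \<in> M \<Longrightarrow> r \<noteq> 0 \<Longrightarrow> s \<noteq> 0 \<Longrightarrow>
      dil x r (dil y s z) = dil (dil x r y) s (dil x r z)"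

locale dilation_morphism = source: dilation_space M dilM + target: dilation_space N dilN
  for M :: "'m set" and dilM and N :: "'n set" and dilN +
  fixes f :: "'m \<Rightarrow> 'n"
  assumes maps_to: "x \<in> M \<Longrightarrow> f x \<in> N"
    and equivariant: "x \<in> M \<Longrightarrow> y \<in> M \<Longrightarrow> r \<noteq> 0 \<Longrightarrow> f (dilM x r y) = dilN (f x) r (f y)"

definition hom_dilation ::
    "('g, 'b) graded_top_group_scheme \<Rightarrow> (real \<Rightarrow> 'g) \<Rightarrow> real \<Rightarrow> (real \<Rightarrow> 'g) \<Rightarrow> real \<Rightarrow> 'g" where
  "hom_dilation G \<gamma> r \<eta> =
     (\<lambda>s \<in> carrier Rx. \<gamma> r \<otimes>\<^bsub>G\<^esub> \<eta> s \<otimes>\<^bsub>G\<^esub> inv\<^bsub>G\<^esub> (\<gamma> r))"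


section \<open>Complex Hilbert spaces and the group AU\<close>

text \<open>The inner product is antilinear in the first and linear in the second argument. Its real
  part is the inner product of the underlying real Hilbert space, so that norm and topology are
  the usual ones.\<close>

class complex_hilbert_space = real_inner + complete_space +
  fixes scaleC :: "complex \<Rightarrow> 'a \<Rightarrow> 'a" (infixr "*\<^sub>C" 75)
    and cinner :: "'a \<Rightarrow> 'a \<Rightarrow> complex"
  assumes scaleC_add_right: "a *\<^sub>C (x + y) = a *\<^sub>C x + a *\<^sub>C y"
    and scaleC_add_left: "(a + b) *\<^sub>C x = a *\<^sub>C x + b *\<^sub>C x"
    and scaleC_scaleC: "a *\<^sub>C (b *\<^sub>C x) = (a * b) *\<^sub>C x"
    and scaleR_scaleC: "r *\<^sub>R x = complex_of_real r *\<^sub>C x"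
    and cinner_commute: "cinner x y = cnj (cinner y x)"
    and cinner_add_right: "cinner x (y + z) = cinner x y + cinner x z"
    and cinner_scaleC_right: "cinner x (a *\<^sub>C y) = a * cinner x y"
    and Re_cinner: "Re (cinner x y) = inner x y"

definition unitary :: "('h::complex_hilbert_space \<Rightarrow> 'h) \<Rightarrow> bool" where
  "unitary U \<longleftrightarrow> (\<forall>x y. U (x + y) = U x + U y) \<and> (\<forall>a x. U (a *\<^sub>C x) = a *\<^sub>C U x) \<and>
     surj U \<and> (\<forall>x y. cinner (U x) (U y) = cinner x y)"

definition antiunitary :: "('h::complex_hilbert_space \<Rightarrow> 'h) \<Rightarrow> bool" where
  "antiunitary U \<longleftrightarrow> (\<forall>x y. U (x + y) = U x + U y) \<and> (\<forall>a x. U (a *\<^sub>C x) = cnj a *\<^sub>C U x) \<and>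
     surj U \<and> (\<forall>x y. cinner (U x) (U y) = cnj (cinner x y))"

text \<open>Unitary and antiunitary operators are bounded and real linear, hence live in
  \<open>'h \<Rightarrow>\<^sub>L 'h\<close>. An operator is both unitary and antiunitary only if the space is \<open>{0}\<close>.\<close>

definition AU :: "('h::complex_hilbert_space \<Rightarrow>\<^sub>L 'h) graded_top_group" where
  "AU = \<lparr>carrier = {U. unitary (blinfun_apply U) \<or> antiunitary (blinfun_apply U)},
         mult = (o\<^sub>L), one = id_blinfun,
         topol = subtopology strong_operator_topology
                   {U. unitary (blinfun_apply U) \<or> antiunitary (blinfun_apply U)},
         grade = (\<lambda>U. if unitary (blinfun_apply U) then 1 else -1)\<rparr>"

definition antiunitary_representation ::
    "('g, 'b) graded_top_group_scheme \<Rightarrow> ('g \<Rightarrow> 'h::complex_hilbert_space \<Rightarrow>\<^sub>L 'h) \<Rightarrow> bool" where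
  "antiunitary_representation G U \<longleftrightarrow> U \<in> Hom_gr G AU"


section \<open>Unbounded operators and Borel functional calculus\<close>

text \<open>A possibly unbounded operator is represented by its graph, a set of pairs
  \<open>(x, A x)\<close> with \<open>x\<close> in the domain of \<open>A\<close>. Then \<open>A O B\<close> is the graph of \<open>B \<circ> A\<close> on its
  natural domain.\<close>

type_synonym 'h operator = "('h \<times> 'h) set"

definition op_graph :: "('h \<Rightarrow> 'h) \<Rightarrow> 'h operator" where
  "op_graph T = {(x, T x) | x. True}"

definition adjoint_op :: "'h::complex_hilbert_space operator \<Rightarrow> 'h operator" where
  "adjoint_op A = {(y, z). \<forall>(x, w) \<in> A. cinner y w = cinner z x}"

text \<open>The adjoint of an antilinear operator satisfies \<open>\<langle>y, S x\<rangle> = \<langle>x, S\<^sup>* y\<rangle>\<close>.\<close>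

definition antilinear_adjoint_op :: "'h::complex_hilbert_space operator \<Rightarrow> 'h operator" where
  "antilinear_adjoint_op S = {(y, z). \<forall>(x, w) \<in> S. cinner y w = cinner x z}"

text \<open>Linearity and single-valuedness of \<open>A\<close> follow from density of the domain and
  \<open>A = A\<^sup>*\<close>, which also makes \<open>\<langle>x, A x\<rangle>\<close> real.\<close>

definition positive_selfadjoint :: "'h::complex_hilbert_space operator \<Rightarrow> bool" where
  "positive_selfadjoint A \<longleftrightarrow> closure (Domain A) = UNIV \<and> adjoint_op A = A \<and>
     (\<forall>(x, y) \<in> A. Re (cinner x y) \<ge> 0)"

definition orthogonal_projection :: "('h::complex_hilbert_space \<Rightarrow> 'h) \<Rightarrow> bool" where
  "orthogonal_projection P \<longleftrightarrow> (\<forall>x y. P (x + y) = P x + P y) \<and> (\<forall>a x. P (a *\<^sub>C x) = a *\<^sub>C P x) \<and>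
     (\<forall>x. P (P x) = P x) \<and> (\<forall>x y. cinner (P x) y = cinner x (P y))"

text \<open>Projection-valued Borel measures on the real line. Extensionality fixes the values
  on non-Borel sets, so that spectral measures are unique as functions.\<close>

definition projection_valued_measure ::
    "(real set \<Rightarrow> 'h::complex_hilbert_space \<Rightarrow> 'h) \<Rightarrow> bool" where
  "projection_valued_measure E \<longleftrightarrow> E \<in> extensional (sets borel) \<and>
     (\<forall>B \<in> sets borel. orthogonal_projection (E B)) \<and> (\<forall>x. E UNIV x = x) \<and>
     (\<forall>B :: nat \<Rightarrow> real set. range B \<subseteq> sets borel \<longrightarrow> disjoint_family B \<longrightarrow>
        (\<forall>x. (\<lambda>n. E (B n) x) sums E (\<Union>n. B n) x))"

definition scalar_measure ::
    "(real set \<Rightarrow> 'h::complex_hilbert_space \<Rightarrow> 'h) \<Rightarrow> 'h \<Rightarrow> real measure" where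
  "scalar_measure E x = measure_of UNIV (sets borel) (\<lambda>B. ennreal (Re (cinner x (E B x))))"

definition simple_spectral_integral ::
    "(real set \<Rightarrow> 'h::complex_hilbert_space \<Rightarrow> 'h) \<Rightarrow> (real \<Rightarrow> complex) \<Rightarrow> 'h \<Rightarrow> 'h" where
  "simple_spectral_integral E s x = (\<Sum>c \<in> range s. c *\<^sub>C E (s -` {c}) x)"

text \<open>The normal operator \<open>\<integral> f dE\<close> for Borel \<open>f\<close>: its domain consists of those \<open>x\<close> for
  which \<open>f\<close> is square integrable with respect to \<open>\<langle>x, E(\<cdot>) x\<rangle>\<close>, and it is given there by
  approximating \<open>f\<close> in the mean square by simple functions.\<close>

definition spectral_integral ::
    "(real set \<Rightarrow> 'h::complex_hilbert_space \<Rightarrow> 'h) \<Rightarrow> (real \<Rightarrow> complex) \<Rightarrow> 'h operator" where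
  "spectral_integral E f = {(x, y). \<exists>s :: nat \<Rightarrow> real \<Rightarrow> complex.
     (\<forall>n. simple_function borel (s n)) \<and>
     (\<lambda>n. \<integral>\<^sup>+ l. ennreal ((cmod (f l - s n l))\<^sup>2) \<partial>scalar_measure E x) \<longlonglongrightarrow> 0 \<and>
     (\<lambda>n. simple_spectral_integral E (s n) x) \<longlonglongrightarrow> y}"

definition spectral_measure ::
    "'h::complex_hilbert_space operator \<Rightarrow> real set \<Rightarrow> 'h \<Rightarrow> 'h" where
  "spectral_measure A =
     (THE E. projection_valued_measure E \<and> A = spectral_integral E complex_of_real)"

text \<open>Powers \<open>A\<^sup>z\<close> of a positive selfadjoint operator. Since \<open>0 powr z = 0\<close>, all powers vanish on
  the kernel of \<open>A\<close>. In particular \<open>A\<^sup>i\<^sup>t\<close> is unitary only if \<open>A\<close> is injective.\<close>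

definition op_power :: "'h::complex_hilbert_space operator \<Rightarrow> complex \<Rightarrow> 'h operator" where
  "op_power A z = spectral_integral (spectral_measure A) (\<lambda>l. complex_of_real l powr z)"


section \<open>Standard subspaces\<close>

definition Stand :: "'h::complex_hilbert_space set set" where
  "Stand = {V. subspace V \<and> closed V \<and> V \<inter> (\<lambda>v. \<i> *\<^sub>C v) ` V = {0} \<and>
     closure {v + \<i> *\<^sub>C w | v w. v \<in> V \<and> w \<in> V} = UNIV}"

definition tomita_op :: "'h::complex_hilbert_space set \<Rightarrow> 'h operator" where
  "tomita_op V = {(v + \<i> *\<^sub>C w, v - \<i> *\<^sub>C w) | v w. v \<in> V \<and> w \<in> V}"

definition modular_op :: "'h::complex_hilbert_space set \<Rightarrow> 'h operator" where
  "modular_op V = tomita_op V O antilinear_adjoint_op (tomita_op V)"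

definition modular_conj :: "'h::complex_hilbert_space set \<Rightarrow> 'h \<Rightarrow> 'h" where
  "modular_conj V =
     (THE J. antiunitary J \<and> tomita_op V = op_power (modular_op V) (1/2) O op_graph J)"

definition stand_reflection ::
    "'h::complex_hilbert_space set \<Rightarrow> 'h set \<Rightarrow> 'h set" where
  "stand_reflection V1 V2 = modular_conj V1 ` modular_conj V2 ` V2"

definition stand_flow ::
    "'h::complex_hilbert_space set \<Rightarrow> real \<Rightarrow> 'h set \<Rightarrow> 'h set" where
  "stand_flow V1 t V2 = op_power (modular_op V1) (- \<i> * complex_of_real t / (2 * pi)) `` V2"

definition stand_dilation ::
    "'h::complex_hilbert_space set \<Rightarrow> real \<Rightarrow> 'h set \<Rightarrow> 'h set" where
  "stand_dilation V1 r V2 =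
     (if r > 0 then stand_flow V1 (ln r) V2
      else if r = -1 then stand_reflection V1 V2
      else stand_reflection V1 (stand_flow V1 (ln (- r)) V2))"

text \<open>The positive selfadjoint \<open>\<Delta>\<close> with \<open>\<eta>(e\<^sup>t) = \<Delta>\<^sup>-\<^sup>i\<^sup>t\<^sup>/\<^sup>2\<^sup>\<pi>\<close> for all \<open>t\<close>. By the convention
  for \<open>op_power\<close> it is injective, and hence unique.\<close>

definition hom_modular_op ::
    "(real \<Rightarrow> 'h::complex_hilbert_space \<Rightarrow>\<^sub>L 'h) \<Rightarrow> 'h operator" where
  "hom_modular_op \<eta> = (THE D. positive_selfadjoint D \<and>
     (\<forall>t. op_graph (blinfun_apply (\<eta> (exp t))) =
            op_power D (- \<i> * complex_of_real t / (2 * pi))))"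

definition stand_of_hom ::
    "(real \<Rightarrow> 'h::complex_hilbert_space \<Rightarrow>\<^sub>L 'h) \<Rightarrow> 'h set" where
  "stand_of_hom \<eta> =
     {x. (x, x) \<in> op_power (hom_modular_op \<eta>) (1/2) O op_graph (blinfun_apply (\<eta> (-1)))}"

definition stand_of_rep ::
    "('g \<Rightarrow> 'h::complex_hilbert_space \<Rightarrow>\<^sub>L 'h) \<Rightarrow> (real \<Rightarrow> 'g) \<Rightarrow> 'h set" where
  "stand_of_rep U \<gamma> = stand_of_hom (compose (carrier Rx) U \<gamma>)"

end

theory Submission
  imports Defs "HOL-Probability.Probability"
begin

text \<open>On homomorphisms the dilation is conjugation, \<open>(\<gamma> \<bullet>\<^sub>r \<delta>)(s) = \<gamma>(r) \<delta>(s) \<gamma>(r)\<^sup>-\<^sup>1\<close>, and the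
  representation \<open>U\<close> is multiplicative, so \<open>U \<circ> (\<gamma> \<bullet>\<^sub>r \<delta>)\<close> is the conjugate of \<open>U \<circ> \<delta>\<close> by \<open>U(\<gamma>(r))\<close>.
  The theorem thereby reduces to two facts about operators. The map \<open>\<eta> \<mapsto> Fix (J \<Delta>\<^sup>1\<^sup>/\<^sup>2)\<close> turns
  conjugation into the modular operations on standard subspaces (\<open>stand_of_hom_hom_conj\<close>), and it
  reaches every standard subspace (\<open>stand_of_hom_surj\<close>). Together they also transport the axioms of
  a dilation space, which for conjugation are identities in a group, to the standard subspaces
  (\<open>dilation_space_Stand\<close>).

  Conjugation is understood through the spectral measure \<open>E\<close> of the generator of the unitary group
  \<open>t \<mapsto> \<eta>(e\<^sup>t)\<close>. In terms of it, \<open>\<Delta>\<close> is the integral of \<open>e\<^sup>-\<^sup>2\<^sup>\<pi>\<^sup>l\<close> (\<open>hom_modular_op_eq\<close>), the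
  subspace \<open>V = Fix (J \<Delta>\<^sup>1\<^sup>/\<^sup>2)\<close> is standard, and its modular objects are \<open>\<Delta>\<close> and
  \<open>J = \<eta>(-1)\<close> again (locale \<open>modular_pair\<close>); so the modular flow and the reflection of \<open>V\<close> act by
  the operators \<open>\<eta>(r)\<close>. Conjugation with a unitary \<open>W\<close> transports all of this and maps \<open>V\<close> to \<open>W V\<close>.
  Conjugation with an antiunitary \<open>W\<close> reverses the sign of the generator, because \<open>W\<close> anticommutes
  with \<open>\<i>\<close>. It replaces \<open>\<Delta>\<close> by its inverse, and \<open>V\<close> is mapped to
  \<open>W Fix (J \<Delta>\<^sup>-\<^sup>1\<^sup>/\<^sup>2) = W J V\<close>. This explains the second conjugation in
  \<open>V\<^sub>1 \<bullet>\<^sub>-\<^sub>1 V\<^sub>2 = J\<^sub>1 J\<^sub>2 V\<^sub>2\<close>.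

  That every standard subspace \<open>V\<close> arises is shown with the bounded operators of Rieffel and van
  Daele (locale \<open>standard_subspace\<close>): the sum \<open>R\<close> and the difference \<open>K\<close> of the real orthogonal
  projections onto \<open>V\<close> and \<open>\<i> V\<close>. The operator \<open>R\<close> is complex linear and selfadjoint with
  \<open>0 \<le> R \<le> 2\<close>, the modular operator is \<open>(2 - R) / R\<close>, and \<open>J\<close> is the phase of the antilinear \<open>K\<close>.

  All this rests on spectral theory for projection-valued measures. Unbounded integrals are
  reduced to the multiplicative calculus of bounded functions (\<open>Int_op_iff\<close>). Spectral measures
  are unique because an operator that respects the graphs of two integrals intertwines the
  measures (\<open>intertwines\<close>). They exist for unitary groups by Bochner's theorem (\<open>bochner\<close>,
  \<open>stone\<close>), hence for bounded selfadjoint operators \<open>R\<close>, through \<open>exp (i t R)\<close>, and for positive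
  selfadjoint operators \<open>D\<close>, through \<open>(1 + D)\<^sup>-\<^sup>1\<close> (\<open>positive_spectral_theorem\<close>).\<close>

section \<open>Complex Hilbert spaces\<close>

instance complex_hilbert_space \<subseteq> banach ..

lemma scaleC_one [simp]: "1 *\<^sub>C x = x"
  using scaleR_scaleC[of 1 x] by simp

lemma scaleC_zero_left [simp]: "0 *\<^sub>C x = 0"
  using scaleR_scaleC[of 0 x] by simp

lemma scaleC_zero_right [simp]: "a *\<^sub>C 0 = 0"
  using scaleC_add_right[of a 0 0] by simp

lemma scaleC_minus_right: "a *\<^sub>C (- x) = - (a *\<^sub>C x)"
  using scaleC_add_right[of a x "- x"] by (simp add: eq_neg_iff_add_eq_0 add.commute)

lemma scaleC_minus_left: "(- a) *\<^sub>C x = - (a *\<^sub>C x)"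
  using scaleC_add_left[of a "- a" x] by (simp add: eq_neg_iff_add_eq_0 add.commute)

lemma scaleC_diff_right: "a *\<^sub>C (x - y) = a *\<^sub>C x - a *\<^sub>C y"
  using scaleC_add_right[of a x "- y"] by (simp add: scaleC_minus_right)

lemma scaleC_diff_left: "(a - b) *\<^sub>C x = a *\<^sub>C x - b *\<^sub>C x"
  using scaleC_add_left[of a "- b" x] by (simp add: scaleC_minus_left)

lemma scaleC_of_real: "complex_of_real r *\<^sub>C x = r *\<^sub>R x"
  by (simp add: scaleR_scaleC)

lemma scaleC_scaleR: "a *\<^sub>C (r *\<^sub>R x) = r *\<^sub>R (a *\<^sub>C x)"
  by (simp add: scaleR_scaleC scaleC_scaleC mult.commute)

lemma scaleC_i_i [simp]: "\<i> *\<^sub>C (\<i> *\<^sub>C x) = - x"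
  by (simp add: scaleC_scaleC scaleC_minus_left)

lemma scaleC_eq: "a *\<^sub>C x = Re a *\<^sub>R x + Im a *\<^sub>R (\<i> *\<^sub>C x)"
proof -
  have "a *\<^sub>C x = (complex_of_real (Re a) + complex_of_real (Im a) * \<i>) *\<^sub>C x"
    using complex_eq[of a] by (simp add: mult.commute)
  then show ?thesis by (simp only: scaleC_add_left scaleC_of_real flip: scaleC_scaleC)
qed

lemma scaleC_sum_right: "a *\<^sub>C (\<Sum>i\<in>A. f i) = (\<Sum>i\<in>A. a *\<^sub>C f i)"
  by (induction A rule: infinite_finite_induct) (auto simp: scaleC_add_right)

lemma cinner_add_left: "cinner (x + y) z = cinner x z + cinner y z"
  by (metis cinner_add_right cinner_commute complex_cnj_add)

lemma cinner_scaleC_left: "cinner (a *\<^sub>C x) y = cnj a * cinner x y"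
  by (metis cinner_commute cinner_scaleC_right complex_cnj_mult)

lemma cinner_minus_right: "cinner x (- y) = - cinner x y"
  using cinner_scaleC_right[of x "-1" y] by (simp add: scaleC_minus_left)

lemma cinner_minus_left: "cinner (- x) y = - cinner x y"
  using cinner_scaleC_left[of "-1" x y] by (simp add: scaleC_minus_left)

lemma cinner_diff_right: "cinner x (y - z) = cinner x y - cinner x z"
  using cinner_add_right[of x y "- z"] by (simp add: cinner_minus_right)

lemma cinner_diff_left: "cinner (x - y) z = cinner x z - cinner y z"
  using cinner_add_left[of x "- y" z] by (simp add: cinner_minus_left)

lemma cinner_scaleR_right: "cinner x (r *\<^sub>R y) = complex_of_real r * cinner x y"
  by (simp add: scaleR_scaleC cinner_scaleC_right)

lemma cinner_zero_right [simp]: "cinner x 0 = 0"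
  using cinner_add_right[of x 0 0] by simp

lemma cinner_zero_left [simp]: "cinner 0 x = 0"
  using cinner_add_left[of 0 0 x] by simp

lemma cinner_sum_right: "cinner x (\<Sum>i\<in>A. f i) = (\<Sum>i\<in>A. cinner x (f i))"
  by (induction A rule: infinite_finite_induct) (auto simp: cinner_add_right)

lemma cinner_sum_left: "cinner (\<Sum>i\<in>A. f i) x = (\<Sum>i\<in>A. cinner (f i) x)"
  by (induction A rule: infinite_finite_induct) (auto simp: cinner_add_left)

lemma Im_cinner: "Im (cinner x y) = - inner x (\<i> *\<^sub>C y)"
  by (simp flip: Re_cinner add: cinner_scaleC_right)

lemma cinner_eq: "cinner x y = Complex (inner x y) (- inner x (\<i> *\<^sub>C y))"
  by (simp add: complex_eq_iff Re_cinner Im_cinner)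

lemma cinner_self: "cinner x x = complex_of_real ((norm x)\<^sup>2)"
proof -
  have "Im (cinner x x) = 0"
    using arg_cong[OF cinner_commute[of x x], of Im] by simp
  then show ?thesis by (simp add: complex_eq_iff Re_cinner power2_norm_eq_inner)
qed

lemma inner_i_left: "inner (\<i> *\<^sub>C x) y = - inner x (\<i> *\<^sub>C y)"
  by (simp flip: Re_cinner add: cinner_scaleC_left cinner_scaleC_right)

lemma inner_i_i: "inner (\<i> *\<^sub>C x) (\<i> *\<^sub>C y) = inner x y"
  by (simp add: inner_i_left)

lemma norm_scaleC: "norm (a *\<^sub>C x) = cmod a * norm x"
proof -
  have "complex_of_real ((norm (a *\<^sub>C x))\<^sup>2) = complex_of_real ((cmod a * norm x)\<^sup>2)"
    unfolding cinner_self[symmetric] cinner_scaleC_left cinner_scaleC_right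
    by (simp add: cinner_self power_mult_distrib mult.assoc[symmetric] flip: complex_norm_square)
  then have "(norm (a *\<^sub>C x))\<^sup>2 = (cmod a * norm x)\<^sup>2" by (simp only: of_real_eq_iff)
  then show ?thesis by (simp add: power2_eq_iff_nonneg)
qed

lemma bounded_linear_scaleC: "bounded_linear (\<lambda>x::'a::complex_hilbert_space. a *\<^sub>C x)"
  by (rule bounded_linear_intro[where K="cmod a"])
    (auto simp: scaleC_add_right scaleC_scaleR norm_scaleC mult.commute)

lemmas tendsto_scaleC [tendsto_intros] = bounded_linear.tendsto[OF bounded_linear_scaleC]
lemmas continuous_on_scaleC [continuous_intros] = bounded_linear.continuous_on[OF bounded_linear_scaleC]
lemmas sums_scaleC = bounded_linear.sums[OF bounded_linear_scaleC]

lemma tendsto_cinner [tendsto_intros]: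
  assumes "(f \<longlongrightarrow> a) F" "(g \<longlongrightarrow> b) F"
  shows "((\<lambda>x. cinner (f x) (g x)) \<longlongrightarrow> cinner a b) F"
  unfolding cinner_eq Complex_eq by (intro tendsto_intros assms)

lemma continuous_on_cinner [continuous_intros]:
  assumes "continuous_on S f" "continuous_on S g"
  shows "continuous_on S (\<lambda>x. cinner (f x) (g x))"
  unfolding cinner_eq Complex_eq by (intro continuous_intros assms)

lemma cinner_ext: "(\<And>x. cinner x y = cinner x z) \<Longrightarrow> y = z"
  by (metis Re_cinner vector_eq_ldot)

lemma norm_cinner_le: "cmod (cinner x y) \<le> norm x * norm y"
proof (cases "cinner x y = 0")
  case False
  define c where "c = cnj (cinner x y) / cmod (cinner x y)"
  have c: "cmod c = 1" using False by (simp add: c_def norm_divide)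
  have "complex_of_real (cmod (cinner x y)) = c * cinner x y"
    using False by (simp add: c_def field_simps power2_eq_square flip: complex_norm_square)
  also have "\<dots> = cinner x (c *\<^sub>C y)" by (simp add: cinner_scaleC_right)
  finally have "cmod (cinner x y) = inner x (c *\<^sub>C y)" by (metis Re_cinner Re_complex_of_real)
  also have "\<dots> \<le> norm x * norm (c *\<^sub>C y)" by (rule norm_cauchy_schwarz)
  finally show ?thesis by (simp add: norm_scaleC c)
qed simp

section \<open>Functional calculus of a projection-valued measure\<close>

definition bounded_borel :: "(real \<Rightarrow> complex) \<Rightarrow> bool" where
  "bounded_borel f \<longleftrightarrow> f \<in> borel_measurable borel \<and> bounded (range f)"

lemma bounded_borelI: "f \<in> borel_measurable borel \<Longrightarrow> (\<And>l. cmod (f l) \<le> C) \<Longrightarrow> bounded_borel f"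
  unfolding bounded_borel_def bounded_iff by auto

lemma bounded_borelE:
  assumes "bounded_borel f"
  obtains C where "f \<in> borel_measurable borel" "C > 0" "\<And>l. cmod (f l) \<le> C"
  using assms unfolding bounded_borel_def bounded_pos by (auto simp: image_iff)

lemma bounded_borel_const [simp]: "bounded_borel (\<lambda>_. c)"
  by (rule bounded_borelI[where C="cmod c"]) auto

lemma bounded_borel_indicator [simp]: "B \<in> sets borel \<Longrightarrow> bounded_borel (indicator B)"
  by (rule bounded_borelI[where C=1]) (auto simp: indicator_def)

lemma bounded_borel_add: "bounded_borel f \<Longrightarrow> bounded_borel g \<Longrightarrow> bounded_borel (\<lambda>l. f l + g l)"
  by (elim bounded_borelE, rule_tac C="C + Ca" in bounded_borelI) (auto intro: norm_triangle_mono)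

lemma bounded_borel_diff: "bounded_borel f \<Longrightarrow> bounded_borel g \<Longrightarrow> bounded_borel (\<lambda>l. f l - g l)"
  by (elim bounded_borelE, rule_tac C="C + Ca" in bounded_borelI)
    (auto intro: order_trans[OF norm_triangle_ineq4] add_mono)

lemma bounded_borel_mult: "bounded_borel f \<Longrightarrow> bounded_borel g \<Longrightarrow> bounded_borel (\<lambda>l. f l * g l)"
  by (elim bounded_borelE, rule_tac C="C * Ca" in bounded_borelI)
    (auto simp: norm_mult intro!: mult_mono)

lemma bounded_borel_cnj: "bounded_borel f \<Longrightarrow> bounded_borel (\<lambda>l. cnj (f l))"
  by (elim bounded_borelE, rule_tac C=C in bounded_borelI)
    (auto intro!: borel_measurable_continuous_on[where f=cnj] continuous_intros)

lemmas bounded_borel_intros = bounded_borel_const bounded_borel_indicator bounded_borel_add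
  bounded_borel_diff bounded_borel_mult bounded_borel_cnj

lemma bounded_borel_simple: "simple_function borel s \<Longrightarrow> bounded_borel s"
  unfolding bounded_borel_def
  using simple_functionD(1)[of borel s]
  by (auto simp: borel_measurable_simple_function intro: finite_imp_bounded)

lemma simple_approximation:
  assumes f: "bounded_borel f"
  obtains s :: "nat \<Rightarrow> real \<Rightarrow> complex" and C where "\<And>n. simple_function borel (s n)" "C > 0"
    "\<And>n l. cmod (s n l) \<le> C" "\<And>l. (\<lambda>n. s n l) \<longlonglongrightarrow> f l" "\<And>l. cmod (f l) \<le> C"
proof -
  obtain C where C: "f \<in> borel_measurable borel" "C > 0" "\<And>l. cmod (f l) \<le> C"
    using f by (elim bounded_borelE) blast
  obtain s where s: "\<And>i. simple_function borel (s i)" "\<And>x. x \<in> space borel \<Longrightarrow> (\<lambda>i. s i x) \<longlonglongrightarrow> f x"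
    "\<And>i x. x \<in> space borel \<Longrightarrow> dist (s i x) 0 \<le> 2 * dist (f x) 0"
    using borel_measurable_implies_sequence_metric[OF C(1), of 0] by blast
  have "cmod (s n l) \<le> 2 * C" for n l
    using s(3)[of l n] C(3)[of l] by simp
  moreover have "cmod (f l) \<le> 2 * C" for l using C(2) C(3)[of l] by linarith
  ultimately show ?thesis using that[of s "2 * C"] s C(2) by simp
qed

text \<open>The squared norm in the space of square integrable functions. It takes the value \<open>\<infinity>\<close>
  off that space, which is how vectors outside the domain of an integral are recognised.\<close>

abbreviation l2sq :: "real measure \<Rightarrow> (real \<Rightarrow> complex) \<Rightarrow> ennreal" where
  "l2sq M f \<equiv> \<integral>\<^sup>+ l. ennreal ((cmod (f l))\<^sup>2) \<partial>M"

lemma norm_diff_sq_le: "(norm (a - c))\<^sup>2 \<le> 2 * (norm (a - b))\<^sup>2 + 2 * (norm (b - c :: 'a::real_normed_vector))\<^sup>2"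
proof -
  have "norm (a - c) \<le> norm (a - b) + norm (b - c)" by (metis norm_triangle_ineq diff_add_cancel add_diff_eq)
  then have "(norm (a - c))\<^sup>2 \<le> (norm (a - b) + norm (b - c))\<^sup>2" by (intro power_mono) auto
  also have "\<dots> \<le> 2 * (norm (a - b))\<^sup>2 + 2 * (norm (b - c))\<^sup>2"
    using zero_le_power2[of "norm (a - b) - norm (b - c)"] by (simp add: power2_sum power2_diff)
  finally show ?thesis .
qed

lemma l2sq_triangle:
  assumes [measurable]: "f \<in> borel_measurable M" "g \<in> borel_measurable M" "h \<in> borel_measurable M"
  shows "l2sq M (\<lambda>l. f l - h l) \<le> 2 * l2sq M (\<lambda>l. f l - g l) + 2 * l2sq M (\<lambda>l. g l - h l)"
proof -
  have "l2sq M (\<lambda>l. f l - h l) \<le> (\<integral>\<^sup>+ l. 2 * ennreal ((cmod (f l - g l))\<^sup>2) + 2 * ennreal ((cmod (g l - h l))\<^sup>2) \<partial>M)"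
  proof (rule nn_integral_mono)
    fix l
    have "ennreal ((cmod (f l - h l))\<^sup>2) \<le> ennreal (2 * (cmod (f l - g l))\<^sup>2 + 2 * (cmod (g l - h l))\<^sup>2)"
      by (intro ennreal_leI norm_diff_sq_le)
    then show "ennreal ((cmod (f l - h l))\<^sup>2) \<le> 2 * ennreal ((cmod (f l - g l))\<^sup>2) + 2 * ennreal ((cmod (g l - h l))\<^sup>2)"
      by (simp add: ennreal_mult)
  qed
  also have "\<dots> = 2 * l2sq M (\<lambda>l. f l - g l) + 2 * l2sq M (\<lambda>l. g l - h l)"
    by (simp add: nn_integral_add nn_integral_cmult)
  finally show ?thesis .
qed

text \<open>Dominated convergence with a constant majorant, which is integrable since \<open>M\<close> is finite.\<close>

lemma l2sq_bounded_convergence: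
  assumes "finite_measure M" "sets M = sets borel"
    and f: "f \<in> borel_measurable borel" and s: "\<And>n. s n \<in> borel_measurable borel"
    and C: "\<And>n l. cmod (s n l) \<le> C" and lim: "\<And>l. (\<lambda>n. s n l) \<longlonglongrightarrow> f l"
  shows "(\<lambda>n. l2sq M (\<lambda>l. f l - s n l)) \<longlonglongrightarrow> 0"
proof -
  interpret finite_measure M by fact
  note [measurable_cong] = assms(2)
  note [measurable] = f s
  have Cf: "cmod (f l) \<le> C" for l
    using LIMSEQ_le_const2[OF tendsto_norm[OF lim[of l]]] C by auto
  have "(\<lambda>n. l2sq M (\<lambda>l. f l - s n l)) \<longlonglongrightarrow> (\<integral>\<^sup>+ l. 0 \<partial>M)"
  proof (rule nn_integral_dominated_convergence[where w="\<lambda>_. ennreal ((2 * C)\<^sup>2)"])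
    show "AE x in M. ennreal ((cmod (f x - s j x))\<^sup>2) \<le> ennreal ((2 * C)\<^sup>2)" for j
    proof (rule AE_I2, intro ennreal_leI power_mono)
      fix l show "cmod (f l - s j l) \<le> 2 * C"
        using norm_triangle_ineq4[of "f l" "s j l"] Cf[of l] C[of j l] by linarith
    qed auto
    show "AE x in M. (\<lambda>i. ennreal ((cmod (f x - s i x))\<^sup>2)) \<longlonglongrightarrow> 0"
    proof (rule AE_I2)
      fix l
      have "(\<lambda>i. ennreal ((cmod (f l - s i l))\<^sup>2)) \<longlonglongrightarrow> ennreal ((cmod (f l - f l))\<^sup>2)"
        by (intro tendsto_ennrealI tendsto_intros lim)
      then show "(\<lambda>i. ennreal ((cmod (f l - s i l))\<^sup>2)) \<longlonglongrightarrow> 0" by simp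
    qed
    show "(\<integral>\<^sup>+ x. ennreal ((2 * C)\<^sup>2) \<partial>M) < \<infinity>"
      using emeasure_finite[of "space M"] ennreal_mult_eq_top_iff by (auto simp: top.not_eq_extremum[symmetric])
  qed auto
  then show ?thesis by simp
qed

locale pvm =
  fixes E :: "real set \<Rightarrow> 'h::complex_hilbert_space \<Rightarrow> 'h"
  assumes pvm: "projection_valued_measure E"
begin

abbreviation \<mu> where "\<mu> \<equiv> scalar_measure E"
abbreviation S where "S \<equiv> simple_spectral_integral E"

lemma projection: "B \<in> sets borel \<Longrightarrow> orthogonal_projection (E B)"
  using pvm by (auto simp: projection_valued_measure_def)

lemma E_UNIV [simp]: "E UNIV x = x"
  using pvm by (auto simp: projection_valued_measure_def)

lemma E_sums: "range B \<subseteq> sets borel \<Longrightarrow> disjoint_family B \<Longrightarrow> (\<lambda>n. E (B n) x) sums E (\<Union>n. B n) x"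
  using pvm by (auto simp: projection_valued_measure_def)

lemma E_add: "B \<in> sets borel \<Longrightarrow> E B (x + y) = E B x + E B y"
  using projection by (auto simp: orthogonal_projection_def)

lemma E_scaleC: "B \<in> sets borel \<Longrightarrow> E B (a *\<^sub>C x) = a *\<^sub>C E B x"
  using projection by (auto simp: orthogonal_projection_def)

lemma E_idem: "B \<in> sets borel \<Longrightarrow> E B (E B x) = E B x"
  using projection by (auto simp: orthogonal_projection_def)

lemma E_sym: "B \<in> sets borel \<Longrightarrow> cinner (E B x) y = cinner x (E B y)"
  using projection by (auto simp: orthogonal_projection_def)

lemma E_zero [simp]: "B \<in> sets borel \<Longrightarrow> E B 0 = 0"
  using E_add[of B 0 0] by simp

lemma E_diff: "B \<in> sets borel \<Longrightarrow> E B (x - y) = E B x - E B y"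
  using E_add[of B "x - y" y] by simp

lemma E_minus: "B \<in> sets borel \<Longrightarrow> E B (- x) = - E B x"
  using E_diff[of B 0 x] by simp

lemma E_sum: "B \<in> sets borel \<Longrightarrow> E B (\<Sum>i\<in>A. f i) = (\<Sum>i\<in>A. E B (f i))"
  by (induction A rule: infinite_finite_induct) (auto simp: E_add)

lemma E_empty [simp]: "E {} x = 0"
proof -
  have "(\<lambda>n::nat. E {} x) sums E (\<Union>n::nat. {}) x"
    by (rule E_sums) (auto simp: disjoint_family_on_def)
  then show ?thesis using sums_summable summable_const_iff by blast
qed

lemma E_Un: 
  assumes "A \<in> sets borel" "B \<in> sets borel" "A \<inter> B = {}"
  shows "E (A \<union> B) x = E A x + E B x"
proof -
  have "(\<lambda>n. E (binaryset A B n) x) sums E (\<Union>n. binaryset A B n) x"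
    using assms by (intro E_sums) (auto simp: disjoint_family_on_def binaryset_def)
  moreover have "(\<lambda>n. E (binaryset A B n) x) sums (E A x + E B x)"
    by (rule binaryset_sums) simp
  ultimately show ?thesis by (metis UN_binaryset_eq sums_unique2)
qed

lemma E_disjoint:
  assumes [simp]: "A \<in> sets borel" "B \<in> sets borel" and "A \<inter> B = {}"
  shows "E A (E B x) = 0"
proof -
  \<comment> \<open>\<open>P + Q\<close> being idempotent makes \<open>P Q = - Q P\<close>; conjugating by \<open>P\<close> gives \<open>P Q = - P Q\<close>.\<close>
  have anti: "E A (E B y) = - E B (E A y)" for y
  proof -
    have "E (A \<union> B) (E (A \<union> B) y) = E (A \<union> B) y" by (rule E_idem) auto
    then have "E A y + E A (E B y) + (E B (E A y) + E B y) = E A y + E B y"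
      by (simp add: E_Un assms(3) E_add E_idem)
    then show ?thesis by (simp add: eq_neg_iff_add_eq_0 algebra_simps)
  qed
  have "E A (E B (E A x)) = E A (E B x)" using anti[of "E A x"] anti[of x] by (simp add: E_idem)
  moreover have "E A (E B (E A x)) = - E A (E B x)"
    using anti[of x] by (metis E_idem E_minus assms(1) minus_minus)
  ultimately have "E A (E B x) = - E A (E B x)" by simp
  then show ?thesis by (metis add.left_inverse eq_neg_iff_add_eq_0 scaleR_2 scaleR_eq_0_iff zero_neq_numeral)
qed

lemma E_split: "A \<in> sets borel \<Longrightarrow> B \<in> sets borel \<Longrightarrow> E A x = E (A \<inter> B) x + E (A - B) x"
  by (metis Diff_disjoint E_Un Int_Diff_disjoint Un_Diff_Int Un_commute sets.Diff sets.Int)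

lemma E_Int:
  assumes [measurable]: "A \<in> sets borel" "B \<in> sets borel"
  shows "E A (E B x) = E (A \<inter> B) x"
proof -
  have "E A (E B x) = E A (E (A \<inter> B) x) + E A (E (B - A) x)"
    using E_split[of B A x] by (simp add: E_add Int_commute)
  also have "E A (E (B - A) x) = 0" by (rule E_disjoint) auto
  also have "E A (E (A \<inter> B) x) = E (A \<inter> B) (E (A \<inter> B) x) + E (A - B) (E (A \<inter> B) x)"
    using E_split[of A B "E (A \<inter> B) x"] by simp
  also have "E (A - B) (E (A \<inter> B) x) = 0" by (rule E_disjoint) auto
  finally show ?thesis by (simp add: E_idem)
qed

lemma cinner_E: "B \<in> sets borel \<Longrightarrow> cinner x (E B x) = complex_of_real ((norm (E B x))\<^sup>2)"
  by (metis E_idem E_sym cinner_self)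

lemma norm_E_le: "B \<in> sets borel \<Longrightarrow> norm (E B x) \<le> norm x"
proof -
  assume B: "B \<in> sets borel"
  have "(norm (E B x))\<^sup>2 \<le> norm x * norm (E B x)"
    using norm_cinner_le[of x "E B x"] cinner_E[OF B, of x] by (simp add: norm_power)
  then show ?thesis by (cases "norm (E B x) = 0") (auto simp: power2_eq_square)
qed

lemma bounded_linear_E: "B \<in> sets borel \<Longrightarrow> bounded_linear (E B)"
  by (rule bounded_linear_intro[where K=1]) (auto simp: E_add norm_E_le E_scaleC scaleR_scaleC)

lemma sets_\<mu> [measurable_cong]: "sets (\<mu> x) = sets borel" and space_\<mu> [simp]: "space (\<mu> x) = UNIV"
  by (auto simp: scalar_measure_def sets.sigma_sets_eq[of borel, simplified])

lemma emeasure_\<mu>: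
  assumes "B \<in> sets borel"
  shows "emeasure (\<mu> x) B = ennreal ((norm (E B x))\<^sup>2)"
proof -
  have "emeasure (\<mu> x) B = ennreal (Re (cinner x (E B x)))"
  proof (rule emeasure_measure_of[OF scalar_measure_def])
    show "positive (sets (\<mu> x)) (\<lambda>B. ennreal (Re (cinner x (E B x))))"
      by (simp add: positive_def)
    show "countably_additive (sets (\<mu> x)) (\<lambda>B. ennreal (Re (cinner x (E B x))))"
    proof (rule countably_additiveI)
      fix A :: "nat \<Rightarrow> real set" assume A: "range A \<subseteq> sets (\<mu> x)" "disjoint_family A"
      then have B: "A n \<in> sets borel" for n using sets_\<mu>[of x] by auto
      have "(\<lambda>n. inner x (E (A n) x)) sums inner x (E (\<Union>n. A n) x)"
        using A sets_\<mu>[of x] by (intro bounded_linear.sums[OF bounded_linear_inner_right] E_sums) auto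
      then show "(\<Sum>i. ennreal (Re (cinner x (E (A i) x)))) = ennreal (Re (cinner x (E (\<Union> (range A)) x)))"
        by (intro suminf_ennreal_eq) (auto simp: Re_cinner cinner_E B simp flip: Re_cinner)
    qed
  qed (use assms sets_\<mu>[of x] in auto)
  then show ?thesis by (simp add: cinner_E assms)
qed

lemma finite_measure_\<mu>: "finite_measure (\<mu> x)"
  by (rule finite_measureI) (simp add: emeasure_\<mu>)

lemma E_finite_Union:
  assumes "finite K" "\<And>k. k \<in> K \<Longrightarrow> A k \<in> sets borel" "disjoint_family_on A K"
  shows "E (\<Union>k\<in>K. A k) x = (\<Sum>k\<in>K. E (A k) x)"
  using assms
proof (induction K)
  case (insert k K)
  have "E (\<Union>k\<in>insert k K. A k) x = E (A k \<union> (\<Union>k\<in>K. A k)) x" by simp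
  also have "\<dots> = E (A k) x + E (\<Union>k\<in>K. A k) x"
  proof (rule E_Un)
    show "(\<Union>k\<in>K. A k) \<in> sets borel" using insert by (intro sets.finite_UN) auto
    show "A k \<inter> (\<Union>k\<in>K. A k) = {}" using insert(2,5) by (auto simp: disjoint_family_on_def)
  qed (use insert in auto)
  finally show ?case using insert by (auto simp: disjoint_family_on_def)
qed simp

text \<open>By additivity of \<open>E\<close> the partition into level sets can be refined. Applied to the common
  refinement for two simple functions, this turns the rules for sums and products of simple
  integrals into identities of finite sums.\<close>

lemma S_partition:
  assumes "finite K" "range p \<subseteq> K" "\<And>k. p -` {k} \<in> sets borel"
  shows "S (\<lambda>l. g (p l)) x = (\<Sum>k\<in>K. g k *\<^sub>C E (p -` {k}) x)"
proof -
  have fin: "finite (range p)" using assms finite_subset by blast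
  have "S (\<lambda>l. g (p l)) x = (\<Sum>c\<in>g ` range p. \<Sum>k\<in>{k \<in> range p. g k = c}. g k *\<^sub>C E (p -` {k}) x)"
    unfolding simple_spectral_integral_def
  proof (rule sum.cong)
    fix c assume "c \<in> g ` range p"
    have "(\<lambda>l. g (p l)) -` {c} = (\<Union>k\<in>{k \<in> range p. g k = c}. p -` {k})" by auto
    moreover have "E \<dots> x = (\<Sum>k\<in>{k \<in> range p. g k = c}. E (p -` {k}) x)"
      using fin assms(3) by (intro E_finite_Union) (auto simp: disjoint_family_on_def)
    ultimately show "c *\<^sub>C E ((\<lambda>l. g (p l)) -` {c}) x = (\<Sum>k\<in>{k \<in> range p. g k = c}. g k *\<^sub>C E (p -` {k}) x)"
      by (simp add: scaleC_sum_right)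
  qed auto
  also have "\<dots> = (\<Sum>k\<in>range p. g k *\<^sub>C E (p -` {k}) x)"
    by (rule sum.image_gen[symmetric, OF fin])
  also have "\<dots> = (\<Sum>k\<in>K. g k *\<^sub>C E (p -` {k}) x)"
  proof (rule sum.mono_neutral_left[OF assms(1,2)])
    have "p -` {k} = {}" if "k \<notin> range p" for k using that by auto
    then show "\<forall>k\<in>K - range p. g k *\<^sub>C E (p -` {k}) x = 0" by auto
  qed
  finally show ?thesis .
qed

lemma simple_vimage: "simple_function borel s \<Longrightarrow> s -` {c} \<in> sets borel"
  using simple_functionD(2)[of borel s "{c}"] by simp

lemma simple_finite: "simple_function borel s \<Longrightarrow> finite (range s)"
  using simple_functionD(1)[of borel s] by simp

lemma S_pair:
  assumes s: "simple_function borel s" and t: "simple_function borel t"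
  shows "S (\<lambda>l. g (s l) (t l)) x =
    (\<Sum>c\<in>range s. \<Sum>d\<in>range t. g c d *\<^sub>C E (s -` {c} \<inter> t -` {d}) x)"
proof -
  let ?p = "\<lambda>l. (s l, t l)"
  have *: "?p -` {k} = s -` {fst k} \<inter> t -` {snd k}" for k by (cases k) auto
  have "S (\<lambda>l. (\<lambda>(c, d). g c d) (?p l)) x
      = (\<Sum>k\<in>range s \<times> range t. (\<lambda>(c, d). g c d) k *\<^sub>C E (?p -` {k}) x)"
    unfolding * using s t
    by (subst S_partition[where K="range s \<times> range t" and p="?p"])
       (auto simp: * simple_vimage simple_finite)
  then show ?thesis unfolding * by (simp add: sum.cartesian_product split_def)
qed

lemma S_diff: 
  assumes "simple_function borel s" "simple_function borel t"
  shows "S (\<lambda>l. s l - t l) x = S s x - S t x"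
  using S_pair[OF assms, of "\<lambda>c d. c" x] S_pair[OF assms, of "\<lambda>c d. d" x] S_pair[OF assms, of "(-)" x]
  by (simp add: scaleC_diff_left sum_subtractf)

lemma S_mult:
  assumes s: "simple_function borel s" and t: "simple_function borel t"
  shows "S (\<lambda>l. s l * t l) x = S s (S t x)"
proof -
  have "S s (S t x) = (\<Sum>c\<in>range s. \<Sum>d\<in>range t. (c * d) *\<^sub>C E (s -` {c} \<inter> t -` {d}) x)"
    by (simp add: simple_spectral_integral_def E_sum E_scaleC E_Int simple_vimage[OF s] simple_vimage[OF t]
        scaleC_sum_right scaleC_scaleC)
  then show ?thesis using S_pair[OF assms, of "(*)" x] by simp
qed

lemma S_comp: "simple_function borel s \<Longrightarrow> S (\<lambda>l. g (s l)) x = (\<Sum>c\<in>range s. g c *\<^sub>C E (s -` {c}) x)"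
  by (rule S_partition) (auto simp: simple_finite simple_vimage)

lemma S_adjoint: "simple_function borel s \<Longrightarrow> cinner y (S s x) = cinner (S (\<lambda>l. cnj (s l)) y) x"
  unfolding S_comp[of s cnj]
  by (simp add: simple_spectral_integral_def cinner_sum_right cinner_sum_left
      cinner_scaleC_left cinner_scaleC_right E_sym simple_vimage)

lemma S_add_right: "simple_function borel s \<Longrightarrow> S s (x + y) = S s x + S s y"
  by (simp add: simple_spectral_integral_def E_add simple_vimage scaleC_add_right sum.distrib)

lemma S_scaleC_right: "simple_function borel s \<Longrightarrow> S s (a *\<^sub>C x) = a *\<^sub>C S s x"
  by (simp add: simple_spectral_integral_def E_scaleC simple_vimage scaleC_sum_right scaleC_scaleC mult.commute)

lemma S_indicator:
  assumes B: "B \<in> sets borel"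
  shows "S (indicator B) x = E B x"
proof -
  have "S (\<lambda>l. (\<lambda>b. if b then 1 else 0) (l \<in> B)) x
      = (\<Sum>k\<in>UNIV. (if k then 1 else 0) *\<^sub>C E ((\<lambda>l. l \<in> B) -` {k}) x)"
  proof (rule S_partition)
    have "(\<lambda>l. l \<in> B) -` {k} = (if k then B else - B)" for k by auto
    then show "(\<lambda>l. l \<in> B) -` {k} \<in> sets borel" for k using B by auto
  qed auto
  moreover have "indicator B = (\<lambda>l. if l \<in> B then 1 else 0 :: complex)" by (auto simp: indicator_def)
  moreover have "(\<lambda>l. l \<in> B) -` {True} = B" by auto
  ultimately show ?thesis by (simp add: UNIV_bool)
qed

lemma S_isometry:
  assumes s: "simple_function borel s"
  shows "l2sq (\<mu> x) s = ennreal ((norm (S s x))\<^sup>2)"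
proof -
  have s': "simple_function (\<mu> x) s" using s by (simp add: simple_function_def sets_\<mu>)
  have "complex_of_real ((norm (S s x))\<^sup>2) = cinner (S s x) (S s x)" by (simp add: cinner_self)
  also have "\<dots> = cinner x (S (\<lambda>l. cnj (s l)) (S s x))"
    using S_adjoint[OF simple_function_compose1[OF s, of cnj], of x "S s x"] by simp
  also have "\<dots> = cinner x (S (\<lambda>l. cnj (s l) * s l) x)"
    using S_mult[OF simple_function_compose1[OF s, of cnj] s] by simp
  also have "\<dots> = (\<Sum>c\<in>range s. complex_of_real ((cmod c)\<^sup>2 * (norm (E (s -` {c}) x))\<^sup>2))"
    using S_comp[OF s, of "\<lambda>c. cnj c * c" x]
    by (simp add: cinner_sum_right cinner_scaleC_right cinner_E simple_vimage[OF s] mult.commute flip: complex_norm_square)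
  finally have *: "(norm (S s x))\<^sup>2 = (\<Sum>c\<in>range s. (cmod c)\<^sup>2 * (norm (E (s -` {c}) x))\<^sup>2)"
    by (simp only: of_real_eq_iff flip: of_real_sum)
  have "l2sq (\<mu> x) s = simple_integral (\<mu> x) (\<lambda>l. ennreal ((cmod (s l))\<^sup>2))"
    by (rule nn_integral_eq_simple_integral) (rule simple_function_compose1[OF s'])
  also have "\<dots> = (\<Sum>c\<in>s ` space (\<mu> x). ennreal ((cmod c)\<^sup>2) * emeasure (\<mu> x) {l\<in>space (\<mu> x). s l = c})"
    by (rule simple_function_partition[OF simple_function_compose1[OF s'] s']) auto
  also have "\<dots> = (\<Sum>c\<in>range s. ennreal ((cmod c)\<^sup>2 * (norm (E (s -` {c}) x))\<^sup>2))"
    using simple_vimage[OF s] by (auto simp: emeasure_\<mu> ennreal_mult vimage_def intro!: sum.cong)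
  finally show ?thesis by (simp add: * sum_nonneg)
qed

end

definition trunc :: "real set \<Rightarrow> (real \<Rightarrow> complex) \<Rightarrow> real \<Rightarrow> complex" where
  "trunc B f = (\<lambda>l. indicator B l * f l)"

definition exhausts :: "(nat \<Rightarrow> real set) \<Rightarrow> (real \<Rightarrow> complex) \<Rightarrow> bool" where
  "exhausts B f \<longleftrightarrow> range B \<subseteq> sets borel \<and> incseq B \<and> (\<Union>n. B n) = UNIV \<and> (\<forall>n. bounded_borel (trunc (B n) f))"

lemma exhausts_sets: "exhausts B f \<Longrightarrow> B n \<in> sets borel"
  by (auto simp: exhausts_def)

lemma exhausts_bounded: "exhausts B f \<Longrightarrow> bounded_borel (trunc (B n) f)"
  by (auto simp: exhausts_def)

lemma exhausts_mult:
  assumes "exhausts B f" "exhausts B g"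
  shows "exhausts B (\<lambda>l. f l * g l)"
proof -
  have "trunc (B n) (\<lambda>l. f l * g l) = (\<lambda>l. trunc (B n) f l * trunc (B n) g l)" for n
    by (rule ext) (simp add: trunc_def indicator_def)
  then have "bounded_borel (trunc (B n) (\<lambda>l. f l * g l))" for n
    using bounded_borel_mult[OF exhausts_bounded[OF assms(1)] exhausts_bounded[OF assms(2)], of n n] by simp
  with assms(1) show ?thesis unfolding exhausts_def by blast
qed

lemma exhausts_add:
  assumes "exhausts B f" "exhausts B g"
  shows "exhausts B (\<lambda>l. f l + g l)"
proof -
  have "trunc (B n) (\<lambda>l. f l + g l) = (\<lambda>l. trunc (B n) f l + trunc (B n) g l)" for n
    by (rule ext) (simp add: trunc_def indicator_def)
  then have "bounded_borel (trunc (B n) (\<lambda>l. f l + g l))" for n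
    using bounded_borel_add[OF exhausts_bounded[OF assms(1)] exhausts_bounded[OF assms(2)], of n n] by simp
  with assms(1) show ?thesis unfolding exhausts_def by blast
qed

lemma exhausts_cnj:
  assumes "exhausts B f"
  shows "exhausts B (\<lambda>l. cnj (f l))"
proof -
  have "trunc (B n) (\<lambda>l. cnj (f l)) = (\<lambda>l. cnj (trunc (B n) f l))" for n
    by (rule ext) (simp add: trunc_def indicator_def)
  then have "bounded_borel (trunc (B n) (\<lambda>l. cnj (f l)))" for n
    using bounded_borel_cnj[OF exhausts_bounded[OF assms(1)], of n] by simp
  with assms(1) show ?thesis unfolding exhausts_def by blast
qed

lemma exhausts_exists:
  assumes [measurable]: "f \<in> borel_measurable borel" "g \<in> borel_measurable borel"
  obtains B where "exhausts B f" "exhausts B g"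
proof -
  define B where "B n = {l. cmod (f l) \<le> real n \<and> cmod (g l) \<le> real n}" for n
  have [measurable]: "B n \<in> sets borel" for n unfolding B_def by measurable
  have "incseq B" by (auto simp: B_def incseq_def)
  moreover have "l \<in> (\<Union>n. B n)" for l
    using real_arch_simple[of "max (cmod (f l)) (cmod (g l))"] by (auto simp: B_def)
  moreover have "bounded_borel (trunc (B n) f)" "bounded_borel (trunc (B n) g)" for n
  proof -
    have "trunc (B n) f \<in> borel_measurable borel" "trunc (B n) g \<in> borel_measurable borel"
      unfolding trunc_def by measurable
    then show "bounded_borel (trunc (B n) f)" "bounded_borel (trunc (B n) g)"
      by (auto intro!: bounded_borelI[where C="real n"] simp: trunc_def indicator_def B_def)
  qed
  ultimately show ?thesis by (intro that[of B]) (simp_all add: exhausts_def image_subset_iff set_eq_iff)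
qed

context pvm
begin

abbreviation Int_op where "Int_op \<equiv> spectral_integral E"

definition T :: "(real \<Rightarrow> complex) \<Rightarrow> 'h \<Rightarrow> 'h" where
  "T f x = (THE y. (x, y) \<in> Int_op f)"

lemma l2sq_commute: "l2sq M (\<lambda>l. f l - g l) = l2sq M (\<lambda>l. g l - f l)"
  by (simp add: norm_minus_commute)

lemma simple_borel [measurable_dest]: "simple_function borel (s :: real \<Rightarrow> complex) \<Longrightarrow> s \<in> borel_measurable borel"
  by (rule borel_measurable_simple_function)

lemma Int_opI:
  assumes "\<And>n. simple_function borel (s n)" "(\<lambda>n. l2sq (\<mu> x) (\<lambda>l. f l - s n l)) \<longlonglongrightarrow> 0"
    "(\<lambda>n. S (s n) x) \<longlonglongrightarrow> y"
  shows "(x, y) \<in> Int_op f"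
  unfolding spectral_integral_def mem_Collect_eq prod.case using assms by (intro exI[of _ s] conjI allI)

definition approximates :: "(nat \<Rightarrow> real \<Rightarrow> complex) \<Rightarrow> (real \<Rightarrow> complex) \<Rightarrow> 'h \<Rightarrow> 'h \<Rightarrow> bool" where
  "approximates s f x y \<longleftrightarrow> (\<forall>n. simple_function borel (s n)) \<and>
     (\<lambda>n. l2sq (\<mu> x) (\<lambda>l. f l - s n l)) \<longlonglongrightarrow> 0 \<and> (\<lambda>n. S (s n) x) \<longlonglongrightarrow> y"

lemma approximatesD:
  assumes "approximates s f x y"
  shows "simple_function borel (s n)" "(\<lambda>n. l2sq (\<mu> x) (\<lambda>l. f l - s n l)) \<longlonglongrightarrow> 0"
    "(\<lambda>n. S (s n) x) \<longlonglongrightarrow> y"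
  using assms by (simp_all add: approximates_def)

lemma Int_op_approximates: "(x, y) \<in> Int_op f \<Longrightarrow> \<exists>s. approximates s f x y"
  unfolding spectral_integral_def approximates_def mem_Collect_eq prod.case .

lemma S_dist_le:
  assumes s: "simple_function borel s" and t: "simple_function borel t" and f: "f \<in> borel_measurable borel"
  shows "ennreal ((norm (S s x - S t x))\<^sup>2) \<le> 2 * l2sq (\<mu> x) (\<lambda>l. f l - s l) + 2 * l2sq (\<mu> x) (\<lambda>l. f l - t l)"
proof -
  note [measurable] = borel_measurable_simple_function[OF s] borel_measurable_simple_function[OF t] f
  have "ennreal ((norm (S s x - S t x))\<^sup>2) = l2sq (\<mu> x) (\<lambda>l. s l - t l)"
    using S_isometry[of "\<lambda>l. s l - t l" x] s t by (simp add: S_diff)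
  also have "\<dots> \<le> 2 * l2sq (\<mu> x) (\<lambda>l. s l - f l) + 2 * l2sq (\<mu> x) (\<lambda>l. f l - t l)"
    by (rule l2sq_triangle) auto
  finally show ?thesis by (simp add: l2sq_commute[of _ s f])
qed

lemma Int_op_unique:
  assumes "f \<in> borel_measurable borel" "(x, y) \<in> Int_op f" "(x, z) \<in> Int_op f"
  shows "y = z"
proof -
  obtain s t where "approximates s f x y" "approximates t f x z"
    using Int_op_approximates assms(2,3) by blast
  note s = approximatesD[OF this(1)] and t = approximatesD[OF this(2)]
  have "(\<lambda>n. ennreal ((norm (S (s n) x - S (t n) x))\<^sup>2)) \<longlonglongrightarrow> 0"
  proof (rule tendsto_sandwich[OF _ _ tendsto_const])
    show "\<forall>\<^sub>F n in sequentially. ennreal ((norm (S (s n) x - S (t n) x))\<^sup>2)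
        \<le> 2 * l2sq (\<mu> x) (\<lambda>l. f l - s n l) + 2 * l2sq (\<mu> x) (\<lambda>l. f l - t n l)"
      using S_dist_le[OF s(1) t(1) assms(1)] by (intro always_eventually allI)
    have "(\<lambda>n. 2 * l2sq (\<mu> x) (\<lambda>l. f l - s n l) + 2 * l2sq (\<mu> x) (\<lambda>l. f l - t n l)) \<longlonglongrightarrow> 2 * 0 + 2 * 0"
      by (intro tendsto_add tendsto_mult_ennreal tendsto_const s(2) t(2)) auto
    then show "(\<lambda>n. 2 * l2sq (\<mu> x) (\<lambda>l. f l - s n l) + 2 * l2sq (\<mu> x) (\<lambda>l. f l - t n l)) \<longlonglongrightarrow> 0"
      by simp
  qed simp
  moreover have "(\<lambda>n. ennreal ((norm (S (s n) x - S (t n) x))\<^sup>2)) \<longlonglongrightarrow> ennreal ((norm (y - z))\<^sup>2)"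
    by (intro tendsto_ennrealI tendsto_intros s t)
  ultimately have "ennreal ((norm (y - z))\<^sup>2) = 0" by (rule LIMSEQ_unique[symmetric])
  then show ?thesis by simp
qed

text \<open>The simple integral is isometric for the mean square norm, so approximation in the mean
  square produces Cauchy sequences.\<close>

lemma S_convergent:
  assumes s: "\<And>n. simple_function borel (s n)" and f: "f \<in> borel_measurable borel"
    and lim: "(\<lambda>n. l2sq (\<mu> x) (\<lambda>l. f l - s n l)) \<longlonglongrightarrow> 0"
  shows "convergent (\<lambda>n. S (s n) x)"
proof (rule Cauchy_convergent, rule CauchyI)
  fix e :: real assume "e > 0"
  then have "0 < ennreal (e\<^sup>2 / 4)" by simp
  from order_tendstoD(2)[OF lim this] obtain N where
    N: "\<And>n. n \<ge> N \<Longrightarrow> l2sq (\<mu> x) (\<lambda>l. f l - s n l) < ennreal (e\<^sup>2 / 4)"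
    unfolding eventually_sequentially by blast
  have "norm (S (s m) x - S (s n) x) < e" if "m \<ge> N" "n \<ge> N" for m n
  proof -
    have *: "2 * a < ennreal (e\<^sup>2 / 2)" if "a < ennreal (e\<^sup>2 / 4)" for a
    proof -
      have "2 * a < 2 * ennreal (e\<^sup>2 / 4)" using that
        by (intro ennreal_mult_strict_left_mono) auto
      also have "\<dots> = ennreal (e\<^sup>2 / 2)" by (simp add: ennreal_mult'[symmetric] flip: ennreal_numeral)
      finally show ?thesis .
    qed
    have "ennreal ((norm (S (s m) x - S (s n) x))\<^sup>2)
        \<le> 2 * l2sq (\<mu> x) (\<lambda>l. f l - s m l) + 2 * l2sq (\<mu> x) (\<lambda>l. f l - s n l)"
      by (rule S_dist_le[OF s s f])
    also have "\<dots> < ennreal (e\<^sup>2 / 2) + ennreal (e\<^sup>2 / 2)"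
      using *[OF N[OF that(1)]] *[OF N[OF that(2)]] by (rule add_strict_mono)
    also have "\<dots> = ennreal (e\<^sup>2)" by (simp flip: ennreal_plus)
    finally have "(norm (S (s m) x - S (s n) x))\<^sup>2 < e\<^sup>2" by (simp add: ennreal_less_iff)
    then show ?thesis using \<open>e > 0\<close> by (simp add: power_less_imp_less_base)
  qed
  then show "\<exists>M. \<forall>m\<ge>M. \<forall>n\<ge>M. norm (S (s m) x - S (s n) x) < e" by blast
qed

lemma Int_op_T:
  assumes f: "bounded_borel f"
  shows "(x, T f x) \<in> Int_op f"
proof -
  obtain s C where s: "\<And>n. simple_function borel (s n)" "\<And>n l. cmod (s n l) \<le> C"
    "\<And>l. (\<lambda>n. s n l) \<longlonglongrightarrow> f l"
    using simple_approximation[OF f] by metis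
  have fb: "f \<in> borel_measurable borel" using f by (simp add: bounded_borel_def)
  have l: "(\<lambda>n. l2sq (\<mu> x) (\<lambda>l. f l - s n l)) \<longlonglongrightarrow> 0"
    by (rule l2sq_bounded_convergence[OF finite_measure_\<mu> sets_\<mu> fb]) (use s simple_borel in auto)
  obtain y where y: "(\<lambda>n. S (s n) x) \<longlonglongrightarrow> y"
    using S_convergent[OF s(1) fb l] by (auto simp: convergent_def)
  have y: "(x, y) \<in> Int_op f" by (rule Int_opI[OF s(1) l y])
  have z: "z = y" if "(x, z) \<in> Int_op f" for z by (rule Int_op_unique[OF fb that y])
  have "T f x = y" unfolding T_def by (rule the_equality, rule y, rule z)
  with y show ?thesis by simp
qed

lemma T_eqI:
  assumes f: "bounded_borel f" and "(x, y) \<in> Int_op f"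
  shows "T f x = y"
proof -
  have "f \<in> borel_measurable borel" using f unfolding bounded_borel_def by (rule conjunct1)
  then show ?thesis by (rule Int_op_unique[OF _ Int_op_T[OF f] assms(2)])
qed

lemma S_tendsto_T:
  assumes f: "bounded_borel f" and s: "\<And>n. simple_function borel (s n)" "\<And>n l. cmod (s n l) \<le> C"
    "\<And>l. (\<lambda>n. s n l) \<longlonglongrightarrow> f l"
  shows "(\<lambda>n. S (s n) x) \<longlonglongrightarrow> T f x"
proof -
  have fb: "f \<in> borel_measurable borel" using f by (simp add: bounded_borel_def)
  have l: "(\<lambda>n. l2sq (\<mu> x) (\<lambda>l. f l - s n l)) \<longlonglongrightarrow> 0"
    by (rule l2sq_bounded_convergence[OF finite_measure_\<mu> sets_\<mu> fb]) (use s simple_borel in auto)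
  obtain y where y: "(\<lambda>n. S (s n) x) \<longlonglongrightarrow> y"
    using S_convergent[OF s(1) fb l] by (auto simp: convergent_def)
  have "T f x = y" by (rule T_eqI[OF f Int_opI[OF s(1) l y]])
  with y show ?thesis by simp
qed

lemma T_simple: "simple_function borel s \<Longrightarrow> T s x = S s x"
proof -
  assume s: "simple_function borel s"
  obtain C where "\<And>l. cmod (s l) \<le> C" using bounded_borel_simple[OF s] bounded_borelE by metis
  then have "(\<lambda>n. S s x) \<longlonglongrightarrow> T s x" using s by (intro S_tendsto_T bounded_borel_simple) auto
  then show ?thesis by (simp add: LIMSEQ_const_iff)
qed

lemma T_isometry:
  assumes f: "bounded_borel f"
  shows "l2sq (\<mu> x) f = ennreal ((norm (T f x))\<^sup>2)"
proof -
  obtain s C where s: "\<And>n. simple_function borel (s n)" "\<And>n l. cmod (s n l) \<le> C"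
    "\<And>l. (\<lambda>n. s n l) \<longlonglongrightarrow> f l"
    using simple_approximation[OF f] by metis
  interpret finite_measure "\<mu> x" by (rule finite_measure_\<mu>)
  have [measurable]: "f \<in> borel_measurable borel" using f by (simp add: bounded_borel_def)
  note [measurable] = simple_borel[OF s(1)]
  have "(\<lambda>n. l2sq (\<mu> x) (s n)) \<longlonglongrightarrow> l2sq (\<mu> x) f"
  proof (rule nn_integral_dominated_convergence[where w="\<lambda>_. ennreal (C\<^sup>2)"])
    show "AE x in \<mu> x. ennreal ((cmod (s j x))\<^sup>2) \<le> ennreal (C\<^sup>2)" for j
      using s(2) by (intro AE_I2 ennreal_leI power_mono) auto
    show "AE x in \<mu> x. (\<lambda>i. ennreal ((cmod (s i x))\<^sup>2)) \<longlonglongrightarrow> ennreal ((cmod (f x))\<^sup>2)"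
      by (intro AE_I2 tendsto_ennrealI tendsto_intros s)
    show "(\<integral>\<^sup>+ l. ennreal (C\<^sup>2) \<partial>\<mu> x) < \<infinity>"
      using emeasure_finite[of "space (\<mu> x)"] ennreal_mult_eq_top_iff by (auto simp: top.not_eq_extremum[symmetric])
  qed auto
  moreover have "(\<lambda>n. l2sq (\<mu> x) (s n)) \<longlonglongrightarrow> ennreal ((norm (T f x))\<^sup>2)"
    unfolding S_isometry[OF s(1)] by (intro tendsto_ennrealI tendsto_intros S_tendsto_T[OF f s])
  ultimately show ?thesis by (rule LIMSEQ_unique)
qed

lemma T_add_right:
  assumes f: "bounded_borel f"
  shows "T f (x + y) = T f x + T f y"
proof -
  obtain s C where s: "\<And>n. simple_function borel (s n)" "\<And>n l. cmod (s n l) \<le> C"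
    "\<And>l. (\<lambda>n. s n l) \<longlonglongrightarrow> f l"
    using simple_approximation[OF f] by metis
  have "(\<lambda>n. S (s n) (x + y)) \<longlonglongrightarrow> T f (x + y)" by (rule S_tendsto_T[OF f s])
  moreover have "(\<lambda>n. S (s n) (x + y)) \<longlonglongrightarrow> T f x + T f y"
    unfolding S_add_right[OF s(1)] by (intro tendsto_add S_tendsto_T[OF f s])
  ultimately show ?thesis by (rule LIMSEQ_unique)
qed

lemma T_scaleC_right:
  assumes f: "bounded_borel f"
  shows "T f (a *\<^sub>C x) = a *\<^sub>C T f x"
proof -
  obtain s C where s: "\<And>n. simple_function borel (s n)" "\<And>n l. cmod (s n l) \<le> C"
    "\<And>l. (\<lambda>n. s n l) \<longlonglongrightarrow> f l"
    using simple_approximation[OF f] by metis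
  have "(\<lambda>n. S (s n) (a *\<^sub>C x)) \<longlonglongrightarrow> T f (a *\<^sub>C x)" by (rule S_tendsto_T[OF f s])
  moreover have "(\<lambda>n. S (s n) (a *\<^sub>C x)) \<longlonglongrightarrow> a *\<^sub>C T f x"
    unfolding S_scaleC_right[OF s(1)] by (intro tendsto_scaleC S_tendsto_T[OF f s])
  ultimately show ?thesis by (rule LIMSEQ_unique)
qed

lemma T_zero_right [simp]: "bounded_borel f \<Longrightarrow> T f 0 = 0"
  using T_scaleC_right[of f 0 0] by simp

lemma T_minus_right: "bounded_borel f \<Longrightarrow> T f (- x) = - T f x"
  using T_scaleC_right[of f "-1" x] by (simp add: scaleC_minus_left)

lemma T_diff_right: "bounded_borel f \<Longrightarrow> T f (x - y) = T f x - T f y"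
  using T_add_right[of f x "- y"] by (simp add: T_minus_right)

lemma T_norm_le:
  assumes f: "bounded_borel f" and C: "\<And>l. cmod (f l) \<le> C"
  shows "norm (T f x) \<le> C * norm x"
proof -
  have "C \<ge> 0" using order_trans[OF norm_ge_zero C[of 0]] .
  have "ennreal ((norm (T f x))\<^sup>2) \<le> (\<integral>\<^sup>+ l. ennreal (C\<^sup>2) \<partial>\<mu> x)"
    unfolding T_isometry[OF f, symmetric] using C by (intro nn_integral_mono ennreal_leI power_mono) auto
  also have "\<dots> = ennreal ((C * norm x)\<^sup>2)"
    by (simp add: emeasure_\<mu> ennreal_mult[symmetric] power_mult_distrib)
  finally show ?thesis using \<open>C \<ge> 0\<close> by (simp add: ennreal_le_iff power_mono_iff)
qed

lemma bounded_linear_T: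
  assumes f: "bounded_borel f"
  shows "bounded_linear (T f)"
proof -
  obtain C where C: "\<And>l. cmod (f l) \<le> C" using f bounded_borelE by metis
  show ?thesis
    by (rule bounded_linear_intro[where K=C])
      (use T_norm_le[OF f C] T_add_right[OF f] T_scaleC_right[OF f] in \<open>auto simp: mult.commute scaleR_scaleC\<close>)
qed

lemma T_diff:
  assumes f: "bounded_borel f" and g: "bounded_borel g"
  shows "T (\<lambda>l. f l - g l) x = T f x - T g x"
proof -
  obtain s C where s: "\<And>n. simple_function borel (s n)" "\<And>n l. cmod (s n l) \<le> C"
    "\<And>l. (\<lambda>n. s n l) \<longlonglongrightarrow> f l"
    using simple_approximation[OF f] by metis
  obtain t D where t: "\<And>n. simple_function borel (t n)" "\<And>n l. cmod (t n l) \<le> D"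
    "\<And>l. (\<lambda>n. t n l) \<longlonglongrightarrow> g l"
    using simple_approximation[OF g] by metis
  have "(\<lambda>n. S (\<lambda>l. s n l - t n l) x) \<longlonglongrightarrow> T (\<lambda>l. f l - g l) x"
  proof (rule S_tendsto_T[where C="C + D"])
    show "cmod (s n l - t n l) \<le> C + D" for n l
      using norm_triangle_ineq4[of "s n l" "t n l"] s(2)[of n l] t(2)[of n l] by linarith
  qed (intro bounded_borel_diff f g simple_function_diff s t tendsto_diff)+
  moreover have "(\<lambda>n. S (\<lambda>l. s n l - t n l) x) \<longlonglongrightarrow> T f x - T g x"
    unfolding S_diff[OF s(1) t(1)] by (intro tendsto_diff S_tendsto_T[OF f s] S_tendsto_T[OF g t])
  ultimately show ?thesis by (rule LIMSEQ_unique)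
qed

text \<open>By the isometry of \<open>T\<close> this is dominated convergence in the mean square.\<close>

lemma T_tendsto:
  assumes f: "f \<in> borel_measurable borel" and s: "\<And>n. s n \<in> borel_measurable borel"
    and C: "\<And>n l. cmod (s n l) \<le> C" and lim: "\<And>l. (\<lambda>n. s n l) \<longlonglongrightarrow> f l"
  shows "(\<lambda>n. T (s n) x) \<longlonglongrightarrow> T f x"
proof -
  have Cf: "cmod (f l) \<le> C" for l
    using LIMSEQ_le_const2[OF tendsto_norm[OF lim[of l]]] C by auto
  have bf: "bounded_borel f" and bs: "bounded_borel (s n)" for n
    using f s Cf C by (auto intro: bounded_borelI[where C=C])
  have "(\<lambda>n. l2sq (\<mu> x) (\<lambda>l. f l - s n l)) \<longlonglongrightarrow> 0"
    by (rule l2sq_bounded_convergence[OF finite_measure_\<mu> sets_\<mu> f s C lim])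
  then have "(\<lambda>n. ennreal ((norm (T f x - T (s n) x))\<^sup>2)) \<longlonglongrightarrow> ennreal 0"
    using T_isometry[OF bounded_borel_diff[OF bf bs]] T_diff[OF bf bs] by simp
  then have "(\<lambda>n. (norm (T f x - T (s n) x))\<^sup>2) \<longlonglongrightarrow> 0"
    by (subst (asm) tendsto_ennreal_iff) auto
  then have "(\<lambda>n. sqrt ((norm (T f x - T (s n) x))\<^sup>2)) \<longlonglongrightarrow> sqrt 0" by (rule tendsto_real_sqrt)
  then have "(\<lambda>n. T f x - T (s n) x) \<longlonglongrightarrow> 0" by (simp add: tendsto_norm_zero_iff)
  then have "(\<lambda>n. T f x - (T f x - T (s n) x)) \<longlonglongrightarrow> T f x - 0" by (intro tendsto_intros)
  then show ?thesis by simp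
qed

text \<open>The two factors are approximated one after the other, so that only products with a simple
  factor occur.\<close>

lemma T_mult:
  assumes f: "bounded_borel f" and g: "bounded_borel g"
  shows "T (\<lambda>l. f l * g l) x = T f (T g x)"
proof -
  have simple: "T (\<lambda>l. u l * g l) x = T u (T g x)" if u: "simple_function borel u" for u
  proof -
    obtain t D where t: "\<And>n. simple_function borel (t n)" "\<And>n l. cmod (t n l) \<le> D"
      "\<And>l. (\<lambda>n. t n l) \<longlonglongrightarrow> g l"
      using simple_approximation[OF g] by metis
    obtain C where C: "\<And>l. cmod (u l) \<le> C" "C > 0" using bounded_borel_simple[OF u] bounded_borelE by metis
    have "(\<lambda>n. T (\<lambda>l. u l * t n l) x) \<longlonglongrightarrow> T (\<lambda>l. u l * g l) x"
    proof (rule T_tendsto[where C="C * D"])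
      show "cmod (u l * t n l) \<le> C * D" for n l 
        using C t(2) by (auto simp: norm_mult intro!: mult_mono)
    next
      have [measurable]: "g \<in> borel_measurable borel" "u \<in> borel_measurable borel" "t n \<in> borel_measurable borel" for n
        using g u t simple_borel by (simp_all add: bounded_borel_def)
      show "(\<lambda>l. u l * g l) \<in> borel_measurable borel" "(\<lambda>l. u l * t n l) \<in> borel_measurable borel" for n
        by measurable
    qed (intro tendsto_intros t)
    moreover have "(\<lambda>n. T (\<lambda>l. u l * t n l) x) \<longlonglongrightarrow> T u (T g x)"
    proof -
      have "T (\<lambda>l. u l * t n l) x = T u (T (t n) x)" for n
        using u t(1) by (simp add: T_simple S_mult)
      moreover have "(\<lambda>n. T u (T (t n) x)) \<longlonglongrightarrow> T u (T g x)"
        using S_tendsto_T[OF g t] u t(1)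
        by (intro bounded_linear.tendsto[OF bounded_linear_T]) (auto simp: T_simple bounded_borel_simple)
      ultimately show ?thesis by simp
    qed
    ultimately show ?thesis by (rule LIMSEQ_unique)
  qed
  obtain s C where s: "\<And>n. simple_function borel (s n)" "\<And>n l. cmod (s n l) \<le> C"
    "\<And>l. (\<lambda>n. s n l) \<longlonglongrightarrow> f l" "C > 0"
    using simple_approximation[OF f] by metis
  obtain D where D: "\<And>l. cmod (g l) \<le> D" "D > 0" using g bounded_borelE by metis
  have "(\<lambda>n. T (\<lambda>l. s n l * g l) x) \<longlonglongrightarrow> T (\<lambda>l. f l * g l) x"
  proof (rule T_tendsto[where C="C * D"])
    show "cmod (s n l * g l) \<le> C * D" for n l 
      using D s(2,4) by (auto simp: norm_mult intro!: mult_mono)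
  next
    have [measurable]: "g \<in> borel_measurable borel" "f \<in> borel_measurable borel" "s n \<in> borel_measurable borel" for n
      using g f s simple_borel by (simp_all add: bounded_borel_def)
    show "(\<lambda>l. f l * g l) \<in> borel_measurable borel" "(\<lambda>l. s n l * g l) \<in> borel_measurable borel" for n
      by measurable
  qed (intro tendsto_intros s)
  moreover have "(\<lambda>n. T (\<lambda>l. s n l * g l) x) \<longlonglongrightarrow> T f (T g x)"
    unfolding simple[OF s(1)] using S_tendsto_T[OF f s(1-3)] by (simp add: T_simple s)
  ultimately show ?thesis by (rule LIMSEQ_unique)
qed

lemma T_indicator: "B \<in> sets borel \<Longrightarrow> T (indicator B) x = E B x"
  using T_simple[of "indicator B"] by (simp add: S_indicator)

lemma T_const: "T (\<lambda>_. c) x = c *\<^sub>C x"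
proof -
  have "T (\<lambda>_. c) x = S (\<lambda>_. c) x" by (rule T_simple) simp
  then show ?thesis by (simp add: simple_spectral_integral_def vimage_def)
qed

lemma T_scaleC: "bounded_borel f \<Longrightarrow> T (\<lambda>l. c * f l) x = c *\<^sub>C T f x"
  using T_mult[OF bounded_borel_const] by (simp add: T_const)

lemma T_add: 
  assumes "bounded_borel f" "bounded_borel g"
  shows "T (\<lambda>l. f l + g l) x = T f x + T g x"
  using T_diff[OF assms(1) bounded_borel_mult[OF bounded_borel_const[of "-1"] assms(2)], of x]
    T_scaleC[OF assms(2), of "-1" x]
  by (simp add: scaleC_minus_left)

lemma T_adjoint:
  assumes f: "bounded_borel f"
  shows "cinner y (T f x) = cinner (T (\<lambda>l. cnj (f l)) y) x"
proof -
  obtain s C where s: "\<And>n. simple_function borel (s n)" "\<And>n l. cmod (s n l) \<le> C"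
    "\<And>l. (\<lambda>n. s n l) \<longlonglongrightarrow> f l"
    using simple_approximation[OF f] by metis
  have "(\<lambda>n. S (\<lambda>l. cnj (s n l)) y) \<longlonglongrightarrow> T (\<lambda>l. cnj (f l)) y"
  proof (rule S_tendsto_T[where C=C])
    show "bounded_borel (\<lambda>l. cnj (f l))" by (rule bounded_borel_cnj[OF f])
    show "simple_function borel (\<lambda>l. cnj (s n l))" for n by (rule simple_function_compose1[OF s(1)])
  qed (use s in \<open>auto intro!: tendsto_cnj\<close>)
  then have "(\<lambda>n. cinner (S (\<lambda>l. cnj (s n l)) y) x) \<longlonglongrightarrow> cinner (T (\<lambda>l. cnj (f l)) y) x"
    by (intro tendsto_intros)
  moreover have "(\<lambda>n. cinner y (S (s n) x)) \<longlonglongrightarrow> cinner y (T f x)"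
    by (intro tendsto_intros S_tendsto_T[OF f s])
  ultimately show ?thesis unfolding S_adjoint[OF s(1)] by (rule LIMSEQ_unique[symmetric])
qed

lemma T_commute: "bounded_borel f \<Longrightarrow> bounded_borel g \<Longrightarrow> T f (T g x) = T g (T f x)"
  by (simp flip: T_mult add: mult.commute)

lemma T_trunc: "B \<in> sets borel \<Longrightarrow> bounded_borel f \<Longrightarrow> T (trunc B f) x = E B (T f x)"
  unfolding trunc_def by (simp add: T_mult bounded_borel_indicator T_indicator)

lemma E_incseq: 
  assumes "range B \<subseteq> sets borel" "incseq B" "(\<Union>n. B n) = UNIV"
  shows "(\<lambda>n. E (B n) x) \<longlonglongrightarrow> x"
proof -
  have "(\<lambda>n. T (indicator (B n)) x) \<longlonglongrightarrow> T (\<lambda>_. 1) x"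
  proof (rule T_tendsto[where C=1])
    fix l
    have "(\<lambda>n. indicator (B n) l :: complex) \<longlonglongrightarrow> indicator (\<Union>n. B n) l"
      by (rule LIMSEQ_indicator_incseq[OF assms(2)])
    then show "(\<lambda>n. indicator (B n) l :: complex) \<longlonglongrightarrow> 1" by (simp add: assms(3))
  qed (use assms(1) in \<open>auto simp: indicator_def\<close>)
  then show ?thesis using assms(1) by (simp add: T_indicator T_const image_subset_iff)
qed

lemma E_exhausts: "exhausts B f \<Longrightarrow> (\<lambda>n. E (B n) x) \<longlonglongrightarrow> x"
  by (rule E_incseq) (auto simp: exhausts_def)

lemma Int_op_trunc:
  assumes f: "f \<in> borel_measurable borel" and xy: "(x, y) \<in> Int_op f" and B: "B \<in> sets borel"
  shows "(x, E B y) \<in> Int_op (trunc B f)"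
proof -
  obtain s where "approximates s f x y" using Int_op_approximates[OF xy] ..
  note s = approximatesD[OF this]
  have ind: "simple_function borel (indicator B :: real \<Rightarrow> complex)" using B by simp
  have 1: "simple_function borel (trunc B (s n))" for n
    unfolding trunc_def by (intro simple_function_mult ind s)
  have "S (trunc B (s n)) x = E B (S (s n) x)" for n
    unfolding trunc_def using S_mult[OF ind s(1)] by (simp add: S_indicator B)
  then have 2: "(\<lambda>n. S (trunc B (s n)) x) \<longlonglongrightarrow> E B y"
    using bounded_linear.tendsto[OF bounded_linear_E[OF B] s(3)] by simp
  have "(\<lambda>n. l2sq (\<mu> x) (\<lambda>l. trunc B f l - trunc B (s n) l)) \<longlonglongrightarrow> 0"
  proof (rule tendsto_sandwich[OF _ _ tendsto_const s(2)])
    show "\<forall>\<^sub>F n in sequentially. l2sq (\<mu> x) (\<lambda>l. trunc B f l - trunc B (s n) l) \<le> l2sq (\<mu> x) (\<lambda>l. f l - s n l)"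
      by (intro always_eventually allI nn_integral_mono) (auto simp: trunc_def indicator_def)
  qed auto
  from Int_opI[OF 1 this 2] show ?thesis .
qed

text \<open>The domain and the values of an unbounded spectral integral are determined by its bounded
  truncations. This turns every later statement about unbounded functions into algebra with the
  multiplicative map \<open>T\<close>.\<close>

lemma Int_op_iff:
  assumes f: "f \<in> borel_measurable borel" and B: "exhausts B f"
  shows "(x, y) \<in> Int_op f \<longleftrightarrow> (\<forall>n. E (B n) y = T (trunc (B n) f) x)"
proof safe
  fix n assume "(x, y) \<in> Int_op f"
  then show "E (B n) y = T (trunc (B n) f) x"
    using T_eqI[OF exhausts_bounded[OF B] Int_op_trunc[OF f]] exhausts_sets[OF B] by metis
next
  assume eq: "\<forall>n. E (B n) y = T (trunc (B n) f) x"
  note [measurable] = f exhausts_sets[OF B]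
  have [measurable]: "trunc (B n) f \<in> borel_measurable borel" for n
    using exhausts_bounded[OF B] by (simp add: bounded_borel_def)
  have inc: "incseq B" and un: "\<Union> (range B) = UNIV" using B by (auto simp: exhausts_def)
  have ev: "eventually (\<lambda>n. l \<in> B n) sequentially" for l
  proof -
    obtain N where "l \<in> B N" using un by blast
    then show ?thesis using inc by (auto simp: eventually_sequentially incseq_def)
  qed
  have cut_lim: "(\<lambda>n. trunc (B n) f l) \<longlonglongrightarrow> f l" for l
    by (rule tendsto_eventually, rule eventually_mono[OF ev[of l]]) (simp add: trunc_def)
  have fin: "l2sq (\<mu> x) f < \<infinity>"
  proof -
    have "(\<lambda>n. l2sq (\<mu> x) (trunc (B n) f)) \<longlonglongrightarrow> l2sq (\<mu> x) f"
    proof (rule nn_integral_LIMSEQ)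
      show "incseq (\<lambda>i x. ennreal ((cmod (trunc (B i) f x))\<^sup>2))"
        using inc by (fastforce simp: incseq_def trunc_def indicator_def le_fun_def)
      show "(\<lambda>i. ennreal ((cmod (trunc (B i) f l))\<^sup>2)) \<longlonglongrightarrow> ennreal ((cmod (f l))\<^sup>2)" for l
        by (intro tendsto_ennrealI tendsto_intros cut_lim)
    qed auto
    moreover have "l2sq (\<mu> x) (trunc (B n) f) \<le> ennreal ((norm y)\<^sup>2)" for n
      using eq by (auto simp: T_isometry[OF exhausts_bounded[OF B]] norm_E_le simp flip: eq[rule_format]
        intro!: ennreal_leI power_mono)
    ultimately have "l2sq (\<mu> x) f \<le> ennreal ((norm y)\<^sup>2)" by (intro LIMSEQ_le_const2) auto
    from le_less_trans[OF this ennreal_less_top] show ?thesis by simp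
  qed
  have tail: "(\<lambda>n. l2sq (\<mu> x) (\<lambda>l. f l - trunc (B n) f l)) \<longlonglongrightarrow> 0"
  proof -
    have "(\<lambda>n. l2sq (\<mu> x) (\<lambda>l. f l - trunc (B n) f l)) \<longlonglongrightarrow> (\<integral>\<^sup>+ l. 0 \<partial>\<mu> x)"
    proof (rule nn_integral_dominated_convergence[where w="\<lambda>l. ennreal ((cmod (f l))\<^sup>2)"])
      show "AE l in \<mu> x. (\<lambda>i. ennreal ((cmod (f l - trunc (B i) f l))\<^sup>2)) \<longlonglongrightarrow> 0"
      proof (rule AE_I2)
        fix l
        have "(\<lambda>i. ennreal ((cmod (f l - trunc (B i) f l))\<^sup>2)) \<longlonglongrightarrow> ennreal ((cmod (f l - f l))\<^sup>2)"
          by (intro tendsto_ennrealI tendsto_intros cut_lim)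
        then show "(\<lambda>i. ennreal ((cmod (f l - trunc (B i) f l))\<^sup>2)) \<longlonglongrightarrow> 0" by simp
      qed
    qed (use fin in \<open>auto simp: trunc_def indicator_def\<close>)
    then show ?thesis by simp
  qed
  have "\<exists>s. simple_function borel s \<and> l2sq (\<mu> x) (\<lambda>l. trunc (B n) f l - s l) < ennreal (1 / Suc n)
      \<and> norm (S s x - E (B n) y) < 1 / Suc n" for n
  proof -
    obtain s where "approximates s (trunc (B n) f) x (E (B n) y)"
      using Int_op_approximates[OF Int_op_T[OF exhausts_bounded[OF B]]] eq by metis
    note s = approximatesD[OF this]
    have "\<forall>\<^sub>F k in sequentially. l2sq (\<mu> x) (\<lambda>l. trunc (B n) f l - s k l) < ennreal (1 / Suc n)"
      by (rule order_tendstoD(2)[OF s(2)]) simp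
    moreover have "\<forall>\<^sub>F k in sequentially. norm (S (s k) x - E (B n) y) < 1 / Suc n"
      using tendstoD[OF s(3), of "1 / Suc n"] by (simp add: dist_norm)
    ultimately have "\<forall>\<^sub>F k in sequentially. l2sq (\<mu> x) (\<lambda>l. trunc (B n) f l - s k l) < ennreal (1 / Suc n)
       \<and> norm (S (s k) x - E (B n) y) < 1 / Suc n" by eventually_elim simp
    then show ?thesis using s(1) eventually_happens' sequentially_bot by blast
  qed
  then have "\<forall>n. \<exists>s. simple_function borel s \<and> l2sq (\<mu> x) (\<lambda>l. trunc (B n) f l - s l) < ennreal (1 / Suc n)
      \<and> norm (S s x - E (B n) y) < 1 / Suc n" ..
  from choice[OF this] obtain s where "\<forall>n. simple_function borel (s n)
      \<and> l2sq (\<mu> x) (\<lambda>l. trunc (B n) f l - s n l) < ennreal (1 / Suc n)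
      \<and> norm (S (s n) x - E (B n) y) < 1 / Suc n" ..
  then have s: "simple_function borel (s n)"
    "l2sq (\<mu> x) (\<lambda>l. trunc (B n) f l - s n l) < ennreal (1 / Suc n)"
    "norm (S (s n) x - E (B n) y) < 1 / Suc n" for n by simp_all
  have inv0: "(\<lambda>n. 1 / real (Suc n)) \<longlonglongrightarrow> 0" using LIMSEQ_inverse_real_of_nat by (simp add: inverse_eq_divide)
  have "(\<lambda>n. S (s n) x - E (B n) y) \<longlonglongrightarrow> 0"
    by (rule Lim_null_comparison[OF _ inv0]) (intro always_eventually allI less_imp_le s(3))
  from tendsto_add[OF this E_exhausts[OF B, of y]] have 3: "(\<lambda>n. S (s n) x) \<longlonglongrightarrow> y" by simp
  have "(\<lambda>n. l2sq (\<mu> x) (\<lambda>l. f l - s n l)) \<longlonglongrightarrow> 0"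
  proof (rule tendsto_sandwich[OF _ _ tendsto_const])
    show "\<forall>\<^sub>F n in sequentially. l2sq (\<mu> x) (\<lambda>l. f l - s n l)
       \<le> 2 * l2sq (\<mu> x) (\<lambda>l. f l - trunc (B n) f l) + 2 * ennreal (1 / Suc n)"
    proof (intro always_eventually allI)
      fix n
      note [measurable] = simple_borel[OF s(1)[of n]]
      have "l2sq (\<mu> x) (\<lambda>l. f l - s n l) \<le> 2 * l2sq (\<mu> x) (\<lambda>l. f l - trunc (B n) f l) + 2 * l2sq (\<mu> x) (\<lambda>l. trunc (B n) f l - s n l)"
        by (rule l2sq_triangle) auto
      also have "\<dots> \<le> 2 * l2sq (\<mu> x) (\<lambda>l. f l - trunc (B n) f l) + 2 * ennreal (1 / Suc n)"
        using s(2)[of n] by (intro add_left_mono mult_left_mono) auto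
      finally show "l2sq (\<mu> x) (\<lambda>l. f l - s n l) \<le> 2 * l2sq (\<mu> x) (\<lambda>l. f l - trunc (B n) f l) + 2 * ennreal (1 / Suc n)" .
    qed
    have "(\<lambda>n. 2 * l2sq (\<mu> x) (\<lambda>l. f l - trunc (B n) f l) + 2 * ennreal (1 / Suc n)) \<longlonglongrightarrow> 2 * 0 + 2 * ennreal 0"
      by (intro tendsto_add tendsto_mult_ennreal tendsto_const tail tendsto_ennrealI inv0) auto
    then show "(\<lambda>n. 2 * l2sq (\<mu> x) (\<lambda>l. f l - trunc (B n) f l) + 2 * ennreal (1 / Suc n)) \<longlonglongrightarrow> 0" by simp
  qed auto
  from Int_opI[OF s(1) this 3] show "(x, y) \<in> Int_op f" .
qed

end

context pvm
begin

lemma Int_op_iff_T: "bounded_borel f \<Longrightarrow> (x, y) \<in> Int_op f \<longleftrightarrow> y = T f x"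
  using Int_op_T T_eqI by blast

lemma trunc_mult: "trunc B (\<lambda>l. f l * g l) = (\<lambda>l. trunc B f l * trunc B g l)"
  by (rule ext) (simp add: trunc_def indicator_def)

lemma T_trunc_E: "exhausts B f \<Longrightarrow> T (trunc (B n) f) (E (B n) x) = T (trunc (B n) f) x"
proof -
  assume B: "exhausts B f"
  have "T (\<lambda>l. trunc (B n) f l * indicator (B n) l) x = T (trunc (B n) f) (T (indicator (B n)) x)"
    by (rule T_mult[OF exhausts_bounded[OF B] bounded_borel_indicator[OF exhausts_sets[OF B]]])
  moreover have "(\<lambda>l. trunc (B n) f l * indicator (B n) l) = trunc (B n) f"
    by (rule ext) (simp add: trunc_def indicator_def)
  ultimately show ?thesis by (simp add: T_indicator exhausts_sets[OF B])
qed

lemma Int_op_closed: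
  assumes f: "f \<in> borel_measurable borel"
    and "\<And>n. (x n, y n) \<in> Int_op f" "x \<longlonglongrightarrow> a" "y \<longlonglongrightarrow> b"
  shows "(a, b) \<in> Int_op f"
proof -
  obtain B where B: "exhausts B f" using exhausts_exists[OF f f] .
  have "E (B k) b = T (trunc (B k) f) a" for k
  proof -
    have "(\<lambda>n. E (B k) (y n)) \<longlonglongrightarrow> E (B k) b"
      by (rule bounded_linear.tendsto[OF bounded_linear_E[OF exhausts_sets[OF B]] assms(4)])
    moreover have "E (B k) (y n) = T (trunc (B k) f) (x n)" for n
      using assms(2)[of n] Int_op_iff[OF f B] by blast
    moreover have "(\<lambda>n. T (trunc (B k) f) (x n)) \<longlonglongrightarrow> T (trunc (B k) f) a"
      by (rule bounded_linear.tendsto[OF bounded_linear_T[OF exhausts_bounded[OF B]] assms(3)])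
    ultimately show ?thesis using LIMSEQ_unique by simp
  qed
  then show ?thesis using Int_op_iff[OF f B] by blast
qed

lemma Int_op_comp:
  assumes f: "f \<in> borel_measurable borel" and g: "g \<in> borel_measurable borel"
    and xy: "(x, y) \<in> Int_op f"
  shows "(y, z) \<in> Int_op g \<longleftrightarrow> (x, z) \<in> Int_op (\<lambda>l. g l * f l)"
proof -
  obtain B where B: "exhausts B f" "exhausts B g" by (rule exhausts_exists[OF f g])
  have fg: "(\<lambda>l. g l * f l) \<in> borel_measurable borel" using f g by measurable
  have B': "exhausts B (\<lambda>l. g l * f l)" by (rule exhausts_mult[OF B(2,1)])
  have "T (trunc (B n) (\<lambda>l. g l * f l)) x = T (trunc (B n) g) y" for n
  proof -
    have "T (trunc (B n) (\<lambda>l. g l * f l)) x = T (trunc (B n) g) (T (trunc (B n) f) x)"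
      unfolding trunc_mult by (rule T_mult[OF exhausts_bounded[OF B(2)] exhausts_bounded[OF B(1)]])
    also have "T (trunc (B n) f) x = E (B n) y" using xy Int_op_iff[OF f B(1)] by simp
    finally show ?thesis by (simp add: T_trunc_E[OF B(2)])
  qed
  then show ?thesis using Int_op_iff[OF g B(2)] Int_op_iff[OF fg B'] by simp
qed

lemma Int_op_domain:
  assumes h: "h \<in> borel_measurable borel" and b: "bounded_borel b"
    and xw: "(x, w) \<in> Int_op h"
  shows "(x, T b w) \<in> Int_op (\<lambda>l. b l * h l)"
  using Int_op_comp[OF h _ xw, of b "T b w"] Int_op_T[OF b] b by (simp add: bounded_borel_def)

lemma Int_op_add:
  assumes f: "f \<in> borel_measurable borel" and g: "g \<in> borel_measurable borel"
    and "(x, y) \<in> Int_op f" "(x, z) \<in> Int_op g"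
  shows "(x, y + z) \<in> Int_op (\<lambda>l. f l + g l)"
proof -
  obtain B where B: "exhausts B f" "exhausts B g" by (rule exhausts_exists[OF f g])
  have fg: "(\<lambda>l. f l + g l) \<in> borel_measurable borel" using f g by measurable
  have "trunc (B n) (\<lambda>l. f l + g l) = (\<lambda>l. trunc (B n) f l + trunc (B n) g l)" for n
    by (rule ext) (simp add: trunc_def indicator_def)
  then have "E (B n) (y + z) = T (trunc (B n) (\<lambda>l. f l + g l)) x" for n
    using assms(3,4) Int_op_iff[OF f B(1)] Int_op_iff[OF g B(2)]
    by (simp add: E_add exhausts_sets[OF B(1)] T_add exhausts_bounded[OF B(1)] exhausts_bounded[OF B(2)])
  then show ?thesis using Int_op_iff[OF fg exhausts_add[OF B]] by blast
qed

lemma Int_op_const: "(x, y) \<in> Int_op (\<lambda>_. c) \<longleftrightarrow> y = c *\<^sub>C x"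
  by (simp add: Int_op_iff_T T_const)

lemma Int_op_right:
  assumes f: "f \<in> borel_measurable borel"
    and "(x, y) \<in> Int_op f" "(x', y') \<in> Int_op f"
  shows "(x + x', y + y') \<in> Int_op f" "(c *\<^sub>C x, c *\<^sub>C y) \<in> Int_op f"
proof -
  obtain B where B: "exhausts B f" using exhausts_exists[OF f f] .
  show "(x + x', y + y') \<in> Int_op f" "(c *\<^sub>C x, c *\<^sub>C y) \<in> Int_op f"
    using assms(2,3) unfolding Int_op_iff[OF f B]
    by (simp_all add: E_add E_scaleC exhausts_sets[OF B] T_add_right T_scaleC_right exhausts_bounded[OF B])
qed

lemma Int_op_dense:
  assumes f: "f \<in> borel_measurable borel"
  shows "closure (Domain (Int_op f)) = UNIV"
proof -
  obtain B where B: "exhausts B f" using exhausts_exists[OF f f] .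
  have "x \<in> closure (Domain (Int_op f))" for x
  proof (rule closure_sequential[THEN iffD2], intro exI conjI allI)
    show "(\<lambda>n. E (B n) x) \<longlonglongrightarrow> x" by (rule E_exhausts[OF B])
    fix n
    have "(x, E (B n) x) \<in> Int_op (indicator (B n))"
      by (simp add: Int_op_iff_T bounded_borel_indicator exhausts_sets[OF B] T_indicator)
    moreover have "(x, T (trunc (B n) f) x) \<in> Int_op (\<lambda>l. f l * indicator (B n) l)"
      using Int_op_T[OF exhausts_bounded[OF B], of x n] by (simp add: trunc_def mult.commute)
    ultimately have "(E (B n) x, T (trunc (B n) f) x) \<in> Int_op f"
      using Int_op_comp[of "indicator (B n)" f x "E (B n) x"] f exhausts_sets[OF B] by simp
    then show "E (B n) x \<in> Domain (Int_op f)" by blast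
  qed
  then show ?thesis by blast
qed

text \<open>The vectors \<open>E (B n) u\<close> lie in the domain of the integral. Testing the adjoint relation on
  them gives all truncations of the adjoint, which determine it.\<close>

lemma Int_op_adjoint:
  assumes f: "f \<in> borel_measurable borel"
  shows "adjoint_op (Int_op f) = Int_op (\<lambda>l. cnj (f l))"
proof -
  obtain B where B: "exhausts B f" using exhausts_exists[OF f f] .
  note Bs = exhausts_sets[OF B] and Bb = exhausts_bounded[OF B]
  have cf: "(\<lambda>l. cnj (f l)) \<in> borel_measurable borel"
    using f by (rule borel_measurable_continuous_on[where f=cnj, rotated]) (intro continuous_intros)
  have tr: "trunc (B n) (\<lambda>l. cnj (f l)) = (\<lambda>l. cnj (trunc (B n) f l))" for n
    by (rule ext) (simp add: trunc_def indicator_def)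
  note iff = Int_op_iff[OF f B] and iff' = Int_op_iff[OF cf exhausts_cnj[OF B], unfolded tr]
  have "(y, z) \<in> adjoint_op (Int_op f) \<longleftrightarrow> (y, z) \<in> Int_op (\<lambda>l. cnj (f l))" for y z
  proof
    assume "(y, z) \<in> adjoint_op (Int_op f)"
    then have adj: "cinner y w = cinner z x" if "(x, w) \<in> Int_op f" for x w
      using that unfolding adjoint_op_def by blast
    have "E (B n) z = T (\<lambda>l. cnj (trunc (B n) f l)) y" for n
    proof (rule cinner_ext)
      fix u
      have "(E (B n) u, T (trunc (B n) f) u) \<in> Int_op f"
      proof -
        have "(u, E (B n) u) \<in> Int_op (indicator (B n))"
          by (simp add: Int_op_iff_T bounded_borel_indicator Bs T_indicator)
        moreover have "(u, T (trunc (B n) f) u) \<in> Int_op (\<lambda>l. f l * indicator (B n) l)"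
          using Int_op_T[OF Bb, of u n] by (simp add: trunc_def mult.commute)
        ultimately show ?thesis
          using Int_op_comp[of "indicator (B n)" f u "E (B n) u"] f Bs by simp
      qed
      from adj[OF this] have "cinner (T (\<lambda>l. cnj (trunc (B n) f l)) y) u = cinner (E (B n) z) u"
        by (simp add: T_adjoint[OF Bb] E_sym Bs)
      then show "cinner u (E (B n) z) = cinner u (T (\<lambda>l. cnj (trunc (B n) f l)) y)"
        by (metis cinner_commute)
    qed
    then show "(y, z) \<in> Int_op (\<lambda>l. cnj (f l))" unfolding iff' by blast
  next
    assume yz: "(y, z) \<in> Int_op (\<lambda>l. cnj (f l))"
    have "cinner y w = cinner z x" if xw: "(x, w) \<in> Int_op f" for x w
    proof (rule LIMSEQ_unique)
      show "(\<lambda>n. cinner y (E (B n) w)) \<longlonglongrightarrow> cinner y w"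
        by (intro tendsto_intros E_exhausts[OF B])
      have "cinner y (E (B n) w) = cinner (E (B n) z) x" for n
        using xw yz unfolding iff iff' by (simp add: T_adjoint[OF Bb])
      moreover have "(\<lambda>n. cinner (E (B n) z) x) \<longlonglongrightarrow> cinner z x"
        by (intro tendsto_intros E_exhausts[OF B])
      ultimately show "(\<lambda>n. cinner y (E (B n) w)) \<longlonglongrightarrow> cinner z x" by simp
    qed
    then show "(y, z) \<in> adjoint_op (Int_op f)" unfolding adjoint_op_def by blast
  qed
  then show ?thesis by (auto simp: set_eq_iff)
qed

lemma T_AE:
  assumes f: "bounded_borel f" and g: "bounded_borel g" and B: "B \<in> sets borel" "\<And>x. E B x = x"
    and eq: "\<And>l. l \<in> B \<Longrightarrow> f l = g l"
  shows "T f x = T g x"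
proof -
  have "trunc B f = trunc B g" by (rule ext) (simp add: trunc_def indicator_def eq)
  then show ?thesis using T_trunc[OF B(1) f, of x] T_trunc[OF B(1) g, of x] by (simp add: B(2))
qed

text \<open>Multiplication with the indicator function of \<open>B\<close> acts as the identity, so only the values
  on \<open>B\<close> count. This removes the singularities of functions such as \<open>1 / l\<close> and \<open>ln l\<close>.\<close>

lemma Int_op_AE:
  assumes f: "f \<in> borel_measurable borel" and g: "g \<in> borel_measurable borel"
    and B: "B \<in> sets borel" "\<And>x. E B x = x" and eq: "\<And>l. l \<in> B \<Longrightarrow> f l = g l"
  shows "Int_op f = Int_op g"
proof -
  obtain A where A: "exhausts A f" "exhausts A g" by (rule exhausts_exists[OF f g])
  have "T (trunc (A n) f) x = T (trunc (A n) g) x" for n x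
    by (rule T_AE[OF exhausts_bounded[OF A(1)] exhausts_bounded[OF A(2)] B]) (simp add: trunc_def eq)
  then show ?thesis using Int_op_iff[OF f A(1)] Int_op_iff[OF g A(2)] by (auto simp: set_eq_iff)
qed

lemma positive_selfadjoint_Int_op:
  assumes f: "f \<in> borel_measurable borel" and nn: "\<And>l. f l \<ge> 0"
  shows "positive_selfadjoint (Int_op (\<lambda>l. complex_of_real (f l)))"
proof -
  let ?f = "\<lambda>l. complex_of_real (f l)"
  have f': "?f \<in> borel_measurable borel" using f by measurable
  obtain B where B: "exhausts B ?f" using exhausts_exists[OF f' f'] .
  note Bs = exhausts_sets[OF B] and Bb = exhausts_bounded[OF B]
  have "0 \<le> Re (cinner x y)" if xy: "(x, y) \<in> Int_op ?f" for x y
  proof (rule LIMSEQ_le_const)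
    show "(\<lambda>n. Re (cinner (E (B n) x) y)) \<longlonglongrightarrow> Re (cinner x y)"
      by (intro tendsto_intros E_exhausts[OF B])
    have "0 \<le> Re (cinner (E (B n) x) y)" for n
    proof -
      let ?s = "\<lambda>l. complex_of_real (sqrt (f l))"
      obtain C where C: "C > 0" "\<And>l. cmod (trunc (B n) ?f l) \<le> C" using Bb[of n] bounded_borelE by blast
      have s: "bounded_borel (trunc (B n) ?s)"
      proof (rule bounded_borelI[where C="sqrt C"])
        show "trunc (B n) ?s \<in> borel_measurable borel" unfolding trunc_def using f Bs by measurable
        show "cmod (trunc (B n) ?s l) \<le> sqrt C" for l
          using C(1) C(2)[of l] nn[of l] by (auto simp: trunc_def indicator_def)
      qed
      have sq: "trunc (B n) ?f = (\<lambda>l. trunc (B n) ?s l * trunc (B n) ?s l)"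
        using nn by (intro ext) (simp add: trunc_def indicator_def flip: of_real_mult)
      have "cinner (E (B n) x) y = cinner x (T (trunc (B n) ?f) x)"
        using xy unfolding Int_op_iff[OF f' B] by (simp add: E_sym Bs)
      also have "\<dots> = cinner x (T (trunc (B n) ?s) (T (trunc (B n) ?s) x))"
        unfolding sq by (simp add: T_mult[OF s s])
      also have "\<dots> = cinner (T (\<lambda>l. cnj (trunc (B n) ?s l)) x) (T (trunc (B n) ?s) x)"
        by (rule T_adjoint[OF s])
      also have "(\<lambda>l. cnj (trunc (B n) ?s l)) = trunc (B n) ?s"
        by (rule ext) (simp add: trunc_def indicator_def)
      finally show ?thesis by (simp add: cinner_self)
    qed
    then show "\<exists>N. \<forall>n\<ge>N. 0 \<le> Re (cinner (E (B n) x) y)" by blast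
  qed
  then show ?thesis
    unfolding positive_selfadjoint_def
    using Int_op_dense[OF f'] Int_op_adjoint[OF f'] by auto
qed

end

text \<open>The image measure under \<open>h\<close>. Functions of an operator that are not defined on the whole line
  are handled by moving the measure instead.\<close>

definition push :: "(real \<Rightarrow> real) \<Rightarrow> (real set \<Rightarrow> 'h \<Rightarrow> 'h) \<Rightarrow> real set \<Rightarrow> 'h \<Rightarrow> 'h" where
  "push h E = (\<lambda>B\<in>sets borel. E (h -` B))"

lemma (in pvm) pvm_push:
  assumes h: "h \<in> borel_measurable borel"
  shows "pvm (push h E)"
proof
  have v: "h -` B \<in> sets borel" if "B \<in> sets borel" for B
    using measurable_sets[OF h that] by simp
  show "projection_valued_measure (push h E)"
    unfolding projection_valued_measure_def
  proof (intro conjI allI ballI impI)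
    fix B :: "nat \<Rightarrow> real set" and x assume B: "range B \<subseteq> sets borel" "disjoint_family B"
    have "(\<lambda>n. E (h -` B n) x) sums E (\<Union>n. h -` B n) x"
      using B v by (intro E_sums) (auto simp: disjoint_family_on_def)
    moreover have "(\<Union>n. B n) \<in> sets borel" using B by auto
    ultimately show "(\<lambda>n. push h E (B n) x) sums push h E (\<Union> (range B)) x"
      using B by (auto simp: push_def vimage_UN image_subset_iff)
  qed (auto simp: push_def projection v)
qed

lemma (in pvm) S_push:
  assumes h: "h \<in> borel_measurable borel" and s: "simple_function borel s"
  shows "simple_spectral_integral (push h E) s x = S (\<lambda>l. s (h l)) x"
proof -
  have "S (\<lambda>l. s (h l)) x = (\<Sum>c\<in>range s. c *\<^sub>C E ((\<lambda>l. s (h l)) -` {c}) x)"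
  proof (rule S_partition[where g="\<lambda>c. c"])
    fix c
    have "(\<lambda>l. s (h l)) -` {c} = h -` (s -` {c})" by auto
    then show "(\<lambda>l. s (h l)) -` {c} \<in> sets borel"
      using measurable_sets[OF h simple_vimage[OF s, of c]] by simp
  qed (auto simp: simple_finite[OF s])
  also have "\<dots> = simple_spectral_integral (push h E) s x"
    unfolding simple_spectral_integral_def
    by (intro sum.cong refl) (simp add: push_def simple_vimage[OF s], simp add: vimage_def)
  finally show ?thesis by simp
qed

lemma (in pvm) T_push:
  assumes h: "h \<in> borel_measurable borel" and f: "bounded_borel f"
  shows "pvm.T (push h E) f x = T (\<lambda>l. f (h l)) x"
proof -
  interpret P: pvm "push h E" by (rule pvm_push[OF h])
  obtain C s where s: "\<And>n. simple_function borel (s n)" "C > 0" "\<And>n l. cmod (s n l) \<le> C"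
    "\<And>l. (\<lambda>n. s n l) \<longlonglongrightarrow> f l" "\<And>l. cmod (f l) \<le> C"
    using simple_approximation[OF f] by metis
  have sh: "simple_function borel (\<lambda>l. s n (h l))" for n
  proof -
    have "finite (range (\<lambda>l. s n (h l)))"
      by (rule finite_subset[OF _ simple_finite[OF s(1)[of n]]]) blast
    moreover have "(\<lambda>l. s n (h l)) -` {c} \<in> sets borel" for c
      using measurable_sets[OF h simple_vimage[OF s(1), of n c]] by (simp add: vimage_def)
    ultimately show ?thesis unfolding simple_function_def by simp
  qed
  have fh: "bounded_borel (\<lambda>l. f (h l))"
    using f h s(5) by (intro bounded_borelI[where C=C]) (auto simp: bounded_borel_def intro: measurable_compose)
  have "(\<lambda>n. P.S (s n) x) \<longlonglongrightarrow> P.T f x" by (rule P.S_tendsto_T[OF f s(1,3,4)])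
  moreover have "(\<lambda>n. S (\<lambda>l. s n (h l)) x) \<longlonglongrightarrow> T (\<lambda>l. f (h l)) x"
    by (rule S_tendsto_T[OF fh sh s(3,4)])
  ultimately show ?thesis unfolding S_push[OF h s(1)] by (rule LIMSEQ_unique)
qed

lemma (in pvm) Int_op_push:
  assumes h: "h \<in> borel_measurable borel" and f: "f \<in> borel_measurable borel"
  shows "spectral_integral (push h E) f = Int_op (\<lambda>l. f (h l))"
proof -
  interpret P: pvm "push h E" by (rule pvm_push[OF h])
  obtain B where B: "exhausts B f" using exhausts_exists[OF f f] .
  have fh: "(\<lambda>l. f (h l)) \<in> borel_measurable borel" using h f by (rule measurable_compose)
  have v: "h -` A \<in> sets borel" if "A \<in> sets borel" for A
    using measurable_sets[OF h that] by simp
  have tr: "trunc (h -` B n) (\<lambda>l. f (h l)) = (\<lambda>l. trunc (B n) f (h l))" for n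
    by (rule ext) (simp add: trunc_def indicator_def)
  have B': "exhausts (\<lambda>n. h -` B n) (\<lambda>l. f (h l))"
    unfolding exhausts_def tr
  proof (intro conjI allI)
    show "range (\<lambda>n. h -` B n) \<subseteq> sets borel" using v exhausts_sets[OF B] by blast
    show "incseq (\<lambda>n. h -` B n)" using B by (fastforce simp: exhausts_def incseq_def)
    show "(\<Union>n. h -` B n) = UNIV" using B by (auto simp: exhausts_def simp flip: vimage_UN)
    fix n
    obtain C where "trunc (B n) f \<in> borel_measurable borel" "\<And>l. cmod (trunc (B n) f l) \<le> C"
      using exhausts_bounded[OF B, of n] bounded_borelE by blast
    then show "bounded_borel (\<lambda>l. trunc (B n) f (h l))"
      by (intro bounded_borelI[where C=C] measurable_compose[OF h])
  qed
  have "(x, y) \<in> P.Int_op f \<longleftrightarrow> (x, y) \<in> Int_op (\<lambda>l. f (h l))" for x y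
    unfolding P.Int_op_iff[OF f B] Int_op_iff[OF fh B'] T_push[OF h exhausts_bounded[OF B]] tr
    by (simp add: push_def exhausts_sets[OF B])
  then show ?thesis by (auto simp: set_eq_iff)
qed

section \<open>Intertwining operators and uniqueness of the spectral measure\<close>

text \<open>Newton's iteration for the sign: a polynomial recursion that converges pointwise on
  \<open>[-1, 1]\<close>, so that it can be performed inside an algebra of bounded operators.\<close>

fun sgn_iter :: "nat \<Rightarrow> real \<Rightarrow> real" where
  "sgn_iter 0 v = v"
| "sgn_iter (Suc n) v = (3 * sgn_iter n v - sgn_iter n v ^ 3) / 2"

lemma sgn_iter_minus: "sgn_iter n (- v) = - sgn_iter n v"
  by (induction n) (simp_all add: power3_eq_cube field_simps)

lemma sgn_iter_pos:
  assumes "0 < v" "v \<le> 1"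
  shows "v \<le> sgn_iter n v \<and> sgn_iter n v \<le> 1 \<and> sgn_iter n v \<le> sgn_iter (Suc n) v"
proof -
  have step: "u \<le> (3 * u - u ^ 3) / 2 \<and> (3 * u - u ^ 3) / 2 \<le> 1" if "0 < u" "u \<le> 1" for u :: real
  proof
    have "0 \<le> u * (1 - u\<^sup>2)" using that by (intro mult_nonneg_nonneg) (auto simp: power_le_one)
    then show "u \<le> (3 * u - u ^ 3) / 2" by (simp add: algebra_simps power2_eq_square power3_eq_cube)
    have "0 \<le> (1 - u)\<^sup>2 * (u + 2)" using that by (intro mult_nonneg_nonneg) auto
    then show "(3 * u - u ^ 3) / 2 \<le> 1" by (simp add: algebra_simps power2_eq_square power3_eq_cube)
  qed
  have "v \<le> sgn_iter n v \<and> sgn_iter n v \<le> 1"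
  proof (induction n)
    case (Suc n)
    then show ?case using step[of "sgn_iter n v"] assms by auto
  qed (use assms in simp)
  then show ?thesis using step[of "sgn_iter n v"] assms by auto
qed

lemma sgn_iter_bound:
  assumes "\<bar>v\<bar> \<le> 1"
  shows "\<bar>sgn_iter n v\<bar> \<le> 1"
proof -
  have "v = 0 \<Longrightarrow> sgn_iter n v = 0" by (induction n) auto
  moreover have "0 < v \<Longrightarrow> ?thesis" using sgn_iter_pos[of v n] assms by auto
  moreover have "v < 0 \<Longrightarrow> ?thesis" using sgn_iter_pos[of "- v" n] assms by (auto simp: sgn_iter_minus)
  ultimately show ?thesis by (cases v "0 :: real" rule: linorder_cases) auto
qed

lemma sgn_iter_tendsto:
  assumes "\<bar>v\<bar> \<le> 1"
  shows "(\<lambda>n. sgn_iter n v) \<longlonglongrightarrow> sgn v"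
proof -
  have pos: "(\<lambda>n. sgn_iter n v) \<longlonglongrightarrow> 1" if "0 < v" "v \<le> 1" for v
  proof -
    note p = sgn_iter_pos[OF that]
    have "incseq (\<lambda>n. sgn_iter n v)" using p by (intro incseq_SucI) blast
    then obtain L where L: "(\<lambda>n. sgn_iter n v) \<longlonglongrightarrow> L"
      using p by (elim incseq_convergent[where B=1]) auto
    have "v \<le> L" using L p by (intro LIMSEQ_le_const) auto
    have "(\<lambda>n. sgn_iter (Suc n) v) \<longlonglongrightarrow> L" using L by (rule LIMSEQ_Suc)
    moreover have "(\<lambda>n. (3 * sgn_iter n v - sgn_iter n v ^ 3) / 2) \<longlonglongrightarrow> (3 * L - L ^ 3) / 2"
      by (intro tendsto_intros L) auto
    ultimately have "L = (3 * L - L ^ 3) / 2" unfolding sgn_iter.simps by (rule LIMSEQ_unique)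
    then have "L * (1 - L\<^sup>2) = 0" by (simp add: algebra_simps power2_eq_square power3_eq_cube)
    with \<open>v \<le> L\<close> that have "L\<^sup>2 = 1" by auto
    with \<open>v \<le> L\<close> that have "L = 1" by (auto simp: power2_eq_1_iff)
    with L show ?thesis by simp
  qed
  consider "v = 0" | "0 < v" | "v < 0" by linarith
  then show ?thesis
  proof cases
    case 1
    then have "sgn_iter n v = 0" for n by (induction n) auto
    with 1 show ?thesis by simp
  next
    case 3
    then have "(\<lambda>n. - sgn_iter n (- v)) \<longlonglongrightarrow> - 1" using assms by (intro tendsto_minus pos) auto
    with 3 show ?thesis by (simp add: sgn_iter_minus)
  qed (use pos assms in auto)
qed

lemma (in pvm) E_compl: "A \<in> sets borel \<Longrightarrow> E (UNIV - A) x = x - E A x"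
  using E_split[of UNIV A x] by (simp add: algebra_simps)

text \<open>An operator \<open>C\<close>, merely real linear, that maps the graph of \<open>\<integral> l dE\<close> into that of
  \<open>\<integral> l dF\<close> intertwines the two spectral measures. It intertwines the resolvents
  \<open>(1 + (l - a)\<^sup>2)\<^sup>-\<^sup>1\<close> and \<open>(l - a) (1 + (l - a)\<^sup>2)\<^sup>-\<^sup>1\<close>, which have real coefficients,
  hence by the sign iteration the projections of half lines, and these generate the
  Borel sets.\<close>

locale intertwiner = E: pvm E + F: pvm F for E :: "real set \<Rightarrow> 'h::complex_hilbert_space \<Rightarrow> 'h" 
    and F :: "real set \<Rightarrow> 'h \<Rightarrow> 'h" +
  fixes C :: "'h \<Rightarrow> 'h"
  assumes linear_C: "bounded_linear C"
    and graph: "(x, y) \<in> spectral_integral E complex_of_real \<Longrightarrow>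
      (C x, C y) \<in> spectral_integral F complex_of_real"
begin

definition intertwined :: "(real \<Rightarrow> real) \<Rightarrow> bool" where
  "intertwined f \<longleftrightarrow> bounded_borel (\<lambda>l. complex_of_real (f l)) \<and>
     (\<forall>x. C (E.T (\<lambda>l. complex_of_real (f l)) x) = F.T (\<lambda>l. complex_of_real (f l)) (C x))"

lemma C_add: "C (x + y) = C x + C y"
  by (rule linear_add[OF bounded_linear.linear[OF linear_C]])

lemma C_diff: "C (x - y) = C x - C y"
  by (rule linear_diff[OF bounded_linear.linear[OF linear_C]])

lemma C_scaleR: "C (r *\<^sub>R x) = r *\<^sub>R C x"
  by (rule linear_scale[OF bounded_linear.linear[OF linear_C]])

lemma intertwined_const: "intertwined (\<lambda>_. c)"
  by (simp add: intertwined_def E.T_const F.T_const scaleC_of_real C_scaleR)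

lemma intertwined_mult: "intertwined f \<Longrightarrow> intertwined g \<Longrightarrow> intertwined (\<lambda>l. f l * g l)"
  by (simp add: intertwined_def bounded_borel_mult E.T_mult F.T_mult)

lemma intertwined_add: "intertwined f \<Longrightarrow> intertwined g \<Longrightarrow> intertwined (\<lambda>l. f l + g l)"
  by (simp add: intertwined_def bounded_borel_add E.T_add F.T_add C_add)

lemma intertwined_tendsto:
  assumes s: "\<And>n. intertwined (s n)" and K: "\<And>n l. \<bar>s n l\<bar> \<le> K"
    and lim: "\<And>l. (\<lambda>n. s n l) \<longlonglongrightarrow> f l" and f: "f \<in> borel_measurable borel"
  shows "intertwined f"
  unfolding intertwined_def
proof (intro conjI allI)
  have fK: "\<bar>f l\<bar> \<le> K" for l
    using LIMSEQ_le_const2[OF tendsto_rabs[OF lim[of l]]] K by blast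
  have f': "(\<lambda>l. complex_of_real (f l)) \<in> borel_measurable borel" using f by measurable
  show "bounded_borel (\<lambda>l. complex_of_real (f l))"
    by (rule bounded_borelI[OF f', where C=K]) (simp add: fK)
  have s': "(\<lambda>l. complex_of_real (s n l)) \<in> borel_measurable borel" for n
    using s[of n] by (simp add: intertwined_def bounded_borel_def)
  have K': "cmod (complex_of_real (s n l)) \<le> K" for n l by (simp add: K)
  have lim': "(\<lambda>n. complex_of_real (s n l)) \<longlonglongrightarrow> complex_of_real (f l)" for l
    by (rule tendsto_of_real[OF lim])
  fix x
  have "(\<lambda>n. C (E.T (\<lambda>l. complex_of_real (s n l)) x)) \<longlonglongrightarrow> C (E.T (\<lambda>l. complex_of_real (f l)) x)"
    by (rule bounded_linear.tendsto[OF linear_C E.T_tendsto[OF f' s' K' lim']])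
  moreover have "(\<lambda>n. F.T (\<lambda>l. complex_of_real (s n l)) (C x)) \<longlonglongrightarrow> F.T (\<lambda>l. complex_of_real (f l)) (C x)"
    by (rule F.T_tendsto[OF f' s' K' lim'])
  moreover have "C (E.T (\<lambda>l. complex_of_real (s n l)) x) = F.T (\<lambda>l. complex_of_real (s n l)) (C x)" for n
    using s[of n] by (simp add: intertwined_def)
  ultimately show "C (E.T (\<lambda>l. complex_of_real (f l)) x) = F.T (\<lambda>l. complex_of_real (f l)) (C x)"
    using LIMSEQ_unique by simp
qed

lemma graph_shift:
  assumes "(x, y) \<in> E.Int_op (\<lambda>l. complex_of_real (l - a))"
  shows "(C x, C y) \<in> F.Int_op (\<lambda>l. complex_of_real (l - a))"
proof -
  have "(x, y + a *\<^sub>R x) \<in> E.Int_op (\<lambda>l. complex_of_real (l - a) + complex_of_real a)"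
    using assms by (intro E.Int_op_add) (auto simp: E.Int_op_const scaleC_of_real)
  then have "(C x, C (y + a *\<^sub>R x)) \<in> F.Int_op complex_of_real" by (intro graph) simp
  then have "(C x, C (y + a *\<^sub>R x) + (- a) *\<^sub>R C x) \<in> F.Int_op (\<lambda>l. complex_of_real l + complex_of_real (- a))"
    by (intro F.Int_op_add) (auto simp: F.Int_op_const scaleC_of_real simp del: of_real_minus)
  then show ?thesis by (simp add: C_add C_scaleR)
qed

text \<open>With \<open>g = l - a\<close>, \<open>r = 1 / (1 + g\<^sup>2)\<close> and \<open>q = g r\<close>, the vectors \<open>w = r x\<close> and \<open>q x\<close> satisfy
  \<open>g w = q x\<close> and \<open>g (q x) = x - w\<close>. These are statements about the graph of \<open>g\<close>, which \<open>C\<close>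
  preserves, and on the other side they force \<open>C w = r (C x)\<close>.\<close>

lemma intertwined_resolvent:
  "intertwined (\<lambda>l. (l - a) / (1 + (l - a)\<^sup>2))"
proof -
  define g r q where "g = (\<lambda>l. complex_of_real (l - a))" and "r = (\<lambda>l. complex_of_real (1 / (1 + (l - a)\<^sup>2)))"
    and "q = (\<lambda>l. complex_of_real ((l - a) / (1 + (l - a)\<^sup>2)))"
  have pos: "1 + (l - a)\<^sup>2 > 0" for l by (simp add: add_pos_nonneg)
  have [measurable]: "g \<in> borel_measurable borel" by (simp add: g_def)
  have r: "bounded_borel r"
  proof (rule bounded_borelI[where C=1])
    show "cmod (r l) \<le> 1" for l using pos[of l] by (simp add: r_def norm_divide del: of_real_add)
  qed (simp add: r_def)
  have q: "bounded_borel q"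
  proof (rule bounded_borelI[where C=1])
    fix l
    have "\<bar>l - a\<bar> \<le> 1 + (l - a)\<^sup>2"
      using zero_le_power2[of "\<bar>l - a\<bar> - 1"] zero_le_power2[of "l - a"] unfolding power2_diff power2_abs by simp
    then have "\<bar>(l - a) / (1 + (l - a)\<^sup>2)\<bar> \<le> 1" using pos[of l] by (simp add: abs_divide)
    then show "cmod (q l) \<le> 1" unfolding q_def norm_of_real .
  qed (simp add: q_def)
  have rm: "r \<in> borel_measurable borel" and qm: "q \<in> borel_measurable borel"
    using r q by (simp_all add: bounded_borel_def)
  have gr: "(\<lambda>l. g l * r l) = q" by (rule ext) (simp add: g_def r_def q_def)
  have gq: "(\<lambda>l. g l * q l) = (\<lambda>l. 1 - r l)"
  proof
    fix l
    have "(l - a) * ((l - a) / (1 + (l - a)\<^sup>2)) = 1 - 1 / (1 + (l - a)\<^sup>2)"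
      using pos[of l] by (simp add: field_simps power2_eq_square)
    then have "complex_of_real ((l - a) * ((l - a) / (1 + (l - a)\<^sup>2))) = complex_of_real (1 - 1 / (1 + (l - a)\<^sup>2))"
      by simp
    then show "g l * q l = 1 - r l" unfolding g_def q_def r_def of_real_mult of_real_diff of_real_1 .
  qed
  have rg: "(\<lambda>l. r l * (g l * g l + 1)) = (\<lambda>_. 1)"
  proof
    fix l
    have "1 / (1 + (l - a)\<^sup>2) * ((l - a) * (l - a) + 1) = 1"
      using pos[of l] by (simp add: field_simps power2_eq_square)
    then have "complex_of_real (1 / (1 + (l - a)\<^sup>2) * ((l - a) * (l - a) + 1)) = complex_of_real 1" by (simp only:)
    then show "r l * (g l * g l + 1) = 1" unfolding g_def r_def of_real_mult of_real_add of_real_1 .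
  qed
  have "C (E.T q x) = F.T q (C x)" for x
  proof -
    define w where "w = E.T r x"
    have xw: "(x, w) \<in> E.Int_op r" by (simp add: w_def E.Int_op_T r)
    have "(w, E.T q x) \<in> E.Int_op g"
      using E.Int_op_comp[OF rm _ xw, of g "E.T q x"] E.Int_op_T[OF q] gr by simp
    then have 1: "(C w, C (E.T q x)) \<in> F.Int_op g" unfolding g_def by (rule graph_shift)
    have "(E.T q x, x - w) \<in> E.Int_op g"
      using E.Int_op_comp[OF qm _ E.Int_op_T[OF q], of g x "x - w"] gq
        E.Int_op_T[OF bounded_borel_diff[OF bounded_borel_const r], of x 1]
      by (simp add: E.T_diff r E.T_const w_def)
    then have 2: "(C (E.T q x), C x - C w) \<in> F.Int_op g"
      unfolding g_def C_diff[symmetric] by (rule graph_shift)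
    have "(C w, C x - C w) \<in> F.Int_op (\<lambda>l. g l * g l)"
      using F.Int_op_comp[OF _ _ 1, of g] 2 by simp
    then have "(C w, (C x - C w) + C w) \<in> F.Int_op (\<lambda>l. g l * g l + 1)"
      by (intro F.Int_op_add) (auto simp: F.Int_op_const)
    then have "(C w, F.T r (C x)) \<in> F.Int_op (\<lambda>l. r l * (g l * g l + 1))"
      by (intro F.Int_op_domain[OF _ r]) auto
    then have "C w = F.T r (C x)" by (simp add: rg F.Int_op_const)
    then have "(C x, C w) \<in> F.Int_op r" by (simp add: F.Int_op_T r)
    then have "(C x, C (E.T q x)) \<in> F.Int_op q"
      using F.Int_op_comp[OF rm, of g "C x" "C w"] 1 gr by simp
    then show ?thesis by (simp add: F.Int_op_iff_T q)
  qed
  then show ?thesis using q unfolding intertwined_def q_def by blast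
qed

text \<open>The function \<open>v\<close> has the sign of \<open>l - a\<close> and takes values in \<open>[-1, 1]\<close>, so the iteration
  leads from it to \<open>sgn (l - a)\<close> within the intertwined functions.\<close>

lemma intertwined_greaterThan: "C (E {a<..} x) = F {a<..} (C x)"
proof -
  define v where "v = (\<lambda>l::real. 2 * ((l - a) / (1 + (l - a)\<^sup>2)))"
  have pos: "1 + (l - a)\<^sup>2 > 0" for l by (simp add: add_pos_nonneg)
  have v1: "\<bar>v l\<bar> \<le> 1" for l
  proof -
    have "2 * \<bar>l - a\<bar> \<le> 1 + (l - a)\<^sup>2"
      using zero_le_power2[of "\<bar>l - a\<bar> - 1"] unfolding power2_diff power2_abs by simp
    then have "\<bar>2 * (l - a)\<bar> \<le> 1 + (l - a)\<^sup>2" by (simp only: abs_mult abs_numeral)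
    then show ?thesis using pos[of l] unfolding v_def times_divide_eq_right abs_divide by simp
  qed
  have sgnv: "sgn (v l) = sgn (l - a)" for l
    using pos[of l] unfolding v_def sgn_mult sgn_divide by simp
  have v: "intertwined v" unfolding v_def by (intro intertwined_mult intertwined_const intertwined_resolvent)
  have it: "intertwined (\<lambda>l. sgn_iter n (v l))" for n
  proof (induction n)
    case (Suc n)
    have "intertwined (\<lambda>l. (3 / 2) * sgn_iter n (v l) +
        (- 1 / 2) * (sgn_iter n (v l) * (sgn_iter n (v l) * sgn_iter n (v l))))"
      by (intro intertwined_add intertwined_mult intertwined_const Suc)
    moreover have "(\<lambda>l. (3 / 2) * sgn_iter n (v l) +
        (- 1 / 2) * (sgn_iter n (v l) * (sgn_iter n (v l) * sgn_iter n (v l)))) = (\<lambda>l. sgn_iter (Suc n) (v l))"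
      by (rule ext) (simp add: power3_eq_cube field_simps)
    ultimately show ?case by simp
  qed (simp add: v)
  have s: "intertwined (\<lambda>l. sgn (l - a))"
  proof (rule intertwined_tendsto[OF it sgn_iter_bound[OF v1]])
    show "(\<lambda>n. sgn_iter n (v l)) \<longlonglongrightarrow> sgn (l - a)" for l
      using sgn_iter_tendsto[OF v1[of l]] by (simp add: sgnv)
  qed simp
  have "intertwined (\<lambda>l. (1 / 2) * (sgn (l - a) + sgn (l - a) * sgn (l - a)))"
    by (intro intertwined_add intertwined_mult intertwined_const s)
  moreover have "(\<lambda>l. complex_of_real ((1 / 2) * (sgn (l - a) + sgn (l - a) * sgn (l - a)))) = indicator {a<..}"
    by (rule ext) (auto simp: sgn_if)
  ultimately show ?thesis unfolding intertwined_def by (simp add: E.T_indicator F.T_indicator)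
qed

theorem intertwines:
  assumes "B \<in> sets borel"
  shows "C (E B x) = F B (C x)"
proof -
  have stable: "Int_stable (range (greaterThan :: real \<Rightarrow> real set))"
  proof (rule Int_stableI)
    fix A B assume "A \<in> range (greaterThan :: real \<Rightarrow> real set)" "B \<in> range (greaterThan :: real \<Rightarrow> real set)"
    then obtain a b where "A = {a<..}" "B = {b<..}" by blast
    then have "A \<inter> B = {max a b<..}" by auto
    then show "A \<inter> B \<in> range greaterThan" by blast
  qed
  have "B \<in> sigma_sets UNIV (range greaterThan)"
    using assms by (simp add: borel_Ioi)
  from stable subset_UNIV[of "range greaterThan", folded Pow_UNIV] this have "\<forall>x. C (E B x) = F B (C x)"
  proof (induction rule: sigma_sets_induct_disjoint)
    case (compl A)
    then have "A \<in> sets borel" "\<forall>x. C (E A x) = F A (C x)" by (simp_all add: borel_Ioi)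
    then show "\<forall>x. C (E (UNIV - A) x) = F (UNIV - A) (C x)"
      by (simp add: E.E_compl F.E_compl C_diff)
  next
    case (union A)
    note A = union(1,2) and IH = union(3)
    have A': "range A \<subseteq> sets borel" using A(2) by (simp add: borel_Ioi)
    show "\<forall>x. C (E (\<Union> (range A)) x) = F (\<Union> (range A)) (C x)"
    proof
      fix x
      have "(\<lambda>n. C (E (A n) x)) sums C (E (\<Union> (range A)) x)"
        by (rule bounded_linear.sums[OF linear_C E.E_sums[OF A' A(1)]])
      moreover have "(\<lambda>n. F (A n) (C x)) sums F (\<Union> (range A)) (C x)"
        by (rule F.E_sums[OF A' A(1)])
      ultimately show "C (E (\<Union> (range A)) x) = F (\<Union> (range A)) (C x)"
        using IH sums_unique2 by simp
    qed
  qed (auto simp: intertwined_greaterThan linear_0[OF bounded_linear.linear[OF linear_C]])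
  then show ?thesis ..
qed

end

text \<open>Uniqueness of the spectral measure is the case \<open>C = id\<close>.\<close>

theorem spectral_measure_eqI:
  assumes E: "pvm E" and A: "A = spectral_integral E complex_of_real"
  shows "spectral_measure A = E"
  unfolding spectral_measure_def
proof (rule the_equality)
  show "projection_valued_measure E \<and> A = spectral_integral E complex_of_real"
    using pvm.pvm[OF E] A by blast
next
  fix F assume "projection_valued_measure F \<and> A = spectral_integral F complex_of_real"
  then have F: "pvm F" "A = spectral_integral F complex_of_real" by (auto intro: pvm.intro)
  interpret intertwiner F E "\<lambda>x. x"
    using E A F by (intro intertwiner.intro intertwiner_axioms.intro) (auto simp: bounded_linear_ident)
  show "F = E"
  proof
    fix B
    show "F B = E B"
    proof (cases "B \<in> sets borel")
      case False
      then show ?thesis using pvm.pvm[OF E] pvm.pvm[OF F(1)]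
        by (auto simp: projection_valued_measure_def extensional_def)
    qed (use intertwines in auto)
  qed
qed

section \<open>Orthogonal projections and the representation of functionals\<close>

text \<open>A minimising sequence is a Cauchy sequence by the parallelogram law.\<close>

lemma closest_point_exists:
  fixes V :: "'a::{real_inner,complete_space} set"
  assumes V: "subspace V" "closed V"
  obtains p where "p \<in> V" "\<And>v. v \<in> V \<Longrightarrow> norm (x - p) \<le> norm (x - v)"
proof -
  define d where "d = Inf ((\<lambda>v. (norm (x - v))\<^sup>2) ` V)"
  have V0: "V \<noteq> {}" using V(1) subspace_0 by blast
  have bdd: "bdd_below ((\<lambda>v. (norm (x - v))\<^sup>2) ` V)" by (rule bdd_belowI[of _ 0]) auto
  have d: "d \<le> (norm (x - v))\<^sup>2" if "v \<in> V" for v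
    unfolding d_def using bdd that by (intro cInf_lower) auto
  have "\<exists>v\<in>V. (norm (x - v))\<^sup>2 < d + 1 / Suc n" for n
  proof -
    have "d < d + 1 / Suc n" by simp
    then have "\<exists>y\<in>(\<lambda>v. (norm (x - v))\<^sup>2) ` V. y < d + 1 / Suc n"
      using cInf_less_iff[OF _ bdd, of "d + 1 / Suc n"] V0 unfolding d_def by simp
    then show ?thesis by blast
  qed
  then have "\<forall>n. \<exists>v. v \<in> V \<and> (norm (x - v))\<^sup>2 < d + 1 / Suc n" by blast
  from choice[OF this] obtain v where "\<forall>n. v n \<in> V \<and> (norm (x - v n))\<^sup>2 < d + 1 / Suc n" ..
  then have v: "v n \<in> V" "(norm (x - v n))\<^sup>2 < d + 1 / Suc n" for n by auto
  have par: "(norm (v m - v n))\<^sup>2 \<le> 2 / Suc m + 2 / Suc n" for m n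
  proof -
    have "(1/2) *\<^sub>R (v m + v n) \<in> V"
      using V(1) v(1) by (intro subspace_scale subspace_add)
    from d[OF this] have "4 * d \<le> (norm (2 *\<^sub>R (x - (1/2) *\<^sub>R (v m + v n))))\<^sup>2"
      by (simp add: power_mult_distrib)
    also have "2 *\<^sub>R (x - (1/2) *\<^sub>R (v m + v n)) = (x - v m) + (x - v n)"
      by (simp add: algebra_simps scaleR_2)
    finally have "4 * d \<le> (norm ((x - v m) + (x - v n)))\<^sup>2" .
    moreover have "(norm ((x - v m) + (x - v n)))\<^sup>2 + (norm (v m - v n))\<^sup>2
        = 2 * (norm (x - v m))\<^sup>2 + 2 * (norm (x - v n))\<^sup>2"
    proof -
      have "v m - v n = (x - v n) - (x - v m)" by simp
      then show ?thesis
        by (simp only: power2_norm_eq_inner inner_add_left inner_add_right inner_diff_left inner_diff_right)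
          (simp add: inner_commute algebra_simps)
    qed
    ultimately show ?thesis using v(2)[of m] v(2)[of n] by simp
  qed
  have "Cauchy v"
  proof (rule CauchyI)
    fix e :: real assume e: "e > 0"
    obtain N where N: "4 / e\<^sup>2 < real N" using reals_Archimedean2 by blast
    have "norm (v m - v n) < e" if mn: "m \<ge> N" "n \<ge> N" for m n
    proof -
      have "2 / Suc k < e\<^sup>2 / 2" if "k \<ge> N" for k
      proof -
        have "4 / e\<^sup>2 < real (Suc k)" using N that by simp
        then show ?thesis using e by (simp add: field_simps)
      qed
      from this[OF mn(1)] this[OF mn(2)] par[of m n] have "(norm (v m - v n))\<^sup>2 < e\<^sup>2" by simp
      then show ?thesis using e by (simp add: power_less_imp_less_base)
    qed
    then show "\<exists>M. \<forall>m\<ge>M. \<forall>n\<ge>M. norm (v m - v n) < e" by blast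
  qed
  then obtain p where p: "v \<longlonglongrightarrow> p" using Cauchy_convergent_iff convergent_def by blast
  have "p \<in> V" using closed_sequentially[OF V(2) _ p] v(1) by blast
  moreover have "norm (x - p) \<le> norm (x - w)" if "w \<in> V" for w
  proof -
    have "(\<lambda>n. (norm (x - v n))\<^sup>2) \<longlonglongrightarrow> (norm (x - p))\<^sup>2" by (intro tendsto_intros p)
    moreover have "(\<lambda>n. d + 1 / real (Suc n)) \<longlonglongrightarrow> d + 0"
      using LIMSEQ_inverse_real_of_nat by (intro tendsto_intros) (simp add: inverse_eq_divide)
    ultimately have "(norm (x - p))\<^sup>2 \<le> d + 0"
      by (rule LIMSEQ_le) (use v(2) less_imp_le in blast)
    then have "(norm (x - p))\<^sup>2 \<le> (norm (x - w))\<^sup>2" using d[OF that] by linarith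
    then show ?thesis by (rule power2_le_imp_le) simp
  qed
  ultimately show ?thesis by (rule that)
qed

definition proj :: "'a::{real_inner,complete_space} set \<Rightarrow> 'a \<Rightarrow> 'a" where
  "proj V x = (SOME p. p \<in> V \<and> (\<forall>v\<in>V. inner (x - p) v = 0))"

context
  fixes V :: "'a::{real_inner,complete_space} set"
  assumes V: "subspace V" "closed V"
begin

lemma proj: "proj V x \<in> V" "v \<in> V \<Longrightarrow> inner (x - proj V x) v = 0"
proof -
  obtain p where p: "p \<in> V" "\<And>v. v \<in> V \<Longrightarrow> norm (x - p) \<le> norm (x - v)"
    using closest_point_exists[OF V] by blast
  have "inner (x - p) v = 0" if v: "v \<in> V" for v
  proof (cases "v = 0")
    case False
    define t where "t = inner (x - p) v / (norm v)\<^sup>2"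
    have "p + t *\<^sub>R v \<in> V" using V(1) p(1) v by (intro subspace_add subspace_scale)
    from p(2)[OF this] have "(norm (x - p))\<^sup>2 \<le> (norm ((x - p) - t *\<^sub>R v))\<^sup>2"
      by (simp add: algebra_simps)
    also have "\<dots> = (norm (x - p))\<^sup>2 - 2 * t * inner (x - p) v + t\<^sup>2 * (norm v)\<^sup>2"
      by (simp only: power2_norm_eq_inner inner_diff_left inner_diff_right)
        (simp add: inner_commute algebra_simps power2_eq_square)
    also have "t\<^sup>2 * (norm v)\<^sup>2 = t * inner (x - p) v"
      using False by (simp add: t_def power2_eq_square)
    finally have "t * inner (x - p) v \<le> 0" by simp
    then have "(inner (x - p) v)\<^sup>2 / (norm v)\<^sup>2 \<le> 0" by (simp add: t_def power2_eq_square)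
    then have "(inner (x - p) v)\<^sup>2 \<le> 0" using False by (simp add: divide_le_0_iff)
    then show ?thesis by simp
  qed simp
  with p(1) have "\<exists>p. p \<in> V \<and> (\<forall>v\<in>V. inner (x - p) v = 0)" by blast
  from someI_ex[OF this] show "proj V x \<in> V" "v \<in> V \<Longrightarrow> inner (x - proj V x) v = 0"
    unfolding proj_def by blast+
qed

lemma proj_eqI: "p \<in> V \<Longrightarrow> (\<And>v. v \<in> V \<Longrightarrow> inner (x - p) v = 0) \<Longrightarrow> proj V x = p"
proof -
  assume p: "p \<in> V" "\<And>v. v \<in> V \<Longrightarrow> inner (x - p) v = 0"
  have "proj V x - p \<in> V" using subspace_diff[OF V(1) proj(1) p(1)] .
  from p(2)[OF this] proj(2)[OF this, of x]
  have "inner ((x - p) - (x - proj V x)) (proj V x - p) = 0"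
    by (simp only: inner_diff_left[of "x - p" "x - proj V x"])
  then show ?thesis by simp
qed

lemma proj_fixed: "proj V x = x \<longleftrightarrow> x \<in> V"
proof
  assume "x \<in> V"
  then show "proj V x = x" by (rule proj_eqI) simp
qed (use proj(1)[of x] in simp)

lemma proj_add: "proj V (x + y) = proj V x + proj V y"
proof (rule proj_eqI)
  show "proj V x + proj V y \<in> V" by (intro subspace_add V proj)
  fix v assume "v \<in> V"
  have "x + y - (proj V x + proj V y) = (x - proj V x) + (y - proj V y)" by simp
  then show "inner (x + y - (proj V x + proj V y)) v = 0"
    using proj(2)[OF \<open>v \<in> V\<close>, of x] proj(2)[OF \<open>v \<in> V\<close>, of y] by (simp only: inner_add_left add_0)
qed

lemma proj_scaleR: "proj V (r *\<^sub>R x) = r *\<^sub>R proj V x"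
proof (rule proj_eqI)
  show "r *\<^sub>R proj V x \<in> V" by (intro subspace_scale V proj)
  fix v assume "v \<in> V"
  from proj(2)[OF this, of x] show "inner (r *\<^sub>R x - r *\<^sub>R proj V x) v = 0"
    by (simp flip: scaleR_diff_right)
qed

lemma proj_idem: "proj V (proj V x) = proj V x"
  using proj_fixed proj(1)[of x] by blast

lemma proj_sym: "inner (proj V x) y = inner x (proj V y)"
  using proj(2)[OF proj(1)[of y], of x] proj(2)[OF proj(1)[of x], of y]
  by (simp add: inner_diff_left inner_diff_right) (simp add: inner_commute inner_diff_left inner_diff_right)

lemma inner_proj: "inner x (proj V x) = (norm (proj V x))\<^sup>2"
  by (metis power2_norm_eq_inner proj_idem proj_sym)

lemma norm_proj_le: "norm (proj V x) \<le> norm x"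
proof -
  have "(norm (proj V x))\<^sup>2 \<le> norm x * norm (proj V x)"
    unfolding inner_proj[symmetric] by (rule norm_cauchy_schwarz)
  then show ?thesis by (cases "norm (proj V x) = 0") (auto simp: power2_eq_square)
qed

lemma bounded_linear_proj: "bounded_linear (proj V)"
  by (rule bounded_linear_intro[where K=1]) (auto simp: proj_add proj_scaleR norm_proj_le)

end

text \<open>The representing vector spans the orthogonal complement of the kernel.\<close>

lemma riesz_representation:
  fixes f :: "'a::{real_inner,complete_space} \<Rightarrow> real"
  assumes f: "bounded_linear f"
  obtains z where "\<And>x. f x = inner z x"
proof (cases "\<forall>x. f x = 0")
  case True
  then show ?thesis using that[of 0] by simp
next
  case False
  then obtain x0 where x0: "f x0 \<noteq> 0" by blast
  note lin = bounded_linear.linear[OF f]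
  define N where "N = {x. f x = 0}"
  have N: "subspace N" "closed N"
    using lin unfolding N_def
    by (auto simp: subspace_def linear_0 linear_add linear_scale
        intro!: closed_Collect_eq linear_continuous_on[OF f])
  define u where "u = x0 - proj N x0"
  have fu: "f u \<noteq> 0" using x0 proj(1)[OF N, of x0] by (simp add: u_def linear_diff[OF lin] N_def)
  have u0: "u \<noteq> 0" using fu linear_0[OF lin] by auto
  have "f x = inner ((f u / (norm u)\<^sup>2) *\<^sub>R u) x" for x
  proof -
    have "f x *\<^sub>R u - f u *\<^sub>R x \<in> N"
      by (simp add: N_def linear_diff[OF lin] linear_scale[OF lin])
    then have "inner u (f x *\<^sub>R u - f u *\<^sub>R x) = 0" unfolding u_def by (rule proj(2)[OF N])
    then have "f x * (norm u)\<^sup>2 = f u * inner u x"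
      by (simp add: inner_diff_right power2_norm_eq_inner)
    then show ?thesis using u0 by (simp add: field_simps)
  qed
  then show ?thesis by (rule that)
qed

section \<open>Measures are determined by their Fourier transforms\<close>

definition weighted_sum :: "'k set \<Rightarrow> ('k \<Rightarrow> real) \<Rightarrow> ('k \<Rightarrow> real measure) \<Rightarrow> real measure" where
  "weighted_sum K c M = measure_of UNIV (sets borel) (\<lambda>A. \<Sum>k\<in>K. ennreal (c k) * emeasure (M k) A)"

context
  fixes K :: "'k set" and c :: "'k \<Rightarrow> real" and M :: "'k \<Rightarrow> real measure"
  assumes K: "finite K" and c: "\<And>k. k \<in> K \<Longrightarrow> c k \<ge> 0"
    and M: "\<And>k. k \<in> K \<Longrightarrow> finite_measure (M k)" "\<And>k. k \<in> K \<Longrightarrow> sets (M k) = sets borel"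
begin

lemma sets_weighted_sum [measurable_cong]: "sets (weighted_sum K c M) = sets borel"
  and space_weighted_sum: "space (weighted_sum K c M) = UNIV"
  by (auto simp: weighted_sum_def sets.sigma_sets_eq[of borel, simplified])

lemma emeasure_weighted_sum:
  assumes "A \<in> sets borel"
  shows "emeasure (weighted_sum K c M) A = (\<Sum>k\<in>K. ennreal (c k) * emeasure (M k) A)"
proof (rule emeasure_measure_of[OF weighted_sum_def])
  show "countably_additive (sets (weighted_sum K c M)) (\<lambda>A. \<Sum>k\<in>K. ennreal (c k) * emeasure (M k) A)"
  proof (rule countably_additiveI)
    fix A :: "nat \<Rightarrow> real set" assume A: "range A \<subseteq> sets (weighted_sum K c M)" "disjoint_family A"
    have "(\<Sum>i. \<Sum>k\<in>K. ennreal (c k) * emeasure (M k) (A i)) = (\<Sum>k\<in>K. \<Sum>i. ennreal (c k) * emeasure (M k) (A i))"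
      by (rule suminf_sum) auto
    also have "\<dots> = (\<Sum>k\<in>K. ennreal (c k) * emeasure (M k) (\<Union> (range A)))"
      using A M(2) by (intro sum.cong) (auto simp: ennreal_suminf_cmult suminf_emeasure sets_weighted_sum)
    finally show "(\<Sum>i. \<Sum>k\<in>K. ennreal (c k) * emeasure (M k) (A i)) =
        (\<Sum>k\<in>K. ennreal (c k) * emeasure (M k) (\<Union> (range A)))" .
  qed
qed (use assms in \<open>auto simp: positive_def sets_weighted_sum\<close>)

lemma nn_integral_weighted_sum:
  assumes "f \<in> borel_measurable borel"
  shows "(\<integral>\<^sup>+ x. f x \<partial>weighted_sum K c M) = (\<Sum>k\<in>K. ennreal (c k) * (\<integral>\<^sup>+ x. f x \<partial>M k))"
proof -
  have meas: "g \<in> borel_measurable (M k)" if "g \<in> borel_measurable borel" "k \<in> K" 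
    for g :: "real \<Rightarrow> ennreal" and k
    using that measurable_cong_sets[OF M(2)[OF that(2)] refl] by blast
  have measN: "g \<in> borel_measurable (weighted_sum K c M)" if "g \<in> borel_measurable borel"
    for g :: "real \<Rightarrow> ennreal"
    using that measurable_cong_sets[OF sets_weighted_sum refl] by blast
  show ?thesis
    using assms
  proof (induction rule: borel_measurable_induct)
    case (cong f g)
    then have "f = g" by auto
    with cong show ?case by simp
  next
    case (set A)
    then have "A \<in> sets (weighted_sum K c M)" "\<And>k. k \<in> K \<Longrightarrow> A \<in> sets (M k)"
      using M(2) by (simp_all add: sets_weighted_sum)
    then show ?case using set by (simp add: emeasure_weighted_sum)
  next
    case (mult u v)
    show ?case
      unfolding nn_integral_cmult[OF measN[OF mult(2)]] mult.IH sum_distrib_left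
      by (intro sum.cong refl) (simp only: nn_integral_cmult[OF meas[OF mult(2)]] mult.left_commute)
  next
    case (add u v)
    show ?case
      unfolding nn_integral_add[OF measN[OF add.hyps(3)] measN[OF add.hyps(1)]] add.IH sum.distrib[symmetric]
      by (intro sum.cong refl) (simp only: nn_integral_add[OF meas[OF add.hyps(3)] meas[OF add.hyps(1)]] distrib_left)
  next
    case (seq U)
    have UM: "U i \<in> borel_measurable (M k)" if "k \<in> K" for i k using meas seq.hyps(1) that by blast
    have UN: "U i \<in> borel_measurable (weighted_sum K c M)" for i by (rule measN[OF seq.hyps(1)])
    have "(\<integral>\<^sup>+ x. (SUP i. U i x) \<partial>weighted_sum K c M) = (SUP i. \<Sum>k\<in>K. ennreal (c k) * (\<integral>\<^sup>+ x. U i x \<partial>M k))"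
      unfolding nn_integral_monotone_convergence_SUP[OF seq.hyps(3) UN] seq.IH ..
    also have "\<dots> = (\<Sum>k\<in>K. SUP i. ennreal (c k) * (\<integral>\<^sup>+ x. U i x \<partial>M k))"
    proof (rule ennreal_SUP_sum)
      fix k
      show "incseq (\<lambda>i. ennreal (c k) * (\<integral>\<^sup>+ x. U i x \<partial>M k))"
        using seq.hyps(3) by (intro incseq_SucI mult_left_mono nn_integral_mono) (auto dest!: incseq_SucD simp: le_fun_def)
    qed
    also have "\<dots> = (\<Sum>k\<in>K. ennreal (c k) * (\<integral>\<^sup>+ x. (SUP i. U i x) \<partial>M k))"
      by (intro sum.cong refl) (simp only: SUP_mult_left_ennreal[symmetric] nn_integral_monotone_convergence_SUP[OF seq.hyps(3) UM])
    finally show ?case by (simp only: SUP_apply)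
  qed
qed

end

lemma integral_weighted_sum:
  fixes K :: "'k set"
  assumes K: "finite K" and c: "\<And>k. k \<in> K \<Longrightarrow> c k \<ge> 0"
    and M: "\<And>k. k \<in> K \<Longrightarrow> real_distribution (M k)"
    and f: "f \<in> borel_measurable borel" "\<And>x::real. \<bar>f x :: real\<bar> \<le> 1"
  shows "(\<integral>x. f x \<partial>weighted_sum K c M) = (\<Sum>k\<in>K. c k * (\<integral>x. f x \<partial>M k))"
    and "measure (weighted_sum K c M) A = (if A \<in> sets borel then \<Sum>k\<in>K. c k * measure (M k) A else 0)"
    and "finite_measure (weighted_sum K c M)"
proof -
  let ?N = "weighted_sum K c M"
  have fin: "finite_measure (M k)" and sM: "sets (M k) = sets borel" if "k \<in> K" for k
  proof -
    interpret real_distribution "M k" by (rule M[OF that])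
    show "finite_measure (M k)" "sets (M k) = sets borel" by unfold_locales simp
  qed
  have em: "emeasure ?N A = (\<Sum>k\<in>K. ennreal (c k) * emeasure (M k) A)" if "A \<in> sets borel" for A
    by (rule emeasure_weighted_sum) (fact K c fin sM that | simp add: c fin sM)+
  have nn: "(\<integral>\<^sup>+ x. g x \<partial>?N) = (\<Sum>k\<in>K. ennreal (c k) * (\<integral>\<^sup>+ x. g x \<partial>M k))"
    if "g \<in> borel_measurable borel" for g
    by (rule nn_integral_weighted_sum) (fact K that | simp add: c fin sM)+
  have sN: "sets ?N = sets borel" by (rule sets_weighted_sum) (fact K | simp add: c fin sM)+
  have spN: "space ?N = UNIV" by (rule space_weighted_sum) (fact K | simp add: c fin sM)+
  have em_M: "emeasure (M k) A = ennreal (measure (M k) A)" if "k \<in> K" for k A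
    by (rule finite_measure.emeasure_eq_measure[OF fin[OF that]])
  have em': "emeasure ?N A = ennreal (\<Sum>k\<in>K. c k * measure (M k) A)" if "A \<in> sets borel" for A
    unfolding em[OF that] using c by (subst sum_ennreal[symmetric]) (auto simp: em_M ennreal_mult intro!: sum.cong)
  have meas: "measure ?N A = (\<Sum>k\<in>K. c k * measure (M k) A)" if "A \<in> sets borel" for A
    unfolding measure_def[of ?N] em'[OF that] using c by (intro enn2real_ennreal sum_nonneg) auto
  show "measure ?N A = (if A \<in> sets borel then \<Sum>k\<in>K. c k * measure (M k) A else 0)"
    using meas by (auto simp: measure_notin_sets sN)
  show finN: "finite_measure ?N" by (rule finite_measureI) (simp add: spN em')
  have int: "integrable L f" if "finite_measure L" "sets L = sets borel" for L
    using that f measurable_cong_sets[OF that(2) refl, of borel]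
    by (intro finite_measure.integrable_const_bound[where f=f and B=1]) auto
  have nonneg: "0 \<le> f x + 1" for x using f(2)[of x] by linarith
  have shift: "ennreal ((\<integral>x. f x \<partial>L) + measure L UNIV) = (\<integral>\<^sup>+ x. ennreal (f x + 1) \<partial>L)"
    and shift0: "0 \<le> (\<integral>x. f x \<partial>L) + measure L UNIV"
    if L: "finite_measure L" "sets L = sets borel" for L
  proof -
    interpret finite_measure L by fact
    have sp: "space L = UNIV" using sets_eq_imp_space_eq[OF L(2)] by simp
    have "(\<integral>x. f x + 1 \<partial>L) = (\<integral>x. f x \<partial>L) + measure L UNIV"
      using int[OF L] by (simp add: sp)
    moreover have "(\<integral>\<^sup>+ x. ennreal (f x + 1) \<partial>L) = ennreal (\<integral>x. f x + 1 \<partial>L)"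
      using int[OF L] nonneg by (intro nn_integral_eq_integral) auto
    moreover have "0 \<le> (\<integral>x. f x + 1 \<partial>L)" using nonneg by (intro integral_nonneg_AE) auto
    ultimately show "ennreal ((\<integral>x. f x \<partial>L) + measure L UNIV) = (\<integral>\<^sup>+ x. ennreal (f x + 1) \<partial>L)"
      "0 \<le> (\<integral>x. f x \<partial>L) + measure L UNIV" by simp_all
  qed
  have "ennreal ((\<integral>x. f x \<partial>?N) + measure ?N UNIV) = (\<integral>\<^sup>+ x. ennreal (f x + 1) \<partial>?N)"
    by (rule shift[OF finN sN])
  also have "\<dots> = (\<Sum>k\<in>K. ennreal (c k) * (\<integral>\<^sup>+ x. ennreal (f x + 1) \<partial>M k))"
    by (rule nn, intro measurable_compose[OF _ measurable_ennreal] borel_measurable_add f(1) borel_measurable_const)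
  also have "\<dots> = (\<Sum>k\<in>K. ennreal (c k * ((\<integral>x. f x \<partial>M k) + measure (M k) UNIV)))"
    by (intro sum.cong refl) (simp add: shift[OF fin sM, symmetric] ennreal_mult c shift0[OF fin sM])
  also have "\<dots> = ennreal (\<Sum>k\<in>K. c k * ((\<integral>x. f x \<partial>M k) + measure (M k) UNIV))"
    using c shift0[OF fin sM] by (intro sum_ennreal) (auto intro!: mult_nonneg_nonneg)
  finally have "(\<integral>x. f x \<partial>?N) + measure ?N UNIV = (\<Sum>k\<in>K. c k * ((\<integral>x. f x \<partial>M k) + measure (M k) UNIV))"
    using shift0[OF finN sN] c shift0[OF fin sM] by (subst (asm) ennreal_inj) (auto intro!: sum_nonneg mult_nonneg_nonneg)
  then show "(\<integral>x. f x \<partial>?N) = (\<Sum>k\<in>K. c k * (\<integral>x. f x \<partial>M k))"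
    by (simp add: meas distrib_left sum.distrib)
qed

lemma char_cos_sin:
  assumes "finite_measure M" "sets M = sets borel"
  shows "char M t = Complex (\<integral>x. cos (t * x) \<partial>M) (\<integral>x. sin (t * x) \<partial>M)"
proof -
  interpret finite_measure M by fact
  note [measurable_cong] = assms(2)
  have int: "complex_integrable M (\<lambda>x. iexp (t * x))"
    by (rule integrable_const_bound[where B=1]) auto
  show ?thesis
    unfolding char_def using integral_Re[OF int] integral_Im[OF int]
    by (simp add: complex_eq_iff Re_exp Im_exp)
qed

text \<open>Split the weights into positive and negative parts; after normalisation both parts are
  probability measures with the same characteristic function.\<close>

lemma signed_fourier_uniqueness:
  fixes K :: "'k set"
  assumes K: "finite K" and M: "\<And>k. k \<in> K \<Longrightarrow> real_distribution (M k)"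
    and zero: "\<And>t. (\<Sum>k\<in>K. complex_of_real (c k) * char (M k) t) = 0"
    and A: "A \<in> sets borel"
  shows "(\<Sum>k\<in>K. c k * measure (M k) A) = 0"
proof -
  define p n where "p k = max (c k) 0" and "n k = max (- c k) 0" for k
  have c: "c k = p k - n k" for k by (simp add: p_def n_def max_def)
  have pn: "p k \<ge> 0" "n k \<ge> 0" for k by (auto simp: p_def n_def)
  have fin: "finite_measure (M k)" and sM: "sets (M k) = sets borel" and one: "measure (M k) UNIV = 1" if "k \<in> K" for k
  proof -
    interpret real_distribution "M k" by (rule M[OF that])
    show "finite_measure (M k)" "sets (M k) = sets borel" by unfold_locales simp
    show "measure (M k) UNIV = 1" using prob_space sets_eq_imp_space_eq[OF events_eq_borel] by simp
  qed
  have cos0: "(\<Sum>k\<in>K. c k * (\<integral>x. cos (t * x) \<partial>M k)) = 0"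
    and sin0: "(\<Sum>k\<in>K. c k * (\<integral>x. sin (t * x) \<partial>M k)) = 0" for t
  proof -
    have "(\<Sum>k\<in>K. complex_of_real (c k) * char (M k) t) =
      Complex (\<Sum>k\<in>K. c k * (\<integral>x. cos (t * x) \<partial>M k)) (\<Sum>k\<in>K. c k * (\<integral>x. sin (t * x) \<partial>M k))"
      by (simp add: complex_eq_iff char_cos_sin[OF fin sM])
    with zero[of t] show "(\<Sum>k\<in>K. c k * (\<integral>x. cos (t * x) \<partial>M k)) = 0"
      "(\<Sum>k\<in>K. c k * (\<integral>x. sin (t * x) \<partial>M k)) = 0" by (simp_all add: complex_eq_iff)
  qed
  define m where "m = (\<Sum>k\<in>K. p k)"
  have "(\<Sum>k\<in>K. c k * (\<integral>x. cos (0 * x) \<partial>M k)) = (\<Sum>k\<in>K. c k)"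
  proof (intro sum.cong refl)
    fix k assume "k \<in> K"
    then show "c k * (\<integral>x. cos (0 * x) \<partial>M k) = c k"
      using one[of k] sets_eq_imp_space_eq[OF sM[of k]] by simp
  qed
  then have m: "(\<Sum>k\<in>K. n k) = m" using cos0[of 0] by (simp add: c sum_subtractf m_def)
  have m0: "m \<ge> 0" unfolding m_def using pn by (intro sum_nonneg) auto
  show ?thesis
  proof (cases "m = 0")
    case True
    then have "\<forall>k\<in>K. p k = 0" "\<forall>k\<in>K. n k = 0"
      using m pn sum_nonneg_eq_0_iff[OF K, of p] sum_nonneg_eq_0_iff[OF K, of n] unfolding m_def by auto
    then show ?thesis by (simp add: c)
  next
    case False
    then have mpos: "m > 0" using m0 by simp
    have nonneg: "p k / m \<ge> 0" "n k / m \<ge> 0" for k using pn mpos by auto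
    let ?P = "weighted_sum K (\<lambda>k. p k / m) M" and ?N = "weighted_sum K (\<lambda>k. n k / m) M"
    have W: "(\<integral>x. f x \<partial>weighted_sum K (\<lambda>k. q k / m) M) = (\<Sum>k\<in>K. q k / m * (\<integral>x. f x \<partial>M k))"
        "measure (weighted_sum K (\<lambda>k. q k / m) M) A = (if A \<in> sets borel then \<Sum>k\<in>K. q k / m * measure (M k) A else 0)"
        "finite_measure (weighted_sum K (\<lambda>k. q k / m) M)"
      if "\<And>k. q k \<ge> 0" "f \<in> borel_measurable borel" "\<And>x. \<bar>f x\<bar> \<le> 1" for q f A
      by ((rule integral_weighted_sum[where f=f]; (fact K M | use that mpos in simp)),
          (rule integral_weighted_sum(2)[where f=f]; (fact K M | use that mpos in simp)),
          (rule integral_weighted_sum(3)[where f=f]; (fact K M | use that mpos in simp)))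
    have rd: "real_distribution (weighted_sum K (\<lambda>k. q k / m) M)" 
      if q: "\<And>k. q k \<ge> 0" "(\<Sum>k\<in>K. q k) = m" for q
    proof -
      have q': "k \<in> K \<Longrightarrow> q k / m \<ge> 0" for k using q mpos by simp
      note I = W[of q "\<lambda>_. 0", OF q(1)]
      have sp: "space (weighted_sum K (\<lambda>k. q k / m) M) = UNIV"
        by (rule space_weighted_sum) (fact K q' | simp add: fin sM)+
      have se: "sets (weighted_sum K (\<lambda>k. q k / m) M) = sets borel"
        by (rule sets_weighted_sum) (fact K q' | simp add: fin sM)+
      interpret finite_measure "weighted_sum K (\<lambda>k. q k / m) M" by (rule I(3)) auto
      have "measure (weighted_sum K (\<lambda>k. q k / m) M) UNIV = 1"
        using I(2)[of UNIV, simplified] mpos q(2) one by (simp add: sum_divide_distrib[symmetric])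
      then have "prob_space (weighted_sum K (\<lambda>k. q k / m) M)"
        by (intro prob_spaceI) (simp add: emeasure_eq_measure sp)
      then show ?thesis
        by (intro real_distribution.intro real_distribution_axioms.intro se)
    qed
    have rdP: "real_distribution ?P" and rdN: "real_distribution ?N"
      using rd[OF pn(1) m_def[symmetric]] rd[OF pn(2) m] by simp_all
    interpret P: real_distribution ?P by (rule rdP)
    interpret N: real_distribution ?N by (rule rdN)
    have eq: "(\<integral>x. f x \<partial>?P) = (\<integral>x. f x \<partial>?N)"
      if f: "f \<in> borel_measurable borel" "\<And>x. \<bar>f x\<bar> \<le> 1" "(\<Sum>k\<in>K. c k * (\<integral>x. f x \<partial>M k)) = 0" for f :: "real \<Rightarrow> real"
    proof -
      have "(\<integral>x. f x \<partial>?P) - (\<integral>x. f x \<partial>?N) = (\<Sum>k\<in>K. c k * (\<integral>x. f x \<partial>M k)) / m"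
        unfolding W(1)[OF pn(1) f(1,2)] W(1)[OF pn(2) f(1,2)]
        by (simp add: sum_subtractf[symmetric] c sum_divide_distrib algebra_simps diff_divide_distrib)
      then show ?thesis using f(3) by simp
    qed
    have "char ?P = char ?N"
    proof
      fix t show "char ?P t = char ?N t"
        unfolding char_cos_sin[OF P.finite_measure_axioms P.events_eq_borel]
          char_cos_sin[OF N.finite_measure_axioms N.events_eq_borel]
        by (intro arg_cong2[of _ _ _ _ Complex] eq cos0 sin0) auto
    qed
    then have "?P = ?N" by (rule Levy_uniqueness[OF rdP rdN])
    then have "measure ?P A = measure ?N A" by simp
    then have "(\<Sum>k\<in>K. p k / m * measure (M k) A) = (\<Sum>k\<in>K. n k / m * measure (M k) A)"
      using W(2)[OF pn(1), where f="\<lambda>_. 0" and A=A] W(2)[OF pn(2), where f="\<lambda>_. 0" and A=A] A by simp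
    then have "(\<Sum>k\<in>K. p k * measure (M k) A) / m = (\<Sum>k\<in>K. n k * measure (M k) A) / m"
      by (simp add: sum_divide_distrib)
    then show ?thesis using mpos by (simp add: c left_diff_distrib sum_subtractf)
  qed
qed

section \<open>Measures from positive definite functions\<close>

lemma real_distribution_tight:
  assumes M: "real_distribution M" and e: "e > 0"
  obtains n :: nat where "measure M {x. \<bar>x\<bar> \<ge> real n} < e"
proof -
  interpret real_distribution M by (rule M)
  have "(\<lambda>n. prob {x. \<bar>x\<bar> \<ge> real n}) \<longlonglongrightarrow> prob (\<Inter>n. {x. \<bar>x\<bar> \<ge> real n})"
    by (rule finite_Lim_measure_decseq) (auto simp: decseq_def)
  moreover have "(\<Inter>n. {x::real. \<bar>x\<bar> \<ge> real n}) = {}"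
  proof -
    have "\<exists>n. \<bar>x\<bar> < real n" for x :: real by (rule reals_Archimedean2)
    then show ?thesis by (simp add: set_eq_iff not_le)
  qed
  ultimately have "(\<lambda>n. prob {x. \<bar>x\<bar> \<ge> real n}) \<longlonglongrightarrow> 0" by simp
  from order_tendstoD(2)[OF this e] obtain n where "prob {x. \<bar>x\<bar> \<ge> real n} < e"
    by (auto simp: eventually_sequentially)
  then show ?thesis by (rule that)
qed

text \<open>Averaging \<open>1 - char M\<close> against a Gaussian measures the tails of \<open>M\<close>.\<close>

lemma gaussian_tail_bound:
  assumes M: "real_distribution M"
  shows "(\<integral>x. 1 - exp (- (s * x)\<^sup>2 / 2) \<partial>M) = (\<integral>z. 1 - Re (char M (s * z)) \<partial>std_normal_distribution)"
    and "s > 0 \<Longrightarrow> (1 - exp (- 1 / 2)) * measure M {x. \<bar>x\<bar> \<ge> 1 / s} \<le> (\<integral>x. 1 - exp (- (s * x)\<^sup>2 / 2) \<partial>M)"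
proof -
  interpret M: real_distribution M by (rule M)
  interpret N: real_distribution std_normal_distribution by (rule real_dist_normal_dist)
  interpret P: pair_prob_space M std_normal_distribution ..
  have int: "integrable (M \<Otimes>\<^sub>M std_normal_distribution) (\<lambda>(x, z). iexp (s * z * x))"
    by (rule P.P.integrable_const_bound[where B=1]) (auto simp: split_beta)
  have "(\<integral>x. complex_of_real (exp (- (s * x)\<^sup>2 / 2)) \<partial>M) = (\<integral>x. (\<integral>z. iexp (s * z * x) \<partial>std_normal_distribution) \<partial>M)"
  proof (rule Bochner_Integration.integral_cong[OF refl])
    fix x
    show "complex_of_real (exp (- (s * x)\<^sup>2 / 2)) = (\<integral>z. iexp (s * z * x) \<partial>std_normal_distribution)"
      using fun_cong[OF char_std_normal_distribution, of "s * x"] unfolding char_def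
      by (simp add: mult_ac)
  qed
  also have "\<dots> = (\<integral>z. (\<integral>x. iexp (s * z * x) \<partial>M) \<partial>std_normal_distribution)"
    by (rule P.Fubini_integral[symmetric, OF int])
  also have "\<dots> = (\<integral>z. char M (s * z) \<partial>std_normal_distribution)" by (simp add: char_def)
  finally have eq: "(\<integral>x. complex_of_real (exp (- (s * x)\<^sup>2 / 2)) \<partial>M) = (\<integral>z. char M (s * z) \<partial>std_normal_distribution)" .
  have chm: "(\<lambda>z. char M (s * z)) \<in> borel_measurable borel" by measurable
  have ci: "integrable std_normal_distribution (\<lambda>z. char M (s * z))"
    using chm by (intro N.integrable_const_bound[where B=1]) (auto simp: M.cmod_char_le_1)
  have ei: "integrable M (\<lambda>x. exp (- (s * x)\<^sup>2 / 2))"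
    by (rule M.integrable_const_bound[where B=1]) auto
  have "(\<integral>x. exp (- (s * x)\<^sup>2 / 2) \<partial>M) = (\<integral>z. Re (char M (s * z)) \<partial>std_normal_distribution)"
    using arg_cong[OF eq, of Re] integral_Re[OF ci] by (simp add: integral_complex_of_real)
  then show "(\<integral>x. 1 - exp (- (s * x)\<^sup>2 / 2) \<partial>M) = (\<integral>z. 1 - Re (char M (s * z)) \<partial>std_normal_distribution)"
    using ei integrable_Re[OF ci] M.prob_space N.prob_space by simp
  assume s: "s > 0"
  have "(1 - exp (- 1 / 2)) * measure M {x. \<bar>x\<bar> \<ge> 1 / s} = (\<integral>x. (1 - exp (- 1 / 2)) * indicator {x. \<bar>x\<bar> \<ge> 1 / s} x \<partial>M)"
    by simp
  also have "\<dots> \<le> (\<integral>x. 1 - exp (- (s * x)\<^sup>2 / 2) \<partial>M)"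
  proof (rule integral_mono)
    show "integrable M (\<lambda>x. (1 - exp (- 1 / 2)) * indicator {x. \<bar>x\<bar> \<ge> 1 / s} x :: real)"
      by (intro integrable_mult_right integrable_real_indicator) (auto simp: M.emeasure_eq_measure)
    show "integrable M (\<lambda>x. 1 - exp (- (s * x)\<^sup>2 / 2))" using ei by simp
    fix x
    show "(1 - exp (- 1 / 2)) * indicator {x. \<bar>x\<bar> \<ge> 1 / s} x \<le> 1 - exp (- (s * x)\<^sup>2 / 2)"
    proof (cases "\<bar>x\<bar> \<ge> 1 / s")
      case True
      then have "1 \<le> \<bar>s * x\<bar>" using s by (simp add: field_simps abs_mult)
      then have "1\<^sup>2 \<le> \<bar>s * x\<bar>\<^sup>2" by (intro power_mono) auto
      then show ?thesis using True by simp
    qed simp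
  qed
  finally show "(1 - exp (- 1 / 2)) * measure M {x. \<bar>x\<bar> \<ge> 1 / s} \<le> (\<integral>x. 1 - exp (- (s * x)\<^sup>2 / 2) \<partial>M)" .
qed

text \<open>By continuity of \<open>\<psi>\<close> at the origin, its average over a narrow Gaussian is close to 1. This
  bounds the tails of almost all \<open>\<mu> n\<close> at once; the finitely many others are tight one by one.\<close>

lemma char_limit_tight:
  assumes \<mu>: "\<And>n. real_distribution (\<mu> n)"
    and lim: "\<And>t. (\<lambda>n. char (\<mu> n) t) \<longlonglongrightarrow> \<psi> t" and cont: "isCont \<psi> 0"
  shows "tight \<mu>"
  unfolding tight_def
proof (intro conjI allI impI \<mu>)
  fix e :: real assume e: "e > 0"
  interpret N: real_distribution std_normal_distribution by (rule real_dist_normal_dist)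
  define c where "c = 1 - exp (- 1 / 2 :: real)"
  have c: "c > 0" by (simp add: c_def)
  have [measurable]: "char (\<mu> n) \<in> borel_measurable borel" for n
    by (rule real_distribution.char_measurable[OF \<mu>])
  have [measurable]: "\<psi> \<in> borel_measurable borel"
    by (rule borel_measurable_LIMSEQ_metric[OF _ lim]) simp
  have chb: "cmod (char (\<mu> n) t) \<le> 1" for n t by (rule real_distribution.cmod_char_le_1[OF \<mu>])
  have psb: "cmod (\<psi> t) \<le> 1" for t using LIMSEQ_le_const2[OF tendsto_norm[OF lim[of t]]] chb by blast
  have psi0: "\<psi> 0 = 1"
    using LIMSEQ_unique[OF lim[of 0]] real_distribution.char_zero[OF \<mu>] by simp
  have re2: "\<bar>1 - Re w\<bar> \<le> 2" if "cmod w \<le> 1" for w using abs_Re_le_cmod[of w] that by linarith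
  define A where "A s = (\<integral>z. 1 - Re (\<psi> (s * z)) \<partial>std_normal_distribution)" for s
  have "(\<lambda>k. A (1 / real (Suc k))) \<longlonglongrightarrow> (\<integral>z. 0 \<partial>std_normal_distribution)"
    unfolding A_def
  proof (rule integral_dominated_convergence[where w="\<lambda>_. 2"])
    show "AE z in std_normal_distribution. (\<lambda>k. 1 - Re (\<psi> (1 / real (Suc k) * z))) \<longlonglongrightarrow> 0"
    proof (rule AE_I2)
      fix z
      have "(\<lambda>k. 1 / real (Suc k) * z) \<longlonglongrightarrow> 0 * z"
        using LIMSEQ_inverse_real_of_nat by (intro tendsto_mult tendsto_const) (simp add: inverse_eq_divide)
      then have "(\<lambda>k. \<psi> (1 / real (Suc k) * z)) \<longlonglongrightarrow> \<psi> 0"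
        using isCont_tendsto_compose[OF cont] by simp
      then have "(\<lambda>k. 1 - Re (\<psi> (1 / real (Suc k) * z))) \<longlonglongrightarrow> 1 - Re (\<psi> 0)" by (intro tendsto_intros)
      then show "(\<lambda>k. 1 - Re (\<psi> (1 / real (Suc k) * z))) \<longlonglongrightarrow> 0" by (simp add: psi0)
    qed
    show "AE z in std_normal_distribution. norm (1 - Re (\<psi> (1 / real (Suc k) * z))) \<le> 2" for k
      using re2[OF psb] by (intro AE_I2) simp
  qed simp_all
  then have "(\<lambda>k. A (1 / real (Suc k))) \<longlonglongrightarrow> 0" by simp
  moreover have ce: "0 < c * e" using c e by simp
  ultimately have "eventually (\<lambda>k. A (1 / real (Suc k)) < c * e) sequentially"
    by (rule order_tendstoD(2))
  then obtain k where k: "A (1 / real (Suc k)) < c * e" by (auto simp: eventually_sequentially)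
  define s where "s = 1 / real (Suc k)"
  have s: "s > 0" by (simp add: s_def)
  have "(\<lambda>n. \<integral>z. 1 - Re (char (\<mu> n) (s * z)) \<partial>std_normal_distribution) \<longlonglongrightarrow> A s"
    unfolding A_def
  proof (rule integral_dominated_convergence[where w="\<lambda>_. 2"])
    show "AE z in std_normal_distribution. (\<lambda>n. 1 - Re (char (\<mu> n) (s * z))) \<longlonglongrightarrow> 1 - Re (\<psi> (s * z))"
      by (intro AE_I2 tendsto_intros lim)
    show "AE z in std_normal_distribution. norm (1 - Re (char (\<mu> n) (s * z))) \<le> 2" for n
      using re2[OF chb] by (intro AE_I2) simp
  qed simp_all
  from order_tendstoD(2)[OF this k[folded s_def]] obtain m where
    m: "\<And>n. n \<ge> m \<Longrightarrow> (\<integral>z. 1 - Re (char (\<mu> n) (s * z)) \<partial>std_normal_distribution) < c * e"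
    by (auto simp: eventually_sequentially)
  have tail1: "measure (\<mu> n) {x. \<bar>x\<bar> \<ge> 1 / s} < e" if "n \<ge> m" for n
  proof -
    have "c * measure (\<mu> n) {x. \<bar>x\<bar> \<ge> 1 / s} < c * e"
      using gaussian_tail_bound(2)[OF \<mu>[of n] s] m[OF that]
      unfolding gaussian_tail_bound(1)[OF \<mu>] c_def by (rule le_less_trans)
    then show ?thesis using c by simp
  qed
  have "\<forall>n. \<exists>j::nat. measure (\<mu> n) {x. \<bar>x\<bar> \<ge> real j} < e" using real_distribution_tight[OF \<mu> e] by metis
  from choice[OF this] obtain j :: "nat \<Rightarrow> nat" where j: "\<forall>n. measure (\<mu> n) {x. \<bar>x\<bar> \<ge> real (j n)} < e" ..
  define b where "b = 1 / s + (\<Sum>n<m. real (j n)) + 1"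
  have sum0: "(\<Sum>n<m. real (j n)) \<ge> 0" by (intro sum_nonneg) auto
  have b: "b > 0" using s sum0 by (simp add: b_def add_pos_nonneg add_nonneg_pos)
  have "1 - e < measure (\<mu> n) {- b<..b}" for n
  proof -
    interpret M: real_distribution "\<mu> n" by (rule \<mu>)
    have out: "measure (\<mu> n) {x. \<bar>x\<bar> \<ge> b} < e"
    proof (cases "n < m")
      case True
      then have "real (j n) \<le> (\<Sum>n<m. real (j n))" by (intro member_le_sum) auto
      moreover have "0 < 1 / s" using s by simp
      ultimately have "real (j n) \<le> b" unfolding b_def by linarith
      then have "measure (\<mu> n) {x. \<bar>x\<bar> \<ge> b} \<le> measure (\<mu> n) {x. \<bar>x\<bar> \<ge> real (j n)}"
        by (intro M.finite_measure_mono) auto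
      with j[rule_format, of n] show ?thesis by linarith
    next
      case False
      have "1 / s \<le> b" using sum0 by (simp add: b_def)
      then have "measure (\<mu> n) {x. \<bar>x\<bar> \<ge> b} \<le> measure (\<mu> n) {x. \<bar>x\<bar> \<ge> 1 / s}"
        by (intro M.finite_measure_mono) auto
      with tail1[of n] False show ?thesis by linarith
    qed
    have "1 - measure (\<mu> n) {- b<..b} = measure (\<mu> n) (UNIV - {- b<..b})"
      using M.prob_compl[of "{- b<..b}"] by simp
    also have "\<dots> \<le> measure (\<mu> n) {x. \<bar>x\<bar> \<ge> b}"
      by (intro M.finite_measure_mono) auto
    finally show ?thesis using out by linarith
  qed
  then show "\<exists>a b. a < b \<and> (\<forall>n. 1 - e < measure (\<mu> n) {a<..b})"
    using b by (intro exI[of _ "- b"] exI[of _ b]) auto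
qed

text \<open>Tightness gives a weakly convergent subsequence, and its limit has the required
  characteristic function.\<close>

lemma char_limit:
  assumes \<mu>: "\<And>n. real_distribution (\<mu> n)"
    and lim: "\<And>t. (\<lambda>n. char (\<mu> n) t) \<longlonglongrightarrow> \<psi> t" and cont: "isCont \<psi> 0"
  obtains M where "real_distribution M" "char M = \<psi>"
proof -
  obtain r M where r: "strict_mono r" and M: "real_distribution M" "weak_conv_m (\<mu> \<circ> id \<circ> r) M"
    using tight_imp_convergent_subsubsequence[OF char_limit_tight[OF \<mu> lim cont] strict_mono_id] by blast
  have "char M t = \<psi> t" for t
  proof (rule LIMSEQ_unique)
    show "(\<lambda>n. char ((\<mu> \<circ> id \<circ> r) n) t) \<longlonglongrightarrow> char M t"
      by (rule levy_continuity1[OF _ M]) (simp add: \<mu>)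
    show "(\<lambda>n. char ((\<mu> \<circ> id \<circ> r) n) t) \<longlonglongrightarrow> \<psi> t"
      using LIMSEQ_subseq_LIMSEQ[OF lim[of t] r] by (simp add: comp_def)
  qed
  then show ?thesis using that M(1) by blast
qed

section \<open>Bochner's theorem for unitary groups\<close>

locale unitary_group =
  fixes U :: "real \<Rightarrow> 'h::complex_hilbert_space \<Rightarrow> 'h"
  assumes unitary: "unitary (U t)"
    and U_add: "U (s + t) x = U s (U t x)"
    and U_zero: "U 0 x = x"
    and U_cont: "continuous_on UNIV (\<lambda>t. U t x)"
begin

lemma U_plus: "U t (x + y) = U t x + U t y"
  using unitary by (simp add: unitary_def)

lemma U_scaleC: "U t (a *\<^sub>C x) = a *\<^sub>C U t x"
  using unitary by (simp add: unitary_def)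

lemma U_cinner: "cinner (U t x) (U t y) = cinner x y"
  using unitary by (simp add: unitary_def)

lemma norm_U: "norm (U t x) = norm x"
proof -
  have "complex_of_real ((norm (U t x))\<^sup>2) = complex_of_real ((norm x)\<^sup>2)"
    by (simp only: cinner_self[symmetric] U_cinner)
  then have "(norm (U t x))\<^sup>2 = (norm x)\<^sup>2" by (simp only: of_real_eq_iff)
  then show ?thesis by (simp add: power2_eq_iff_nonneg)
qed

lemma U_adjoint: "cinner (U t x) y = cinner x (U (- t) y)"
  using U_cinner[of "- t" "U t x" y] U_add[of "- t" t x] by (simp add: U_zero)

lemma U_cinner_U: "cinner (U s x) (U t y) = cinner x (U (t - s) y)"
  using U_adjoint[of s x "U t y"] U_add[of "- s" t y] by simp

definition \<phi> :: "'h \<Rightarrow> real \<Rightarrow> complex" where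
  "\<phi> x t = cinner x (U t x)"

lemma phi_cont: "continuous_on A (\<phi> x)"
  unfolding \<phi>_def using continuous_on_subset[OF U_cont] by (intro continuous_intros) auto

lemma phi_measurable [measurable]: "\<phi> x \<in> borel_measurable borel"
  by (rule borel_measurable_continuous_onI[OF phi_cont])

lemma phi_bound: "cmod (\<phi> x t) \<le> (norm x)\<^sup>2"
  using norm_cinner_le[of x "U t x"] by (simp add: \<phi>_def norm_U power2_eq_square)

lemma phi_zero: "\<phi> x 0 = complex_of_real ((norm x)\<^sup>2)"
  by (simp add: \<phi>_def U_zero cinner_self)

text \<open>The length of the overlap of the interval \<open>[0, a]\<close> with its translate by \<open>u\<close>; its Fourier
  transform is the Fejer kernel.\<close>

definition tent :: "real \<Rightarrow> real \<Rightarrow> real" where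
  "tent a u = max 0 (a - \<bar>u\<bar>)"

lemma tent_cont: "continuous_on A (tent a)"
  unfolding tent_def by (intro continuous_intros)

lemma tent_measurable [measurable]: "tent a \<in> borel_measurable borel"
  by (rule borel_measurable_continuous_onI[OF tent_cont])

lemma interval_overlap: 
  "(\<integral>r. indicator {0..a} r * indicator {0..a} (r - u) \<partial>lborel) = tent a u"
proof -
  have "(\<lambda>r. indicator {0..a} r * indicator {0..a} (r - u)) = (indicator {max 0 u .. min a (a + u)} :: real \<Rightarrow> real)"
    by (rule ext) (auto simp: indicator_def)
  then have "(\<integral>r. indicator {0..a} r * indicator {0..a} (r - u) \<partial>lborel) = measure lborel {max 0 u .. min a (a + u)}"
    by simp
  also have "\<dots> = tent a u" by (auto simp: tent_def measure_def emeasure_lborel_Icc_eq max_def min_def)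
  finally show ?thesis .
qed

text \<open>The Fourier integral of \<open>\<phi> x\<close>. With this cutoff it is the squared norm of the integral of
  \<open>e\<^sup>-\<^sup>i\<^sup>l\<^sup>s U\<^sub>s x\<close> over \<open>0 \<le> s \<le> a\<close>, hence nonnegative.\<close>

definition fejer :: "real \<Rightarrow> 'h \<Rightarrow> real \<Rightarrow> complex" where
  "fejer a x l = (\<integral>u. complex_of_real (tent a u) * (iexp (- l * u) * \<phi> x u) \<partial>lborel)"

lemma fejer_nonneg: "fejer a x l \<ge> 0"
proof -
  define g where "g = (\<lambda>s. iexp (- l * s) *\<^sub>C U s x)"
  define G where "G = (\<lambda>u. iexp (- l * u) * \<phi> x u)"
  have gc: "continuous_on {0..a} g"
  proof -
    have "continuous_on {0..a} (\<lambda>s. Re (iexp (- l * s)) *\<^sub>R U s x + Im (iexp (- l * s)) *\<^sub>R (\<i> *\<^sub>C U s x))"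
      using continuous_on_subset[OF U_cont] by (intro continuous_intros) auto
    then show ?thesis unfolding g_def scaleC_eq[of "iexp _"] .
  qed
  have gi: "g integrable_on {0..a}" by (rule integrable_continuous_real[OF gc])
  have GG: "cinner (g s) (g r) = G (r - s)" for s r
  proof -
    have "cinner (g s) (g r) = cnj (iexp (- l * s)) * iexp (- l * r) * \<phi> x (r - s)"
      unfolding g_def cinner_scaleC_left cinner_scaleC_right U_cinner_U \<phi>_def by (simp only: mult_ac)
    also have "cnj (iexp (- l * s)) = iexp (l * s)" by (simp add: exp_cnj)
    also have "iexp (l * s) * iexp (- l * r) = iexp (- l * (r - s))"
      unfolding exp_add[symmetric] by (rule arg_cong[of _ _ exp]) (simp add: algebra_simps)
    finally show ?thesis by (simp only: G_def)
  qed
  have Gc: "continuous_on A G" for A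
    unfolding G_def by (intro continuous_intros phi_cont)
  have [measurable]: "G \<in> borel_measurable borel" by (rule borel_measurable_continuous_onI[OF Gc])
  have Gb: "cmod (G u) \<le> (norm x)\<^sup>2" for u using phi_bound[of x u] by (simp add: G_def norm_mult)
  define y where "y = integral {0..a} g"
  have blin: "bounded_linear (\<lambda>w. cinner z w)" for z :: 'h
    by (rule bounded_linear_intro[where K="norm z"])
      (simp_all add: cinner_add_right cinner_scaleR_right scaleR_conv_of_real norm_cinner_le mult.commute[of "norm _" "norm z"])
  have hk: "integral {0..a} f = (\<integral>r. indicator {0..a} r *\<^sub>R f r \<partial>lborel)"
    if "continuous_on {0..a} f" for f :: "real \<Rightarrow> complex"
  proof -
    have "set_integrable lborel {0..a} f"
      unfolding set_integrable_def by (rule borel_integrable_compact) (use that in auto)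
    from set_borel_integral_eq_integral(2)[OF this] show ?thesis by (simp add: set_lebesgue_integral_def)
  qed
  have inner1: "cinner z y = integral {0..a} (\<lambda>r. cinner z (g r))" for z
    using integral_linear[OF gi blin[of z]] by (simp add: y_def comp_def)
  have yg: "cinner y (g r) = (\<integral>s. indicator {0..a} s *\<^sub>R G (r - s) \<partial>lborel)" for r
  proof -
    have "cinner y (g r) = cnj (cinner (g r) y)" by (rule cinner_commute)
    also have "cinner (g r) y = integral {0..a} (\<lambda>s. cinner (g r) (g s))" by (rule inner1)
    also have "cnj \<dots> = integral {0..a} (\<lambda>s. cnj (cinner (g r) (g s)))" 
      by (rule integral_cnj)
    also have "\<dots> = integral {0..a} (\<lambda>s. G (r - s))"
      using GG[of _ r] by (simp only: cinner_commute[of "g _" "g r"])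
    also have "\<dots> = (\<integral>s. indicator {0..a} s *\<^sub>R G (r - s) \<partial>lborel)"
      by (rule hk) (intro continuous_on_compose2[OF Gc[of UNIV]] continuous_intros; simp)
    finally show ?thesis .
  qed
  have ygu: "cinner y (g r) = (\<integral>u. indicator {0..a} (r - u) *\<^sub>R G u \<partial>lborel)" for r
    unfolding yg by (subst lborel_integral_real_affine[where c="-1" and t=r]) auto
  have int: "integrable (lborel \<Otimes>\<^sub>M lborel) (\<lambda>(r, u). indicator {0..a} r *\<^sub>R (indicator {0..a} (r - u) *\<^sub>R G u))"
  proof -
    have "integrable (lborel \<Otimes>\<^sub>M lborel) (\<lambda>z. indicator ({0..a} \<times> {-a..a}) z *\<^sub>R 
        (indicator {0..a} (fst z - snd z) *\<^sub>R G (snd z)))"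
      by (rule integrableI_bounded_set_indicator[where B="(norm x)\<^sup>2"])
        (auto simp: lborel.emeasure_pair_measure_Times ennreal_mult_less_top emeasure_lborel_Icc_eq Gb indicator_def)
    moreover have "(\<lambda>(r, u). indicator {0..a} r *\<^sub>R (indicator {0..a} (r - u) *\<^sub>R G u)) =
        (\<lambda>z. indicator ({0..a} \<times> {-a..a}) z *\<^sub>R (indicator {0..a} (fst z - snd z) *\<^sub>R G (snd z)))"
      by (rule ext) (auto simp: indicator_def split: prod.splits)
    ultimately show ?thesis by simp
  qed
  have "cinner y y = integral {0..a} (\<lambda>r. cinner y (g r))" by (rule inner1)
  also have "\<dots> = (\<integral>r. indicator {0..a} r *\<^sub>R cinner y (g r) \<partial>lborel)"
    by (rule hk) (intro continuous_intros gc)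
  also have "\<dots> = (\<integral>r. (\<integral>u. indicator {0..a} r *\<^sub>R (indicator {0..a} (r - u) *\<^sub>R G u) \<partial>lborel) \<partial>lborel)"
    unfolding ygu by (simp only: integral_scaleR_right)
  also have "\<dots> = (\<integral>u. (\<integral>r. indicator {0..a} r *\<^sub>R (indicator {0..a} (r - u) *\<^sub>R G u) \<partial>lborel) \<partial>lborel)"
    by (rule lborel_pair.Fubini_integral[symmetric, OF int])
  also have "\<dots> = (\<integral>u. complex_of_real (tent a u) * G u \<partial>lborel)"
  proof (rule Bochner_Integration.integral_cong[OF refl])
    fix u
    have "(\<integral>r. indicator {0..a} r *\<^sub>R (indicator {0..a} (r - u) *\<^sub>R G u) \<partial>lborel)
        = (\<integral>r. complex_of_real (indicator {0..a} r * indicator {0..a} (r - u)) * G u \<partial>lborel)"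
      by (simp add: scaleR_conv_of_real mult.assoc)
    also have "\<dots> = complex_of_real (\<integral>r. indicator {0..a} r * indicator {0..a} (r - u) \<partial>lborel) * G u"
      by (simp only: integral_mult_left_zero integral_complex_of_real)
    finally show "(\<integral>r. indicator {0..a} r *\<^sub>R (indicator {0..a} (r - u) *\<^sub>R G u) \<partial>lborel) = complex_of_real (tent a u) * G u"
      by (simp only: interval_overlap)
  qed
  finally have "fejer a x l = cinner y y" by (simp add: fejer_def G_def)
  then show ?thesis by (simp add: cinner_self less_eq_complex_def)
qed

text \<open>A Gaussian factor, of width \<open>m\<close>, makes the nonnegative function \<open>fejer m x\<close> integrable. By
  Fubini, the Fourier transform of the product is an average of \<open>\<phi> x\<close> over a window of width
  \<open>1 / m\<close> around \<open>t\<close>.\<close>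

lemma fejer_gauss:
  assumes m: "m > 0"
  defines "N \<equiv> std_normal_distribution"
  shows "integrable N (\<lambda>z. iexp (t * (m * z)) * fejer m x (m * z))"
    and "(\<integral>z. iexp (t * (m * z)) * fejer m x (m * z) \<partial>N) =
      complex_of_real (sqrt (2 * pi)) * (\<integral>z. complex_of_real (tent m (t + z / m) / m) * \<phi> x (t + z / m) \<partial>N)"
proof -
  interpret N: real_distribution N unfolding N_def by (rule real_dist_normal_dist)
  interpret P: pair_sigma_finite N "lborel :: real measure" ..
  define f where "f = (\<lambda>z u. iexp (m * (t - u) * z) * (complex_of_real (tent m u) * \<phi> x u))"
  have fm [measurable]: "(\<lambda>(z, u). f z u) \<in> borel_measurable (borel \<Otimes>\<^sub>M borel)" unfolding f_def by measurable
  have tb: "0 \<le> tent m u" "tent m u \<le> m" "u \<notin> {-m..m} \<Longrightarrow> tent m u = 0" for u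
    using m by (auto simp: tent_def)
  have fb: "cmod (f z u) \<le> m * (norm x)\<^sup>2" for z u
    using tb[of u] phi_bound[of x u] m by (simp add: f_def norm_mult mult_mono)
  have int: "integrable (N \<Otimes>\<^sub>M lborel) (\<lambda>(z, u). f z u)"
  proof -
    have "integrable (N \<Otimes>\<^sub>M lborel) (\<lambda>w. indicator (UNIV \<times> {-m..m}) w *\<^sub>R (case w of (z, u) \<Rightarrow> f z u))"
    proof (rule integrableI_bounded_set_indicator[where B="m * (norm x)\<^sup>2"])
      show "emeasure (N \<Otimes>\<^sub>M lborel) (UNIV \<times> {-m..m}) < \<infinity>"
        using m by (subst lborel.emeasure_pair_measure_Times)
          (auto simp: N.emeasure_eq_measure ennreal_mult_less_top)
    qed (use fb in \<open>auto simp: split_beta\<close>)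
    moreover have "(\<lambda>w. indicator (UNIV \<times> {-m..m}) w *\<^sub>R (case w of (z, u) \<Rightarrow> f z u)) = (\<lambda>(z, u). f z u)"
    proof
      fix w :: "real \<times> real"
      show "indicator (UNIV \<times> {-m..m}) w *\<^sub>R (case w of (z, u) \<Rightarrow> f z u) = (case w of (z, u) \<Rightarrow> f z u)"
        using tb(3)[of "snd w"] by (cases w) (simp add: indicator_def f_def)
    qed
    ultimately show ?thesis by simp
  qed
  have inner: "iexp (t * (m * z)) * fejer m x (m * z) = (\<integral>u. f z u \<partial>lborel)" for z
  proof -
    have "iexp (t * (m * z)) * fejer m x (m * z)
       = (\<integral>u. iexp (t * (m * z)) * (complex_of_real (tent m u) * (iexp (- (m * z) * u) * \<phi> x u)) \<partial>lborel)"
      unfolding fejer_def by (rule integral_mult_right_zero[symmetric])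
    also have "\<dots> = (\<integral>u. f z u \<partial>lborel)"
    proof (rule Bochner_Integration.integral_cong[OF refl])
      fix u
      have "iexp (t * (m * z)) * iexp (- (m * z) * u) = iexp (m * (t - u) * z)"
        unfolding exp_add[symmetric] by (rule arg_cong[of _ _ exp]) (simp add: algebra_simps)
      then show "iexp (t * (m * z)) * (complex_of_real (tent m u) * (iexp (- (m * z) * u) * \<phi> x u)) = f z u"
        unfolding f_def by (simp only: mult_ac)
    qed
    finally show ?thesis .
  qed
  show "integrable N (\<lambda>z. iexp (t * (m * z)) * fejer m x (m * z))"
    unfolding inner using P.integrable_fst[OF int] by simp
  have "(\<integral>z. iexp (t * (m * z)) * fejer m x (m * z) \<partial>N) = (\<integral>z. (\<integral>u. f z u \<partial>lborel) \<partial>N)"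
    by (simp only: inner)
  also have "\<dots> = (\<integral>u. (\<integral>z. f z u \<partial>N) \<partial>lborel)"
    by (rule P.Fubini_integral[symmetric, OF int])
  also have "\<dots> = (\<integral>u. complex_of_real (exp (- (m * (t - u))\<^sup>2 / 2) * tent m u) * \<phi> x u \<partial>lborel)"
  proof (rule Bochner_Integration.integral_cong[OF refl])
    fix u
    have "(\<integral>z. f z u \<partial>N) = (\<integral>z. iexp (m * (t - u) * z) \<partial>N) * (complex_of_real (tent m u) * \<phi> x u)"
      unfolding f_def by (rule integral_mult_left_zero)
    also have "(\<integral>z. iexp (m * (t - u) * z) \<partial>N) = complex_of_real (exp (- (m * (t - u))\<^sup>2 / 2))"
      using fun_cong[OF char_std_normal_distribution, of "m * (t - u)"] unfolding char_def N_def .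
    finally show "(\<integral>z. f z u \<partial>N) = complex_of_real (exp (- (m * (t - u))\<^sup>2 / 2) * tent m u) * \<phi> x u"
      by (simp only: of_real_mult mult.assoc)
  qed
  also have "\<dots> = \<bar>1 / m\<bar> *\<^sub>R (\<integral>v. complex_of_real (exp (- (m * (t - (t + 1 / m * v)))\<^sup>2 / 2) * tent m (t + 1 / m * v)) * \<phi> x (t + 1 / m * v) \<partial>lborel)"
    using m by (intro lborel_integral_real_affine) auto
  also have "\<dots> = (\<integral>v. (1 / m) *\<^sub>R (complex_of_real (exp (- v\<^sup>2 / 2) * tent m (t + v / m)) * \<phi> x (t + v / m)) \<partial>lborel)"
  proof -
    have "(m * (t - (t + 1 / m * v)))\<^sup>2 = v\<^sup>2" for v using m by simp
    then show ?thesis using m by simp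
  qed
  also have "\<dots> = (\<integral>v. complex_of_real (sqrt (2 * pi)) * (std_normal_density v *\<^sub>R (complex_of_real (tent m (t + v / m) / m) * \<phi> x (t + v / m))) \<partial>lborel)"
  proof (rule Bochner_Integration.integral_cong[OF refl])
    fix v
    have "sqrt (2 * pi) * (std_normal_density v * (tent m (t + v / m) / m)) = 1 / m * (exp (- v\<^sup>2 / 2) * tent m (t + v / m))"
      unfolding std_normal_density_def by simp
    then have "complex_of_real (sqrt (2 * pi) * (std_normal_density v * (tent m (t + v / m) / m))) * \<phi> x (t + v / m)
       = complex_of_real (1 / m * (exp (- v\<^sup>2 / 2) * tent m (t + v / m))) * \<phi> x (t + v / m)"
      by (simp only:)
    then show "(1 / m) *\<^sub>R (complex_of_real (exp (- v\<^sup>2 / 2) * tent m (t + v / m)) * \<phi> x (t + v / m))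
       = complex_of_real (sqrt (2 * pi)) * (std_normal_density v *\<^sub>R (complex_of_real (tent m (t + v / m) / m) * \<phi> x (t + v / m)))"
      unfolding of_real_mult[of "sqrt (2 * pi)"] of_real_mult[of "std_normal_density v"] of_real_mult[of "1 / m"] scaleR_conv_of_real
      by (simp only: mult.assoc)
  qed
  also have "\<dots> = complex_of_real (sqrt (2 * pi)) * (\<integral>v. std_normal_density v *\<^sub>R (complex_of_real (tent m (t + v / m) / m) * \<phi> x (t + v / m)) \<partial>lborel)"
    by (rule integral_mult_right_zero)
  also have "(\<integral>v. std_normal_density v *\<^sub>R (complex_of_real (tent m (t + v / m) / m) * \<phi> x (t + v / m)) \<partial>lborel)
      = (\<integral>v. complex_of_real (tent m (t + v / m) / m) * \<phi> x (t + v / m) \<partial>N)"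
    unfolding N_def by (rule integral_density[symmetric]) auto
  finally show "(\<integral>z. iexp (t * (m * z)) * fejer m x (m * z) \<partial>N) =
      complex_of_real (sqrt (2 * pi)) * (\<integral>z. complex_of_real (tent m (t + z / m) / m) * \<phi> x (t + z / m) \<partial>N)" .
qed

lemma fejer_gauss_tendsto:
  "(\<lambda>n. \<integral>z. complex_of_real (tent (Suc n) (t + z / Suc n) / Suc n) * \<phi> x (t + z / Suc n) \<partial>std_normal_distribution)
     \<longlonglongrightarrow> \<phi> x t"
proof -
  interpret N: real_distribution std_normal_distribution by (rule real_dist_normal_dist)
  have inv0: "(\<lambda>n. 1 / real (Suc n)) \<longlonglongrightarrow> 0" using LIMSEQ_inverse_real_of_nat by (simp add: inverse_eq_divide)
  have t1: "tent (Suc n) u / Suc n = max 0 (1 - \<bar>u\<bar> * (1 / Suc n))" for n :: nat and u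
    by (simp add: tent_def max_divide_distrib_right diff_divide_distrib)
  have "(\<lambda>n. \<integral>z. complex_of_real (tent (Suc n) (t + z / Suc n) / Suc n) * \<phi> x (t + z / Suc n) \<partial>std_normal_distribution)
     \<longlonglongrightarrow> (\<integral>z. \<phi> x t \<partial>std_normal_distribution)"
  proof (rule integral_dominated_convergence[where w="\<lambda>_. (norm x)\<^sup>2"])
    show "AE z in std_normal_distribution. (\<lambda>n. complex_of_real (tent (Suc n) (t + z / Suc n) / Suc n) * \<phi> x (t + z / Suc n)) \<longlonglongrightarrow> \<phi> x t"
    proof (rule AE_I2)
      fix z
      have "(\<lambda>n. t + z * (1 / real (Suc n))) \<longlonglongrightarrow> t + z * 0" by (intro tendsto_intros inv0)
      then have l: "(\<lambda>n. t + z / real (Suc n)) \<longlonglongrightarrow> t" by simp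
      have "(\<lambda>n. \<phi> x (t + z / real (Suc n))) \<longlonglongrightarrow> \<phi> x t"
        by (rule continuous_on_tendsto_compose[OF phi_cont[of UNIV] l]) auto
      moreover have "(\<lambda>n. tent (Suc n) (t + z / Suc n) / Suc n) \<longlonglongrightarrow> max 0 (1 - \<bar>t\<bar> * 0)"
        unfolding t1 by (intro tendsto_intros l inv0)
      ultimately have "(\<lambda>n. complex_of_real (tent (Suc n) (t + z / Suc n) / Suc n) * \<phi> x (t + z / Suc n))
          \<longlonglongrightarrow> complex_of_real (max 0 (1 - \<bar>t\<bar> * 0)) * \<phi> x t" by (intro tendsto_intros)
      then show "(\<lambda>n. complex_of_real (tent (Suc n) (t + z / Suc n) / Suc n) * \<phi> x (t + z / Suc n)) \<longlonglongrightarrow> \<phi> x t"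
        by simp
    qed
    show "AE z in std_normal_distribution. norm (complex_of_real (tent (Suc n) (t + z / Suc n) / Suc n) * \<phi> x (t + z / Suc n)) \<le> (norm x)\<^sup>2" for n
    proof (rule AE_I2)
      fix z
      let ?u = "t + z / real (Suc n)"
      have "0 \<le> \<bar>?u\<bar> * (1 / real (Suc n))" by simp
      then have "\<bar>max 0 (1 - \<bar>?u\<bar> * (1 / real (Suc n)))\<bar> \<le> 1" by linarith
      then have "\<bar>max 0 (1 - \<bar>?u\<bar> * (1 / real (Suc n)))\<bar> * cmod (\<phi> x ?u) \<le> 1 * (norm x)\<^sup>2"
        by (intro mult_mono phi_bound) auto
      then show "norm (complex_of_real (tent (Suc n) ?u / Suc n) * \<phi> x ?u) \<le> (norm x)\<^sup>2"
        unfolding norm_mult norm_of_real t1 by simp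
    qed
  qed simp_all
  then show ?thesis using N.prob_space by simp
qed

text \<open>The products of \<open>fejer m x\<close> with a Gaussian are, after normalisation, probability densities.
  Their characteristic functions converge to \<open>\<phi> x\<close>, normalised, which is continuous.\<close>

theorem bochner:
  obtains M where "real_distribution M" "\<And>t. \<phi> x t = complex_of_real ((norm x)\<^sup>2) * char M t"
proof (cases "x = 0")
  case True
  then show ?thesis using that[OF real_dist_normal_dist] by (simp add: \<phi>_def)
next
  case False
  let ?N = "std_normal_distribution"
  interpret N: real_distribution ?N by (rule real_dist_normal_dist)
  define H where "H n t = (\<integral>z. complex_of_real (tent (Suc n) (t + z / Suc n) / Suc n) * \<phi> x (t + z / Suc n) \<partial>?N)" for n t
  have H: "(\<lambda>n. H n t) \<longlonglongrightarrow> \<phi> x t" for t unfolding H_def by (rule fejer_gauss_tendsto)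
  define p where "p n z = Re (fejer (Suc n) x (real (Suc n) * z))" for n z
  have p: "fejer (Suc n) x (real (Suc n) * z) = complex_of_real (p n z)" "p n z \<ge> 0" for n z
    using fejer_nonneg[of "Suc n" x "real (Suc n) * z"] by (auto simp: p_def less_eq_complex_def complex_eq_iff)
  have F: "integrable ?N (\<lambda>z. iexp (t * (real (Suc n) * z)) * complex_of_real (p n z))"
    "(\<integral>z. iexp (t * (real (Suc n) * z)) * complex_of_real (p n z) \<partial>?N) = complex_of_real (sqrt (2 * pi)) * H n t" for n t
    using fejer_gauss[of "real (Suc n)" t x] unfolding H_def p(1) by simp_all
  have pint: "integrable ?N (p n)" for n
    using F(1)[of 0 n] by (simp add: complex_of_real_integrable_eq)
  define c where "c n = (\<integral>z. p n z \<partial>?N)" for n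
  have c: "complex_of_real (c n) = complex_of_real (sqrt (2 * pi)) * H n 0" for n
    using F(2)[of 0 n] by (simp add: c_def)
  have "(\<lambda>n. Re (complex_of_real (sqrt (2 * pi)) * H n 0)) \<longlonglongrightarrow> Re (complex_of_real (sqrt (2 * pi)) * \<phi> x 0)"
    by (intro tendsto_intros H)
  then have "c \<longlonglongrightarrow> sqrt (2 * pi) * (norm x)\<^sup>2"
    unfolding c[symmetric] phi_zero by simp
  moreover have "0 < sqrt (2 * pi) * (norm x)\<^sup>2" using False by simp
  ultimately have "eventually (\<lambda>n. 0 < c n) sequentially" by (rule order_tendstoD(1))
  then obtain k where k: "\<And>n. n \<ge> k \<Longrightarrow> 0 < c n" by (auto simp: eventually_sequentially)
  define \<mu> where "\<mu> n = distr (density ?N (\<lambda>z. ennreal (p n z / c n))) borel (\<lambda>z. real (Suc n) * z)" for n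
  have \<mu>: "real_distribution (\<mu> n)" "char (\<mu> n) t = H n t / H n 0" if n: "n \<ge> k" for n t
  proof -
    have c0: "c n > 0" by (rule k[OF n])
    have pm [measurable]: "p n \<in> borel_measurable borel"
      using borel_measurable_integrable[OF pint[of n]] by simp
    have nn: "p n z / c n \<ge> 0" for z using p(2) c0 by simp
    have "(\<integral>\<^sup>+ z. ennreal (p n z / c n) \<partial>?N) = ennreal (\<integral>z. p n z / c n \<partial>?N)"
      using pint[of n] nn by (intro nn_integral_eq_integral) auto
    also have "\<dots> = 1" using c0 by (simp flip: c_def)
    finally have "prob_space (density ?N (\<lambda>z. ennreal (p n z / c n)))"
      by (intro prob_spaceI) (simp add: emeasure_density)
    then interpret D: prob_space "density ?N (\<lambda>z. ennreal (p n z / c n))" .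
    show "real_distribution (\<mu> n)" unfolding \<mu>_def by (rule D.real_distribution_distr) simp
    have "char (\<mu> n) t = (\<integral>z. iexp (t * (real (Suc n) * z)) \<partial>density ?N (\<lambda>z. ennreal (p n z / c n)))"
      unfolding char_def \<mu>_def by (subst integral_distr) auto
    also have "\<dots> = (\<integral>z. (p n z / c n) *\<^sub>R iexp (t * (real (Suc n) * z)) \<partial>?N)"
      using nn by (intro integral_density) auto
    also have "\<dots> = (\<integral>z. (iexp (t * (real (Suc n) * z)) * complex_of_real (p n z)) / complex_of_real (c n) \<partial>?N)"
      by (intro Bochner_Integration.integral_cong refl) (simp add: scaleR_conv_of_real)
    also have "\<dots> = (complex_of_real (sqrt (2 * pi)) * H n t) / complex_of_real (c n)"
      unfolding F(2)[symmetric] by (rule integral_divide_zero)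
    also have "\<dots> = H n t / H n 0" unfolding c by simp
    finally show "char (\<mu> n) t = H n t / H n 0" .
  qed
  define \<psi> where "\<psi> = (\<lambda>t. \<phi> x t / complex_of_real ((norm x)\<^sup>2))"
  have x0: "complex_of_real ((norm x)\<^sup>2) \<noteq> 0" using False by simp
  obtain M where M: "real_distribution M" "char M = \<psi>"
  proof (rule char_limit[of "\<lambda>n. \<mu> (n + k)" \<psi>])
    show "real_distribution (\<mu> (n + k))" for n by (rule \<mu>(1)) simp
    show "(\<lambda>n. char (\<mu> (n + k)) t) \<longlonglongrightarrow> \<psi> t" for t
    proof -
      have "(\<lambda>n. H (n + k) t / H (n + k) 0) \<longlonglongrightarrow> \<phi> x t / \<phi> x 0"
        using x0 by (intro tendsto_divide LIMSEQ_ignore_initial_segment H) (simp add: phi_zero)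
      then show ?thesis by (simp add: \<mu>(2) \<psi>_def phi_zero)
    qed
    have "isCont (\<phi> x) 0" using phi_cont[of UNIV x] by (simp add: continuous_on_eq_continuous_at)
    then show "isCont \<psi> 0" unfolding \<psi>_def using x0 by (intro continuous_intros) auto
  qed
  show ?thesis
  proof (rule that[OF M(1)])
    show "\<phi> x t = complex_of_real ((norm x)\<^sup>2) * char M t" for t using x0 by (simp add: M(2) \<psi>_def)
  qed
qed

end

text \<open>The densities \<open>g k\<close> are absorbed into the measures and their total masses into the weights.\<close>

lemma signed_fourier_density:
  fixes K :: "'k set"
  assumes K: "finite K" and M: "\<And>k. k \<in> K \<Longrightarrow> real_distribution (M k)"
    and g: "\<And>k. k \<in> K \<Longrightarrow> g k \<in> borel_measurable borel" "\<And>k l. k \<in> K \<Longrightarrow> 0 \<le> g k l" "\<And>k l. k \<in> K \<Longrightarrow> g k l \<le> b"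
    and zero: "\<And>t. (\<Sum>k\<in>K. complex_of_real (c k) * (\<integral>l. complex_of_real (g k l) * iexp (t * l) \<partial>M k)) = 0"
    and A: "A \<in> sets borel"
  shows "(\<Sum>k\<in>K. c k * (\<integral>l. g k l * indicator A l \<partial>M k)) = 0"
proof -
  define J where "J k = (\<integral>l. g k l \<partial>M k)" for k
  define N where "N k = (if J k > 0 then density (M k) (\<lambda>l. ennreal (g k l / J k)) else M k)" for k
  have key: "real_distribution (N k) \<and>
      (\<integral>l. complex_of_real (g k l) * iexp (t * l) \<partial>M k) = complex_of_real (J k) * char (N k) t \<and>
      (\<integral>l. g k l * indicator A l \<partial>M k) = J k * measure (N k) A" if k: "k \<in> K" for k t
  proof -
    interpret M: real_distribution "M k" by (rule M[OF k])
    note [measurable] = g(1)[OF k] A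
    have b0: "b \<ge> 0" using g(2)[OF k, of 0] g(3)[OF k, of 0] by linarith
    have int: "integrable (M k) (g k)"
      using g(2)[OF k] g(3)[OF k] by (intro M.integrable_const_bound[where B=b]) auto
    have J0: "J k \<ge> 0" unfolding J_def using g(2)[OF k] by (intro integral_nonneg_AE) auto
    show ?thesis
    proof (cases "J k > 0")
      case True
      have nn: "g k l / J k \<ge> 0" for l using g(2)[OF k] True by simp
      have "(\<integral>\<^sup>+ l. ennreal (g k l / J k) \<partial>M k) = ennreal (\<integral>l. g k l / J k \<partial>M k)"
        using int nn by (intro nn_integral_eq_integral) auto
      also have "\<dots> = 1" using True by (simp flip: J_def)
      finally have D: "prob_space (density (M k) (\<lambda>l. ennreal (g k l / J k)))"
        by (intro prob_spaceI) (simp add: emeasure_density)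
      have N: "N k = density (M k) (\<lambda>l. ennreal (g k l / J k))" using True by (simp add: N_def)
      interpret D: prob_space "N k" unfolding N by (rule D)
      have rd: "real_distribution (N k)"
        by (intro real_distribution.intro real_distribution_axioms.intro D.prob_space_axioms) (simp add: N)
      have "char (N k) t = (\<integral>l. (g k l / J k) *\<^sub>R iexp (t * l) \<partial>M k)"
        unfolding char_def N using nn by (intro integral_density) auto
      also have "\<dots> = (\<integral>l. complex_of_real (g k l) * iexp (t * l) / complex_of_real (J k) \<partial>M k)"
        by (intro Bochner_Integration.integral_cong refl) (simp add: scaleR_conv_of_real)
      also have "\<dots> = (\<integral>l. complex_of_real (g k l) * iexp (t * l) \<partial>M k) / complex_of_real (J k)"
        by (rule integral_divide_zero)
      finally have 1: "(\<integral>l. complex_of_real (g k l) * iexp (t * l) \<partial>M k) = complex_of_real (J k) * char (N k) t"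
        using True by simp
      have "measure (N k) A = (\<integral>l. indicator A l \<partial>N k)" using A by (simp add: N)
      also have "\<dots> = (\<integral>l. (g k l / J k) *\<^sub>R indicator A l \<partial>M k)"
        unfolding N using nn by (intro integral_density) auto
      also have "\<dots> = (\<integral>l. g k l * indicator A l / J k \<partial>M k)"
        by (intro Bochner_Integration.integral_cong refl) simp
      also have "\<dots> = (\<integral>l. g k l * indicator A l \<partial>M k) / J k" by (rule integral_divide_zero)
      finally have 2: "(\<integral>l. g k l * indicator A l \<partial>M k) = J k * measure (N k) A" using True by simp
      show ?thesis using rd 1 2 by blast
    next
      case False
      then have "J k = 0" using J0 by simp
      then have "AE l in M k. g k l = 0"
        using integral_nonneg_eq_0_iff_AE[OF int] g(2)[OF k] by (simp add: J_def)
      then have "(\<integral>l. complex_of_real (g k l) * iexp (t * l) \<partial>M k) = (\<integral>l. 0 \<partial>M k)"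
        "(\<integral>l. g k l * indicator A l \<partial>M k) = (\<integral>l. 0 \<partial>M k)"
        by (intro integral_cong_AE; force)+
      then show ?thesis using False M[OF k] \<open>J k = 0\<close> by (simp add: N_def)
    qed
  qed
  have "(\<Sum>k\<in>K. (c k * J k) * measure (N k) A) = 0"
  proof (rule signed_fourier_uniqueness[OF K _ _ A])
    show "real_distribution (N k)" if "k \<in> K" for k using key[OF that] by blast
    show "(\<Sum>k\<in>K. complex_of_real (c k * J k) * char (N k) t) = 0" for t
      using zero[of t] key[of _ t] by (simp add: mult.assoc)
  qed
  then show ?thesis using key[of _ 0] by (simp add: mult.assoc)
qed

lemma (in pvm) T_expectation:
  assumes f: "bounded_borel f"
  shows "cinner x (T f x) = (\<integral>l. f l \<partial>\<mu> x)"
proof -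
  interpret finite_measure "\<mu> x" by (rule finite_measure_\<mu>)
  have simple: "cinner x (S s x) = (\<integral>l. s l \<partial>\<mu> x)" if s: "simple_function borel s" for s
  proof -
    have v: "s -` {c} \<in> sets (\<mu> x)" for c by (simp add: sets_\<mu> simple_vimage[OF s])
    have "(\<integral>l. s l \<partial>\<mu> x) = (\<integral>l. (\<Sum>c\<in>range s. complex_of_real (indicator (s -` {c}) l) * c) \<partial>\<mu> x)"
    proof (rule Bochner_Integration.integral_cong[OF refl])
      fix l
      have "(\<Sum>c\<in>range s. complex_of_real (indicator (s -` {c}) l) * c) = (\<Sum>c\<in>range s. if c = s l then c else 0)"
        by (intro sum.cong refl) (auto simp: indicator_def)
      then show "s l = (\<Sum>c\<in>range s. complex_of_real (indicator (s -` {c}) l) * c)"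
        by (simp add: simple_finite[OF s])
    qed
    also have "\<dots> = (\<Sum>c\<in>range s. \<integral>l. complex_of_real (indicator (s -` {c}) l) * c \<partial>\<mu> x)"
    proof (rule Bochner_Integration.integral_sum)
      fix c
      have "integrable (\<mu> x) (indicator (s -` {c}) :: real \<Rightarrow> real)"
        using v by (intro integrable_real_indicator) (auto simp: emeasure_eq_measure)
      then show "integrable (\<mu> x) (\<lambda>l. complex_of_real (indicator (s -` {c}) l) * c)"
        by (intro integrable_mult_left) (simp only: complex_of_real_integrable_eq)
    qed
    also have "\<dots> = (\<Sum>c\<in>range s. complex_of_real (measure (\<mu> x) (s -` {c})) * c)"
      using v by (intro sum.cong refl)
        (simp add: integral_mult_left_zero integral_complex_of_real del: of_real_indicator of_real_mult)
    also have "\<dots> = (\<Sum>c\<in>range s. c * cinner x (E (s -` {c}) x))"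
      by (intro sum.cong refl) (simp add: measure_def emeasure_\<mu> simple_vimage[OF s] cinner_E)
    finally show ?thesis
      by (simp add: simple_spectral_integral_def cinner_sum_right cinner_scaleC_right)
  qed
  obtain C s where s: "\<And>n. simple_function borel (s n)" "C > 0" "\<And>n l. cmod (s n l) \<le> C"
    "\<And>l. (\<lambda>n. s n l) \<longlonglongrightarrow> f l" "\<And>l. cmod (f l) \<le> C"
    using simple_approximation[OF f] by metis
  have [measurable]: "f \<in> borel_measurable borel" "s n \<in> borel_measurable borel" for n
    using f simple_borel[OF s(1)] by (simp_all add: bounded_borel_def)
  have "(\<lambda>n. \<integral>l. s n l \<partial>\<mu> x) \<longlonglongrightarrow> (\<integral>l. f l \<partial>\<mu> x)"
    by (rule integral_dominated_convergence[where w="\<lambda>_. C"]) (auto simp: s(3,4))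
  moreover have "(\<lambda>n. cinner x (S (s n) x)) \<longlonglongrightarrow> cinner x (T f x)"
    by (intro tendsto_intros S_tendsto_T[OF f s(1,3,4)])
  ultimately show ?thesis unfolding simple[OF s(1)] using LIMSEQ_unique by blast
qed

text \<open>Polarisation with \<open>x + y\<close> and with \<open>x + \<i> y\<close>, where complex linearity enters.\<close>

lemma quadratic_form_ext:
  assumes add: "\<And>x y. A (x + y) = A x + A y" "\<And>x y. B (x + y) = B x + B y"
    and scale: "\<And>a x. A (a *\<^sub>C x) = a *\<^sub>C A x" "\<And>a x. B (a *\<^sub>C x) = a *\<^sub>C B x"
    and q: "\<And>x::'h::complex_hilbert_space. cinner x (A x) = cinner x (B x)"
  shows "A y = B y"
proof (rule cinner_ext)
  fix x
  have 1: "cinner x (A y) + cinner y (A x) = cinner x (B y) + cinner y (B x)"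
    using q[of "x + y"] q[of x] q[of y] by (simp add: add cinner_add_left cinner_add_right add.commute)
  have "\<i> * (cinner x (A y) - cinner y (A x)) = \<i> * (cinner x (B y) - cinner y (B x))"
    using q[of "x + \<i> *\<^sub>C y"] q[of x] q[of y]
    by (simp add: add scale cinner_add_left cinner_add_right cinner_scaleC_left cinner_scaleC_right algebra_simps)
  then have "cinner x (A y) - cinner y (A x) = cinner x (B y) - cinner y (B x)" by simp
  with 1 have "(cinner x (A y) + cinner y (A x)) + (cinner x (A y) - cinner y (A x)) =
    (cinner x (B y) + cinner y (B x)) + (cinner x (B y) - cinner y (B x))" by simp
  then show "cinner x (A y) = cinner x (B y)" by simp
qed

section \<open>The projection-valued measure of a unitary group\<close>

context unitary_group
begin

definition M :: "'h \<Rightarrow> real measure" where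
  "M x = (SOME M. real_distribution M \<and> (\<forall>t. \<phi> x t = complex_of_real ((norm x)\<^sup>2) * char M t))"

lemma M: "real_distribution (M x)" "\<phi> x t = complex_of_real ((norm x)\<^sup>2) * char (M x) t"
proof -
  have "\<exists>M. real_distribution M \<and> (\<forall>t. \<phi> x t = complex_of_real ((norm x)\<^sup>2) * char M t)"
    by (rule bochner[of x]) blast
  from someI_ex[OF this] show "real_distribution (M x)" "\<phi> x t = complex_of_real ((norm x)\<^sup>2) * char (M x) t"
    unfolding M_def by blast+
qed

definition m :: "'h \<Rightarrow> real set \<Rightarrow> real" where
  "m x B = (norm x)\<^sup>2 * measure (M x) B"

definition mi :: "'h \<Rightarrow> (real \<Rightarrow> complex) \<Rightarrow> complex" where
  "mi x f = complex_of_real ((norm x)\<^sup>2) * (\<integral>l. f l \<partial>M x)"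

lemma mi_iexp: "mi x (\<lambda>l. iexp (t * l)) = \<phi> x t"
  by (simp add: mi_def M(2) char_def)

text \<open>Every identity below between the measures \<open>M v\<close> is an instance of this lemma. Lists allow
  the finitely many terms to be written out. The bound 4 is that of \<open>\<bar>1 + w e\<^sup>i\<^sup>t\<^sup>l\<bar>\<^sup>2\<close> for
  \<open>\<bar>w\<bar> = 1\<close>.\<close>

lemma fourier_list_density:
  assumes g: "\<And>c g v. (c, g, v) \<in> set L \<Longrightarrow> g \<in> borel_measurable borel \<and> (\<forall>l. 0 \<le> g l \<and> g l \<le> 4)"
    and zero: "\<And>t. (\<Sum>(c, g, v)\<leftarrow>L. complex_of_real c * mi v (\<lambda>l. complex_of_real (g l) * iexp (t * l))) = 0"
    and A: "A \<in> sets borel"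
  shows "(\<Sum>(c, g, v)\<leftarrow>L. c * ((norm v)\<^sup>2 * (\<integral>l. g l * indicator A l \<partial>M v))) = 0"
proof -
  let ?c = "\<lambda>i. fst (L ! i)" and ?g = "\<lambda>i. fst (snd (L ! i))" and ?v = "\<lambda>i. snd (snd (L ! i))"
  have mem: "(?c i, ?g i, ?v i) \<in> set L" if "i \<in> {0..<length L}" for i
    using that by simp
  have "(\<Sum>i\<in>{0..<length L}. (?c i * (norm (?v i))\<^sup>2) * (\<integral>l. ?g i l * indicator A l \<partial>M (?v i))) = 0"
  proof (rule signed_fourier_density[where b=4])
    show "(\<Sum>i\<in>{0..<length L}. complex_of_real (?c i * (norm (?v i))\<^sup>2) * (\<integral>l. complex_of_real (?g i l) * iexp (t * l) \<partial>M (?v i))) = 0" for t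
      using zero[of t] by (simp add: sum_list_sum_nth split_def mi_def mult.assoc)
  qed (use g[OF mem] M(1) A in auto)
  then show ?thesis by (simp add: sum_list_sum_nth split_def mult.assoc)
qed

lemma fourier_list:
  assumes zero: "\<And>t. (\<Sum>(c, v)\<leftarrow>L. complex_of_real c * \<phi> v t) = 0"
    and A: "A \<in> sets borel"
  shows "(\<Sum>(c, v)\<leftarrow>L. c * m v A) = 0"
proof -
  let ?L = "map (\<lambda>(c, v). (c, (\<lambda>l::real. 1::real), v)) L"
  have "(\<Sum>(c, g, v)\<leftarrow>?L. c * ((norm v)\<^sup>2 * (\<integral>l. g l * indicator A l \<partial>M v))) = 0"
  proof (rule fourier_list_density[OF _ _ A])
    show "(\<Sum>(c, g, v)\<leftarrow>?L. complex_of_real c * mi v (\<lambda>l. complex_of_real (g l) * iexp (t * l))) = 0" for t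
      using zero[of t] mi_iexp[of _ t] by (simp add: comp_def split_def)
  qed auto
  moreover have "(\<integral>l. indicator A l \<partial>M v) = measure (M v) A" for v
  proof -
    interpret real_distribution "M v" by (rule M)
    show ?thesis using A by simp
  qed
  ultimately show ?thesis by (simp add: m_def comp_def split_def)
qed

lemma phi_expand:
  "\<phi> (x + y) t = \<phi> x t + \<phi> y t + cinner x (U t y) + cinner y (U t x)"
  "\<phi> (x - y) t = \<phi> x t + \<phi> y t - cinner x (U t y) - cinner y (U t x)"
proof -
  have "U t (x - y) = U t x - U t y" using U_plus[of t "x - y" y] by simp
  then show "\<phi> (x + y) t = \<phi> x t + \<phi> y t + cinner x (U t y) + cinner y (U t x)"
    "\<phi> (x - y) t = \<phi> x t + \<phi> y t - cinner x (U t y) - cinner y (U t x)"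
    by (simp_all add: \<phi>_def U_plus cinner_add_left cinner_add_right cinner_diff_left cinner_diff_right)
qed

text \<open>The polarised measures, which will be the real part of \<open>\<langle>x, E B y\<rangle>\<close>. Each algebraic property
  of \<open>\<beta>\<close> is a linear relation between values of \<open>m\<close>, and it holds because the same relation holds
  for the functions \<open>\<phi> v\<close>.\<close>

definition \<beta> :: "real set \<Rightarrow> 'h \<Rightarrow> 'h \<Rightarrow> real" where
  "\<beta> B x y = (m (x + y) B - m (x - y) B) / 4"

context
  fixes B :: "real set"
  assumes B: "B \<in> sets borel"
begin

lemma beta_add: "\<beta> B (x + x') y = \<beta> B x y + \<beta> B x' y"
proof -
  have "(\<Sum>(c, v)\<leftarrow>[(1, (x + x') + y), (-1, (x + x') - y), (-1, x + y), (1, x - y), (-1, x' + y), (1, x' - y)]. c * m v B) = 0"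
    by (rule fourier_list[OF _ B]) (simp add: phi_expand U_plus cinner_add_left cinner_add_right)
  then show ?thesis by (simp add: \<beta>_def field_simps)
qed

lemma beta_scaleR: "\<beta> B (r *\<^sub>R x) y = r * \<beta> B x y"
proof -
  have "(\<Sum>(c, v)\<leftarrow>[(1, r *\<^sub>R x + y), (-1, r *\<^sub>R x - y), (-r, x + y), (r, x - y)]. c * m v B) = 0"
    by (rule fourier_list[OF _ B])
      (simp add: phi_expand scaleR_scaleC U_scaleC cinner_scaleC_left cinner_scaleC_right algebra_simps)
  then show ?thesis by (simp add: \<beta>_def algebra_simps diff_divide_distrib)
qed

lemma beta_sym: "\<beta> B x y = \<beta> B y x"
proof -
  have "(\<Sum>(c, v)\<leftarrow>[(1, x - y), (-1, y - x)]. c * m v B) = 0"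
    by (rule fourier_list[OF _ B]) (simp add: phi_expand)
  then show ?thesis by (simp add: \<beta>_def add.commute)
qed

lemma beta_i: "\<beta> B x (\<i> *\<^sub>C y) = - \<beta> B (\<i> *\<^sub>C x) y"
proof -
  have "(\<Sum>(c, v)\<leftarrow>[(1, x + \<i> *\<^sub>C y), (-1, x - \<i> *\<^sub>C y), (1, \<i> *\<^sub>C x + y), (-1, \<i> *\<^sub>C x - y)]. c * m v B) = 0"
    by (rule fourier_list[OF _ B])
      (simp add: phi_expand U_scaleC cinner_scaleC_left cinner_scaleC_right algebra_simps)
  then show ?thesis by (simp add: \<beta>_def field_simps)
qed

lemma beta_U: "\<beta> B (U s x) (U s y) = \<beta> B x y"
proof -
  have comm: "U t (U s z) = U s (U t z)" for t z by (metis U_add add.commute)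
  have "(\<Sum>(c, v)\<leftarrow>[(1, U s x + U s y), (-1, U s x - U s y), (-1, x + y), (1, x - y)]. c * m v B) = 0"
    by (rule fourier_list[OF _ B]) (simp add: phi_expand comm U_cinner)
  then show ?thesis by (simp add: \<beta>_def)
qed

lemma beta_self: "\<beta> B x x = m x B"
proof -
  have "(\<Sum>(c, v)\<leftarrow>[(1, x + x), (-1, x - x), (-4, x)]. c * m v B) = 0"
    by (rule fourier_list[OF _ B]) (simp add: \<phi>_def U_plus cinner_add_left cinner_add_right)
  then show ?thesis by (simp add: \<beta>_def)
qed

lemma m_nonneg: "0 \<le> m x B" and m_le: "m x B \<le> (norm x)\<^sup>2"
proof -
  interpret real_distribution "M x" by (rule M)
  show "0 \<le> m x B" "m x B \<le> (norm x)\<^sup>2" by (auto simp: m_def mult_left_le)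
qed

lemma beta_bounded: "bounded_linear (\<lambda>x. \<beta> B x y)"
proof (rule bounded_linear_intro[where K="(1 + (norm y)\<^sup>2) / 2"])
  fix x
  have unit: "\<bar>\<beta> B u y\<bar> \<le> (1 + (norm y)\<^sup>2) / 2" if u: "norm u = 1" for u
  proof -
    have "(norm (u + y))\<^sup>2 + (norm (u - y))\<^sup>2 = 2 * (norm u)\<^sup>2 + 2 * (norm y)\<^sup>2"
      by (simp add: power2_norm_eq_inner inner_add_left inner_add_right inner_diff_left inner_diff_right inner_commute)
    moreover have "\<bar>m (u + y) B - m (u - y) B\<bar> \<le> (norm (u + y))\<^sup>2 + (norm (u - y))\<^sup>2"
      using m_nonneg[of "u + y"] m_nonneg[of "u - y"] m_le[of "u + y"] m_le[of "u - y"] by linarith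
    ultimately show ?thesis using u by (simp add: \<beta>_def)
  qed
  show "norm (\<beta> B x y) \<le> norm x * ((1 + (norm y)\<^sup>2) / 2)"
  proof (cases "x = 0")
    case True
    then show ?thesis using beta_scaleR[of 0 0 y] by simp
  next
    case False
    have "\<beta> B x y = norm x * \<beta> B ((1 / norm x) *\<^sub>R x) y"
      using False beta_scaleR[of "norm x" "(1 / norm x) *\<^sub>R x" y] by simp
    then show ?thesis using unit[of "(1 / norm x) *\<^sub>R x"] False by (simp add: abs_mult mult_left_mono)
  qed
qed (simp_all add: beta_add beta_scaleR)

end

definition proj_op :: "real set \<Rightarrow> 'h \<Rightarrow> 'h" where
  "proj_op = (\<lambda>B\<in>sets borel. \<lambda>y. THE z. \<forall>x. \<beta> B x y = inner x z)"

lemma proj_op: "B \<in> sets borel \<Longrightarrow> inner x (proj_op B y) = \<beta> B x y"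
proof -
  assume B: "B \<in> sets borel"
  obtain z where z: "\<And>x. \<beta> B x y = inner z x"
    using riesz_representation[OF beta_bounded[OF B]] by blast
  have "(THE z. \<forall>x. \<beta> B x y = inner x z) = z"
  proof (rule the_equality)
    show "\<forall>x. \<beta> B x y = inner x z" by (simp add: z inner_commute)
    show "w = z" if "\<forall>x. \<beta> B x y = inner x w" for w
      using that z by (metis inner_commute vector_eq_ldot)
  qed
  then show ?thesis using B z by (simp add: proj_op_def inner_commute)
qed

end

context unitary_group
begin

context
  fixes B :: "real set"
  assumes B: "B \<in> sets borel"
begin

lemma proj_op_add: "proj_op B (y + z) = proj_op B y + proj_op B z"
proof -
  have "inner x (proj_op B (y + z)) = inner x (proj_op B y + proj_op B z)" for x
    using beta_add[OF B, of y z x] by (simp add: inner_add_right proj_op[OF B] beta_sym[OF B, of x])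
  then show ?thesis by (metis vector_eq_ldot)
qed

lemma proj_op_i: "proj_op B (\<i> *\<^sub>C y) = \<i> *\<^sub>C proj_op B y"
proof -
  have "inner x (proj_op B (\<i> *\<^sub>C y)) = inner x (\<i> *\<^sub>C proj_op B y)" for x
    using inner_i_left[of x "proj_op B y"] by (simp add: proj_op[OF B] beta_i[OF B])
  then show ?thesis by (metis vector_eq_ldot)
qed

lemma proj_op_scaleR: "proj_op B (r *\<^sub>R y) = r *\<^sub>R proj_op B y"
proof -
  have "inner x (proj_op B (r *\<^sub>R y)) = inner x (r *\<^sub>R proj_op B y)" for x
    by (simp add: proj_op[OF B] beta_sym[OF B, of x] beta_scaleR[OF B])
  then show ?thesis by (metis vector_eq_ldot)
qed

lemma proj_op_scaleC: "proj_op B (a *\<^sub>C y) = a *\<^sub>C proj_op B y"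
  by (simp add: scaleC_eq[of a] proj_op_add proj_op_scaleR proj_op_i)

lemma proj_op_sym: "cinner (proj_op B x) y = cinner x (proj_op B y)"
proof -
  have "inner (proj_op B x) z = inner x (proj_op B z)" for z
    using beta_sym[OF B, of x z] by (simp add: inner_commute[of _ z] proj_op[OF B])
  then show ?thesis by (simp add: cinner_eq flip: proj_op_i)
qed

lemma proj_op_U: "proj_op B (U s y) = U s (proj_op B y)"
proof -
  have "inner x (proj_op B (U s y)) = inner x (U s (proj_op B y))" for x
  proof -
    have "U s (U (- s) x) = x" using U_add[of s "- s" x] by (simp add: U_zero)
    then have "\<beta> B x (U s y) = \<beta> B (U (- s) x) y" using beta_U[OF B, of s "U (- s) x" y] by simp
    moreover have "inner (U (- s) x) (proj_op B y) = inner x (U s (proj_op B y))"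
      using arg_cong[OF U_adjoint[of "- s" x "proj_op B y"], of Re] by (simp add: Re_cinner)
    ultimately show ?thesis by (simp add: proj_op[OF B])
  qed
  then show ?thesis by (metis vector_eq_ldot)
qed

lemma inner_proj_op_self: "inner x (proj_op B x) = m x B"
  by (simp add: proj_op[OF B] beta_self[OF B])

end

lemma M_integral_indicator: "B \<in> sets borel \<Longrightarrow> (norm x)\<^sup>2 * (\<integral>l. indicator B l \<partial>M x) = m x B"
proof -
  assume B: "B \<in> sets borel"
  interpret real_distribution "M x" by (rule M)
  show ?thesis using B by (simp add: m_def)
qed

text \<open>The vector \<open>y + w U\<^sub>t y\<close> has the measure \<open>\<bar>1 + w e\<^sup>i\<^sup>t\<^sup>l\<bar>\<^sup>2 d\<mu>\<^sub>y(l)\<close>. Comparing it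
  with the quadratic form of \<open>proj_op B\<close>, for two values of \<open>w\<close>, gives a complex identity.\<close>

lemma cinner_proj_op_U:
  assumes B: "B \<in> sets borel"
  shows "cinner y (proj_op B (U t y)) = mi y (\<lambda>l. complex_of_real (indicator B l) * iexp (t * l))"
proof -
  interpret My: real_distribution "M y" by (rule M)
  note [measurable] = B
  have int: "integrable (M y) (\<lambda>l. w * iexp (s * l))" for w s
    by (rule My.integrable_const_bound[where B="cmod w"]) (auto simp: norm_mult)
  have re: "Re (w * cinner y (proj_op B (U t y))) = Re (w * mi y (\<lambda>l. complex_of_real (indicator B l) * iexp (t * l)))"
    if w: "cmod w = 1" for w
  proof -
    have ww: "w * cnj w = 1" using w by (simp add: complex_norm_square[symmetric])
    define g where "g l = (cmod (1 + w * iexp (t * l)))\<^sup>2" for l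
    have gm [measurable]: "g \<in> borel_measurable borel" unfolding g_def by measurable
    have g_eq: "complex_of_real (g l) = 2 + w * iexp (t * l) + cnj w * iexp (- t * l)" for l
    proof -
      have e: "iexp (t * l) * iexp (- t * l) = 1" by (simp flip: exp_add)
      have c: "cnj (iexp (t * l)) = iexp (- t * l)" by (simp add: exp_cnj)
      have "complex_of_real (g l) = (1 + w * iexp (t * l)) * (1 + cnj w * iexp (- t * l))"
        unfolding g_def complex_norm_square complex_cnj_add complex_cnj_mult c by simp
      also have "\<dots> = 1 + w * iexp (t * l) + cnj w * iexp (- t * l) + (w * cnj w) * (iexp (t * l) * iexp (- t * l))"
        by (simp only: ring_distribs mult_1 mult_1_right mult_ac add_ac)
      finally show ?thesis unfolding ww e by simp
    qed
    have gb: "0 \<le> g l \<and> g l \<le> 4" for l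
    proof -
      have "cmod (1 + w * iexp (t * l)) \<le> cmod 1 + cmod (w * iexp (t * l))" by (rule norm_triangle_ineq)
      also have "\<dots> = 2" using w by (simp add: norm_mult)
      finally have "(cmod (1 + w * iexp (t * l)))\<^sup>2 \<le> 2\<^sup>2" by (intro power_mono) auto
      then show ?thesis by (simp add: g_def)
    qed
    let ?v = "y + w *\<^sub>C U t y"
    have "(\<Sum>(c, g, v)\<leftarrow>[(1, \<lambda>_. 1, ?v), (-1, g, y)]. c * ((norm v)\<^sup>2 * (\<integral>l. g l * indicator B l \<partial>M v))) = 0"
    proof (rule fourier_list_density[OF _ _ B])
      fix s
      have "mi y (\<lambda>l. complex_of_real (g l) * iexp (s * l))
        = mi y (\<lambda>l. 2 * iexp (s * l) + w * iexp ((s + t) * l) + cnj w * iexp ((s - t) * l))"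
      proof (rule arg_cong[of _ _ "mi y"], rule ext)
        fix l
        have "iexp (t * l) * iexp (s * l) = iexp ((s + t) * l)" "iexp (- t * l) * iexp (s * l) = iexp ((s - t) * l)"
          unfolding exp_add[symmetric] by (rule arg_cong[of _ _ exp]; simp add: algebra_simps)+
        then show "complex_of_real (g l) * iexp (s * l) = 2 * iexp (s * l) + w * iexp ((s + t) * l) + cnj w * iexp ((s - t) * l)"
          unfolding g_eq distrib_right mult.assoc by simp
      qed
      also have "\<dots> = 2 * mi y (\<lambda>l. iexp (s * l)) + w * mi y (\<lambda>l. iexp ((s + t) * l)) + cnj w * mi y (\<lambda>l. iexp ((s - t) * l))"
        unfolding mi_def using int[of 2 s] int[of w "s + t"] int[of "cnj w" "s - t"]
        by (simp only: Bochner_Integration.integral_add Bochner_Integration.integrable_add integral_mult_right_zero distrib_left mult.left_commute)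
      also have "\<dots> = \<phi> ?v s"
      proof -
        have st: "U s (U t y) = U (s + t) y" "cinner (U t y) (U s y) = cinner y (U (s - t) y)"
          by (simp_all add: U_add U_cinner_U)
        have "\<phi> (w *\<^sub>C U t y) s = (w * cnj w) * \<phi> y s"
          by (simp add: \<phi>_def U_scaleC cinner_scaleC_left cinner_scaleC_right U_cinner_U mult_ac flip: U_add)
        then show ?thesis
          unfolding mi_iexp phi_expand
          by (simp add: ww U_scaleC cinner_scaleC_left cinner_scaleC_right st) (simp add: \<phi>_def)
      qed
      finally show "(\<Sum>(c, g, v)\<leftarrow>[(1, \<lambda>_. 1, ?v), (-1, g, y)]. complex_of_real c * mi v (\<lambda>l. complex_of_real (g l) * iexp (s * l))) = 0"
        using mi_iexp[of ?v s] by simp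
    qed (use gb in auto)
    then have eq: "m ?v B = (norm y)\<^sup>2 * (\<integral>l. g l * indicator B l \<partial>M y)"
      using M_integral_indicator[OF B, of ?v] by simp
    have "m ?v B = inner ?v (proj_op B ?v)" by (simp add: inner_proj_op_self[OF B])
    also have "\<dots> = 2 * m y B + 2 * Re (w * cinner y (proj_op B (U t y)))"
    proof -
      have "cinner ?v (proj_op B ?v) = cinner y (proj_op B y) + (cnj w * w) * cinner (U t y) (proj_op B (U t y))
         + w * cinner y (proj_op B (U t y)) + cnj (w * cinner y (proj_op B (U t y)))"
        using cinner_commute[of "proj_op B (U t y)" y]
        by (simp add: proj_op_add[OF B] proj_op_scaleC[OF B] cinner_add_left cinner_add_right cinner_scaleC_left
            cinner_scaleC_right proj_op_sym[OF B] distrib_left add_ac)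
      moreover have "cinner (U t y) (proj_op B (U t y)) = cinner y (proj_op B y)"
        by (simp add: proj_op_U[OF B] U_cinner)
      moreover have "Re (cinner y (proj_op B y)) = m y B" by (simp add: Re_cinner inner_proj_op_self[OF B])
      ultimately show ?thesis using ww by (simp add: Re_cinner[symmetric] mult.commute)
    qed
    finally have 1: "m ?v B = 2 * m y B + 2 * Re (w * cinner y (proj_op B (U t y)))" .
    have intB: "integrable (M y) (\<lambda>l. u * (complex_of_real (indicator B l) * iexp (s * l)))" for u s
      by (rule My.integrable_const_bound[where B="cmod u"]) (auto simp: norm_mult indicator_def)
    have "(\<integral>l. g l * indicator B l \<partial>M y) = (\<integral>l. 2 * indicator B l + 2 * Re (w * (complex_of_real (indicator B l) * iexp (t * l))) \<partial>M y)"
    proof (rule Bochner_Integration.integral_cong[OF refl])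
      fix l
      have c: "cnj w * iexp (- t * l) = cnj (w * iexp (t * l))" by (simp add: exp_cnj)
      have "complex_of_real (g l) = 2 + w * iexp (t * l) + cnj (w * iexp (t * l))" unfolding g_eq c ..
      from arg_cong[OF this, of Re] have "g l = 2 + 2 * Re (w * iexp (t * l))" by simp
      then show "g l * indicator B l = 2 * indicator B l + 2 * Re (w * (complex_of_real (indicator B l) * iexp (t * l)))"
        by (simp add: indicator_def)
    qed
    also have "\<dots> = 2 * (\<integral>l. indicator B l \<partial>M y) + 2 * (\<integral>l. Re (w * (complex_of_real (indicator B l) * iexp (t * l))) \<partial>M y)"
    proof -
      have i1: "integrable (M y) (indicator B :: real \<Rightarrow> real)"
        by (intro integrable_real_indicator) (auto simp: My.emeasure_eq_measure)
      show ?thesis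
        unfolding integral_mult_right_zero[symmetric]
        by (intro Bochner_Integration.integral_add integrable_mult_right i1 integrable_Re intB)
    qed
    also have "(\<integral>l. Re (w * (complex_of_real (indicator B l) * iexp (t * l))) \<partial>M y)
       = Re (w * (\<integral>l. complex_of_real (indicator B l) * iexp (t * l) \<partial>M y))"
      using integral_Re[OF intB[of w t]] by (simp only: integral_mult_right_zero)
    finally have gB: "(\<integral>l. g l * indicator B l \<partial>M y) = 2 * (\<integral>l. indicator B l \<partial>M y)
        + 2 * Re (w * (\<integral>l. complex_of_real (indicator B l) * iexp (t * l) \<partial>M y))" .
    have "(norm y)\<^sup>2 * (\<integral>l. g l * indicator B l \<partial>M y) = 2 * m y B
        + 2 * ((norm y)\<^sup>2 * Re (w * (\<integral>l. complex_of_real (indicator B l) * iexp (t * l) \<partial>M y)))"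
      unfolding gB M_integral_indicator[OF B, symmetric] by (simp only: distrib_left mult.left_commute)
    moreover have "(norm y)\<^sup>2 * Re (w * z) = Re (w * (complex_of_real ((norm y)\<^sup>2) * z))" for z
      by (simp add: algebra_simps)
    ultimately show ?thesis using eq 1 unfolding mi_def by simp
  qed
  show ?thesis using re[of 1] re[of "- \<i>"] by (simp add: complex_eq_iff)
qed

text \<open>As functions of \<open>C\<close>, \<open>\<langle>x, E (B \<inter> C) y\<rangle>\<close> and \<open>\<langle>E B x, E C y\<rangle>\<close> are complex measures, and
  both have the Fourier transform \<open>t \<mapsto> \<langle>x, E B U\<^sub>t y\<rangle>\<close>.\<close>

theorem proj_op_Int:
  assumes B: "B \<in> sets borel" and C: "C \<in> sets borel"
  shows "proj_op (B \<inter> C) y = proj_op B (proj_op C y)"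
proof -
  note [measurable] = B C
  have "inner x (proj_op (B \<inter> C) y) = inner x (proj_op B (proj_op C y))" for x
  proof -
    let ?x = "proj_op B x" and ?i = "indicator B :: real \<Rightarrow> real"
    have "(\<Sum>(c, g, v)\<leftarrow>[(1, ?i, x + y), (-1, ?i, x - y), (-1, \<lambda>_. 1, ?x + y), (1, \<lambda>_. 1, ?x - y)].
        c * ((norm v)\<^sup>2 * (\<integral>l. g l * indicator C l \<partial>M v))) = 0"
    proof (rule fourier_list_density[OF _ _ C])
      fix t
      have d: "proj_op B (U t (x - y)) = proj_op B (U t x) - proj_op B (U t y)"
        using proj_op_add[OF B, of "U t (x - y)" "U t y"] U_plus[of t "x - y" y] by simp
      have "cinner (x + y) (proj_op B (U t (x + y))) - cinner (x - y) (proj_op B (U t (x - y)))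
          - \<phi> (?x + y) t + \<phi> (?x - y) t = 0"
        by (simp add: d phi_expand U_plus proj_op_add[OF B] proj_op_sym[OF B]
            proj_op_U[OF B, symmetric] cinner_add_left cinner_add_right cinner_diff_left cinner_diff_right)
      then show "(\<Sum>(c, g, v)\<leftarrow>[(1, ?i, x + y), (-1, ?i, x - y), (-1, \<lambda>_. 1, ?x + y), (1, \<lambda>_. 1, ?x - y)].
        complex_of_real c * mi v (\<lambda>l. complex_of_real (g l) * iexp (t * l))) = 0"
        unfolding cinner_proj_op_U[OF B] mi_iexp[symmetric] by (simp add: algebra_simps)
    qed (auto simp: indicator_def)
    moreover have "(norm v)\<^sup>2 * (\<integral>l. ?i l * indicator C l \<partial>M v) = m v (B \<inter> C)" for v
      using M_integral_indicator[of "B \<inter> C" v] by (simp add: indicator_inter_arith)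
    moreover have "(norm v)\<^sup>2 * (\<integral>l. 1 * indicator C l \<partial>M v) = m v C" for v
      using M_integral_indicator[OF C, of v] by simp
    ultimately have "\<beta> (B \<inter> C) x y = \<beta> C ?x y" by (simp add: \<beta>_def)
    then have "inner x (proj_op (B \<inter> C) y) = inner (proj_op B x) (proj_op C y)"
      using proj_op[OF C, of ?x y] proj_op[of "B \<inter> C" x y] by simp
    then show ?thesis using arg_cong[OF proj_op_sym[OF B, of x "proj_op C y"], of Re] by (simp add: Re_cinner)
  qed
  then show ?thesis by (metis vector_eq_ldot)
qed

lemma proj_op_norm: "B \<in> sets borel \<Longrightarrow> (norm (proj_op B x))\<^sup>2 = m x B"
proof -
  assume B: "B \<in> sets borel"
  have "inner (proj_op B x) (proj_op B x) = inner x (proj_op B x)"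
    using arg_cong[OF proj_op_sym[OF B, of x "proj_op B x"], of Re] proj_op_Int[OF B B, of x] by (simp add: Re_cinner)
  then show ?thesis by (simp add: power2_norm_eq_inner inner_proj_op_self[OF B])
qed

lemma proj_op_Un:
  assumes A: "A \<in> sets borel" and B: "B \<in> sets borel" and disj: "A \<inter> B = {}"
  shows "proj_op (A \<union> B) y = proj_op A y + proj_op B y"
proof -
  have m: "m v (A \<union> B) = m v A + m v B" for v
  proof -
    interpret real_distribution "M v" by (rule M)
    show ?thesis using A B disj by (simp add: m_def finite_measure_Union distrib_left)
  qed
  have "A \<union> B \<in> sets borel" using A B by simp
  then have "inner x (proj_op (A \<union> B) y) = inner x (proj_op A y + proj_op B y)" for x
    by (simp add: inner_add_right proj_op A B \<beta>_def m add_divide_distrib diff_divide_distrib)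
  then show ?thesis by (metis vector_eq_ldot)
qed

lemma proj_op_UNIV: "proj_op UNIV y = y"
proof -
  have "m v UNIV = (norm v)\<^sup>2" for v
  proof -
    interpret real_distribution "M v" by (rule M)
    show ?thesis using prob_space by (simp add: m_def)
  qed
  then have "inner x (proj_op UNIV y) = inner x y" for x
    by (simp add: proj_op \<beta>_def power2_norm_eq_inner inner_add_left inner_add_right
        inner_diff_left inner_diff_right inner_commute)
  then show ?thesis by (metis vector_eq_ldot)
qed

text \<open>For countable additivity, the squared norm of a remainder is the measure of a set, and these
  sets decrease to the empty set.\<close>

lemma pvm_proj_op: "pvm proj_op"
proof
  show "projection_valued_measure proj_op"
    unfolding projection_valued_measure_def
  proof (intro conjI ballI allI impI)
    show "proj_op \<in> extensional (sets borel)" by (simp add: proj_op_def)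
    show "proj_op UNIV x = x" for x by (rule proj_op_UNIV)
    show "orthogonal_projection (proj_op B)" if "B \<in> sets borel" for B
      using proj_op_add[OF that] proj_op_scaleC[OF that] proj_op_sym[OF that] proj_op_Int[OF that that]
      by (simp add: orthogonal_projection_def)
  next
    fix B :: "nat \<Rightarrow> real set" and x
    assume B: "range B \<subseteq> sets borel" "disjoint_family B"
    have Bs: "B n \<in> sets borel" for n using B by blast
    interpret real_distribution "M x" by (rule M)
    define P where "P n = (\<Union>i<n. B i)" for n
    define R where "R n = (\<Union>i. B i) - P n" for n
    have Ps: "P n \<in> sets borel" and Us: "(\<Union>i. B i) \<in> sets borel" for n
      using Bs by (auto simp: P_def)
    then have Rs: "R n \<in> sets borel" for n by (auto simp: R_def)
    have part: "(\<Sum>i<n. proj_op (B i) x) = proj_op (P n) x" for n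
    proof (induction n)
      case 0
      have "(norm (proj_op {} x))\<^sup>2 = 0" by (simp add: proj_op_norm m_def)
      then show ?case by (simp add: P_def)
    next
      case (Suc n)
      have "P (Suc n) = P n \<union> B n" by (auto simp: P_def less_Suc_eq)
      moreover have "B i \<inter> B n = {}" if "i < n" for i
        using disjoint_family_onD[OF B(2), of i n] that by simp
      then have "P n \<inter> B n = {}" by (auto simp: P_def)
      ultimately show ?case using Suc proj_op_Un[OF Ps Bs, of n n x] by simp
    qed
    have "(\<lambda>n. proj_op (R n) x) \<longlonglongrightarrow> 0"
    proof -
      have "(\<lambda>n. prob (R n)) \<longlonglongrightarrow> prob (\<Inter>n. R n)"
        using Rs by (intro finite_Lim_measure_decseq) (auto simp: decseq_def R_def P_def)
      moreover have "(\<Inter>n. R n) = {}" by (auto simp: R_def P_def)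
      ultimately have "(\<lambda>n. m x (R n)) \<longlonglongrightarrow> (norm x)\<^sup>2 * 0" unfolding m_def by (intro tendsto_intros) simp
      then have "(\<lambda>n. sqrt ((norm (proj_op (R n) x))\<^sup>2)) \<longlonglongrightarrow> sqrt 0"
        by (intro tendsto_real_sqrt) (simp add: proj_op_norm[OF Rs])
      then show ?thesis by (simp add: tendsto_norm_zero_iff)
    qed
    moreover have "proj_op (\<Union>i. B i) x - proj_op (P n) x = proj_op (R n) x" for n
    proof -
      have "(\<Union>i. B i) = P n \<union> R n" "P n \<inter> R n = {}" by (auto simp: R_def P_def)
      then show ?thesis using proj_op_Un[OF Ps Rs, of n n x] by simp
    qed
    ultimately have "(\<lambda>n. proj_op (\<Union>i. B i) x - (proj_op (\<Union>i. B i) x - proj_op (P n) x)) \<longlonglongrightarrow> proj_op (\<Union>i. B i) x - 0"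
      by (intro tendsto_diff tendsto_const) simp
    then show "(\<lambda>n. proj_op (B n) x) sums proj_op (\<Union> (range B)) x"
      unfolding sums_def part by simp
  qed
qed

lemma bounded_borel_iexp: "bounded_borel (\<lambda>l. iexp (t * l))"
  by (rule bounded_borelI[where C=1]) auto

theorem stone: "pvm.T proj_op (\<lambda>l. iexp (t * l)) x = U t x"
proof -
  interpret E: pvm proj_op by (rule pvm_proj_op)
  have "cinner v (E.T (\<lambda>l. iexp (t * l)) v) = cinner v (U t v)" for v
  proof -
    interpret real_distribution "M v" by (rule M)
    have "scalar_measure proj_op v = density (M v) (\<lambda>_. ennreal ((norm v)\<^sup>2))"
    proof (rule measure_eqI)
      fix A assume "A \<in> sets (scalar_measure proj_op v)"
      then have A: "A \<in> sets borel" by (simp add: E.sets_\<mu>)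
      then show "emeasure (scalar_measure proj_op v) A = emeasure (density (M v) (\<lambda>_. ennreal ((norm v)\<^sup>2))) A"
        by (simp add: E.emeasure_\<mu> proj_op_norm m_def emeasure_density_const emeasure_eq_measure ennreal_mult)
    qed (simp add: E.sets_\<mu>)
    then have "cinner v (E.T (\<lambda>l. iexp (t * l)) v) = (\<integral>l. iexp (t * l) \<partial>density (M v) (\<lambda>_. ennreal ((norm v)\<^sup>2)))"
      by (simp only: E.T_expectation[OF bounded_borel_iexp])
    also have "\<dots> = (\<integral>l. (norm v)\<^sup>2 *\<^sub>R iexp (t * l) \<partial>M v)"
      by (rule integral_density) auto
    also have "\<dots> = mi v (\<lambda>l. iexp (t * l))"
      unfolding mi_def scaleR_conv_of_real by (rule integral_mult_right_zero)
    finally show ?thesis using mi_iexp[of v t] by (simp add: \<phi>_def)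
  qed
  then show ?thesis
    by (rule quadratic_form_ext[where A="E.T (\<lambda>l. iexp (t * l))" and B="U t",
          OF E.T_add_right[OF bounded_borel_iexp] U_plus E.T_scaleC_right[OF bounded_borel_iexp] U_scaleC])
qed

end

text \<open>The function \<open>t \<mapsto> \<langle>x, T (e\<^sup>i\<^sup>t\<^sup>l) x\<rangle>\<close> is the Fourier transform of the scalar measure of \<open>x\<close>.
  It therefore determines the numbers \<open>\<langle>x, E B x\<rangle>\<close>, and by polarisation the projections.\<close>

lemma pvm_eqI_exp:
  assumes E: "pvm E" and F: "pvm F"
    and eq: "\<And>t x. pvm.T E (\<lambda>l. iexp (t * l)) x = pvm.T F (\<lambda>l. iexp (t * l)) x"
  shows "E = F"
proof
  fix B
  interpret E: pvm E by (rule E)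
  interpret F: pvm F by (rule F)
  show "E B = F B"
  proof (cases "B \<in> sets borel")
    case False
    then show ?thesis using E.pvm F.pvm by (simp add: projection_valued_measure_def extensional_def)
  next
    case B: True
    have bb: "bounded_borel (\<lambda>l. iexp (t * l))" for t
      by (rule bounded_borelI[where C=1]) auto
    have q: "cinner x (E B x) = cinner x (F B x)" for x
    proof (cases "x = 0")
      case False
      define N where "N G = density (scalar_measure G x) (\<lambda>_. ennreal (1 / (norm x)\<^sup>2))" for G
      have N: "real_distribution (N G) \<and> char (N G) t = cinner x (pvm.T G (\<lambda>l. iexp (t * l)) x) / complex_of_real ((norm x)\<^sup>2)
          \<and> measure (N G) B = (norm (G B x))\<^sup>2 / (norm x)\<^sup>2" if G: "pvm G" for G t
      proof -
        interpret G: pvm G by (rule G)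
        have em: "emeasure (N G) A = ennreal ((norm (G A x))\<^sup>2 / (norm x)\<^sup>2)" if A: "A \<in> sets borel" for A
        proof -
          have "emeasure (N G) A = ennreal (1 / (norm x)\<^sup>2) * ennreal ((norm (G A x))\<^sup>2)"
            using A by (simp add: N_def emeasure_density_const G.sets_\<mu> G.emeasure_\<mu>)
          also have "\<dots> = ennreal (1 / (norm x)\<^sup>2 * (norm (G A x))\<^sup>2)" by (rule ennreal_mult[symmetric]) auto
          finally show ?thesis by simp
        qed
        have "prob_space (N G)" using em[of UNIV] False by (intro prob_spaceI) (simp add: N_def)
        then have 1: "real_distribution (N G)"
          by (intro real_distribution.intro real_distribution_axioms.intro) (simp_all add: N_def G.sets_\<mu>)
        have "char (N G) t = (\<integral>l. (1 / (norm x)\<^sup>2) *\<^sub>R iexp (t * l) \<partial>scalar_measure G x)"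
          unfolding char_def N_def by (rule integral_density) auto
        also have "\<dots> = (1 / (norm x)\<^sup>2) *\<^sub>R cinner x (G.T (\<lambda>l. iexp (t * l)) x)"
          by (simp only: integral_scaleR_right G.T_expectation[OF bb])
        finally have 2: "char (N G) t = cinner x (G.T (\<lambda>l. iexp (t * l)) x) / complex_of_real ((norm x)\<^sup>2)"
          by (simp add: scaleR_conv_of_real)
        have 3: "measure (N G) B = (norm (G B x))\<^sup>2 / (norm x)\<^sup>2"
          unfolding measure_def em[OF B] by simp
        from 1 2 3 show ?thesis by blast
      qed
      have "char (N E) = char (N F)" using N[OF E] N[OF F] eq by (intro ext) simp
      then have "N E = N F" using N[OF E] N[OF F] by (intro Levy_uniqueness) blast+
      then have "(norm (E B x))\<^sup>2 / (norm x)\<^sup>2 = (norm (F B x))\<^sup>2 / (norm x)\<^sup>2" using N[OF E] N[OF F] by metis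
      then show ?thesis using False by (simp add: E.cinner_E[OF B] F.cinner_E[OF B])
    qed simp
    show ?thesis
      by (rule ext, rule quadratic_form_ext[where A="E B" and B="F B", OF E.E_add[OF B] F.E_add[OF B] E.E_scaleC[OF B] F.E_scaleC[OF B] q])
  qed
qed

lemma (in pvm) Int_op_inverse:
  assumes f: "f \<in> borel_measurable borel" and B: "B \<in> sets borel" "\<And>x. E B x = x"
    and nz: "\<And>l. l \<in> B \<Longrightarrow> f l \<noteq> 0"
  shows "(x, y) \<in> Int_op f \<longleftrightarrow> (y, x) \<in> Int_op (\<lambda>l. 1 / f l)"
proof -
  have g: "(\<lambda>l. 1 / f l) \<in> borel_measurable borel" using f by measurable
  have "Int_op (\<lambda>l. 1 / f l * f l) = Int_op (\<lambda>_. 1)" "Int_op (\<lambda>l. f l * (1 / f l)) = Int_op (\<lambda>_. 1)"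
    using f nz by (intro Int_op_AE[OF _ _ B]; measurable; simp)+
  then have "(z, z) \<in> Int_op (\<lambda>l. 1 / f l * f l)" "(z, z) \<in> Int_op (\<lambda>l. f l * (1 / f l))" for z
    by (simp_all add: Int_op_const)
  then show ?thesis using Int_op_comp[OF f g, of x y x] Int_op_comp[OF g f, of y x y] by blast
qed

section \<open>The spectral theorem for bounded operators\<close>

text \<open>Differentiation shifts the coefficients. The growth condition on \<open>c\<close> makes the series of
  derivatives converge uniformly on bounded intervals.\<close>

lemma exp_series_derivative:
  fixes c :: "nat \<Rightarrow> 'a::banach"
  assumes c: "\<And>n. norm (c n) \<le> A * K ^ n" and K: "K \<ge> 0"
  shows "(\<lambda>n. (t ^ n / fact n) *\<^sub>R c n) sums (\<Sum>n. (t ^ n / fact n) *\<^sub>R c n)"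
    and "((\<lambda>t. \<Sum>n. (t ^ n / fact n) *\<^sub>R c n) has_vector_derivative (\<Sum>n. (t ^ n / fact n) *\<^sub>R c (Suc n))) (at t)"
proof -
  have summ: "summable (\<lambda>n. (t ^ n / fact n) *\<^sub>R d n)" and
    normsum: "summable (\<lambda>n. B * (r * K) ^ n / fact n)"
    if d: "\<And>n. norm (d n) \<le> B * K ^ n" for d :: "nat \<Rightarrow> 'a" and B t r
  proof -
    have s: "summable (\<lambda>n. B * ((r * K) ^ n / fact n))" for r
      using summable_mult[OF summable_exp[of "r * K"], of B] by (simp add: field_simps)
    then show "summable (\<lambda>n. B * (r * K) ^ n / fact n)" by simp
    show "summable (\<lambda>n. (t ^ n / fact n) *\<^sub>R d n)"
    proof (rule summable_comparison_test'[OF s[of "\<bar>t\<bar>"]])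
      fix n
      have "norm ((t ^ n / fact n) *\<^sub>R d n) = \<bar>t\<bar> ^ n / fact n * norm (d n)" by (simp add: power_abs)
      also have "\<dots> \<le> \<bar>t\<bar> ^ n / fact n * (B * K ^ n)" by (intro mult_left_mono d) auto
      finally show "norm ((t ^ n / fact n) *\<^sub>R d n) \<le> B * ((\<bar>t\<bar> * K) ^ n / fact n)"
        by (simp add: power_mult_distrib mult_ac)
    qed
  qed
  show "(\<lambda>n. (t ^ n / fact n) *\<^sub>R c n) sums (\<Sum>n. (t ^ n / fact n) *\<^sub>R c n)"
    by (rule summable_sums[OF summ[OF c]])
  have c': "norm (c (Suc n)) \<le> (A * K) * K ^ n" for n using c[of "Suc n"] by (simp add: mult_ac)
  define r where "r = \<bar>t\<bar> + 1"
  define S where "S = {-r<..<r}"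
  define g where "g t = (\<Sum>n. (t ^ n / fact n) *\<^sub>R c (Suc n))" for t :: real
  define f' where "f' n t = (case n of 0 \<Rightarrow> 0 | Suc k \<Rightarrow> (t ^ k / fact k) *\<^sub>R c (Suc k))" for n and t :: real
  have der: "((\<lambda>t. (t ^ n / fact n) *\<^sub>R c n) has_derivative (\<lambda>h. h *\<^sub>R f' n s)) (at s within S)" for n s
  proof (cases n)
    case (Suc k)
    have d: "((\<lambda>t. t ^ Suc k / fact (Suc k)) has_real_derivative (s ^ k / fact k)) (at s within S)"
    proof -
      have "((\<lambda>t. t ^ Suc k / fact (Suc k)) has_real_derivative (real (Suc k) * s ^ k / fact (Suc k))) (at s within S)"
        using DERIV_cdivide[OF DERIV_pow[of "Suc k" s S], of "fact (Suc k)"] by simp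
      moreover have "real (Suc k) * s ^ k / fact (Suc k) = s ^ k / fact k"
        by (simp add: fact_Suc del: of_nat_Suc)
      ultimately show ?thesis by simp
    qed
    have "(\<lambda>h. (s ^ k / fact k * h) *\<^sub>R c (Suc k)) = (\<lambda>h. h *\<^sub>R f' n s)"
      by (rule ext) (simp add: f'_def Suc mult.commute)
    then show ?thesis
      using has_derivative_scaleR_left[OF d[unfolded has_field_derivative_def], of "c (Suc k)"] Suc by simp
  qed (simp add: f'_def)
  have unif: "uniform_limit S (\<lambda>n s. \<Sum>i<n. (s ^ i / fact i) *\<^sub>R c (Suc i)) g sequentially"
    unfolding g_def
  proof (rule Weierstrass_m_test[OF _ normsum[OF c', of r]])
    fix n s assume "s \<in> S"
    then have s: "\<bar>s\<bar> \<le> r" by (auto simp: S_def)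
    have "norm ((s ^ n / fact n) *\<^sub>R c (Suc n)) = \<bar>s\<bar> ^ n / fact n * norm (c (Suc n))" by (simp add: power_abs)
    also have "\<dots> \<le> r ^ n / fact n * ((A * K) * K ^ n)"
      using s by (intro mult_mono c' divide_right_mono power_mono) auto
    finally show "norm ((s ^ n / fact n) *\<^sub>R c (Suc n)) \<le> (A * K) * (r * K) ^ n / fact n"
      by (simp add: power_mult_distrib mult_ac)
  qed
  have conv: "\<forall>\<^sub>F n in sequentially. \<forall>s\<in>S. \<forall>h. norm ((\<Sum>i<n. h *\<^sub>R f' i s) - h *\<^sub>R g s) \<le> e * norm h" if e: "e > 0" for e
  proof -
    have "\<forall>\<^sub>F n in sequentially. \<forall>s\<in>S. dist (\<Sum>i<n. (s ^ i / fact i) *\<^sub>R c (Suc i)) (g s) < e"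
      using uniform_limitD[OF unif e] .
    then obtain N where N: "\<And>n. N \<le> n \<Longrightarrow> \<forall>s\<in>S. dist (\<Sum>i<n. (s ^ i / fact i) *\<^sub>R c (Suc i)) (g s) < e"
      unfolding eventually_sequentially by blast
    have "\<forall>\<^sub>F n in sequentially. \<forall>s\<in>S. dist (\<Sum>i<n - 1. (s ^ i / fact i) *\<^sub>R c (Suc i)) (g s) < e"
      by (rule eventually_sequentiallyI[of "Suc N"], rule N) simp
    moreover have "\<forall>\<^sub>F n in sequentially. n \<ge> (1::nat)" by (rule eventually_ge_at_top)
    ultimately show ?thesis
    proof eventually_elim
      case (elim n)
      then obtain k where n: "n = Suc k" by (cases n) auto
      show ?case
      proof (intro ballI allI)
        fix s h assume s: "s \<in> S"
        have "(\<Sum>i<n. h *\<^sub>R f' i s) - h *\<^sub>R g s = h *\<^sub>R ((\<Sum>i<k. (s ^ i / fact i) *\<^sub>R c (Suc i)) - g s)"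
          unfolding n sum.lessThan_Suc_shift by (simp add: f'_def scaleR_sum_right scaleR_diff_right)
        moreover have "norm ((\<Sum>i<k. (s ^ i / fact i) *\<^sub>R c (Suc i)) - g s) \<le> e"
          using elim(1) s n by (auto simp: dist_norm intro: less_imp_le)
        ultimately show "norm ((\<Sum>i<n. h *\<^sub>R f' i s) - h *\<^sub>R g s) \<le> e * norm h"
          by (simp add: mult.commute[of e] mult_left_mono)
      qed
    qed
  qed
  have "\<exists>F. \<forall>s\<in>S. (\<lambda>n. (s ^ n / fact n) *\<^sub>R c n) sums F s \<and> (F has_derivative (\<lambda>h. h *\<^sub>R g s)) (at s within S)"
  proof (rule has_derivative_series[where x=0])
    show "convex S" by (simp add: S_def)
    have "r > 0" unfolding r_def by linarith
    then show "0 \<in> S" by (simp add: S_def)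
    show "(\<lambda>n. (0 ^ n / fact n) *\<^sub>R c n) sums (\<Sum>n. (0 ^ n / fact n) *\<^sub>R c n)"
      by (rule summable_sums[OF summ[OF c]])
  qed (rule der conv; assumption?)+
  then obtain F where F: "\<And>s. s \<in> S \<Longrightarrow> (\<lambda>n. (s ^ n / fact n) *\<^sub>R c n) sums F s"
    "\<And>s. s \<in> S \<Longrightarrow> (F has_derivative (\<lambda>h. h *\<^sub>R g s)) (at s within S)" by blast
  have "\<bar>t\<bar> < r" by (simp add: r_def)
  then have t: "t \<in> S" "open S" by (auto simp: S_def)
  have "(F has_vector_derivative g t) (at t)"
    using F(2)[OF t(1)] at_within_open[OF t] by (simp add: has_vector_derivative_def)
  then show "((\<lambda>t. \<Sum>n. (t ^ n / fact n) *\<^sub>R c n) has_vector_derivative (\<Sum>n. (t ^ n / fact n) *\<^sub>R c (Suc n))) (at t)"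
    unfolding g_def[symmetric]
    by (rule has_vector_derivative_transform_within_open[OF _ t(2,1)]) (use F(1) sums_unique in blast)
qed

locale bounded_selfadjoint =
  fixes R :: "'h::complex_hilbert_space \<Rightarrow> 'h"
  assumes linear_R: "bounded_linear R"
    and R_scaleC: "R (a *\<^sub>C x) = a *\<^sub>C R x"
    and R_sym: "cinner (R x) y = cinner x (R y)"
begin

text \<open>\<open>e\<^sup>i\<^sup>t\<^sup>R\<close> as a power series.\<close>

definition V :: "real \<Rightarrow> 'h \<Rightarrow> 'h" where
  "V t x = (\<Sum>n. (t ^ n / fact n) *\<^sub>R (\<i> ^ n *\<^sub>C (R ^^ n) x))"

lemma R_add: "R (x + y) = R x + R y"
  by (rule linear_add[OF bounded_linear.linear[OF linear_R]])

lemma coeff_bound: "\<exists>A K. K \<ge> 0 \<and> (\<forall>n. norm (\<i> ^ n *\<^sub>C (R ^^ n) x) \<le> A * K ^ n)"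
proof -
  obtain K where K: "K \<ge> 0" "\<And>x. norm (R x) \<le> norm x * K"
    using bounded_linear.nonneg_bounded[OF linear_R] by blast
  have "norm ((R ^^ n) x) \<le> norm x * K ^ n" for n
  proof (induction n)
    case (Suc n)
    have "norm ((R ^^ Suc n) x) \<le> norm ((R ^^ n) x) * K" using K(2) by simp
    also have "\<dots> \<le> (norm x * K ^ n) * K" using Suc K(1) by (rule mult_right_mono)
    finally show ?case by (simp add: mult_ac)
  qed simp
  then show ?thesis using K(1) by (intro exI[of _ "norm x"] exI[of _ K]) (simp add: norm_scaleC norm_power)
qed

lemma V_sums: "(\<lambda>n. (t ^ n / fact n) *\<^sub>R (\<i> ^ n *\<^sub>C (R ^^ n) x)) sums V t x"
proof -
  obtain A K where K: "K \<ge> 0" "\<And>n. norm (\<i> ^ n *\<^sub>C (R ^^ n) x) \<le> A * K ^ n"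
    using coeff_bound by blast
  show ?thesis unfolding V_def by (rule exp_series_derivative(1)[OF K(2,1)])
qed

lemma V_deriv: "((\<lambda>t. V t x) has_vector_derivative \<i> *\<^sub>C R (V t x)) (at t)"
proof -
  obtain A K where K: "K \<ge> 0" "\<And>n. norm (\<i> ^ n *\<^sub>C (R ^^ n) x) \<le> A * K ^ n"
    using coeff_bound by blast
  have lin: "bounded_linear (\<lambda>y. \<i> *\<^sub>C R y)"
    using bounded_linear_compose[OF bounded_linear_scaleC[of \<i>] linear_R] .
  have "(\<lambda>n. \<i> *\<^sub>C R ((t ^ n / fact n) *\<^sub>R (\<i> ^ n *\<^sub>C (R ^^ n) x))) sums (\<i> *\<^sub>C R (V t x))"
    by (rule bounded_linear.sums[OF lin V_sums])
  moreover have "\<i> *\<^sub>C R ((t ^ n / fact n) *\<^sub>R (\<i> ^ n *\<^sub>C (R ^^ n) x)) =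
      (t ^ n / fact n) *\<^sub>R (\<i> ^ Suc n *\<^sub>C (R ^^ Suc n) x)" for n
    by (simp only: scaleR_scaleC R_scaleC scaleC_scaleC power_Suc funpow.simps comp_apply mult_ac)
  ultimately have "(\<Sum>n. (t ^ n / fact n) *\<^sub>R (\<i> ^ Suc n *\<^sub>C (R ^^ Suc n) x)) = \<i> *\<^sub>C R (V t x)"
    by (simp only: sums_iff)
  then show ?thesis using exp_series_derivative(2)[OF K(2,1), of t] unfolding V_def by simp
qed

lemma V_zero: "V 0 x = x"
proof -
  have "(\<lambda>n. (0 ^ n / fact n) *\<^sub>R (\<i> ^ n *\<^sub>C (R ^^ n) x)) sums (\<Sum>n\<in>{0}. (0 ^ n / fact n) *\<^sub>R (\<i> ^ n *\<^sub>C (R ^^ n) x))"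
    by (rule sums_finite) auto
  from sums_unique2[OF V_sums[of 0 x] this] show ?thesis by simp
qed

text \<open>Solutions of \<open>w' = i R w\<close> have constant norm, because \<open>R\<close> is symmetric.\<close>

lemma norm_const:
  assumes w: "\<And>t. (w has_vector_derivative \<i> *\<^sub>C R (w t)) (at t)"
  shows "norm (w t) = norm (w 0)"
proof -
  have orth: "inner y (\<i> *\<^sub>C R y) = 0" for y
  proof -
    have "inner y (\<i> *\<^sub>C R y) = - inner (\<i> *\<^sub>C y) (R y)" by (simp add: inner_i_left)
    also have "inner (\<i> *\<^sub>C y) (R y) = inner (\<i> *\<^sub>C R y) y"
      using arg_cong[OF R_sym[of "\<i> *\<^sub>C y" y], of Re] by (simp add: Re_cinner R_scaleC)
    finally show ?thesis by (simp add: inner_commute)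
  qed
  have "((\<lambda>t. inner (w t) (w t)) has_vector_derivative 0) (at t within UNIV)" for t
  proof -
    have "((\<lambda>t. inner (w t) (w t)) has_derivative (\<lambda>h. inner (w t) (h *\<^sub>R (\<i> *\<^sub>C R (w t))) + inner (h *\<^sub>R (\<i> *\<^sub>C R (w t))) (w t))) (at t)"
      using w[of t] unfolding has_vector_derivative_def by (rule has_derivative_inner[OF _ _]) (rule w[unfolded has_vector_derivative_def])
    moreover have "(\<lambda>h. inner (w t) (h *\<^sub>R (\<i> *\<^sub>C R (w t))) + inner (h *\<^sub>R (\<i> *\<^sub>C R (w t))) (w t)) = (\<lambda>h. h *\<^sub>R 0)"
      by (rule ext) (simp add: orth inner_commute[of _ "w t"])
    ultimately show ?thesis unfolding has_vector_derivative_def by simp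
  qed
  then obtain c where "\<And>t. inner (w t) (w t) = c"
    using has_vector_derivative_zero_constant[of UNIV "\<lambda>t. inner (w t) (w t)"] by auto
  then have "inner (w t) (w t) = inner (w 0) (w 0)" by simp
  then show ?thesis by (simp add: norm_eq_sqrt_inner)
qed

lemma solution_eqI:
  assumes u: "\<And>t. (u has_vector_derivative \<i> *\<^sub>C R (u t)) (at t)"
    and v: "\<And>t. (v has_vector_derivative \<i> *\<^sub>C R (v t)) (at t)" and "u 0 = v 0"
  shows "u t = v t"
proof -
  have "((\<lambda>t. u t - v t) has_vector_derivative \<i> *\<^sub>C R (u t - v t)) (at t)" for t
    using has_vector_derivative_diff[OF u v]
    by (simp add: linear_diff[OF bounded_linear.linear[OF linear_R]] scaleC_diff_right)
  from norm_const[OF this, of t] show ?thesis using assms(3) by simp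
qed

lemma V_group: "V (s + t) x = V s (V t x)"
proof (rule solution_eqI[of "\<lambda>s. V (s + t) x" "\<lambda>s. V s (V t x)"])
  show "((\<lambda>s. V (s + t) x) has_vector_derivative \<i> *\<^sub>C R (V (s + t) x)) (at s)" for s
  proof -
    have "((\<lambda>s. s + t) has_vector_derivative 1) (at s)" by (auto intro!: derivative_eq_intros)
    from vector_diff_chain_at[OF this V_deriv] show ?thesis by (simp add: comp_def)
  qed
qed (simp_all add: V_deriv V_zero)

lemma V_add: "V t (x + y) = V t x + V t y"
proof (rule solution_eqI[of "\<lambda>t. V t (x + y)" "\<lambda>t. V t x + V t y"])
  show "((\<lambda>t. V t x + V t y) has_vector_derivative \<i> *\<^sub>C R (V t x + V t y)) (at t)" for t
    using has_vector_derivative_add[OF V_deriv V_deriv] by (simp add: R_add scaleC_add_right)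
qed (simp_all add: V_deriv V_zero)

lemma V_scaleC: "V t (a *\<^sub>C x) = a *\<^sub>C V t x"
proof (rule solution_eqI[of "\<lambda>t. V t (a *\<^sub>C x)" "\<lambda>t. a *\<^sub>C V t x"])
  show "((\<lambda>t. a *\<^sub>C V t x) has_vector_derivative \<i> *\<^sub>C R (a *\<^sub>C V t x)) (at t)" for t
    using bounded_linear.has_vector_derivative[OF bounded_linear_scaleC V_deriv, of a x t]
    by (simp add: R_scaleC scaleC_scaleC mult.commute)
qed (simp_all add: V_deriv V_zero)

lemma norm_V: "norm (V t x) = norm x"
  using norm_const[of "\<lambda>t. V t x", OF V_deriv] by (simp add: V_zero)

end

text \<open>Real polarisation recovers the real part of the inner product from the norm, and the
  behaviour on multiples of \<open>\<i>\<close> its imaginary part. The sign in \<open>c\<close> separates unitary from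
  antiunitary operators.\<close>

lemma isometry_cinner:
  assumes add: "\<And>x y. W (x + y) = W x + W y" and scale: "\<And>x. W (\<i> *\<^sub>C x) = c *\<^sub>C W x"
    and norm: "\<And>x. norm (W x) = norm x"
  shows "c = \<i> \<Longrightarrow> cinner (W x) (W y) = cinner x y"
    and "c = - \<i> \<Longrightarrow> cinner (W x) (W y) = cnj (cinner x y)"
proof -
  have i: "inner (W x) (W y) = inner x y" for x y
  proof -
    have "(norm (W (x + y)))\<^sup>2 = (norm (x + y))\<^sup>2" "(norm (W x))\<^sup>2 = (norm x)\<^sup>2" "(norm (W y))\<^sup>2 = (norm y)\<^sup>2"
      by (simp_all only: norm)
    then show ?thesis
      by (simp add: add power2_norm_eq_inner inner_add_left inner_add_right inner_commute)
  qed
  show "c = \<i> \<Longrightarrow> cinner (W x) (W y) = cinner x y"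
    using i[of x "\<i> *\<^sub>C y"] by (simp add: cinner_eq i scale)
  assume c: "c = - \<i>"
  have "- inner (W x) (\<i> *\<^sub>C W y) = inner x (\<i> *\<^sub>C y)"
    using i[of x "\<i> *\<^sub>C y"] unfolding scale c scaleC_minus_left by simp
  then show "cinner (W x) (W y) = cnj (cinner x y)"
    by (simp add: cinner_eq i complex_eq_iff)
qed

context bounded_selfadjoint
begin

lemma unitary_group_V: "unitary_group V"
proof
  show "unitary (V t)" for t
    unfolding unitary_def
  proof (intro conjI allI)
    have "x = V t (V (- t) x)" for x using V_group[of t "- t" x] by (simp add: V_zero)
    then show "surj (V t)" by (metis surjI)
    show "cinner (V t x) (V t y) = cinner x y" for x y
      by (rule isometry_cinner(1)[OF V_add V_scaleC norm_V refl])
  qed (simp_all add: V_add V_scaleC)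
  show "continuous_on UNIV (\<lambda>t. V t x)" for x
    using has_vector_derivative_continuous[OF V_deriv] by (simp add: continuous_on_eq_continuous_at)
qed (simp_all add: V_group V_zero)

theorem spectral_theorem: "\<exists>E. pvm E \<and> (\<forall>x y. (x, y) \<in> spectral_integral E complex_of_real \<longleftrightarrow> y = R x)"
proof -
  interpret V: unitary_group V by (rule unitary_group_V)
  define E where "E = V.proj_op"
  interpret E: pvm E unfolding E_def by (rule V.pvm_proj_op)
  have TE: "E.T (\<lambda>l. iexp (t * l)) x = V t x" for t x unfolding E_def by (rule V.stone)
  have idm: "complex_of_real \<in> borel_measurable borel" by measurable
  define B where "B n = {- real n..real n}" for n
  have tr: "cmod (trunc (B n) complex_of_real l) \<le> real n" for n l
    by (auto simp: trunc_def B_def indicator_def)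
  have Bs: "B n \<in> sets borel" for n by (simp add: B_def)
  have tm: "trunc (B n) f \<in> borel_measurable borel" if "f \<in> borel_measurable borel" for n f
    unfolding trunc_def using that Bs by measurable
  have B: "exhausts B complex_of_real"
    unfolding exhausts_def
  proof (intro conjI allI)
    show "range B \<subseteq> sets borel" using Bs by blast
    show "incseq B" by (auto simp: B_def incseq_def)
    have "l \<in> (\<Union>n. B n)" for l
    proof -
      obtain n where "\<bar>l\<bar> \<le> real n" using real_arch_simple by blast
      then have "l \<in> B n" by (auto simp: B_def)
      then show ?thesis by blast
    qed
    then show "(\<Union>n. B n) = UNIV" by blast
    show "bounded_borel (trunc (B n) complex_of_real)" for n
      by (rule bounded_borelI[OF tm[OF idm] tr])
  qed
  have bb: "bounded_borel (\<lambda>l. iexp (t * l))" for t by (rule bounded_borelI[where C=1]) auto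
  have R: "(x, R x) \<in> E.Int_op complex_of_real" for x
  proof -
    \<comment> \<open>Both sides of the equality are the limit of the difference quotients of the group,
      compressed by \<open>E (B n)\<close>.\<close>
    have "E (B n) (R x) = E.T (trunc (B n) complex_of_real) x" for n
    proof -
      define q where "q k l = complex_of_real (real (Suc k)) * (iexp (1 / real (Suc k) * l) - 1)" for k :: nat and l :: real
      have qm: "q k \<in> borel_measurable borel" for k unfolding q_def by measurable
      have qb: "bounded_borel (q k)" for k
        unfolding q_def by (intro bounded_borel_intros bb)
      have qx: "E.T (q k) x = real (Suc k) *\<^sub>R (V (1 / real (Suc k)) x - x)" for k
        unfolding q_def
        by (simp only: E.T_scaleC[OF bounded_borel_diff[OF bb bounded_borel_const]] E.T_diff[OF bb bounded_borel_const]
            TE E.T_const scaleC_one scaleC_of_real)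
      have inv0: "(\<lambda>k. 1 / real (Suc k)) \<longlonglongrightarrow> 0" using LIMSEQ_inverse_real_of_nat by (simp add: inverse_eq_divide)
      have "(\<lambda>k. E.T (q k) x) \<longlonglongrightarrow> \<i> *\<^sub>C R x"
      proof -
        have "((\<lambda>h. norm (V (0 + h) x - V 0 x - h *\<^sub>R (\<i> *\<^sub>C R (V 0 x))) / norm h) \<longlongrightarrow> 0) (at 0)"
          using V_deriv[of x 0] unfolding has_vector_derivative_def has_derivative_at by blast
        moreover have "filterlim (\<lambda>k. 1 / real (Suc k)) (at 0) sequentially"
          using inv0 by (simp add: filterlim_at)
        ultimately have "(\<lambda>k. norm (V (0 + 1 / real (Suc k)) x - V 0 x - (1 / real (Suc k)) *\<^sub>R (\<i> *\<^sub>C R (V 0 x))) / norm (1 / real (Suc k))) \<longlonglongrightarrow> 0"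
          by (rule filterlim_compose)
        moreover have "norm (V (0 + 1 / real (Suc k)) x - V 0 x - (1 / real (Suc k)) *\<^sub>R (\<i> *\<^sub>C R (V 0 x))) / norm (1 / real (Suc k))
          = norm (E.T (q k) x - \<i> *\<^sub>C R x)" for k
        proof -
          have "E.T (q k) x - \<i> *\<^sub>C R x = real (Suc k) *\<^sub>R (V (1 / real (Suc k)) x - x - (1 / real (Suc k)) *\<^sub>R (\<i> *\<^sub>C R x))"
            unfolding qx by (simp add: scaleR_diff_right[of "real (Suc k)" _ "(1 / real (Suc k)) *\<^sub>R _"] del: of_nat_Suc)
          then have "norm (E.T (q k) x - \<i> *\<^sub>C R x) = real (Suc k) * norm (V (1 / real (Suc k)) x - x - (1 / real (Suc k)) *\<^sub>R (\<i> *\<^sub>C R x))"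
            by (simp only: norm_scaleR abs_of_nat)
          then show ?thesis by (simp add: V_zero mult.commute del: of_nat_Suc)
        qed
        ultimately have "(\<lambda>k. E.T (q k) x - \<i> *\<^sub>C R x) \<longlonglongrightarrow> 0" by (simp add: tendsto_norm_zero_iff)
        from tendsto_add[OF this tendsto_const[of "\<i> *\<^sub>C R x"]] show ?thesis by simp
      qed
      then have "(\<lambda>k. E (B n) (E.T (q k) x)) \<longlonglongrightarrow> E (B n) (\<i> *\<^sub>C R x)"
        by (rule bounded_linear.tendsto[OF E.bounded_linear_E[OF Bs]])
      then have 1: "(\<lambda>k. E.T (trunc (B n) (q k)) x) \<longlonglongrightarrow> \<i> *\<^sub>C E (B n) (R x)"
        by (simp add: E.T_trunc[OF Bs qb] E.E_scaleC[OF Bs])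
      have 2: "(\<lambda>k. E.T (trunc (B n) (q k)) x) \<longlonglongrightarrow> E.T (\<lambda>l. \<i> * trunc (B n) complex_of_real l) x"
      proof (rule E.T_tendsto[where C="real n"])
        show "(\<lambda>l. \<i> * trunc (B n) complex_of_real l) \<in> borel_measurable borel"
          using tm[OF idm, of n] by measurable
        show "trunc (B n) (q k) \<in> borel_measurable borel" for k by (rule tm[OF qm])
        have e1: "cmod (q k l) \<le> \<bar>l\<bar>" for k l
        proof -
          have "cmod (iexp (1 / real (Suc k) * l) - 1) \<le> \<bar>1 / real (Suc k) * l\<bar>"
            using iexp_approx1[of "1 / real (Suc k) * l" 0] by simp
          then have "real (Suc k) * cmod (iexp (1 / real (Suc k) * l) - 1) \<le> real (Suc k) * \<bar>1 / real (Suc k) * l\<bar>"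
            by (intro mult_left_mono) auto
          then show ?thesis unfolding q_def norm_mult norm_of_real by (simp add: abs_mult)
        qed
        show "cmod (trunc (B n) (q k) l) \<le> real n" for k l
          using e1[of k l] by (auto simp: trunc_def B_def indicator_def)
        fix l
        have e2: "cmod (q k l - \<i> * l) \<le> l\<^sup>2 / 2 * (1 / real (Suc k))" for k
        proof -
          let ?y = "1 / real (Suc k) * l"
          have "cmod (iexp ?y - (1 + \<i> * ?y)) \<le> ?y\<^sup>2 / 2"
            using iexp_approx1[of ?y 1] by (simp add: numeral_2_eq_2)
          then have "real (Suc k) * cmod (iexp ?y - (1 + \<i> * ?y)) \<le> real (Suc k) * (?y\<^sup>2 / 2)"
            by (intro mult_left_mono) auto
          also have "real (Suc k) * (?y\<^sup>2 / 2) = l\<^sup>2 / 2 * (1 / real (Suc k))"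
            by (simp add: power2_eq_square)
          also have "real (Suc k) * cmod (iexp ?y - (1 + \<i> * ?y)) = cmod (q k l - \<i> * l)"
          proof -
            have "q k l - \<i> * l = complex_of_real (real (Suc k)) * (iexp ?y - (1 + \<i> * ?y))"
              unfolding q_def by (simp add: right_diff_distrib distrib_left del: of_nat_Suc)
            then show ?thesis by (simp only: norm_mult norm_of_real abs_of_nat)
          qed
          finally show ?thesis .
        qed
        have "(\<lambda>k. l\<^sup>2 / 2 * (1 / real (Suc k))) \<longlonglongrightarrow> l\<^sup>2 / 2 * 0" by (intro tendsto_intros inv0)
        then have "(\<lambda>k. q k l - \<i> * l) \<longlonglongrightarrow> 0"
          by (intro Lim_null_comparison[OF always_eventually[OF allI[OF e2]]]) simp
        from tendsto_add[OF this tendsto_const[of "\<i> * complex_of_real l"]]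
        have "(\<lambda>k. indicator (B n) l * q k l) \<longlonglongrightarrow> indicator (B n) l * (\<i> * l)" by (intro tendsto_intros) simp
        then show "(\<lambda>k. trunc (B n) (q k) l) \<longlonglongrightarrow> \<i> * trunc (B n) complex_of_real l"
          by (simp add: trunc_def mult.left_commute)
      qed
      have "\<i> *\<^sub>C E (B n) (R x) = \<i> *\<^sub>C E.T (trunc (B n) complex_of_real) x"
        using LIMSEQ_unique[OF 1 2] E.T_scaleC[OF exhausts_bounded[OF B]] by simp
      then have "\<i> *\<^sub>C (\<i> *\<^sub>C E (B n) (R x)) = \<i> *\<^sub>C (\<i> *\<^sub>C E.T (trunc (B n) complex_of_real) x)" by (rule arg_cong)
      then show ?thesis by simp
    qed
    then show ?thesis using E.Int_op_iff[OF idm B] by blast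
  qed
  have "(x, y) \<in> E.Int_op complex_of_real \<longleftrightarrow> y = R x" for x y
    using R[of x] E.Int_op_unique[OF idm] by blast
  then show ?thesis using E.pvm_axioms by blast
qed

end

section \<open>The spectral theorem for positive selfadjoint operators\<close>

text \<open>The bounded operator \<open>(1 + D)\<^sup>-\<^sup>1\<close> is everywhere defined, because a vector orthogonal to
  the range of \<open>1 + D\<close> would be an eigenvector of \<open>D\<^sup>* = D\<close> for the eigenvalue \<open>-1\<close>. Its
  spectral measure is transported by \<open>b \<mapsto> 1 / b - 1\<close>.\<close>

theorem positive_spectral_theorem:
  assumes D: "positive_selfadjoint D"
  obtains E where "pvm E" "D = spectral_integral E complex_of_real"
proof -
  have dense: "closure (Domain D) = UNIV" and adj: "adjoint_op D = D"
    and pos: "\<And>x y. (x, y) \<in> D \<Longrightarrow> 0 \<le> Re (cinner x y)"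
    using D by (auto simp: positive_selfadjoint_def)
  have memI: "(y, z) \<in> D" if "\<And>x w. (x, w) \<in> D \<Longrightarrow> cinner y w = cinner z x" for y z
    by (subst adj[symmetric]) (use that in \<open>auto simp: adjoint_op_def\<close>)
  have sym: "cinner y w = cinner z x" if "(y, z) \<in> D" "(x, w) \<in> D" for x y z w
    using that(1) that(2) by (subst (asm) adj[symmetric]) (auto simp: adjoint_op_def)
  have add: "(x + x', y + y') \<in> D" if "(x, y) \<in> D" "(x', y') \<in> D" for x y x' y'
    by (rule memI) (use sym[OF that(1)] sym[OF that(2)] in \<open>simp add: cinner_add_left\<close>)
  have scale: "(a *\<^sub>C x, a *\<^sub>C y) \<in> D" if "(x, y) \<in> D" for a x y
    by (rule memI) (use sym[OF that] in \<open>simp add: cinner_scaleC_left\<close>)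
  have scaleR: "(r *\<^sub>R x, r *\<^sub>R y) \<in> D" if "(x, y) \<in> D" for r x y
    using scale[OF that, of "complex_of_real r"] by (simp add: scaleC_of_real)
  have diff: "(x - x', y - y') \<in> D" if "(x, y) \<in> D" "(x', y') \<in> D" for x y x' y'
    using add[OF that(1) scaleR[OF that(2), of "-1"]] by simp
  have single: "z = 0" if "(0, z) \<in> D" for z
  proof -
    have "Domain D \<subseteq> {x. cinner z x = 0}" using sym[OF that] by fastforce
    moreover have "closed {x. cinner z x = 0}"
      by (intro closed_Collect_eq continuous_intros)
    ultimately have "closure (Domain D) \<subseteq> {x. cinner z x = 0}" by (rule closure_minimal)
    then have "cinner z z = 0" using dense by auto
    then show ?thesis by (simp add: cinner_self)
  qed
  have ineq: "(norm x)\<^sup>2 + (norm y)\<^sup>2 \<le> (norm (x + y))\<^sup>2" if "(x, y) \<in> D" for x y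
    using pos[OF that] by (simp add: Re_cinner power2_norm_eq_inner inner_add_left inner_add_right inner_commute)
  have le: "norm x \<le> norm (x + y)" "norm y \<le> norm (x + y)" if "(x, y) \<in> D" for x y
    using ineq[OF that] by (auto intro!: power2_le_imp_le[of "norm _"] elim: order_trans[rotated])
  define Rg where "Rg = {x + y | x y. (x, y) \<in> D}"
  have "subspace Rg"
  proof (rule subspaceI)
    have "(0, 0) \<in> D" by (rule memI) simp
    then show "0 \<in> Rg" by (force simp: Rg_def)
    show "u + v \<in> Rg" if uv: "u \<in> Rg" "v \<in> Rg" for u v
    proof -
      obtain x y x' y' where e: "u = x + y" "(x, y) \<in> D" "v = x' + y'" "(x', y') \<in> D" using uv unfolding Rg_def by blast
      have "u + v = (x + x') + (y + y')" by (simp add: e add_ac)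
      then show ?thesis using add[OF e(2,4)] unfolding Rg_def by blast
    qed
    show "r *\<^sub>R u \<in> Rg" if u: "u \<in> Rg" for r u
    proof -
      obtain x y where e: "u = x + y" "(x, y) \<in> D" using u unfolding Rg_def by blast
      have "r *\<^sub>R u = r *\<^sub>R x + r *\<^sub>R y" by (simp add: e scaleR_add_right)
      then show ?thesis using scaleR[OF e(2), of r] unfolding Rg_def by blast
    qed
  qed
  moreover have "closed Rg"
    unfolding closed_sequential_limits
  proof (intro allI impI)
    fix u w assume "(\<forall>n. u n \<in> Rg) \<and> u \<longlonglongrightarrow> w"
    then have u: "\<And>n. u n \<in> Rg" "u \<longlonglongrightarrow> w" by auto
    have "\<forall>n. \<exists>p. u n = fst p + snd p \<and> p \<in> D" using u(1) by (force simp: Rg_def)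
    from choice[OF this] obtain p where p: "\<And>n. u n = fst (p n) + snd (p n)" "\<And>n. p n \<in> D" by blast
    have du: "(fst (p m) - fst (p n), snd (p m) - snd (p n)) \<in> D" for m n
      using diff[of "fst (p m)" "snd (p m)" "fst (p n)" "snd (p n)"] p(2) by simp
    have sum: "fst (p m) - fst (p n) + (snd (p m) - snd (p n)) = u m - u n" for m n by (simp add: p(1))
    have cu: "Cauchy u" using u(2) by (rule LIMSEQ_imp_Cauchy)
    have c: "Cauchy v" if "\<And>m n. norm (v m - v n) \<le> norm (u m - u n)" for v :: "nat \<Rightarrow> 'a"
    proof (rule CauchyI)
      fix e :: real assume "e > 0"
      then obtain M where "\<forall>m\<ge>M. \<forall>n\<ge>M. norm (u m - u n) < e" using CauchyD[OF cu] by blast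
      then show "\<exists>M. \<forall>m\<ge>M. \<forall>n\<ge>M. norm (v m - v n) < e" using that le_less_trans by blast
    qed
    have "Cauchy (\<lambda>n. fst (p n))" "Cauchy (\<lambda>n. snd (p n))"
      using le[OF du] by (auto intro!: c simp: sum)
    then obtain x y where xy: "(\<lambda>n. fst (p n)) \<longlonglongrightarrow> x" "(\<lambda>n. snd (p n)) \<longlonglongrightarrow> y"
      unfolding Cauchy_convergent_iff convergent_def by blast
    have "(x, y) \<in> D"
    proof (rule memI)
      fix a b assume ab: "(a, b) \<in> D"
      have "(\<lambda>n. cinner (fst (p n)) b) \<longlonglongrightarrow> cinner x b" by (intro tendsto_intros xy)
      moreover have "(\<lambda>n. cinner (snd (p n)) a) \<longlonglongrightarrow> cinner y a" by (intro tendsto_intros xy)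
      moreover have "cinner (fst (p n)) b = cinner (snd (p n)) a" for n
        using sym[of "fst (p n)" "snd (p n)" a b] p(2) ab by simp
      ultimately show "cinner x b = cinner y a" using LIMSEQ_unique by simp
    qed
    moreover have "w = x + y"
      using LIMSEQ_unique[OF u(2)] tendsto_add[OF xy] by (simp add: p(1)[symmetric])
    ultimately show "w \<in> Rg" by (auto simp: Rg_def)
  qed
  ultimately have Rg: "subspace Rg" "closed Rg" by auto
  have onto: "w \<in> Rg" for w
  proof -
    define z where "z = w - proj Rg w"
    have orth: "inner z (x + y) = 0" if "(x, y) \<in> D" for x y
      unfolding z_def using that by (intro proj(2)[OF Rg]) (auto simp: Rg_def)
    have "(z, - z) \<in> D"
    proof (rule memI)
      fix x y assume xy: "(x, y) \<in> D"
      have "\<i> *\<^sub>C (x + y) = \<i> *\<^sub>C x + \<i> *\<^sub>C y" by (rule scaleC_add_right)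
      then have "cinner z (x + y) = 0"
        using orth[OF xy] orth[OF scale[OF xy, of \<i>]] by (simp add: cinner_eq complex_eq_iff)
      then show "cinner z y = cinner (- z) x"
        by (simp add: cinner_add_right cinner_minus_left add_eq_0_iff)
    qed
    from pos[OF this] have "z = 0" by (simp add: cinner_minus_right cinner_self)
    then show ?thesis using proj(1)[OF Rg, of w] by (simp add: z_def)
  qed
  have uniq: "x = x'" if "(x, y) \<in> D" "(x', y') \<in> D" "x + y = x' + y'" for x y x' y'
  proof -
    have "norm (x - x') \<le> norm ((x - x') + (y - y'))" by (rule le(1)[OF diff[OF that(1,2)]])
    also have "(x - x') + (y - y') = 0" using that(3) by (simp add: algebra_simps)
    finally show ?thesis by simp
  qed
  define R where "R w = (SOME x. (x, w - x) \<in> D)" for w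
  have R: "(R w, w - R w) \<in> D" for w
  proof -
    obtain x y where "w = x + y" "(x, y) \<in> D" using onto[of w] by (auto simp: Rg_def)
    then have "(x, w - x) \<in> D" by simp
    then show ?thesis unfolding R_def by (rule someI)
  qed
  have R_eq: "R w = x \<longleftrightarrow> (x, w - x) \<in> D" for w x
    using R[of w] uniq[OF R[of w], of x "w - x"] by auto
  have R_scaleC: "R (a *\<^sub>C x) = a *\<^sub>C R x" for a x
    unfolding R_eq using scale[OF R[of x], of a] by (simp add: scaleC_diff_right)
  have R_add: "R (x + y) = R x + R y" for x y
    unfolding R_eq using add[OF R[of x] R[of y]] by (simp add: algebra_simps)
  have R_scaleR: "R (r *\<^sub>R x) = r *\<^sub>R R x" for r x
    using R_scaleC[of "complex_of_real r" x] by (simp add: scaleC_of_real)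
  have R_norm: "norm (R x) \<le> norm x * 1" for x using le(1)[OF R[of x]] by simp
  have R_sym: "cinner (R x) y = cinner x (R y)" for x y
    using sym[OF R[of x] R[of y]] by (simp add: cinner_diff_left cinner_diff_right)
  have "bounded_selfadjoint R"
    by (rule bounded_selfadjoint.intro[OF bounded_linear_intro[OF R_add R_scaleR R_norm] R_scaleC R_sym])
  then obtain F where F: "pvm F" "\<And>x y. (x, y) \<in> spectral_integral F complex_of_real \<longleftrightarrow> y = R x"
    using bounded_selfadjoint.spectral_theorem by blast
  interpret F: pvm F by (rule F(1))
  have inj: "w = 0" if "R w = 0" for w
    using that single[of w] R_eq[of w 0] by simp
  have idm: "complex_of_real \<in> borel_measurable borel" by measurable
  have F0: "F {0} x = 0" for x
  proof (rule inj)
    have "(x, F {0} x) \<in> F.Int_op (indicator {0})"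
      by (simp add: F.Int_op_iff_T bounded_borel_indicator F.T_indicator)
    moreover have "(\<lambda>l. complex_of_real l * indicator {0} l) = (\<lambda>_. 0)"
      by (rule ext) (simp add: indicator_def)
    ultimately have "(F {0} x, 0) \<in> F.Int_op complex_of_real"
      using F.Int_op_comp[OF _ idm, of "indicator {0}" x "F {0} x" 0] by (simp add: F.Int_op_const)
    then show "R (F {0} x) = 0" using F(2) by simp
  qed
  have nz: "- {0::real} \<in> sets borel" "F (- {0}) x = x" for x
    using F.E_compl[of "{0}" x] F0[of x] by (simp_all add: Compl_eq_Diff_UNIV)
  define h where "h b = 1 / b - 1" for b :: real
  have hm: "h \<in> borel_measurable borel" unfolding h_def by measurable
  have inv: "(\<lambda>l. 1 / complex_of_real l) \<in> borel_measurable borel" by measurable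
  have "(x, y) \<in> D \<longleftrightarrow> (x, y) \<in> spectral_integral (push h F) complex_of_real" for x y
  proof -
    have "(x, y) \<in> D \<longleftrightarrow> R (x + y) = x" unfolding R_eq by simp
    also have "\<dots> \<longleftrightarrow> (x + y, x) \<in> F.Int_op complex_of_real" unfolding F(2) by auto
    also have "\<dots> \<longleftrightarrow> (x, x + y) \<in> F.Int_op (\<lambda>l. 1 / complex_of_real l)"
      by (rule F.Int_op_inverse[OF idm nz]) simp
    also have "\<dots> \<longleftrightarrow> (x, y) \<in> F.Int_op (\<lambda>l. complex_of_real (h l))"
    proof
      assume "(x, x + y) \<in> F.Int_op (\<lambda>l. 1 / complex_of_real l)"
      then have "(x, (x + y) + (- 1) *\<^sub>C x) \<in> F.Int_op (\<lambda>l. 1 / complex_of_real l + (- 1))"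
        by (intro F.Int_op_add[OF inv]) (auto simp: F.Int_op_const)
      then show "(x, y) \<in> F.Int_op (\<lambda>l. complex_of_real (h l))"
        by (simp add: scaleC_minus_left h_def)
    next
      assume "(x, y) \<in> F.Int_op (\<lambda>l. complex_of_real (h l))"
      moreover have "(\<lambda>l. complex_of_real (h l)) \<in> borel_measurable borel" using hm by measurable
      ultimately have "(x, y + 1 *\<^sub>C x) \<in> F.Int_op (\<lambda>l. complex_of_real (h l) + 1)"
        by (intro F.Int_op_add) (auto simp: F.Int_op_const)
      then show "(x, x + y) \<in> F.Int_op (\<lambda>l. 1 / complex_of_real l)"
        by (simp add: h_def add.commute)
    qed
    also have "\<dots> \<longleftrightarrow> (x, y) \<in> spectral_integral (push h F) complex_of_real"
      by (simp add: F.Int_op_push[OF hm idm])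
    finally show ?thesis .
  qed
  then have "D = spectral_integral (push h F) complex_of_real" by (auto simp: set_eq_iff)
  with F.pvm_push[OF hm] show ?thesis by (rule that)
qed

section \<open>The modular operator of a homomorphism\<close>

text \<open>\<open>E\<close> is the spectral measure of the generator of \<open>t \<mapsto> \<eta>(e\<^sup>t)\<close>, that is, of
  \<open>- (2 \<pi>)\<^sup>-\<^sup>1 log \<Delta>\<close>. In this parametrisation conjugation with an antiunitary
  operator and the inversion of \<open>\<Delta>\<close> are reflections of the line.\<close>

definition log_pvm :: "(real set \<Rightarrow> 'h \<Rightarrow> 'h) \<Rightarrow> (real \<Rightarrow> 'h::complex_hilbert_space \<Rightarrow>\<^sub>L 'h) \<Rightarrow> bool" where
  "log_pvm E \<eta> \<longleftrightarrow> pvm E \<and> (\<forall>t x. blinfun_apply (\<eta> (exp t)) x = pvm.T E (\<lambda>l. iexp (t * l)) x)"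

lemma bounded_iexp: "bounded_borel (\<lambda>l. iexp (t * l))"
  by (rule bounded_borelI[where C=1]) auto

lemma powr_eq:
  "complex_of_real l powr z = (if l = 0 then 0 else if l > 0 then exp (z * complex_of_real (ln l))
     else exp (z * (complex_of_real (ln (- l)) + \<i> * pi)))"
  by (cases "l = 0") (auto simp: powr_def Ln_of_real' abs_if mult.commute)

lemma powr_measurable: "(\<lambda>l. complex_of_real l powr z) \<in> borel_measurable borel"
  unfolding powr_eq by measurable

lemma op_power_Int_op:
  fixes z :: complex
  assumes E: "pvm E"
  shows "op_power (spectral_integral E (\<lambda>l. complex_of_real (exp (- 2 * pi * l)))) z
    = spectral_integral E (\<lambda>l. exp (complex_of_real (- 2 * pi * l) * z))"
proof -
  interpret E: pvm E by (rule E)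
  let ?h = "\<lambda>l::real. exp (- 2 * pi * l)"
  have h: "?h \<in> borel_measurable borel" by measurable
  have "spectral_integral E (\<lambda>l. complex_of_real (?h l)) = spectral_integral (push ?h E) complex_of_real"
    by (rule E.Int_op_push[OF h, symmetric]) measurable
  then have "spectral_measure (spectral_integral E (\<lambda>l. complex_of_real (?h l))) = push ?h E"
    by (rule spectral_measure_eqI[OF E.pvm_push[OF h]])
  then have "op_power (spectral_integral E (\<lambda>l. complex_of_real (?h l))) z = E.Int_op (\<lambda>l. complex_of_real (?h l) powr z)"
    unfolding op_power_def by (simp only: E.Int_op_push[OF h powr_measurable])
  moreover have "(\<lambda>l. complex_of_real (?h l) powr z) = (\<lambda>l. exp (complex_of_real (- 2 * pi * l) * z))"
    by (rule ext) (simp add: powr_eq mult_ac)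
  ultimately show ?thesis by simp
qed

lemma op_graph_eq_Int_op:
  assumes "pvm E" "bounded_borel f"
  shows "op_graph W = spectral_integral E f \<longleftrightarrow> (\<forall>x. W x = pvm.T E f x)"
  using pvm.Int_op_iff_T[OF assms] by (auto simp: op_graph_def set_eq_iff)

text \<open>For uniqueness, let \<open>D\<close> be another positive operator with the same imaginary powers. They are
  unitary, which excludes negative spectrum and an eigenvalue 0 of \<open>D\<close>. The image of its
  spectral measure under \<open>l \<mapsto> - ln l / 2\<pi>\<close> has the same unitary group as \<open>E\<close>.\<close>

theorem hom_modular_op_eq:
  assumes E: "log_pvm E \<eta>"
  shows "hom_modular_op \<eta> = spectral_integral E (\<lambda>l. complex_of_real (exp (- 2 * pi * l)))"
  unfolding hom_modular_op_def
proof (rule the_equality)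
  have pE: "pvm E" and \<eta>: "\<And>t x. blinfun_apply (\<eta> (exp t)) x = pvm.T E (\<lambda>l. iexp (t * l)) x"
    using E by (auto simp: log_pvm_def)
  interpret E: pvm E by (rule pE)
  let ?D = "spectral_integral E (\<lambda>l. complex_of_real (exp (- 2 * pi * l)))"
  show "positive_selfadjoint ?D \<and> (\<forall>t. op_graph (blinfun_apply (\<eta> (exp t))) = op_power ?D (- \<i> * complex_of_real t / (2 * pi)))"
  proof (intro conjI allI)
    show "positive_selfadjoint ?D" by (rule E.positive_selfadjoint_Int_op) auto
    fix t
    have "(\<lambda>l. exp (complex_of_real (- 2 * pi * l) * (- \<i> * complex_of_real t / complex_of_real (2 * pi)))) = (\<lambda>l. iexp (t * l))"
      by (rule ext) (simp add: field_simps)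
    then show "op_graph (blinfun_apply (\<eta> (exp t))) = op_power ?D (- \<i> * complex_of_real t / (2 * pi))"
      unfolding op_power_Int_op[OF pE] by (simp only: op_graph_eq_Int_op[OF pE bounded_iexp] \<eta>) simp
  qed
  fix D assume "positive_selfadjoint D \<and> (\<forall>t. op_graph (blinfun_apply (\<eta> (exp t))) = op_power D (- \<i> * complex_of_real t / (2 * pi)))"
  then have D: "positive_selfadjoint D"
    and pw: "\<And>t. op_graph (blinfun_apply (\<eta> (exp t))) = op_power D (- \<i> * complex_of_real t / (2 * pi))" by auto
  obtain F where pF: "pvm F" and DF: "D = spectral_integral F complex_of_real"
    by (rule positive_spectral_theorem[OF D])
  interpret F: pvm F by (rule pF)
  define f where "f t l = complex_of_real l powr (- \<i> * complex_of_real t / (2 * pi))" for t l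
  have fm: "f t \<in> borel_measurable borel" for t unfolding f_def by (rule powr_measurable)
  have f_pos: "f t l = iexp (t * (- ln l / (2 * pi)))" if "l > 0" for t l
    using that by (simp add: f_def powr_eq field_simps)
  have f_neg: "cmod (f t l) = exp (t / 2)" if "l < 0" for t l
    using that by (simp add: f_def powr_eq norm_exp_eq_Re distrib_left)
  have fb: "bounded_borel (f t)" for t
  proof (rule bounded_borelI[OF fm])
    show "cmod (f t l) \<le> max 1 (exp (t / 2))" for l
      using f_neg[of l t] f_pos[of l t] by (cases "l = 0"; cases "l > 0") (auto simp: f_def)
  qed
  have fT: "blinfun_apply (\<eta> (exp t)) x = F.T (f t) x" for t x
    using pw[of t] op_graph_eq_Int_op[OF pF fb[of t]]
    unfolding op_power_def spectral_measure_eqI[OF pF DF] f_def by blast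
  have one: "F.T (f 0) x = x" for x
    using fT[of 0 x] \<eta>[of 0 x] by (simp add: E.T_const)
  have isom: "norm (F.T (f t) x) = norm x" for t x
  proof -
    have "ennreal ((norm (E.T (\<lambda>l. iexp (t * l)) x))\<^sup>2) = l2sq (scalar_measure E x) (\<lambda>l. iexp (t * l))"
      by (rule E.T_isometry[OF bounded_iexp, symmetric])
    also have "\<dots> = ennreal ((norm x)\<^sup>2)" by (simp add: E.emeasure_\<mu>)
    finally have "norm (E.T (\<lambda>l. iexp (t * l)) x) = norm x" by (simp add: power2_eq_iff_nonneg)
    then show ?thesis by (simp only: fT[symmetric] \<eta>)
  qed
  have zero: "F {0} x = 0" for x
  proof -
    have "F {0} x = F {0} (F.T (f 0) x)" by (simp add: one)
    also have "\<dots> = F.T (trunc {0} (f 0)) x" by (simp add: F.T_trunc fb)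
    also have "trunc {0} (f 0) = (\<lambda>_. 0)" by (rule ext) (simp add: trunc_def indicator_def f_def)
    finally show ?thesis by (simp add: F.T_const)
  qed
  \<comment> \<open>On the negative half line \<open>\<bar>l\<^sup>i\<^sup>s\<bar>\<close> is a constant different from 1, which unitarity excludes.\<close>
  have neg: "F {..<0} x = 0" for x
  proof -
    define g where "g l = indicator {..<0} l / f 1 l" for l
    have g_bound: "cmod (g l) \<le> exp (- 1 / 2)" for l
      using f_neg[of l 1] by (simp add: g_def indicator_def norm_divide exp_minus field_simps)
    have gb: "bounded_borel g"
      by (rule bounded_borelI[OF _ g_bound]) (use fm[of 1] in \<open>simp add: g_def[abs_def]\<close>)
    have "(\<lambda>l. g l * f 1 l) = indicator {..<0}"
    proof
      fix l show "g l * f 1 l = indicator {..<0} l"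
      proof (cases "l < 0")
        case True
        have "f 1 l \<noteq> 0" using f_neg[OF True, of 1] by auto
        then show ?thesis by (simp add: g_def)
      qed (simp add: g_def)
    qed
    then have "F {..<0} x = F.T g (F.T (f 1) x)"
      using F.T_mult[OF gb fb[of 1], of x] by (simp add: F.T_indicator)
    moreover have "F {..<0} (F {..<0} x) = F {..<0} x" by (rule F.E_idem) simp
    moreover define y where "y = F {..<0} x"
    ultimately have "y = F.T g (F.T (f 1) y)"
      using F.T_mult[OF gb fb[of 1], of y] \<open>(\<lambda>l. g l * f 1 l) = indicator {..<0}\<close> by (simp add: F.T_indicator)
    then have "norm y \<le> exp (- 1 / 2) * norm y"
      using F.T_norm_le[OF gb g_bound, of "F.T (f 1) y"] by (simp add: isom)
    then have "(1 - exp (- 1 / 2)) * norm y \<le> 0" by (simp add: algebra_simps)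
    then have "norm y \<le> 0" by (simp add: mult_le_0_iff)
    then show ?thesis by (simp add: y_def)
  qed
  have supp: "{0::real<..} \<in> sets borel" "F {0<..} x = x" for x
  proof -
    have "F {..0} x = F {..<0} x + F {0} x"
      using F.E_Un[of "{..<0}" "{0}" x] by (simp add: ivl_disj_un(2)[symmetric] Un_commute)
    moreover have "UNIV - {..0} = {0::real<..}" by auto
    ultimately show "F {0<..} x = x" using F.E_compl[of "{..0}" x] by (simp add: zero neg)
  qed simp
  define h where "h l = - ln l / (2 * pi)" for l :: real
  have h: "h \<in> borel_measurable borel" unfolding h_def by measurable
  have hb: "bounded_borel (\<lambda>l. iexp (t * h l))" for t
    using h by (intro bounded_borelI[where C=1]) auto
  have "push h F = E"
  proof (rule pvm_eqI_exp[OF F.pvm_push[OF h] pE])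
    fix t x
    have "pvm.T (push h F) (\<lambda>l. iexp (t * l)) x = F.T (\<lambda>l. iexp (t * h l)) x"
      by (rule F.T_push[OF h bounded_iexp])
    also have "\<dots> = F.T (f t) x"
      by (rule F.T_AE[OF hb fb supp]) (simp add: f_pos h_def)
    finally show "pvm.T (push h F) (\<lambda>l. iexp (t * l)) x = E.T (\<lambda>l. iexp (t * l)) x" by (simp only: \<eta>[symmetric] fT)
  qed
  then have "?D = F.Int_op (\<lambda>l. complex_of_real (exp (- 2 * pi * h l)))"
    using F.Int_op_push[OF h, of "\<lambda>l. complex_of_real (exp (- 2 * pi * l))"] by simp
  also have "\<dots> = F.Int_op complex_of_real"
    using h by (intro F.Int_op_AE[OF _ _ supp]) (simp_all add: h_def)
  finally show "D = ?D" by (simp add: DF)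
qed

lemma stand_of_hom_eq:
  assumes "log_pvm E \<eta>"
  shows "stand_of_hom \<eta> = {x. \<exists>y. (x, y) \<in> spectral_integral E (\<lambda>l. complex_of_real (exp (- pi * l))) \<and> x = blinfun_apply (\<eta> (-1)) y}"
proof -
  have E: "pvm E" using assms by (simp add: log_pvm_def)
  have "(\<lambda>l. exp (complex_of_real (- 2 * pi * l) * (1 / 2))) = (\<lambda>l. complex_of_real (exp (- pi * l)))"
    by (rule ext) (simp add: exp_of_real[symmetric])
  then show ?thesis
    unfolding stand_of_hom_def hom_modular_op_eq[OF assms] op_power_Int_op[OF E] by (auto simp: op_graph_def)
qed

section \<open>Conjugation with unitary and antiunitary operators\<close>

text \<open>Unitary and antiunitary operators are treated together: \<open>\<kappa>\<close> is the identity or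
  complex conjugation, and \<open>\<sigma>\<close> is the corresponding sign.\<close>

locale symmetry =
  fixes W :: "'h::complex_hilbert_space \<Rightarrow> 'h" and \<kappa> :: "complex \<Rightarrow> complex" and \<sigma> :: real
  assumes cases: "(\<kappa> = (\<lambda>a. a) \<and> \<sigma> = 1 \<and> unitary W) \<or> (\<kappa> = cnj \<and> \<sigma> = -1 \<and> antiunitary W)"
begin

lemma W_add: "W (x + y) = W x + W y"
  and W_scaleC: "W (a *\<^sub>C x) = \<kappa> a *\<^sub>C W x"
  and W_cinner: "cinner (W x) (W y) = \<kappa> (cinner x y)"
  and W_surj: "surj W"
  using cases by (auto simp: unitary_def antiunitary_def)

lemma kappa_real [simp]: "\<kappa> (complex_of_real r) = complex_of_real r"
  and kappa_kappa [simp]: "\<kappa> (\<kappa> a) = a"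
  and kappa_tendsto: "(f \<longlongrightarrow> a) F \<Longrightarrow> ((\<lambda>x. \<kappa> (f x)) \<longlongrightarrow> \<kappa> a) F"
  and kappa_norm [simp]: "cmod (\<kappa> a) = cmod a"
  and kappa_iexp: "\<kappa> (iexp (t * (\<sigma> * l))) = iexp (t * l)"
  and sigma_sq [simp]: "\<sigma> * \<sigma> = 1"
  using cases by (auto intro: tendsto_cnj simp: exp_cnj)

lemma kappa_bounded_borel: "bounded_borel f \<Longrightarrow> bounded_borel (\<lambda>l. \<kappa> (f l))"
  using cases bounded_borel_cnj by auto

lemma W_norm: "norm (W x) = norm x"
proof -
  have "complex_of_real ((norm (W x))\<^sup>2) = complex_of_real ((norm x)\<^sup>2)"
    using W_cinner[of x x] by (simp only: cinner_self kappa_real)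
  then have "(norm (W x))\<^sup>2 = (norm x)\<^sup>2" by (simp only: of_real_eq_iff)
  then show ?thesis by (simp add: power2_eq_iff_nonneg)
qed

lemma W_scaleR: "W (r *\<^sub>R x) = r *\<^sub>R W x"
  by (simp add: scaleR_scaleC W_scaleC)

lemma W_bounded_linear: "bounded_linear W"
  by (rule bounded_linear_intro[where K=1]) (simp_all add: W_add W_scaleR W_norm)

lemma W_zero: "W 0 = 0"
  using W_scaleR[of 0 0] by simp

lemma W_diff: "W (x - y) = W x - W y"
  by (rule linear_diff[OF bounded_linear.linear[OF W_bounded_linear]])

lemma W_sum: "W (\<Sum>i\<in>A. f i) = (\<Sum>i\<in>A. W (f i))"
  by (induction A rule: infinite_finite_induct) (auto simp: W_add W_zero)

lemma W_inj: "inj W"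
proof (rule injI)
  fix x y assume "W x = W y"
  then have "norm (x - y) = 0" using W_norm[of "x - y"] by (simp add: W_diff)
  then show "x = y" by simp
qed

abbreviation Wi where "Wi \<equiv> inv_into UNIV W"

lemma inv_W [simp]: "Wi (W x) = x" and W_inv [simp]: "W (Wi x) = x"
  using W_inj W_surj by (simp_all add: surj_f_inv_f)

definition conj_pvm :: "(real set \<Rightarrow> 'h \<Rightarrow> 'h) \<Rightarrow> real set \<Rightarrow> 'h \<Rightarrow> 'h" where
  "conj_pvm E = (\<lambda>B\<in>sets borel. \<lambda>x. W (E B (Wi x)))"

lemma conj_pvm_W: "B \<in> sets borel \<Longrightarrow> conj_pvm E B (W x) = W (E B x)"
  by (simp add: conj_pvm_def)

context
  fixes E :: "real set \<Rightarrow> 'h \<Rightarrow> 'h"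
  assumes E: "pvm E"
begin

interpretation E: pvm E by (rule E)

lemma pvm_conj: "pvm (conj_pvm E)"
proof
  show "projection_valued_measure (conj_pvm E)"
    unfolding projection_valued_measure_def
  proof (intro conjI ballI allI impI)
    show "conj_pvm E \<in> extensional (sets borel)" by (simp add: conj_pvm_def)
    show "conj_pvm E UNIV x = x" for x by (simp add: conj_pvm_def)
    fix B :: "real set" assume B: "B \<in> sets borel"
    have W: "\<exists>u. x = W u" for x using W_inv[of x] by metis
    show "orthogonal_projection (conj_pvm E B)"
      unfolding orthogonal_projection_def
    proof (intro conjI allI)
      fix x y
      obtain u v where uv: "x = W u" "y = W v" using W by blast
      show "conj_pvm E B (x + y) = conj_pvm E B x + conj_pvm E B y"
        by (simp add: uv W_add[symmetric] conj_pvm_W[OF B] E.E_add[OF B])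
      show "conj_pvm E B (conj_pvm E B x) = conj_pvm E B x"
        by (simp add: uv conj_pvm_W[OF B] E.E_idem[OF B])
      show "cinner (conj_pvm E B x) y = cinner x (conj_pvm E B y)"
        by (simp add: uv conj_pvm_W[OF B] W_cinner E.E_sym[OF B])
      fix a
      have "a *\<^sub>C W u = W (\<kappa> a *\<^sub>C u)" by (simp add: W_scaleC)
      then show "conj_pvm E B (a *\<^sub>C x) = a *\<^sub>C conj_pvm E B x"
        by (simp only: uv conj_pvm_W[OF B] E.E_scaleC[OF B]) (simp add: W_scaleC)
    qed
  next
    fix B :: "nat \<Rightarrow> real set" and x
    assume B: "range B \<subseteq> sets borel" "disjoint_family B"
    have "(\<lambda>n. W (E (B n) (Wi x))) sums W (E (\<Union>n. B n) (Wi x))"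
      by (rule bounded_linear.sums[OF W_bounded_linear E.E_sums[OF B]])
    moreover have "B n \<in> sets borel" "(\<Union>n. B n) \<in> sets borel" for n using B(1) by auto
    ultimately show "(\<lambda>n. conj_pvm E (B n) x) sums conj_pvm E (\<Union> (range B)) x" by (simp add: conj_pvm_def)
  qed
qed

interpretation C: pvm "conj_pvm E" by (rule pvm_conj)

lemma T_conj:
  assumes f: "bounded_borel f"
  shows "C.T f (W x) = W (E.T (\<lambda>l. \<kappa> (f l)) x)"
proof -
  obtain K s where s: "\<And>n. simple_function borel (s n)" "K > 0" "\<And>n l. cmod (s n l) \<le> K"
    "\<And>l. (\<lambda>n. s n l) \<longlonglongrightarrow> f l" "\<And>l. cmod (f l) \<le> K"
    using simple_approximation[OF f] by metis
  have S: "C.S (s n) (W x) = W (E.S (\<lambda>l. \<kappa> (s n l)) x)" for n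
    unfolding E.S_comp[OF s(1)] unfolding simple_spectral_integral_def
    by (simp add: W_sum W_scaleC conj_pvm_W E.simple_vimage[OF s(1)])
  have "(\<lambda>n. C.S (s n) (W x)) \<longlonglongrightarrow> C.T f (W x)" by (rule C.S_tendsto_T[OF f s(1,3,4)])
  moreover have "(\<lambda>n. W (E.S (\<lambda>l. \<kappa> (s n l)) x)) \<longlonglongrightarrow> W (E.T (\<lambda>l. \<kappa> (f l)) x)"
  proof (rule bounded_linear.tendsto[OF W_bounded_linear E.S_tendsto_T[OF kappa_bounded_borel[OF f]]])
    show "simple_function borel (\<lambda>l. \<kappa> (s n l))" for n by (rule simple_function_compose1[OF s(1)])
    show "cmod (\<kappa> (s n l)) \<le> K" for n l by (simp add: s(3))
    show "(\<lambda>n. \<kappa> (s n l)) \<longlonglongrightarrow> \<kappa> (f l)" for l by (rule kappa_tendsto[OF s(4)])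
  qed
  ultimately show ?thesis unfolding S by (rule LIMSEQ_unique)
qed

lemma Int_op_conj:
  assumes f: "f \<in> borel_measurable borel"
  shows "(W x, W y) \<in> C.Int_op (\<lambda>l. complex_of_real (f l)) \<longleftrightarrow> (x, y) \<in> E.Int_op (\<lambda>l. complex_of_real (f l))"
proof -
  have f': "(\<lambda>l. complex_of_real (f l)) \<in> borel_measurable borel" using f by measurable
  obtain B where B: "exhausts B (\<lambda>l. complex_of_real (f l))" using exhausts_exists[OF f' f'] .
  have "(\<lambda>l. \<kappa> (trunc (B n) (\<lambda>l. complex_of_real (f l)) l)) = trunc (B n) (\<lambda>l. complex_of_real (f l))" for n
  proof
    fix l show "\<kappa> (trunc (B n) (\<lambda>l. complex_of_real (f l)) l) = trunc (B n) (\<lambda>l. complex_of_real (f l)) l"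
      using kappa_real[of 0] by (simp add: trunc_def indicator_def)
  qed
  then show ?thesis
    unfolding C.Int_op_iff[OF f' B] E.Int_op_iff[OF f' B]
    by (simp add: conj_pvm_W exhausts_sets[OF B] T_conj[OF exhausts_bounded[OF B]] inj_eq[OF W_inj])
qed

definition reflected :: "real set \<Rightarrow> 'h \<Rightarrow> 'h" where
  "reflected = push (\<lambda>l. \<sigma> * l) (conj_pvm E)"

lemma pvm_reflected: "pvm reflected"
  unfolding reflected_def by (rule C.pvm_push) measurable

lemma Int_op_reflected:
  assumes f: "f \<in> borel_measurable borel"
  shows "(W x, W y) \<in> spectral_integral reflected (\<lambda>l. complex_of_real (f (\<sigma> * l)))
    \<longleftrightarrow> (x, y) \<in> E.Int_op (\<lambda>l. complex_of_real (f l))"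
proof -
  note [measurable] = f
  have "(\<lambda>l. complex_of_real (f (\<sigma> * l))) \<in> borel_measurable borel" by measurable
  then have "spectral_integral reflected (\<lambda>l. complex_of_real (f (\<sigma> * l))) = C.Int_op (\<lambda>l. complex_of_real (f (\<sigma> * (\<sigma> * l))))"
    unfolding reflected_def by (intro C.Int_op_push) measurable
  then show ?thesis using Int_op_conj[OF f] by (simp add: mult.assoc[symmetric])
qed

lemma log_pvm_reflected:
  assumes "log_pvm E \<eta>"
    and "\<And>t x. blinfun_apply (\<eta>' (exp t)) (W x) = W (blinfun_apply (\<eta> (exp t)) x)"
  shows "log_pvm reflected \<eta>'"
  unfolding log_pvm_def
proof (intro conjI allI pvm_reflected)
  fix t y
  have m: "(\<lambda>l. \<sigma> * l) \<in> borel_measurable borel" by measurable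
  have b: "bounded_borel (\<lambda>l. iexp (t * (\<sigma> * l)))" by (rule bounded_borelI[where C=1]) auto
  obtain x where y: "y = W x" using W_inv by metis
  have "pvm.T reflected (\<lambda>l. iexp (t * l)) (W x) = W (E.T (\<lambda>l. iexp (t * l)) x)"
    unfolding reflected_def C.T_push[OF m bounded_iexp] T_conj[OF b] kappa_iexp ..
  then show "blinfun_apply (\<eta>' (exp t)) y = pvm.T reflected (\<lambda>l. iexp (t * l)) y"
    using assms by (simp only: y log_pvm_def)
qed

end

end

lemma log_pvm_unique: "log_pvm E \<eta> \<Longrightarrow> log_pvm F \<eta> \<Longrightarrow> E = F"
  by (rule pvm_eqI_exp) (auto simp: log_pvm_def)

lemma symmetry_unitary: "unitary W \<Longrightarrow> symmetry W (\<lambda>a. a) 1"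
  by (simp add: symmetry_def)

lemma symmetry_antiunitary: "antiunitary W \<Longrightarrow> symmetry W cnj (-1)"
  by (simp add: symmetry_def)

lemma (in pvm) Int_op_zero:
  assumes f: "f \<in> borel_measurable borel"
  shows "(0, 0) \<in> Int_op f"
proof -
  obtain B where B: "exhausts B f" using exhausts_exists[OF f f] .
  show ?thesis unfolding Int_op_iff[OF f B] by (simp add: exhausts_sets[OF B] exhausts_bounded[OF B])
qed

section \<open>The standard subspace of a homomorphism\<close>

locale modular_pair =
  fixes \<eta> :: "real \<Rightarrow> 'h::complex_hilbert_space \<Rightarrow>\<^sub>L 'h" and E :: "real set \<Rightarrow> 'h \<Rightarrow> 'h"
  assumes log: "log_pvm E \<eta>"
    and anti: "antiunitary (blinfun_apply (\<eta> (-1)))"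
    and invol: "blinfun_apply (\<eta> (-1)) (blinfun_apply (\<eta> (-1)) x) = x"
    and commute: "blinfun_apply (\<eta> (exp t)) (blinfun_apply (\<eta> (-1)) x) = blinfun_apply (\<eta> (-1)) (blinfun_apply (\<eta> (exp t)) x)"
begin

abbreviation J where "J \<equiv> blinfun_apply (\<eta> (-1))"

sublocale E: pvm E using log by (simp add: log_pvm_def)

sublocale J: symmetry J cnj "-1" by (rule symmetry_antiunitary[OF anti])

abbreviation (input) root_delta :: "real \<Rightarrow> complex" where
  "root_delta \<equiv> \<lambda>l. complex_of_real (exp (- pi * l))"

abbreviation V where "V \<equiv> stand_of_hom \<eta>"

lemma root_delta_measurable: "root_delta \<in> borel_measurable borel"
  by measurable

lemma Int_op_J:
  assumes "f \<in> borel_measurable borel"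
  shows "(J x, J y) \<in> E.Int_op (\<lambda>l. complex_of_real (f (- l))) \<longleftrightarrow> (x, y) \<in> E.Int_op (\<lambda>l. complex_of_real (f l))"
proof -
  have "log_pvm (J.reflected E) \<eta>"
    by (rule J.log_pvm_reflected[OF E.pvm_axioms log commute])
  then have "J.reflected E = E" using log_pvm_unique log by blast
  then show ?thesis using J.Int_op_reflected[OF E.pvm_axioms assms, of x y] by simp
qed

lemma root_delta_inverse: "(x, y) \<in> E.Int_op root_delta \<longleftrightarrow> (y, x) \<in> E.Int_op (\<lambda>l. complex_of_real (exp (pi * l)))"
proof -
  have "(x, y) \<in> E.Int_op root_delta \<longleftrightarrow> (y, x) \<in> E.Int_op (\<lambda>l. 1 / root_delta l)"
    by (rule E.Int_op_inverse[OF root_delta_measurable, of UNIV]) auto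
  moreover have "(\<lambda>l. 1 / root_delta l) = (\<lambda>l. complex_of_real (exp (pi * l)))"
    by (rule ext) (simp add: exp_minus flip: of_real_inverse inverse_eq_divide)
  ultimately show ?thesis by simp
qed

lemma V_iff: "x \<in> V \<longleftrightarrow> (x, J x) \<in> E.Int_op root_delta"
  unfolding stand_of_hom_eq[OF log] by (auto simp: invol)

text \<open>The relation \<open>S = J \<Delta>\<^sup>1\<^sup>/\<^sup>2\<close> is an involution because \<open>J \<Delta>\<^sup>1\<^sup>/\<^sup>2 J = \<Delta>\<^sup>-\<^sup>1\<^sup>/\<^sup>2\<close>.\<close>

lemma S_involution: "(x, J w) \<in> E.Int_op root_delta \<Longrightarrow> (w, J x) \<in> E.Int_op root_delta"
proof -
  assume "(x, J w) \<in> E.Int_op root_delta"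
  then have "(J x, J (J w)) \<in> E.Int_op (\<lambda>l. complex_of_real (exp (- pi * (- l))))"
    using Int_op_J[of "\<lambda>l. exp (- pi * l)" x "J w"] by simp
  then show ?thesis unfolding root_delta_inverse by (simp add: invol)
qed

lemma V_complex:
  assumes "v \<in> V" "w \<in> V"
  shows "(v + \<i> *\<^sub>C w, J (v - \<i> *\<^sub>C w)) \<in> E.Int_op root_delta"
proof -
  have "(v + \<i> *\<^sub>C w, J v + \<i> *\<^sub>C J w) \<in> E.Int_op root_delta"
    using assms unfolding V_iff by (intro E.Int_op_right[OF root_delta_measurable]) auto
  moreover have "J (v - \<i> *\<^sub>C w) = J v + \<i> *\<^sub>C J w"
    by (simp add: J.W_diff J.W_scaleC scaleC_minus_left)
  ultimately show ?thesis by simp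
qed

text \<open>The involution \<open>S\<close> splits a vector of its domain as \<open>x = v + \<i> u\<close> with \<open>v = (x + S x) / 2\<close> and
  \<open>u = (x - S x) / 2\<i>\<close> fixed by \<open>S\<close>.\<close>

lemma tomita_op_V: "tomita_op V = {(x, w). (x, J w) \<in> E.Int_op root_delta}"
proof -
  have "(x, w) \<in> tomita_op V" if xw: "(x, J w) \<in> E.Int_op root_delta" for x w
  proof -
    define v u where "v = (1 / 2 :: complex) *\<^sub>C (x + w)" and "u = (- \<i> / 2) *\<^sub>C (x - w)"
    note wx = S_involution[OF xw]
    have "(x + w, J w + J x) \<in> E.Int_op root_delta"
      using xw wx by (rule E.Int_op_right(1)[OF root_delta_measurable])
    moreover have "J v = (1 / 2) *\<^sub>C (J w + J x)" by (simp add: v_def J.W_scaleC J.W_add add.commute)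
    ultimately have v: "v \<in> V" unfolding V_iff v_def
      using E.Int_op_right(2)[OF root_delta_measurable, of "x + w" "J w + J x"] by simp
    have "(x + (- 1) *\<^sub>C w, J w + (- 1) *\<^sub>C J x) \<in> E.Int_op root_delta"
      using xw wx by (intro E.Int_op_right[OF root_delta_measurable])
    then have "(u, (- \<i> / 2) *\<^sub>C (J w - J x)) \<in> E.Int_op root_delta"
      unfolding u_def using E.Int_op_right(2)[OF root_delta_measurable, of "x - w" "J w - J x" _ _ "- \<i> / 2"]
      by (simp add: scaleC_minus_left)
    moreover have "J u = (- \<i> / 2) *\<^sub>C (J w - J x)"
      by (simp add: u_def J.W_scaleC J.W_diff scaleC_diff_right scaleC_minus_left)
    ultimately have u: "u \<in> V" unfolding V_iff by simp
    have iu: "\<i> *\<^sub>C u = (1 / 2) *\<^sub>C (x - w)" by (simp add: u_def scaleC_scaleC)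
    have h: "(1 / 2 :: complex) *\<^sub>C z + (1 / 2) *\<^sub>C z = z" for z :: 'h
      by (simp flip: scaleC_add_left)
    have "x = v + \<i> *\<^sub>C u" "w = v - \<i> *\<^sub>C u"
      using h[of x] h[of w] by (simp_all add: iu v_def scaleC_add_right scaleC_diff_right)
    then show ?thesis using u v unfolding tomita_op_def by blast
  qed
  then show ?thesis using V_complex by (auto simp: tomita_op_def)
qed

lemma stand_V: "V \<in> Stand"
  unfolding Stand_def
proof (intro CollectI conjI)
  have z: "(0, 0) \<in> E.Int_op root_delta"
    by (rule E.Int_op_zero[OF root_delta_measurable])
  show "subspace V"
  proof (rule subspaceI)
    show "0 \<in> V" using z by (simp add: V_iff J.W_zero)
    show "x + y \<in> V" if "x \<in> V" "y \<in> V" for x y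
      using that unfolding V_iff J.W_add by (rule E.Int_op_right(1)[OF root_delta_measurable])
    show "c *\<^sub>R x \<in> V" if "x \<in> V" for c x
      using E.Int_op_right(2)[OF root_delta_measurable that[unfolded V_iff] that[unfolded V_iff], of "complex_of_real c"]
      unfolding V_iff J.W_scaleR by (simp only: scaleC_of_real)
  qed
  show "closed V"
    unfolding closed_sequential_limits
  proof (intro allI impI)
    fix u x assume u: "(\<forall>n. u n \<in> V) \<and> u \<longlonglongrightarrow> x"
    then have 1: "(u n, J (u n)) \<in> E.Int_op root_delta" and 2: "u \<longlonglongrightarrow> x" for n
      by (simp_all only: V_iff[symmetric])
    show "x \<in> V" unfolding V_iff
      by (rule E.Int_op_closed[OF root_delta_measurable 1 2 bounded_linear.tendsto[OF J.W_bounded_linear 2]])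
  qed
  show "V \<inter> (\<lambda>v. \<i> *\<^sub>C v) ` V = {0}"
  proof -
    have zero: "x = 0" if "x \<in> V" and v: "v \<in> V" "x = \<i> *\<^sub>C v" for x v
    proof -
      have "(x, \<i> *\<^sub>C J v) \<in> E.Int_op root_delta"
        unfolding v(2) by (rule E.Int_op_right(2)[OF root_delta_measurable]) (use v(1) in \<open>simp_all only: V_iff\<close>)
      moreover have "(x, - (\<i> *\<^sub>C J v)) \<in> E.Int_op root_delta"
        using that(1) unfolding V_iff v(2) by (simp add: J.W_scaleC scaleC_minus_left)
      ultimately have "\<i> *\<^sub>C J v = - (\<i> *\<^sub>C J v)" by (rule E.Int_op_unique[OF root_delta_measurable])
      then have "\<i> *\<^sub>C J v = 0" by (metis add.left_inverse eq_neg_iff_add_eq_0 scaleR_2 scaleR_eq_0_iff zero_neq_numeral)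
      then have "norm v = 0" using J.W_norm[of v] norm_scaleC[of \<i> "J v"] by simp
      then show ?thesis by (simp add: v(2))
    qed
    have 0: "0 \<in> V" using z by (simp add: V_iff J.W_zero)
    show ?thesis
    proof (intro equalityI subsetI)
      fix x assume "x \<in> {0::'h}"
      then show "x \<in> V \<inter> (\<lambda>v. \<i> *\<^sub>C v) ` V" using 0 by (auto intro!: image_eqI[of _ _ 0])
    qed (use zero in blast)
  qed
  have "Domain (E.Int_op root_delta) \<subseteq> {v + \<i> *\<^sub>C w | v w. v \<in> V \<and> w \<in> V}"
  proof
    fix x assume "x \<in> Domain (E.Int_op root_delta)"
    then obtain y where "(x, y) \<in> E.Int_op root_delta" by blast
    then have "(x, J y) \<in> tomita_op V" by (simp add: tomita_op_V invol)
    then show "x \<in> {v + \<i> *\<^sub>C w | v w. v \<in> V \<and> w \<in> V}" by (auto simp: tomita_op_def)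
  qed
  from closure_mono[OF this] show "closure {v + \<i> *\<^sub>C w | v w. v \<in> V \<and> w \<in> V} = UNIV"
    using E.Int_op_dense[OF root_delta_measurable] by auto
qed

text \<open>From \<open>S = J \<Delta>\<^sup>1\<^sup>/\<^sup>2\<close> follows \<open>S\<^sup>* = \<Delta>\<^sup>1\<^sup>/\<^sup>2 J\<close>, so that \<open>S\<^sup>* S\<close> is the square of \<open>\<Delta>\<^sup>1\<^sup>/\<^sup>2\<close>.\<close>

lemma modular_op_V: "modular_op V = E.Int_op (\<lambda>l. complex_of_real (exp (- 2 * pi * l)))"
proof -
  let ?S = "{(x, w). (x, J w) \<in> E.Int_op root_delta}"
  have sa: "adjoint_op (E.Int_op root_delta) = E.Int_op root_delta"
    using E.Int_op_adjoint[OF root_delta_measurable] by simp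
  have "(y, z) \<in> antilinear_adjoint_op ?S \<longleftrightarrow> (J y, z) \<in> E.Int_op root_delta" for y z
  proof -
    have "(y, z) \<in> antilinear_adjoint_op ?S \<longleftrightarrow> (\<forall>x v. (x, v) \<in> E.Int_op root_delta \<longrightarrow> cinner y (J v) = cinner x z)"
      unfolding antilinear_adjoint_op_def by (auto simp: invol) (metis invol)
    also have "\<dots> \<longleftrightarrow> (\<forall>x v. (x, v) \<in> E.Int_op root_delta \<longrightarrow> cinner (J y) v = cinner z x)"
    proof -
      have "cinner y (J v) = cnj (cinner (J y) v)" for v
        using J.W_cinner[of "J y" v] by (simp add: invol)
      moreover have "cinner x z = cnj (cinner z x)" for x by (rule cinner_commute)
      ultimately show ?thesis by simp
    qed
    also have "\<dots> \<longleftrightarrow> (J y, z) \<in> adjoint_op (E.Int_op root_delta)"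
      unfolding adjoint_op_def by auto
    finally show ?thesis unfolding sa .
  qed
  then have "(x, z) \<in> modular_op V \<longleftrightarrow> (\<exists>v. (x, v) \<in> E.Int_op root_delta \<and> (v, z) \<in> E.Int_op root_delta)" for x z
    unfolding modular_op_def tomita_op_V by (auto simp: relcomp_unfold) (metis invol)
  moreover have "(\<exists>v. (x, v) \<in> E.Int_op root_delta \<and> (v, z) \<in> E.Int_op root_delta)
      \<longleftrightarrow> (x, z) \<in> E.Int_op (\<lambda>l. complex_of_real (exp (- 2 * pi * l)))" for x z
  proof -
    let ?D = "\<lambda>l. complex_of_real (exp (- 2 * pi * l))"
    have sq: "(\<lambda>l. root_delta l * root_delta l) = ?D"
      by (rule ext) (simp flip: of_real_mult exp_add)
    \<comment> \<open>The domain of \<open>\<Delta>\<close> lies in that of \<open>\<Delta>\<^sup>1\<^sup>/\<^sup>2\<close> since \<open>\<Delta>\<^sup>1\<^sup>/\<^sup>2 (1 + \<Delta>)\<^sup>-\<^sup>1\<close> is bounded.\<close>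
    have "\<exists>v. (x, v) \<in> E.Int_op root_delta" if xz: "(x, z) \<in> E.Int_op ?D"
    proof -
      define b where "b l = root_delta l / (1 + ?D l)" for l
      have pos: "1 + ?D l \<noteq> 0" for l
      proof -
        have "1 + exp (- 2 * pi * l) > 0" by (simp add: add_pos_pos)
        then have "complex_of_real (1 + exp (- 2 * pi * l)) \<noteq> 0" unfolding of_real_eq_0_iff by linarith
        then show ?thesis by simp
      qed
      have b: "bounded_borel b"
      proof (rule bounded_borelI[where C=1])
        show "b \<in> borel_measurable borel" unfolding b_def by measurable
        fix l
        define e where "e = exp (- pi * l)"
        have e2: "exp (- 2 * pi * l) = e\<^sup>2" by (simp add: e_def power2_eq_square flip: exp_add)
        have "b l = complex_of_real (e / (1 + e\<^sup>2))" unfolding b_def e2 by (simp add: e_def)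
        moreover have "\<bar>e / (1 + e\<^sup>2)\<bar> \<le> 1"
        proof -
          have "0 \<le> e" "0 < 1 + e\<^sup>2" by (simp_all add: e_def add_pos_nonneg)
          moreover from this have "e \<le> 1 + e\<^sup>2" using zero_le_power2[of "e - 1"] unfolding power2_diff by simp
          ultimately show ?thesis by (simp add: field_simps)
        qed
        ultimately show "cmod (b l) \<le> 1" by (simp only: norm_of_real)
      qed
      have "(x, 1 *\<^sub>C x + z) \<in> E.Int_op (\<lambda>l. 1 + ?D l)"
        using xz by (intro E.Int_op_add) (auto simp: E.Int_op_const)
      then have "(x, E.T b (1 *\<^sub>C x + z)) \<in> E.Int_op (\<lambda>l. b l * (1 + ?D l))"
        by (intro E.Int_op_domain[OF _ b]) auto
      moreover have "(\<lambda>l. b l * (1 + ?D l)) = root_delta" using pos by (simp add: b_def)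
      ultimately show ?thesis by auto
    qed
    then show ?thesis using E.Int_op_comp[OF root_delta_measurable root_delta_measurable, unfolded sq] by blast
  qed
  ultimately show ?thesis by (auto simp: set_eq_iff)
qed

lemma op_power_modular_op: "op_power (modular_op V) z = E.Int_op (\<lambda>l. exp (complex_of_real (- 2 * pi * l) * z))"
  unfolding modular_op_V by (rule op_power_Int_op[OF E.pvm_axioms])

text \<open>The polar decomposition determines \<open>J\<close> on the range of \<open>\<Delta>\<^sup>1\<^sup>/\<^sup>2\<close>, which is the domain of
  \<open>\<Delta>\<^sup>-\<^sup>1\<^sup>/\<^sup>2\<close> and hence dense.\<close>

lemma modular_conj_V: "modular_conj V = J"
  unfolding modular_conj_def
proof (rule the_equality)
  have "(\<lambda>l. exp (complex_of_real (- 2 * pi * l) * (1 / 2))) = root_delta"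
    by (rule ext) (simp add: exp_of_real[symmetric])
  then have half: "op_power (modular_op V) (1 / 2) = E.Int_op root_delta"
    unfolding op_power_modular_op by (simp only:)
  have S: "tomita_op V = E.Int_op root_delta O op_graph J"
    unfolding tomita_op_V op_graph_def by (auto simp: relcomp_unfold invol)
  then show "antiunitary J \<and> tomita_op V = op_power (modular_op V) (1 / 2) O op_graph J"
    using anti by (simp add: half)
  fix J' assume J': "antiunitary J' \<and> tomita_op V = op_power (modular_op V) (1 / 2) O op_graph J'"
  interpret J': symmetry J' cnj "-1" using J' by (intro symmetry_antiunitary) simp
  have eq: "J' v = J v" if xv: "(x, v) \<in> E.Int_op root_delta" for x v
  proof -
    have "(x, J' v) \<in> E.Int_op root_delta O op_graph J" 
      using J' xv unfolding half S by (auto simp: op_graph_def)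
    then show ?thesis using E.Int_op_unique[OF root_delta_measurable xv] by (auto simp: op_graph_def)
  qed
  have "Domain (E.Int_op (\<lambda>l. complex_of_real (exp (pi * l)))) \<subseteq> {v. J' v = J v}"
    using eq root_delta_inverse by blast
  moreover have "closed {v. J' v = J v}"
    by (intro closed_Collect_eq linear_continuous_on J.W_bounded_linear J'.W_bounded_linear)
  ultimately have "closure (Domain (E.Int_op (\<lambda>l. complex_of_real (exp (pi * l))))) \<subseteq> {v. J' v = J v}"
    by (rule closure_minimal)
  moreover have "closure (Domain (E.Int_op (\<lambda>l. complex_of_real (exp (pi * l))))) = UNIV"
    by (rule E.Int_op_dense) measurable
  ultimately show "J' = J" by auto
qed

lemma stand_flow_V: "stand_flow V t X = blinfun_apply (\<eta> (exp t)) ` X"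
proof -
  have "(\<lambda>l. exp (complex_of_real (- 2 * pi * l) * (- \<i> * complex_of_real t / complex_of_real (2 * pi)))) = (\<lambda>l. iexp (t * l))"
    by (rule ext) (simp add: field_simps)
  then have "op_power (modular_op V) (- \<i> * complex_of_real t / complex_of_real (2 * pi)) = E.Int_op (\<lambda>l. iexp (t * l))"
    unfolding op_power_modular_op by (simp only:)
  then show ?thesis
    unfolding stand_flow_def using log E.Int_op_iff_T[OF bounded_iexp] 
    by (auto simp: log_pvm_def Image_def)
qed

end

text \<open>Real coefficients are what an operator that may be antilinear respects.\<close>

lemma (in intertwiner) intertwines_T:
  assumes f: "f \<in> borel_measurable borel" "\<And>l. \<bar>f l\<bar> \<le> b"
  shows "C (E.T (\<lambda>l. complex_of_real (f l)) x) = F.T (\<lambda>l. complex_of_real (f l)) (C x)"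
proof -
  have bf: "bounded_borel (\<lambda>l. complex_of_real (f l))"
    using f by (intro bounded_borelI[where C=b]) auto
  obtain K s where s: "\<And>n. simple_function borel (s n)" "K > 0" "\<And>n l. cmod (s n l) \<le> K"
    "\<And>l. (\<lambda>n. s n l) \<longlonglongrightarrow> complex_of_real (f l)" "\<And>l. cmod (complex_of_real (f l)) \<le> K"
    using simple_approximation[OF bf] by metis
  define u where "u n l = complex_of_real (Re (s n l))" for n l
  have u: "simple_function borel (u n)" "cmod (u n l) \<le> K" "(\<lambda>n. u n l) \<longlonglongrightarrow> complex_of_real (f l)" for n l
  proof -
    show "simple_function borel (u n)"
      unfolding u_def by (rule simple_function_compose1[OF s(1), of "\<lambda>c. complex_of_real (Re c)"])
    show "cmod (u n l) \<le> K"
      using order_trans[OF abs_Re_le_cmod s(3)] by (simp add: u_def)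
    have "(\<lambda>n. u n l) \<longlonglongrightarrow> complex_of_real (Re (complex_of_real (f l)))"
      unfolding u_def by (intro tendsto_intros s(4))
    then show "(\<lambda>n. u n l) \<longlonglongrightarrow> complex_of_real (f l)" by simp
  qed
  have C_sum: "C (\<Sum>c\<in>A. g c) = (\<Sum>c\<in>A. C (g c))" for A and g :: "complex \<Rightarrow> _"
    by (rule linear_sum[OF bounded_linear.linear[OF linear_C]])
  have S: "C (E.S (u n) x) = F.S (u n) (C x)" for n
    unfolding u_def E.S_comp[OF s(1), of "\<lambda>c. complex_of_real (Re c)"] F.S_comp[OF s(1), of "\<lambda>c. complex_of_real (Re c)"]
    by (simp add: C_sum scaleC_of_real C_scaleR intertwines E.simple_vimage[OF s(1)])
  have "(\<lambda>n. C (E.S (u n) x)) \<longlonglongrightarrow> C (E.T (\<lambda>l. complex_of_real (f l)) x)"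
    by (rule bounded_linear.tendsto[OF linear_C E.S_tendsto_T[OF bf u]])
  moreover have "(\<lambda>n. F.S (u n) (C x)) \<longlonglongrightarrow> F.T (\<lambda>l. complex_of_real (f l)) (C x)"
    by (rule F.S_tendsto_T[OF bf u])
  ultimately show ?thesis unfolding S by (rule LIMSEQ_unique)
qed

lemma (in pvm) E_incseq_Union:
  assumes "range B \<subseteq> sets borel" "incseq B"
  shows "(\<lambda>n. E (B n) x) \<longlonglongrightarrow> E (\<Union>n. B n) x"
proof -
  have Bs: "B n \<in> sets borel" "(\<Union>n. B n) \<in> sets borel" for n using assms(1) by auto
  have "(\<lambda>n. T (indicator (B n)) x) \<longlonglongrightarrow> T (indicator (\<Union>n. B n)) x"
  proof (rule T_tendsto[where C=1])
    show "(\<lambda>n. indicator (B n) l :: complex) \<longlonglongrightarrow> indicator (\<Union>n. B n) l" for l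
      by (rule LIMSEQ_indicator_incseq[OF assms(2)])
  qed (use Bs in \<open>auto simp: indicator_def\<close>)
  then show ?thesis by (simp only: T_indicator Bs)
qed

text \<open>On the range of \<open>E (B n)\<close>, for \<open>B n\<close> bounded and away from 0 on the negative half line, the
  quadratic form is \<open>- \<parallel>s x\<parallel>\<^sup>2\<close> with the invertible function \<open>s = \<surd>-l\<close>.\<close>

lemma (in pvm) E_negative_null:
  assumes pos: "\<And>x y. (x, y) \<in> Int_op complex_of_real \<Longrightarrow> 0 \<le> Re (cinner x y)"
  shows "E {..<0} x = 0"
proof -
  define B where "B n = {- real (Suc n)..- (1 / real (Suc n))}" for n
  have Bs [measurable]: "B n \<in> sets borel" for n by (simp add: B_def)
  have idm: "complex_of_real \<in> borel_measurable borel" by measurable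
  have zero: "E (B n) x = 0" for n
  proof -
    define y where "y = E (B n) x"
    let ?f = "trunc (B n) complex_of_real"
    define s r where "s = trunc (B n) (\<lambda>l. complex_of_real (sqrt (- l)))" 
      and "r = trunc (B n) (\<lambda>l. 1 / complex_of_real (sqrt (- l)))"
    have inB: "0 < - l" "- l \<le> real (Suc n)" "1 / real (Suc n) \<le> - l" if "l \<in> B n" for l
    proof -
      have "0 < 1 / real (Suc n)" by simp
      moreover have "- real (Suc n) \<le> l" "l \<le> - (1 / real (Suc n))"
        using that by (simp_all only: B_def atLeastAtMost_iff)
      ultimately show "0 < - l" "- l \<le> real (Suc n)" "1 / real (Suc n) \<le> - l" by linarith+
    qed
    have fb: "bounded_borel ?f"
    proof (rule bounded_borelI[where C="real (Suc n)"])
      show "?f \<in> borel_measurable borel" unfolding trunc_def by measurable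
      show "cmod (?f l) \<le> real (Suc n)" for l
        using inB[of l] by (cases "l \<in> B n") (auto simp: trunc_def indicator_def)
    qed
    have sb: "bounded_borel s"
    proof (rule bounded_borelI[where C="sqrt (real (Suc n))"])
      show "s \<in> borel_measurable borel" unfolding s_def trunc_def by measurable
      show "cmod (s l) \<le> sqrt (real (Suc n))" for l
        using inB[of l] by (cases "l \<in> B n") (auto simp: s_def trunc_def indicator_def)
    qed
    have rb: "bounded_borel r"
    proof (rule bounded_borelI[where C="sqrt (real (Suc n))"])
      show "r \<in> borel_measurable borel" unfolding r_def trunc_def by measurable
      show "cmod (r l) \<le> sqrt (real (Suc n))" for l
      proof (cases "l \<in> B n")
        case True
        have "1 / - l \<le> real (Suc n)" using inB[OF True] by (simp add: field_simps)
        then have "sqrt (1 / - l) \<le> sqrt (real (Suc n))" by (rule real_sqrt_le_mono)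
        then have "1 / sqrt (- l) \<le> sqrt (real (Suc n))" by (simp only: real_sqrt_divide real_sqrt_one)
        moreover have "cmod (r l) = 1 / sqrt (- l)"
          using True inB(1)[OF True] by (simp add: r_def trunc_def norm_divide)
        ultimately show ?thesis by (simp only:)
      qed (simp add: r_def trunc_def)
    qed
    have rs: "(\<lambda>l. r l * s l) = indicator (B n)"
    proof
      fix l show "r l * s l = indicator (B n) l"
        using inB(1)[of l] by (cases "l \<in> B n") (auto simp: r_def s_def trunc_def)
    qed
    have ss: "?f = (\<lambda>l. (- 1) * (s l * s l))"
    proof
      fix l show "?f l = (- 1) * (s l * s l)"
        using inB(1)[of l] by (cases "l \<in> B n") (auto simp: s_def trunc_def simp flip: of_real_mult)
    qed
    have ys: "E (B n) y = y" unfolding y_def by (rule E_idem[OF Bs])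
    have yz: "(y, T ?f x) \<in> Int_op complex_of_real"
    proof -
      have "(x, y) \<in> Int_op (indicator (B n))" 
        by (simp add: y_def Int_op_iff_T bounded_borel_indicator Bs T_indicator)
      moreover have "(x, T ?f x) \<in> Int_op (\<lambda>l. complex_of_real l * indicator (B n) l)"
        using Int_op_T[OF fb, of x] by (simp add: trunc_def mult.commute)
      ultimately show ?thesis using Int_op_comp[of "indicator (B n)" complex_of_real x y] idm Bs by simp
    qed
    have ssb: "bounded_borel (\<lambda>l. s l * s l)" by (rule bounded_borel_mult[OF sb sb])
    have "cinner y (T ?f x) = cinner x (E (B n) (T ?f x))" unfolding y_def by (rule E_sym[OF Bs])
    also have "\<dots> = cinner x (T ?f x)"
    proof -
      have "trunc (B n) ?f = ?f" by (rule ext) (simp add: trunc_def indicator_def)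
      then show ?thesis using T_trunc[OF Bs fb, of n x] by simp
    qed
    also have "\<dots> = - cinner (T (\<lambda>l. cnj (s l)) x) (T s x)"
    proof -
      have "T ?f x = (- 1) *\<^sub>C T s (T s x)"
        unfolding ss T_scaleC[OF ssb] T_mult[OF sb sb] ..
      then show ?thesis by (simp only: cinner_scaleC_right T_adjoint[OF sb]) simp
    qed
    also have "(\<lambda>l. cnj (s l)) = s" by (rule ext) (simp add: s_def trunc_def indicator_def)
    finally have "(norm (T s x))\<^sup>2 \<le> 0" using pos[OF yz] by (simp add: cinner_self)
    then have "T s x = 0" by simp
    then show ?thesis using T_mult[OF rb sb, of x] by (simp add: rs T_indicator Bs rb)
  qed
  have inc: "incseq B"
  proof (rule incseq_SucI)
    fix n
    have "1 / real (Suc (Suc n)) \<le> 1 / real (Suc n)" by (simp add: frac_le)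
    then show "B n \<le> B (Suc n)" by (auto simp: B_def)
  qed
  have "l \<in> (\<Union>n. B n)" if "l < 0" for l
  proof -
    obtain a b :: nat where "- l \<le> real a" "1 / - l \<le> real b" using real_arch_simple by metis
    then have "- l \<le> real (Suc (max a b))" "1 / - l \<le> real (Suc (max a b))" by auto
    then have "l \<in> B (max a b)" using that by (auto simp: B_def field_simps)
    then show ?thesis by blast
  qed
  moreover have "l < 0" if "l \<in> B n" for l n
  proof -
    have "0 < 1 / real (Suc n)" by simp
    moreover have "l \<le> - (1 / real (Suc n))" using that by (simp only: B_def atLeastAtMost_iff)
    ultimately show ?thesis by linarith
  qed
  ultimately have un: "(\<Union>n. B n) = {..<0}" by auto
  have "(\<lambda>n. E (B n) x) \<longlonglongrightarrow> E {..<0} x"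
    using E_incseq_Union[of B x] inc Bs unfolding un by blast
  then show ?thesis unfolding zero by (simp add: LIMSEQ_const_iff)
qed

lemma (in pvm) E_eigenvector:
  "(E {a} x, complex_of_real a *\<^sub>C E {a} x) \<in> Int_op complex_of_real"
proof -
  have "(x, E {a} x) \<in> Int_op (indicator {a})"
    by (simp add: Int_op_iff_T bounded_borel_indicator T_indicator)
  moreover have "(\<lambda>l. complex_of_real l * indicator {a} l) = (\<lambda>l. complex_of_real a * indicator {a} l)"
    by (rule ext) (simp add: indicator_def)
  moreover have "(x, complex_of_real a *\<^sub>C E {a} x) \<in> Int_op (\<lambda>l. complex_of_real a * indicator {a} l)"
    by (subst Int_op_iff_T) (simp_all add: bounded_borel_mult bounded_borel_indicator T_scaleC T_indicator)
  ultimately show ?thesis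
    using Int_op_comp[of "indicator {a}" complex_of_real x "E {a} x"] by simp
qed

section \<open>Every standard subspace comes from a homomorphism\<close>

text \<open>The real orthogonal projections onto \<open>V\<close> and \<open>\<i> V\<close> have a complex linear sum \<open>R\<close> and an
  antilinear difference \<open>K\<close>, with \<open>K\<^sup>2 = R (2 - R)\<close> and \<open>K R = (2 - R) K\<close>. All modular
  objects are bounded functions of \<open>R\<close>, or limits of such, multiplied by \<open>K\<close>:
  \<open>\<Delta> = (2 - R) / R\<close>, and \<open>J\<close> is the phase of \<open>K\<close>.\<close>

locale standard_subspace =
  fixes V :: "'h::complex_hilbert_space set"
  assumes V: "V \<in> Stand"
begin

lemma sub: "subspace V" "closed V" and separating: "V \<inter> (\<lambda>v. \<i> *\<^sub>C v) ` V = {0}"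
  and cyclic: "closure {v + \<i> *\<^sub>C w | v w. v \<in> V \<and> w \<in> V} = UNIV"
  using V by (auto simp: Stand_def)

abbreviation P where "P \<equiv> proj V"

definition Q :: "'h \<Rightarrow> 'h" where "Q x = \<i> *\<^sub>C P (- (\<i> *\<^sub>C x))"

definition R :: "'h \<Rightarrow> 'h" where "R x = P x + Q x"

definition K :: "'h \<Rightarrow> 'h" where "K x = P x - Q x"

lemma P_minus: "P (- x) = - P x"
  using proj_scaleR[OF sub, of "-1" x] by simp

lemma P_diff: "P (x - y) = P x - P y"
  using proj_add[OF sub, of x "- y"] by (simp add: P_minus)

lemma P_i: "P (\<i> *\<^sub>C x) = \<i> *\<^sub>C Q x" and Q_i: "Q (\<i> *\<^sub>C x) = \<i> *\<^sub>C P x"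
  by (simp_all add: Q_def P_minus)

lemma Q_add: "Q (x + y) = Q x + Q y" and Q_scaleR: "Q (r *\<^sub>R x) = r *\<^sub>R Q x"
proof -
  have "- (\<i> *\<^sub>C (x + y)) = - (\<i> *\<^sub>C x) + - (\<i> *\<^sub>C y)" by (simp add: scaleC_add_right)
  then show "Q (x + y) = Q x + Q y" unfolding Q_def by (simp only: proj_add[OF sub] scaleC_add_right)
  have "- (\<i> *\<^sub>C (r *\<^sub>R x)) = r *\<^sub>R (- (\<i> *\<^sub>C x))" by (simp add: scaleC_scaleR)
  then show "Q (r *\<^sub>R x) = r *\<^sub>R Q x" unfolding Q_def by (simp only: proj_scaleR[OF sub] scaleC_scaleR)
qed

lemma Q_minus: "Q (- x) = - Q x"
  using Q_scaleR[of "-1" x] by simp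

lemma Q_diff: "Q (x - y) = Q x - Q y"
  using Q_add[of x "- y"] by (simp add: Q_minus)

lemma Q_idem: "Q (Q x) = Q x"
  unfolding Q_def by (simp add: proj_idem[OF sub])

lemma Q_sym: "inner (Q x) y = inner x (Q y)"
proof -
  have "inner (Q x) y = - inner (P (- (\<i> *\<^sub>C x))) (\<i> *\<^sub>C y)" by (simp add: Q_def inner_i_left)
  also have "\<dots> = inner (P (\<i> *\<^sub>C x)) (\<i> *\<^sub>C y)" by (simp add: P_minus)
  also have "\<dots> = inner (\<i> *\<^sub>C x) (P (\<i> *\<^sub>C y))" by (rule proj_sym[OF sub])
  also have "\<dots> = inner x (Q y)" by (simp add: P_i inner_i_i)
  finally show ?thesis .
qed

lemma inner_Q: "inner x (Q x) = (norm (Q x))\<^sup>2"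
  by (metis Q_idem Q_sym power2_norm_eq_inner)

lemma Q_norm: "norm (Q x) \<le> norm x"
  using norm_proj_le[OF sub, of "- (\<i> *\<^sub>C x)"] by (simp add: Q_def norm_scaleC)

lemma Q_fixed: "Q x = x \<Longrightarrow> \<exists>v\<in>V. x = \<i> *\<^sub>C v"
  using proj(1)[OF sub] unfolding Q_def by metis

lemma bounded_linear_Q: "bounded_linear Q"
  by (rule bounded_linear_intro[where K=1]) (simp_all add: Q_add Q_scaleR Q_norm)

lemma bounded_linear_R: "bounded_linear R"
  unfolding R_def[abs_def] by (intro bounded_linear_add bounded_linear_proj[OF sub] bounded_linear_Q)

lemma bounded_linear_K: "bounded_linear K"
  unfolding K_def[abs_def] by (intro bounded_linear_sub bounded_linear_proj[OF sub] bounded_linear_Q)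

lemma R_add: "R (x + y) = R x + R y" and R_scaleR: "R (r *\<^sub>R x) = r *\<^sub>R R x" and R_diff: "R (x - y) = R x - R y"
  by (simp_all add: R_def proj_add[OF sub] proj_scaleR[OF sub] P_diff Q_add Q_scaleR Q_diff scaleR_add_right)

lemma R_i: "R (\<i> *\<^sub>C x) = \<i> *\<^sub>C R x"
  by (simp add: R_def P_i Q_i scaleC_add_right add.commute)

lemma R_scaleC: "R (a *\<^sub>C x) = a *\<^sub>C R x"
  by (simp add: scaleC_eq[of a] R_add R_scaleR R_i)

lemma K_i: "K (\<i> *\<^sub>C x) = - (\<i> *\<^sub>C K x)"
  by (simp add: K_def P_i Q_i scaleC_diff_right)

lemma K_add: "K (x + y) = K x + K y" and K_scaleR: "K (r *\<^sub>R x) = r *\<^sub>R K x"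
  by (simp_all add: K_def proj_add[OF sub] proj_scaleR[OF sub] Q_add Q_scaleR scaleR_diff_right)

lemma K_diff: "K (x - y) = K x - K y"
  by (simp add: K_def P_diff Q_diff)

lemma R_sym: "cinner (R x) y = cinner x (R y)"
proof -
  have "inner (R x) z = inner x (R z)" for z
    by (simp add: R_def inner_add_left inner_add_right proj_sym[OF sub] Q_sym)
  then show ?thesis by (simp add: cinner_eq flip: R_i)
qed

lemma K_sym: "inner (K x) y = inner x (K y)"
  by (simp add: K_def inner_diff_left inner_diff_right proj_sym[OF sub] Q_sym)

lemma K_square: "K (K x) = R (2 *\<^sub>R x - R x)"
  by (simp add: K_def R_def P_diff Q_diff Q_add Q_scaleR proj_add[OF sub] proj_scaleR[OF sub] proj_idem[OF sub] Q_idem scaleR_2)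

lemma K_R: "K (R x) = 2 *\<^sub>R K x - R (K x)"
  by (simp add: K_def R_def P_diff Q_diff Q_add proj_add[OF sub] proj_idem[OF sub] Q_idem scaleR_2)

text \<open>A vector orthogonal to \<open>V\<close> and \<open>\<i> V\<close> vanishes because \<open>V + \<i> V\<close> is dense.\<close>

lemma R_injective: "R x = 0 \<Longrightarrow> x = 0"
proof -
  assume "R x = 0"
  then have "inner x (P x) + inner x (Q x) = 0" by (metis R_def inner_add_right inner_zero_right)
  then have "(norm (P x))\<^sup>2 + (norm (Q x))\<^sup>2 = 0" by (simp add: inner_proj[OF sub] inner_Q)
  then have PQ: "P x = 0" "Q x = 0" by (simp_all add: sum_power2_eq_zero_iff)
  have "inner x (v + \<i> *\<^sub>C w) = 0" if vw: "v \<in> V" "w \<in> V" for v w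
  proof -
    have "inner x v = 0" using proj(2)[OF sub vw(1), of x] PQ by simp
    moreover have "P (\<i> *\<^sub>C x) = 0" using PQ by (simp add: P_i)
    then have "inner (\<i> *\<^sub>C x) w = 0" using proj(2)[OF sub vw(2), of "\<i> *\<^sub>C x"] by simp
    ultimately show ?thesis by (simp add: inner_add_right inner_i_left)
  qed
  then have "{v + \<i> *\<^sub>C w | v w. v \<in> V \<and> w \<in> V} \<subseteq> {y. inner x y = 0}" by blast
  moreover have "closed {y. inner x y = 0}" by (intro closed_Collect_eq continuous_intros)
  ultimately have "closure {v + \<i> *\<^sub>C w | v w. v \<in> V \<and> w \<in> V} \<subseteq> {y. inner x y = 0}" by (rule closure_minimal)
  then have "inner x x = 0" unfolding cyclic by blast
  then show "x = 0" by simp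
qed

text \<open>The eigenvalue 2 would require a vector fixed by both projections, that is, in
  \<open>V \<inter> \<i> V\<close>.\<close>

lemma R_two: "R x = 2 *\<^sub>R x \<Longrightarrow> x = 0"
proof -
  assume R2: "R x = 2 *\<^sub>R x"
  have expand: "(norm (x - z))\<^sup>2 = inner x x - inner x z" if "inner x z = (norm z)\<^sup>2" for z
  proof -
    have "(norm (x - z))\<^sup>2 = inner x x - inner x z - (inner z x - inner z z)"
      by (simp only: power2_norm_eq_inner inner_diff_left inner_diff_right)
    moreover have "inner z x = inner z z" using that by (metis inner_commute power2_norm_eq_inner)
    ultimately show ?thesis by (simp only: diff_self diff_0_right)
  qed
  have "(norm (x - P x))\<^sup>2 + (norm (x - Q x))\<^sup>2 = 2 * inner x x - inner x (R x)"
    unfolding expand[OF inner_proj[OF sub]] expand[OF inner_Q] R_def inner_add_right by linarith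
  also have "\<dots> = 0" by (simp only: R2 inner_scaleR_right)
  finally have "x - P x = 0" "x - Q x = 0"
    using sum_power2_eq_zero_iff[of "norm (x - P x)" "norm (x - Q x)"] by simp_all
  then have "P x = x" "Q x = x" by simp_all
  then have "x \<in> V" "\<exists>v\<in>V. x = \<i> *\<^sub>C v" using proj_fixed[OF sub] Q_fixed by auto
  then have "x \<in> V \<inter> (\<lambda>v. \<i> *\<^sub>C v) ` V" by blast
  then show "x = 0" unfolding separating by simp
qed

lemma inner_R: "inner x (R x) = (norm (P x))\<^sup>2 + (norm (Q x))\<^sup>2"
  by (simp add: R_def inner_add_right inner_proj[OF sub] inner_Q)

lemma inner_two_minus_R: "0 \<le> inner x (2 *\<^sub>R x - R x)"
proof -
  have "(norm (P x))\<^sup>2 \<le> (norm x)\<^sup>2" "(norm (Q x))\<^sup>2 \<le> (norm x)\<^sup>2"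
    using norm_proj_le[OF sub] Q_norm by (auto intro: power_mono)
  moreover have "inner x (2 *\<^sub>R x - R x) = 2 * (norm x)\<^sup>2 - ((norm (P x))\<^sup>2 + (norm (Q x))\<^sup>2)"
    by (simp add: inner_diff_right inner_R power2_norm_eq_inner[of x])
  ultimately show ?thesis by linarith
qed

sublocale R: bounded_selfadjoint R
  by (rule bounded_selfadjoint.intro[OF bounded_linear_R R_scaleC R_sym])

definition F :: "real set \<Rightarrow> 'h \<Rightarrow> 'h" where
  "F = (SOME F. pvm F \<and> (\<forall>x y. (x, y) \<in> spectral_integral F complex_of_real \<longleftrightarrow> y = R x))"

lemma F_props: "pvm F" "(x, y) \<in> spectral_integral F complex_of_real \<longleftrightarrow> y = R x"
  using someI_ex[OF R.spectral_theorem] unfolding F_def by blast+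

sublocale F: pvm F by (rule F_props(1))

lemma idm: "complex_of_real \<in> borel_measurable borel" by measurable

lemma flip_measurable: "(\<lambda>l::real. 2 - l) \<in> borel_measurable borel" by measurable

lemma flip_op: "(x, y) \<in> spectral_integral (push (\<lambda>l. 2 - l) F) complex_of_real \<longleftrightarrow> y = 2 *\<^sub>R x - R x"
proof -
  have *: "spectral_integral (push (\<lambda>l. 2 - l) F) complex_of_real = F.Int_op (\<lambda>l. complex_of_real (2 - l))"
    by (rule F.Int_op_push[OF flip_measurable idm])
  have fm: "(\<lambda>l. complex_of_real (2 - l)) \<in> borel_measurable borel" by measurable
  have "(x, R x) \<in> F.Int_op complex_of_real" using F_props(2) by blast
  then have "(x, T) \<in> F.Int_op (\<lambda>l. (- 1) * complex_of_real l)" if "T = - R x" for T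
    using F.Int_op_comp[OF idm, of "\<lambda>_. -1" x "R x" T] that by (simp add: F.Int_op_const scaleC_minus_left)
  then have "(x, 2 *\<^sub>C x + - R x) \<in> F.Int_op (\<lambda>l. 2 + (- 1) * complex_of_real l)"
    by (intro F.Int_op_add) (auto simp: F.Int_op_const)
  moreover have "2 *\<^sub>C x + - R x = 2 *\<^sub>R x - R x" using scaleC_of_real[of 2 x] by simp
  ultimately have "(x, 2 *\<^sub>R x - R x) \<in> F.Int_op (\<lambda>l. complex_of_real (2 - l))" by simp
  then show ?thesis unfolding * using F.Int_op_unique[OF fm] by blast
qed

text \<open>\<open>0 \<le> R \<le> 2\<close>, and neither end point is an eigenvalue.\<close>

lemma F_support: "F {0<..<2} x = x"
proof -
  interpret G: pvm "push (\<lambda>l. 2 - l) F" by (rule F.pvm_push[OF flip_measurable])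
  have "F {..<0} x = 0"
    by (rule F.E_negative_null) (simp add: F_props(2) Re_cinner inner_R)
  moreover have "F {2<..} x = 0"
  proof -
    have "push (\<lambda>l. 2 - l) F {..<0} x = 0"
      by (rule G.E_negative_null) (simp add: flip_op Re_cinner inner_two_minus_R)
    moreover have "(\<lambda>l. 2 - l) -` {..<0} = {2::real<..}" by auto
    ultimately show ?thesis by (simp add: push_def)
  qed
  moreover have "F {0} x = 0"
    using F.E_eigenvector[of 0 x] R_injective unfolding F_props(2) by simp
  moreover have "F {2} x = 0"
    using F.E_eigenvector[of 2 x] R_two[of "F {2} x"] unfolding F_props(2) scaleC_of_real by simp
  moreover have "F (({..<0} \<union> {0}) \<union> ({2} \<union> {2<..})) x = F {..<0} x + F {0} x + (F {2} x + F {2<..} x)"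
  proof -
    have "F ({..<0} \<union> {0}) x = F {..<0} x + F {0} x" "F ({2} \<union> {2<..}) x = F {2} x + F {2<..} x"
      by (rule F.E_Un; simp)+
    moreover have "F (({..<0} \<union> {0}) \<union> ({2} \<union> {2<..})) x = F ({..<0} \<union> {0}) x + F ({2} \<union> {2<..}) x"
      by (rule F.E_Un) auto
    ultimately show ?thesis by (simp only:)
  qed
  moreover have "UNIV - (({..<0} \<union> {0}) \<union> ({2} \<union> {2<..})) = {0::real<..<2}" by auto
  moreover have "({..<0} \<union> {0}) \<union> ({2} \<union> {2<..}) \<in> sets (borel :: real measure)" by auto
  ultimately show ?thesis using F.E_compl[of "({..<0} \<union> {0}) \<union> ({2} \<union> {2<..})" x] by simp
qed

text \<open>\<open>K R = (2 - R) K\<close> says that \<open>K\<close> intertwines \<open>F\<close> with its reflection \<open>l \<mapsto> 2 - l\<close>.\<close>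

lemma K_T:
  assumes f: "f \<in> borel_measurable borel" "\<And>l. \<bar>f l\<bar> \<le> b"
  shows "K (F.T (\<lambda>l. complex_of_real (f l)) x) = F.T (\<lambda>l. complex_of_real (f (2 - l))) (K x)"
proof -
  interpret I: intertwiner F "push (\<lambda>l. 2 - l) F" K
  proof (intro intertwiner.intro intertwiner_axioms.intro F.pvm_axioms F.pvm_push[OF flip_measurable] bounded_linear_K)
    show "(K x, K y) \<in> spectral_integral (push (\<lambda>l. 2 - l) F) complex_of_real"
      if "(x, y) \<in> F.Int_op complex_of_real" for x y
      using that by (simp add: F_props(2) flip_op K_R)
  qed
  have "bounded_borel (\<lambda>l. complex_of_real (f l))" using f by (intro bounded_borelI[where C=b]) auto
  then show ?thesis using I.intertwines_T[OF f] F.T_push[OF flip_measurable] by simp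
qed

end

lemma (in pvm) unitary_T_iexp: "unitary (T (\<lambda>l. iexp (t * l)))"
  and T_iexp_add: "T (\<lambda>l. iexp ((s + t) * l)) x = T (\<lambda>l. iexp (s * l)) (T (\<lambda>l. iexp (t * l)) x)"
  and T_iexp_zero: "T (\<lambda>l. iexp (0 * l)) x = x"
proof -
  show zero: "T (\<lambda>l. iexp (0 * l)) x = x" for x
    by (simp add: T_const)
  show add: "T (\<lambda>l. iexp ((s + t) * l)) x = T (\<lambda>l. iexp (s * l)) (T (\<lambda>l. iexp (t * l)) x)" for s t x
  proof -
    have "(\<lambda>l. iexp ((s + t) * l)) = (\<lambda>l. iexp (s * l) * iexp (t * l))"
      by (rule ext) (simp add: distrib_right distrib_left exp_add)
    then show ?thesis by (simp only: T_mult[OF bounded_iexp bounded_iexp])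
  qed
  have inverse: "T (\<lambda>l. iexp (t * l)) (T (\<lambda>l. iexp ((- t) * l)) x) = x" for t x
    using add[of t "- t" x] unfolding add.right_inverse zero by (rule sym)
  have cnj: "(\<lambda>l. cnj (iexp (t * l))) = (\<lambda>l. iexp ((- t) * l))"
    by (rule ext) (simp add: exp_cnj)
  have isometry: "cinner (T (\<lambda>l. iexp (t * l)) x) (T (\<lambda>l. iexp (t * l)) y) = cinner x y" for x y
    using inverse[of "- t" x] unfolding T_adjoint[OF bounded_iexp] cnj by simp
  show "unitary (T (\<lambda>l. iexp (t * l)))"
    unfolding unitary_def
    using isometry by (intro conjI allI T_add_right T_scaleC_right bounded_iexp surjI[where f="T (\<lambda>l. iexp ((- t) * l))"] inverse)
qed

context standard_subspace
begin

definition D :: "(real \<Rightarrow> real) \<Rightarrow> 'h \<Rightarrow> 'h" where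
  "D f = F.T (\<lambda>l. complex_of_real (f l))"

abbreviation bounded_real :: "(real \<Rightarrow> real) \<Rightarrow> bool" where
  "bounded_real f \<equiv> bounded_borel (\<lambda>l. complex_of_real (f l))"

lemma bounded_realI: "f \<in> borel_measurable borel \<Longrightarrow> (\<And>l. \<bar>f l\<bar> \<le> b) \<Longrightarrow> bounded_real f"
  by (rule bounded_borelI[where C=b]) auto

lemma D_mult: "bounded_real f \<Longrightarrow> bounded_real g \<Longrightarrow> D (\<lambda>l. f l * g l) x = D f (D g x)"
  unfolding D_def of_real_mult by (rule F.T_mult)

lemma D_diff: "bounded_real f \<Longrightarrow> bounded_real g \<Longrightarrow> D (\<lambda>l. f l - g l) x = D f x - D g x"
  unfolding D_def of_real_diff by (rule F.T_diff)

lemma D_graph: "bounded_real f \<Longrightarrow> (x, y) \<in> F.Int_op (\<lambda>l. complex_of_real (f l)) \<longleftrightarrow> y = D f x"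
  unfolding D_def by (rule F.Int_op_iff_T)

lemma D_add_right: "bounded_real f \<Longrightarrow> D f (x + y) = D f x + D f y"
  and D_diff_right: "bounded_real f \<Longrightarrow> D f (x - y) = D f x - D f y"
  and D_scaleC_right: "bounded_real f \<Longrightarrow> D f (a *\<^sub>C x) = a *\<^sub>C D f x"
  and bounded_linear_D: "bounded_real f \<Longrightarrow> bounded_linear (D f)"
  unfolding D_def by (rule F.T_add_right F.T_diff_right F.T_scaleC_right F.bounded_linear_T; assumption)+

lemma D_sym: "bounded_real f \<Longrightarrow> cinner (D f x) y = cinner x (D f y)"
  unfolding D_def by (simp add: F.T_adjoint)

lemma K_D:
  assumes "bounded_real f"
  shows "K (D f x) = D (\<lambda>l. f (2 - l)) (K x)"
proof -
  obtain b where m: "(\<lambda>l. complex_of_real (f l)) \<in> borel_measurable borel"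
    and b: "\<And>l. cmod (complex_of_real (f l)) \<le> b"
    using assms by (elim bounded_borelE) blast
  have "f \<in> borel_measurable borel" using measurable_compose[OF m borel_measurable_Re] by simp
  then show ?thesis unfolding D_def by (rule K_T[where b=b]) (use b in simp)
qed

text \<open>The identity function, cut off outside the spectrum of \<open>R\<close> so that it is bounded.\<close>

definition clip :: "real \<Rightarrow> real" where "clip l = max 0 (min 2 l)"

definition k :: "real \<Rightarrow> real" where "k l = sqrt (clip l) * sqrt (2 - clip l)"

definition A :: "nat \<Rightarrow> real set" where "A n = {l. 1 / real (Suc n) \<le> k l}"

definition g :: "nat \<Rightarrow> real \<Rightarrow> real" where "g n l = indicator (A n) l / k l"

lemma clip_bounds: "0 \<le> clip l" "clip l \<le> 2" and clip_flip: "clip (2 - l) = 2 - clip l"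
  and clip_eq: "0 < l \<Longrightarrow> l < 2 \<Longrightarrow> clip l = l"
  by (auto simp: clip_def)

lemma clip_measurable [measurable]: "clip \<in> borel_measurable borel"
  and k_measurable [measurable]: "k \<in> borel_measurable borel"
  unfolding clip_def[abs_def] k_def[abs_def] by measurable

lemma A_sets [measurable]: "A n \<in> sets borel"
  unfolding A_def by measurable

lemma k_flip: "k (2 - l) = k l"
  by (simp add: k_def clip_flip mult.commute)

lemma k_nonneg: "0 \<le> k l" and k_square: "k l * k l = clip l * (2 - clip l)"
  using clip_bounds[of l] by (simp_all add: k_def algebra_simps)

lemma k_bound: "\<bar>k l\<bar> \<le> 2"
proof -
  have "k l \<le> sqrt 2 * sqrt 2"
    unfolding k_def using clip_bounds[of l] by (intro mult_mono real_sqrt_le_mono) auto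
  then show ?thesis using k_nonneg[of l] by simp
qed

lemma k_pos: "0 < l \<Longrightarrow> l < 2 \<Longrightarrow> 0 < k l"
  by (simp add: k_def clip_eq)

lemma A_pos: "l \<in> A n \<Longrightarrow> 0 < k l"
proof -
  assume "l \<in> A n"
  then have "1 / real (Suc n) \<le> k l" by (simp add: A_def)
  moreover have "0 < 1 / real (Suc n)" by simp
  ultimately show ?thesis by linarith
qed

lemma g_flip: "g n (2 - l) = g n l"
  by (simp add: g_def k_flip A_def indicator_def)

lemma g_k: "g n l * k l = indicator (A n) l"
  by (cases "l \<in> A n") (simp_all add: g_def less_imp_neq[OF A_pos, symmetric])

lemma bounded_clip: "bounded_real clip"
  by (rule bounded_realI[where b=2]) (use clip_bounds in auto)

lemma bounded_k: "bounded_real k"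
  by (rule bounded_realI[OF k_measurable k_bound])

lemma bounded_g: "bounded_real (g n)"
proof (rule bounded_realI[where b="real (Suc n)"])
  show "g n \<in> borel_measurable borel" unfolding g_def[abs_def] by measurable
  show "\<bar>g n l\<bar> \<le> real (Suc n)" for l
  proof (cases "l \<in> A n")
    case True
    have "1 / k l \<le> 1 / (1 / real (Suc n))" using True by (intro divide_left_mono) (auto simp: A_def A_pos[OF True])
    then show ?thesis using True A_pos[OF True] by (simp add: g_def)
  qed (simp add: g_def)
qed

lemma D_indicator: "D (indicator (A n)) x = F (A n) x"
  using F.T_indicator[OF A_sets] by (simp add: D_def of_real_indicator)

lemma D_k_g: "D k (D (g n) x) = F (A n) x"
proof -
  have "D k (D (g n) x) = D (\<lambda>l. g n l * k l) x"
    by (simp only: D_mult[OF bounded_k bounded_g, symmetric] mult.commute)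
  also have "(\<lambda>l. g n l * k l) = indicator (A n)" by (rule ext) (rule g_k)
  finally show ?thesis by (simp only: D_indicator)
qed

lemma D_commute: "bounded_real f \<Longrightarrow> bounded_real f' \<Longrightarrow> D f (D f' x) = D f' (D f x)"
  unfolding D_def by (rule F.T_commute)

lemma D_clip: "D clip x = R x"
proof -
  have "F.Int_op (\<lambda>l. complex_of_real (clip l)) = F.Int_op complex_of_real"
    by (rule F.Int_op_AE[OF _ _ _ F_support]) (auto simp: clip_eq)
  then show ?thesis using D_graph[OF bounded_clip] F_props(2) by blast
qed

lemma D_two_minus_clip: "D (\<lambda>l. 2 - clip l) x = 2 *\<^sub>R x - R x"
  using D_diff[OF _ bounded_clip, of "\<lambda>_. 2" x] D_clip F.T_const[of "complex_of_real 2"]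
  by (simp add: D_def scaleC_of_real del: of_real_numeral)

lemma bounded_two_minus_clip: "bounded_real (\<lambda>l. 2 - clip l)"
  by (rule bounded_realI[where b=2]) (use clip_bounds in auto)

lemma K_K: "K (K x) = D k (D k x)"
proof -
  have "D k (D k x) = D (\<lambda>l. clip l * (2 - clip l)) x"
    by (simp only: D_mult[OF bounded_k bounded_k, symmetric] k_square)
  also have "\<dots> = R (2 *\<^sub>R x - R x)"
    by (simp only: D_mult[OF bounded_clip bounded_two_minus_clip] D_clip D_two_minus_clip)
  finally show ?thesis by (simp only: K_square)
qed

text \<open>\<open>K\<close> is symmetric and \<open>K\<^sup>2 = k(R)\<^sup>2\<close>, so \<open>k(R)\<close> is its absolute value.\<close>

lemma norm_K: "norm (K x) = norm (D k x)"
proof -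
  have "(norm (K x))\<^sup>2 = inner x (D k (D k x))"
    by (simp only: power2_norm_eq_inner K_sym K_K)
  also have "\<dots> = (norm (D k x))\<^sup>2"
    by (simp only: power2_norm_eq_inner Re_cinner[symmetric] D_sym[OF bounded_k, symmetric])
  finally show ?thesis by (simp add: power2_eq_iff_nonneg)
qed

lemma A_tendsto: "(\<lambda>n. F (A n) x) \<longlonglongrightarrow> x"
proof -
  have "incseq A"
  proof (rule incseq_SucI)
    fix n
    have "1 / real (Suc (Suc n)) \<le> 1 / real (Suc n)" by (simp add: frac_le)
    then show "A n \<le> A (Suc n)" by (auto simp: A_def)
  qed
  moreover have "(\<Union>n. A n) = {0<..<2}"
  proof (intro equalityI subsetI)
    fix l assume "l \<in> (\<Union>n. A n)"
    then have "0 < k l" using A_pos by blast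
    then show "l \<in> {0<..<2}"
      by (cases "l \<le> 0"; cases "2 \<le> l") (simp_all add: k_def clip_def)
  next
    fix l :: real assume "l \<in> {0<..<2}"
    then have "0 < k l" using k_pos by simp
    then obtain n where "inverse (real (Suc n)) < k l" using reals_Archimedean by blast
    then have "l \<in> A n" by (simp add: A_def inverse_eq_divide)
    then show "l \<in> (\<Union>n. A n)" by blast
  qed
  moreover have "range A \<subseteq> sets borel" using A_sets by blast
  ultimately show ?thesis using F.E_incseq_Union[of A x] F_support by simp
qed

text \<open>The phase of \<open>K\<close>, that is, \<open>K / k(R)\<close>, where the division is performed on the sets \<open>A n\<close>
  on which \<open>k\<close> is bounded away from zero.\<close>

definition J :: "'h \<Rightarrow> 'h" where "J x = lim (\<lambda>n. K (D (g n) x))"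

lemma J_tendsto: "(\<lambda>n. K (D (g n) x)) \<longlonglongrightarrow> J x"
proof -
  have "dist (K (D (g n) x)) (K (D (g m) x)) = dist (F (A n) x) (F (A m) x)" for n m
  proof -
    have "norm (K (D (g n) x - D (g m) x)) = norm (F (A n) x - F (A m) x)"
      by (simp only: norm_K D_diff_right[OF bounded_k] D_k_g)
    then show ?thesis by (simp only: dist_norm K_diff)
  qed
  moreover have "Cauchy (\<lambda>n. F (A n) x)" by (rule LIMSEQ_imp_Cauchy[OF A_tendsto])
  ultimately have "Cauchy (\<lambda>n. K (D (g n) x))" by (simp only: Cauchy_def)
  then show ?thesis unfolding J_def by (simp add: Cauchy_convergent convergent_LIMSEQ_iff[symmetric])
qed

lemma J_eqI: "(\<lambda>n. K (D (g n) x)) \<longlonglongrightarrow> y \<Longrightarrow> J x = y"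
  by (rule LIMSEQ_unique[OF J_tendsto])

lemma J_add: "J (x + y) = J x + J y"
  by (rule J_eqI) (simp only: D_add_right[OF bounded_g] K_add tendsto_add J_tendsto)

lemma J_i: "J (\<i> *\<^sub>C x) = - (\<i> *\<^sub>C J x)"
  by (rule J_eqI) (simp only: D_scaleC_right[OF bounded_g] K_i tendsto_minus
      bounded_linear.tendsto[OF bounded_linear_scaleC] J_tendsto)

lemma J_scaleR: "J (r *\<^sub>R x) = r *\<^sub>R J x"
proof (rule J_eqI)
  have "D (g n) (r *\<^sub>R x) = r *\<^sub>R D (g n) x" for n
    using D_scaleC_right[OF bounded_g, of n "complex_of_real r" x] by (simp only: scaleC_of_real)
  then show "(\<lambda>n. K (D (g n) (r *\<^sub>R x))) \<longlonglongrightarrow> r *\<^sub>R J x"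
    by (simp only: K_scaleR tendsto_scaleR tendsto_const J_tendsto)
qed

lemma J_norm: "norm (J x) = norm x"
proof -
  have "(\<lambda>n. norm (K (D (g n) x))) \<longlonglongrightarrow> norm (J x)" by (rule tendsto_norm[OF J_tendsto])
  moreover have "(\<lambda>n. norm (F (A n) x)) \<longlonglongrightarrow> norm x" by (rule tendsto_norm[OF A_tendsto])
  ultimately show ?thesis unfolding norm_K D_k_g by (rule LIMSEQ_unique)
qed

lemma bounded_linear_J: "bounded_linear J"
  by (rule bounded_linear_intro[where K=1]) (simp_all add: J_add J_scaleR J_norm)

lemma J_D: "bounded_real f \<Longrightarrow> bounded_real (\<lambda>l. f (2 - l)) \<Longrightarrow> J (D f x) = D (\<lambda>l. f (2 - l)) (J x)"
  by (rule J_eqI) (simp only: D_commute[OF bounded_g] K_D bounded_linear.tendsto[OF bounded_linear_D] J_tendsto)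

lemma J_D_k: "J (D k x) = K x"
  by (rule J_eqI) (simp only: D_commute[OF bounded_g bounded_k] D_k_g bounded_linear.tendsto[OF bounded_linear_K] A_tendsto)

lemma J_K: "J (K x) = D k x"
proof (rule J_eqI)
  have "D (g n) (K x) = K (D (g n) x)" for n
    using K_D[OF bounded_g, of n x] by (simp only: g_flip)
  then show "(\<lambda>n. K (D (g n) (K x))) \<longlonglongrightarrow> D k x"
    by (simp only: K_K D_k_g bounded_linear.tendsto[OF bounded_linear_D[OF bounded_k]] A_tendsto)
qed

lemma J_J: "J (J x) = x"
proof -
  have "J (J (F (A n) x)) = F (A n) x" for n
    by (simp only: D_k_g[symmetric] J_D_k J_K)
  moreover have "(\<lambda>n. J (J (F (A n) x))) \<longlonglongrightarrow> J (J x)"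
    by (intro bounded_linear.tendsto[OF bounded_linear_J] A_tendsto)
  ultimately have "(\<lambda>n. F (A n) x) \<longlonglongrightarrow> J (J x)" by (simp only:)
  then show ?thesis by (rule LIMSEQ_unique[OF _ A_tendsto])
qed

lemma antiunitary_J: "antiunitary J"
  unfolding antiunitary_def
proof (intro conjI allI J_add)
  show "surj J" by (rule surjI[of J J]) (rule J_J)
  show "cinner (J x) (J y) = cnj (cinner x y)" for x y
    by (rule isometry_cinner(2)[OF J_add _ J_norm refl]) (simp add: J_i scaleC_minus_left)
  show "J (a *\<^sub>C x) = cnj a *\<^sub>C J x" for a x
    by (simp add: scaleC_eq[of a] scaleC_eq[of "cnj a"] J_add J_scaleR J_i)
qed

lemma J_R: "J (R x) = 2 *\<^sub>R J x - R (J x)"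
proof -
  have "J (D clip x) = D (\<lambda>l. clip (2 - l)) (J x)"
    by (rule J_D[OF bounded_clip]) (simp only: clip_flip bounded_two_minus_clip)
  then show ?thesis by (simp only: clip_flip D_clip D_two_minus_clip)
qed

end

text \<open>The multiplicative homomorphisms for which the modular objects exist; strong continuity
  enters only through the spectral resolution of \<open>t \<mapsto> \<eta>(e\<^sup>t)\<close>.\<close>

definition modular_hom :: "(real \<Rightarrow> 'h::complex_hilbert_space \<Rightarrow>\<^sub>L 'h) \<Rightarrow> bool" where
  "modular_hom \<eta> \<longleftrightarrow> (\<exists>E. log_pvm E \<eta>) \<and> antiunitary (blinfun_apply (\<eta> (-1))) \<and>
     (\<forall>r s. r \<noteq> 0 \<longrightarrow> s \<noteq> 0 \<longrightarrow> \<eta> (r * s) = \<eta> r o\<^sub>L \<eta> s)"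

context standard_subspace
begin

text \<open>\<open>e\<^sup>-\<^sup>2\<^sup>\<pi>\<^sup>h\<^sup>(\<^sup>l\<^sup>) = (2 - l) / l\<close>, so that the image of \<open>F\<close> under \<open>h\<close> belongs to
  \<open>\<Delta> = (2 - R) / R\<close>.\<close>

definition h :: "real \<Rightarrow> real" where
  "h l = (if 0 < l \<and> l < 2 then - ln ((2 - l) / l) / (2 * pi) else 0)"

lemma h_measurable [measurable]: "h \<in> borel_measurable borel"
  unfolding h_def[abs_def] by measurable

lemma h_flip: "h (2 - l) = - h l"
proof (cases "0 < l \<and> l < 2")
  case True
  then have "ln (l / (2 - l)) = - ln ((2 - l) / l)" by (simp add: ln_div)
  then show ?thesis using True by (simp only: h_def) simp
qed (auto simp: h_def)

lemma exp_h: "0 < l \<Longrightarrow> l < 2 \<Longrightarrow> exp (- pi * h l) = sqrt ((2 - l) / l)"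
proof -
  assume l: "0 < l" "l < 2"
  then have "exp (- pi * h l) = exp (ln ((2 - l) / l) / 2)" by (simp add: h_def)
  also have "\<dots> = sqrt ((2 - l) / l)"
    using l by (simp add: sqrt_def root_powr_inverse powr_def)
  finally show ?thesis .
qed

abbreviation E where "E \<equiv> push h F"

sublocale E: pvm E by (rule F.pvm_push[OF h_measurable])

definition W :: "real \<Rightarrow> 'h \<Rightarrow> 'h" where "W t = E.T (\<lambda>l. iexp (t * l))"

lemma W_add: "W (s + t) x = W s (W t x)" and W_zero: "W 0 x = x"
  unfolding W_def by (rule E.T_iexp_add E.T_iexp_zero)+

lemma bounded_linear_W: "bounded_linear (W t)"
  unfolding W_def by (rule E.bounded_linear_T[OF bounded_iexp])

text \<open>\<open>h\<close> is odd under \<open>l \<mapsto> 2 - l\<close>, and \<open>J\<close> is antilinear: the two signs in the imaginary part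
  of \<open>e\<^sup>i\<^sup>t\<^sup>h\<close> cancel.\<close>

lemma J_W: "J (W t x) = W t (J x)"
proof -
  have c: "bounded_real (\<lambda>l. cos (t * h l))" and s: "bounded_real (\<lambda>l. sin (t * h l))"
    and s': "bounded_real (\<lambda>l. sin (t * h (2 - l)))"
    by (rule bounded_realI[where b=1]; simp)+
  have W: "W t x = D (\<lambda>l. cos (t * h l)) x + \<i> *\<^sub>C D (\<lambda>l. sin (t * h l)) x" for x
  proof -
    have "(\<lambda>l. iexp (t * h l)) = (\<lambda>l. complex_of_real (cos (t * h l)) + \<i> * complex_of_real (sin (t * h l)))"
      by (rule ext) (simp only: cis_conv_exp[symmetric] complex_eq_iff, simp)
    then show ?thesis
      unfolding W_def D_def F.T_push[OF h_measurable bounded_iexp]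
      by (simp only: F.T_add[OF c bounded_borel_mult[OF bounded_borel_const s]] F.T_scaleC[OF s])
  qed
  have "J (D (\<lambda>l. cos (t * h l)) x) = D (\<lambda>l. cos (t * h l)) (J x)"
    using J_D[OF c, of x] c by (simp add: h_flip)
  moreover have "J (D (\<lambda>l. sin (t * h l)) x) = - D (\<lambda>l. sin (t * h l)) (J x)"
  proof -
    have "J (D (\<lambda>l. sin (t * h l)) x) = D (\<lambda>l. sin (t * h (2 - l))) (J x)"
      by (rule J_D[OF s s'])
    also have "(\<lambda>l. sin (t * h (2 - l))) = (\<lambda>l. 0 - sin (t * h l))" by (rule ext) (simp add: h_flip)
    also have "D \<dots> (J x) = D (\<lambda>_. 0) (J x) - D (\<lambda>l. sin (t * h l)) (J x)"
      by (rule D_diff[OF _ s]) simp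
    also have "D (\<lambda>_. 0) (J x) = 0" using F.T_const[of 0] by (simp add: D_def)
    finally show ?thesis by simp
  qed
  ultimately show ?thesis unfolding W J_add J_i by (simp only: scaleC_minus_right minus_minus)
qed

definition \<eta> :: "real \<Rightarrow> 'h \<Rightarrow>\<^sub>L 'h" where
  "\<eta> r = Blinfun (if 0 < r then W (ln r) else (\<lambda>x. J (W (ln (- r)) x)))"

lemma \<eta>_apply: "blinfun_apply (\<eta> r) = (if 0 < r then W (ln r) else (\<lambda>x. J (W (ln (- r)) x)))"
proof -
  have "bounded_linear (\<lambda>x. J (W (ln (- r)) x))"
    by (rule bounded_linear_compose[OF bounded_linear_J bounded_linear_W])
  then show ?thesis unfolding \<eta>_def by (intro bounded_linear_Blinfun_apply) (simp add: bounded_linear_W)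
qed

lemma \<eta>_minus_one: "blinfun_apply (\<eta> (-1)) = J"
  by (rule ext) (simp add: \<eta>_apply W_zero)

lemma modular_hom_\<eta>: "modular_hom \<eta>"
  unfolding modular_hom_def
proof (intro conjI allI impI exI)
  show "log_pvm E \<eta>"
    unfolding log_pvm_def by (simp add: \<eta>_apply W_def E.pvm_axioms)
  show "antiunitary (blinfun_apply (\<eta> (-1)))" by (simp only: \<eta>_minus_one antiunitary_J)
  fix r s :: real assume rs: "r \<noteq> 0" "s \<noteq> 0"
  show "\<eta> (r * s) = \<eta> r o\<^sub>L \<eta> s"
  proof (rule blinfun_eqI)
    fix x
    consider "r > 0" "s > 0" | "r > 0" "s < 0" | "r < 0" "s > 0" | "r < 0" "s < 0"
      using rs by linarith
    then show "blinfun_apply (\<eta> (r * s)) x = blinfun_apply (\<eta> r o\<^sub>L \<eta> s) x"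
    proof cases
      case 1
      then show ?thesis by (simp add: \<eta>_apply ln_mult W_add)
    next
      case 2
      then have "ln (- (r * s)) = ln r + ln (- s)" using ln_mult[of r "- s"] by simp
      moreover have "\<not> 0 < r * s" using 2 mult_pos_neg[of r s] by linarith
      ultimately show ?thesis using 2 by (simp add: \<eta>_apply W_add J_W)
    next
      case 3
      then have "ln (- (r * s)) = ln (- r) + ln s" using ln_mult[of "- r" s] by simp
      moreover have "\<not> 0 < r * s" using 3 mult_neg_pos[of r s] by linarith
      ultimately show ?thesis using 3 by (simp add: \<eta>_apply W_add)
    next
      case 4
      then have "ln (r * s) = ln (- r) + ln (- s)" using ln_mult[of "- r" "- s"] by simp
      moreover have "0 < r * s" using 4 by (simp add: mult_neg_neg)
      ultimately show ?thesis using 4 by (simp add: \<eta>_apply W_add J_W J_J)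
    qed
  qed
qed

text \<open>\<open>x = J \<Delta>\<^sup>1\<^sup>/\<^sup>2 x\<close> means \<open>(2 - R)\<^sup>1\<^sup>/\<^sup>2 x = R\<^sup>1\<^sup>/\<^sup>2 J x\<close>. Multiplied with \<open>J R\<^sup>1\<^sup>/\<^sup>2\<close>, this becomes
  \<open>K x = (2 - R) x\<close>, that is, \<open>P x = x\<close>.\<close>

lemma stand_of_hom_\<eta>: "stand_of_hom \<eta> = V"
proof -
  define w where "w l = exp (- pi * h l)" for l
  define p where "p l = sqrt (clip l)" for l
  define q where "q l = sqrt (2 - clip l)" for l
  have [measurable]: "w \<in> borel_measurable borel" "p \<in> borel_measurable borel" "q \<in> borel_measurable borel"
    unfolding w_def[abs_def] p_def[abs_def] q_def[abs_def] by measurable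
  have wm: "(\<lambda>l. complex_of_real (w l)) \<in> borel_measurable borel"
    and pm: "(\<lambda>l. complex_of_real (p l)) \<in> borel_measurable borel"
    and qm: "(\<lambda>l. complex_of_real (q l)) \<in> borel_measurable borel"
    and ipm: "(\<lambda>l. 1 / complex_of_real (p l)) \<in> borel_measurable borel"
    by measurable
  have bp: "bounded_real p" and bq: "bounded_real q"
    by (rule bounded_realI[where b="sqrt 2"]; use clip_bounds in \<open>auto simp: p_def q_def\<close>)+
  have mid: "\<And>x. F {0<..<2} x = x" "{0<..<2::real} \<in> sets borel" by (rule F_support) simp
  have pq: "0 < p l" "w l = q l / p l" if "l \<in> {0<..<2}" for l
  proof -
    have l: "0 < l" "l < 2" using that by simp_all
    show "0 < p l" using l by (simp add: p_def clip_eq)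
    show "w l = q l / p l"
      unfolding w_def p_def q_def clip_eq[OF l] exp_h[OF l] by (rule real_sqrt_divide)
  qed
  have pp: "D p (D p x) = R x" and ppq: "D p (D q x) = D k x" for x
  proof -
    have "D p (D p x) = D (\<lambda>l. p l * p l) x" by (rule D_mult[OF bp bp, symmetric])
    also have "(\<lambda>l. p l * p l) = clip" by (rule ext) (simp add: p_def clip_bounds)
    finally show "D p (D p x) = R x" by (simp only: D_clip)
    have "D p (D q x) = D (\<lambda>l. p l * q l) x" by (rule D_mult[OF bp bq, symmetric])
    also have "(\<lambda>l. p l * q l) = k" by (rule ext) (simp add: p_def q_def k_def)
    finally show "D p (D q x) = D k x" .
  qed
  have graph: "(x, y) \<in> F.Int_op (\<lambda>l. complex_of_real (w l)) \<longleftrightarrow> D q x = D p y" for x y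
  proof
    assume xy: "(x, y) \<in> F.Int_op (\<lambda>l. complex_of_real (w l))"
    have "(x, D p y) \<in> F.Int_op (\<lambda>l. complex_of_real (p l) * complex_of_real (w l))"
      unfolding D_def by (rule F.Int_op_domain[OF wm bp xy])
    also have "F.Int_op (\<lambda>l. complex_of_real (p l) * complex_of_real (w l)) = F.Int_op (\<lambda>l. complex_of_real (q l))"
    proof (rule F.Int_op_AE[OF _ qm mid(2,1)])
      show "complex_of_real (p l) * complex_of_real (w l) = complex_of_real (q l)" if "l \<in> {0<..<2}" for l
        using pq[OF that] by simp
    qed measurable
    finally show "D q x = D p y" by (simp only: D_graph[OF bq])
  next
    assume eq: "D q x = D p y"
    have "(y, D p y) \<in> F.Int_op (\<lambda>l. complex_of_real (p l))" by (simp only: D_graph[OF bp])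
    then have "(D p y, y) \<in> F.Int_op (\<lambda>l. 1 / complex_of_real (p l))"
      by (subst (asm) F.Int_op_inverse[OF pm mid(2,1)]) (use pq(1) in \<open>force+\<close>)
    moreover have "(x, D q x) \<in> F.Int_op (\<lambda>l. complex_of_real (q l))" by (simp only: D_graph[OF bq])
    ultimately have "(x, y) \<in> F.Int_op (\<lambda>l. 1 / complex_of_real (p l) * complex_of_real (q l))"
      using F.Int_op_comp[OF qm ipm] eq by simp
    also have "F.Int_op (\<lambda>l. 1 / complex_of_real (p l) * complex_of_real (q l)) = F.Int_op (\<lambda>l. complex_of_real (w l))"
    proof (rule F.Int_op_AE[OF _ wm mid(2,1)])
      show "1 / complex_of_real (p l) * complex_of_real (q l) = complex_of_real (w l)" if "l \<in> {0<..<2}" for l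
        using pq[OF that] by simp
    qed measurable
    finally show "(x, y) \<in> F.Int_op (\<lambda>l. complex_of_real (w l))" .
  qed
  have p_inj: "D p x = D p y \<longleftrightarrow> x = y" for x y
  proof
    assume "D p x = D p y"
    then have "R (x - y) = D p (D p x - D p y)" unfolding pp[symmetric] by (simp only: D_diff_right[OF bp])
    then have "R (x - y) = 0"
      unfolding \<open>D p x = D p y\<close> diff_self linear_0[OF bounded_linear.linear[OF bounded_linear_D[OF bp]]] .
    then show "x = y" using R_injective[of "x - y"] by simp
  qed simp
  have "x \<in> stand_of_hom \<eta> \<longleftrightarrow> x \<in> V" for x
  proof -
    have log: "log_pvm E \<eta>"
      unfolding log_pvm_def by (simp add: \<eta>_apply W_def E.pvm_axioms)
    have "spectral_integral E (\<lambda>l. complex_of_real (exp (- pi * l))) = F.Int_op (\<lambda>l. complex_of_real (w l))"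
      unfolding w_def by (rule F.Int_op_push[OF h_measurable]) measurable
    then have "x \<in> stand_of_hom \<eta> \<longleftrightarrow> (\<exists>y. (x, y) \<in> F.Int_op (\<lambda>l. complex_of_real (w l)) \<and> x = J y)"
      unfolding stand_of_hom_eq[OF log] \<eta>_minus_one by simp
    also have "\<dots> \<longleftrightarrow> (x, J x) \<in> F.Int_op (\<lambda>l. complex_of_real (w l))"
      using J_J by (metis (no_types))
    also have "\<dots> \<longleftrightarrow> D p (D q x) = D p (D p (J x))" unfolding graph p_inj ..
    also have "\<dots> \<longleftrightarrow> J (D k x) = J (R (J x))" unfolding pp ppq by (metis (no_types) J_J)
    also have "\<dots> \<longleftrightarrow> K x = 2 *\<^sub>R x - R x" unfolding J_D_k J_R J_J ..
    also have "\<dots> \<longleftrightarrow> (2::real) *\<^sub>R P x = 2 *\<^sub>R x" unfolding K_def R_def by (auto simp: algebra_simps scaleR_2)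
    also have "\<dots> \<longleftrightarrow> x \<in> V" using proj_fixed[OF sub, of x] by simp
    finally show ?thesis .
  qed
  then show ?thesis by blast
qed

end

section \<open>Conjugation of homomorphisms and the operations on standard subspaces\<close>

lemma blinfun_compose_assoc: "(A o\<^sub>L B) o\<^sub>L C = A o\<^sub>L (B o\<^sub>L C)"
  and blinfun_compose_id_left: "id_blinfun o\<^sub>L A = A"
  by (rule blinfun_eqI; simp)+

lemma modular_hom_one: "modular_hom \<eta> \<Longrightarrow> \<eta> 1 = id_blinfun"
proof (rule blinfun_eqI)
  fix x assume "modular_hom \<eta>"
  then obtain E where "log_pvm E \<eta>" by (auto simp: modular_hom_def)
  then have "pvm E" and "blinfun_apply (\<eta> (exp 0)) x = pvm.T E (\<lambda>l. iexp (0 * l)) x"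
    unfolding log_pvm_def by blast+
  then show "blinfun_apply (\<eta> 1) x = blinfun_apply id_blinfun x"
    by (simp only: pvm.T_iexp_zero exp_zero blinfun_apply_id_blinfun id_apply)
qed

lemma modular_hom_mult: "modular_hom \<eta> \<Longrightarrow> r \<noteq> 0 \<Longrightarrow> s \<noteq> 0 \<Longrightarrow> \<eta> (r * s) = \<eta> r o\<^sub>L \<eta> s"
  by (simp add: modular_hom_def)

lemma modular_hom_inverse:
  assumes "modular_hom \<eta>" "r \<noteq> 0"
  shows "\<eta> r o\<^sub>L \<eta> (inverse r) = id_blinfun" "\<eta> (inverse r) o\<^sub>L \<eta> r = id_blinfun"
  using assms by (simp_all add: modular_hom_mult[symmetric] modular_hom_one)

lemma modular_hom_unitary:
  assumes "modular_hom \<eta>" "0 < r"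
  shows "unitary (blinfun_apply (\<eta> r))"
proof -
  obtain E where E: "log_pvm E \<eta>" using assms(1) by (auto simp: modular_hom_def)
  then have pE: "pvm E" by (simp add: log_pvm_def)
  have "blinfun_apply (\<eta> (exp (ln r))) = pvm.T E (\<lambda>l. iexp (ln r * l))"
    using E unfolding log_pvm_def by blast
  then show ?thesis using pvm.unitary_T_iexp[OF pE, of "ln r"] assms(2) by simp
qed

lemma modular_hom_modular_pair:
  assumes "modular_hom \<eta>"
  obtains E where "modular_pair \<eta> E"
proof -
  obtain E where E: "log_pvm E \<eta>" using assms by (auto simp: modular_hom_def)
  have "modular_pair \<eta> E"
  proof
    show "log_pvm E \<eta>" by (rule E)
    show "antiunitary (blinfun_apply (\<eta> (-1)))" using assms by (simp add: modular_hom_def)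
    show "blinfun_apply (\<eta> (-1)) (blinfun_apply (\<eta> (-1)) x) = x" for x
      using arg_cong[OF modular_hom_inverse(1)[OF assms, of "-1"], of "\<lambda>A. blinfun_apply A x"] by simp
    show "blinfun_apply (\<eta> (exp t)) (blinfun_apply (\<eta> (-1)) x) = blinfun_apply (\<eta> (-1)) (blinfun_apply (\<eta> (exp t)) x)" for t x
      using modular_hom_mult[OF assms, of "exp t" "-1"] modular_hom_mult[OF assms, of "-1" "exp t"]
      by (simp flip: blinfun_apply_blinfun_compose)
  qed
  then show ?thesis by (rule that)
qed

lemma stand_of_hom_cong:
  assumes "\<And>r. r \<noteq> 0 \<Longrightarrow> \<eta> r = \<eta>' r"
  shows "stand_of_hom \<eta> = stand_of_hom \<eta>'"
  by (simp add: stand_of_hom_def hom_modular_op_def assms)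

definition conjugate ::
    "'h::complex_hilbert_space \<Rightarrow>\<^sub>L 'h \<Rightarrow> 'h \<Rightarrow>\<^sub>L 'h \<Rightarrow> (real \<Rightarrow> 'h \<Rightarrow>\<^sub>L 'h) \<Rightarrow> real \<Rightarrow> 'h \<Rightarrow>\<^sub>L 'h" where
  "conjugate A B \<eta> s = A o\<^sub>L \<eta> s o\<^sub>L B"

text \<open>Conjugation with an antiunitary operator inverts the modular operator, so it replaces \<open>V\<close> by
  the image of \<open>J V\<close>, the symplectic complement.\<close>

lemma conjugate_modular_hom:
  fixes A B :: "'h::complex_hilbert_space \<Rightarrow>\<^sub>L 'h"
  assumes \<eta>: "modular_hom \<eta>" and AB: "A o\<^sub>L B = id_blinfun" "B o\<^sub>L A = id_blinfun"
    and sym: "unitary (blinfun_apply A) \<or> antiunitary (blinfun_apply A)"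
  shows "modular_hom (conjugate A B \<eta>)"
    and "unitary (blinfun_apply A) \<Longrightarrow> stand_of_hom (conjugate A B \<eta>) = blinfun_apply A ` stand_of_hom \<eta>"
    and "antiunitary (blinfun_apply A) \<Longrightarrow>
      stand_of_hom (conjugate A B \<eta>) = blinfun_apply A ` blinfun_apply (\<eta> (-1)) ` stand_of_hom \<eta>"
proof -
  obtain E where "modular_pair \<eta> E" by (rule modular_hom_modular_pair[OF \<eta>])
  then interpret M: modular_pair \<eta> E .
  have BA: "blinfun_apply B (blinfun_apply A x) = x" for x
    using arg_cong[OF AB(2), of "\<lambda>C. blinfun_apply C x"] by simp
  have conj: "blinfun_apply (conjugate A B \<eta> s) (blinfun_apply A x) = blinfun_apply A (blinfun_apply (\<eta> s) x)" for s x
    by (simp add: conjugate_def BA)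
  have result: "log_pvm (symmetry.reflected (blinfun_apply A) \<sigma> E) (conjugate A B \<eta>)
      \<and> antiunitary (blinfun_apply (conjugate A B \<eta> (-1)))
      \<and> (\<forall>x. blinfun_apply A x \<in> stand_of_hom (conjugate A B \<eta>) \<longleftrightarrow> 
            (x, M.J x) \<in> M.E.Int_op (\<lambda>l. complex_of_real (exp (- pi * (\<sigma> * l)))))"
    if "symmetry (blinfun_apply A) \<kappa> \<sigma>" for \<kappa> \<sigma>
  proof -
    interpret S: symmetry "blinfun_apply A" \<kappa> \<sigma> by (rule that)
    have log: "log_pvm (S.reflected E) (conjugate A B \<eta>)"
      by (rule S.log_pvm_reflected[OF M.E.pvm_axioms M.log conj])
    have ex: "\<exists>u. x = blinfun_apply A u" for x using S.W_inv[of x] by metis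
    have anti: "antiunitary (blinfun_apply (conjugate A B \<eta> (-1)))"
      unfolding antiunitary_def
    proof (intro conjI allI)
      fix x y a
      obtain u v where uv: "x = blinfun_apply A u" "y = blinfun_apply A v" using ex by metis
      have ax: "a *\<^sub>C x = blinfun_apply A (\<kappa> a *\<^sub>C u)" by (simp add: uv S.W_scaleC)
      have kappa: "\<kappa> (cnj z) = cnj (\<kappa> z)" for z using S.cases by auto
      show "blinfun_apply (conjugate A B \<eta> (-1)) (x + y)
          = blinfun_apply (conjugate A B \<eta> (-1)) x + blinfun_apply (conjugate A B \<eta> (-1)) y"
        by (rule blinfun.add_right)
      show "blinfun_apply (conjugate A B \<eta> (-1)) (a *\<^sub>C x) = cnj a *\<^sub>C blinfun_apply (conjugate A B \<eta> (-1)) x"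
        unfolding ax unfolding uv conj M.J.W_scaleC unfolding S.W_scaleC kappa S.kappa_kappa ..
      show "cinner (blinfun_apply (conjugate A B \<eta> (-1)) x) (blinfun_apply (conjugate A B \<eta> (-1)) y) = cnj (cinner x y)"
        unfolding uv conj S.W_cinner M.J.W_cinner kappa ..
    next
      show "surj (blinfun_apply (conjugate A B \<eta> (-1)))"
      proof (rule surjI[where f="\<lambda>x. blinfun_apply A (M.J (blinfun_apply B x))"])
        fix x
        obtain u where "x = blinfun_apply A u" using ex by metis
        then show "blinfun_apply (conjugate A B \<eta> (-1)) (blinfun_apply A (M.J (blinfun_apply B x))) = x"
          by (simp only: conj BA M.invol)
      qed
    qed
    have JJ: "blinfun_apply (conjugate A B \<eta> (-1)) (blinfun_apply (conjugate A B \<eta> (-1)) y) = y" for y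
    proof -
      obtain u where "y = blinfun_apply A u" using ex by metis
      then show ?thesis by (simp only: conj M.invol)
    qed
    have "blinfun_apply A x \<in> stand_of_hom (conjugate A B \<eta>) \<longleftrightarrow> 
        (x, M.J x) \<in> M.E.Int_op (\<lambda>l. complex_of_real (exp (- pi * (\<sigma> * l))))" for x
    proof -
      let ?I = "spectral_integral (S.reflected E) (\<lambda>l. complex_of_real (exp (- pi * l)))"
      have "blinfun_apply A x \<in> stand_of_hom (conjugate A B \<eta>) 
          \<longleftrightarrow> (blinfun_apply A x, blinfun_apply (conjugate A B \<eta> (-1)) (blinfun_apply A x)) \<in> ?I"
      proof
        assume "blinfun_apply A x \<in> stand_of_hom (conjugate A B \<eta>)"
        then obtain y where y: "(blinfun_apply A x, y) \<in> ?I" "blinfun_apply A x = blinfun_apply (conjugate A B \<eta> (-1)) y"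
          unfolding stand_of_hom_eq[OF log] by blast
        show "(blinfun_apply A x, blinfun_apply (conjugate A B \<eta> (-1)) (blinfun_apply A x)) \<in> ?I"
          using y(1) unfolding y(2) JJ .
      next
        assume "(blinfun_apply A x, blinfun_apply (conjugate A B \<eta> (-1)) (blinfun_apply A x)) \<in> ?I"
        then show "blinfun_apply A x \<in> stand_of_hom (conjugate A B \<eta>)"
          unfolding stand_of_hom_eq[OF log] by (intro CollectI exI conjI) (assumption, rule JJ[symmetric])
      qed
      also have "\<dots> \<longleftrightarrow> (blinfun_apply A x, blinfun_apply A (M.J x)) \<in> ?I" unfolding conj ..
      also have "?I = spectral_integral (S.reflected E) (\<lambda>l. complex_of_real (exp (- pi * (\<sigma> * (\<sigma> * l)))))"
        by (simp only: mult.assoc[symmetric] S.sigma_sq mult_1)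
      also have "(blinfun_apply A x, blinfun_apply A (M.J x)) \<in> \<dots> \<longleftrightarrow> 
          (x, M.J x) \<in> M.E.Int_op (\<lambda>l. complex_of_real (exp (- pi * (\<sigma> * l))))"
        by (rule S.Int_op_reflected[OF M.E.pvm_axioms]) measurable
      finally show ?thesis .
    qed
    then show ?thesis using log anti by blast
  qed
  have mult: "conjugate A B \<eta> (r * s) = conjugate A B \<eta> r o\<^sub>L conjugate A B \<eta> s" if "r \<noteq> 0" "s \<noteq> 0" for r s
    by (rule blinfun_eqI) (simp add: conjugate_def modular_hom_mult[OF \<eta> that] BA)
  show "modular_hom (conjugate A B \<eta>)"
    using sym
  proof
    assume "unitary (blinfun_apply A)"
    from result[OF symmetry_unitary[OF this]] show ?thesis
      unfolding modular_hom_def by (intro conjI exI allI impI mult) (elim conjE, assumption)+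
  next
    assume "antiunitary (blinfun_apply A)"
    from result[OF symmetry_antiunitary[OF this]] show ?thesis
      unfolding modular_hom_def by (intro conjI exI allI impI mult) (elim conjE, assumption)+
  qed
  have ex: "\<exists>u. x = blinfun_apply A u" for x
    using arg_cong[OF AB(1), of "\<lambda>C. blinfun_apply C x"] by (intro exI[of _ "blinfun_apply B x"]) simp
  have image: "X = blinfun_apply A ` Y" if XY: "\<And>x. blinfun_apply A x \<in> X \<longleftrightarrow> x \<in> Y" for X Y
  proof (intro equalityI subsetI)
    fix x assume x: "x \<in> X"
    obtain u where u: "x = blinfun_apply A u" using ex by blast
    show "x \<in> blinfun_apply A ` Y" using x unfolding u XY by (rule imageI)
  next
    fix x assume "x \<in> blinfun_apply A ` Y"
    then show "x \<in> X" by (rule imageE) (simp only: XY)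
  qed
  show "stand_of_hom (conjugate A B \<eta>) = blinfun_apply A ` stand_of_hom \<eta>" if A: "unitary (blinfun_apply A)"
  proof -
    have "blinfun_apply A x \<in> stand_of_hom (conjugate A B \<eta>) \<longleftrightarrow> x \<in> M.V" for x
      using result[OF symmetry_unitary[OF A]] unfolding M.V_iff mult_1 by blast
    then show ?thesis by (rule image)
  qed
  show "stand_of_hom (conjugate A B \<eta>) = blinfun_apply A ` M.J ` stand_of_hom \<eta>" if A: "antiunitary (blinfun_apply A)"
  proof -
    have "blinfun_apply A x \<in> stand_of_hom (conjugate A B \<eta>) \<longleftrightarrow> M.J x \<in> M.V" for x
    proof -
      have "(\<lambda>l. complex_of_real (exp (- pi * (- 1 * l)))) = (\<lambda>l. complex_of_real (exp (pi * l)))" by simp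
      then have "blinfun_apply A x \<in> stand_of_hom (conjugate A B \<eta>) \<longleftrightarrow> (x, M.J x) \<in> M.E.Int_op (\<lambda>l. complex_of_real (exp (pi * l)))"
        using result[OF symmetry_antiunitary[OF A]] by (simp only:)
      then show ?thesis unfolding M.V_iff M.root_delta_inverse M.invol .
    qed
    moreover have "M.J x \<in> M.V \<longleftrightarrow> x \<in> M.J ` M.V" for x
    proof
      assume "M.J x \<in> M.V"
      then have "M.J (M.J x) \<in> M.J ` M.V" by (rule imageI)
      then show "x \<in> M.J ` M.V" by (simp only: M.invol)
    next
      assume "x \<in> M.J ` M.V"
      then show "M.J x \<in> M.V" by (rule imageE) (simp only: M.invol)
    qed
    ultimately have "blinfun_apply A x \<in> stand_of_hom (conjugate A B \<eta>) \<longleftrightarrow> x \<in> M.J ` M.V" for x by simp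
    then show ?thesis by (rule image)
  qed
qed

abbreviation hom_conj :: "(real \<Rightarrow> 'h::complex_hilbert_space \<Rightarrow>\<^sub>L 'h) \<Rightarrow> real \<Rightarrow> (real \<Rightarrow> 'h \<Rightarrow>\<^sub>L 'h) \<Rightarrow> real \<Rightarrow> 'h \<Rightarrow>\<^sub>L 'h" where
  "hom_conj \<rho> r \<eta> \<equiv> conjugate (\<rho> r) (\<rho> (inverse r)) \<eta>"

lemma modular_hom_antiunitary:
  assumes "modular_hom \<eta>" "r < 0"
  shows "antiunitary (blinfun_apply (\<eta> r))"
proof -
  have "\<eta> ((-1) * - r) = \<eta> (-1) o\<^sub>L \<eta> (- r)" using assms(2) by (intro modular_hom_mult[OF assms(1)]) auto
  then have eq: "blinfun_apply (\<eta> r) = (\<lambda>x. blinfun_apply (\<eta> (-1)) (blinfun_apply (\<eta> (- r)) x))" by auto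
  have "unitary (blinfun_apply (\<eta> (- r)))" "antiunitary (blinfun_apply (\<eta> (-1)))"
    using modular_hom_unitary[OF assms(1), of "- r"] assms by (auto simp: modular_hom_def)
  moreover from this have "surj (blinfun_apply (\<eta> (-1)) \<circ> blinfun_apply (\<eta> (- r)))"
    by (intro comp_surj) (auto simp: unitary_def antiunitary_def)
  ultimately show ?thesis unfolding eq by (simp add: unitary_def antiunitary_def comp_def)
qed

lemma modular_hom_hom_conj:
  assumes "modular_hom \<rho>" "modular_hom \<eta>" "r \<noteq> 0"
  shows "modular_hom (hom_conj \<rho> r \<eta>)"
  using assms modular_hom_unitary[OF assms(1), of r] modular_hom_antiunitary[OF assms(1), of r]
  by (intro conjugate_modular_hom(1) modular_hom_inverse) (auto simp: neq_iff)

text \<open>The factorisation \<open>\<rho>(r) = \<rho>(-1) \<rho>(-r)\<close> for \<open>r < 0\<close> corresponds to the definition of the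
  dilation of standard subspaces for negative parameters.\<close>

lemma stand_of_hom_hom_conj:
  assumes \<rho>: "modular_hom \<rho>" and \<eta>: "modular_hom \<eta>" and r: "r \<noteq> 0"
  shows "stand_of_hom (hom_conj \<rho> r \<eta>) = stand_dilation (stand_of_hom \<rho>) r (stand_of_hom \<eta>)"
proof -
  obtain E where "modular_pair \<rho> E" by (rule modular_hom_modular_pair[OF \<rho>])
  then interpret P: modular_pair \<rho> E .
  have flow: "stand_of_hom (hom_conj \<rho> s \<eta>) = stand_flow P.V (ln s) (stand_of_hom \<eta>)" if "0 < s" for s
  proof -
    have "stand_of_hom (hom_conj \<rho> s \<eta>) = blinfun_apply (\<rho> s) ` stand_of_hom \<eta>"
      using that modular_hom_unitary[OF \<rho> that] 
      by (intro conjugate_modular_hom(2)[OF \<eta>] modular_hom_inverse[OF \<rho>]) auto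
    then show ?thesis using that by (simp add: P.stand_flow_V)
  qed
  have reflection: "stand_of_hom (hom_conj \<rho> (-1) \<zeta>) = stand_reflection P.V (stand_of_hom \<zeta>)"
    if \<zeta>: "modular_hom \<zeta>" for \<zeta>
  proof -
    obtain F where "modular_pair \<zeta> F" by (rule modular_hom_modular_pair[OF \<zeta>])
    then interpret Z: modular_pair \<zeta> F .
    have "stand_of_hom (hom_conj \<rho> (-1) \<zeta>) = P.J ` Z.J ` Z.V"
      by (intro conjugate_modular_hom(3)[OF \<zeta>] modular_hom_inverse[OF \<rho>] disjI2 P.anti) auto
    then show ?thesis by (simp only: stand_reflection_def P.modular_conj_V Z.modular_conj_V)
  qed
  consider "0 < r" | "r = -1" | "r < 0" "r \<noteq> -1" using r by linarith
  then show ?thesis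
  proof cases
    case 1
    then show ?thesis by (simp only: flow stand_dilation_def if_True)
  next
    case 2
    then show ?thesis using reflection[OF \<eta>] by (simp add: stand_dilation_def)
  next
    case 3
    have "\<rho> r = \<rho> (-1) o\<^sub>L \<rho> (- r)"
      using modular_hom_mult[OF \<rho>, of "-1" "- r"] 3 by simp
    moreover have "\<rho> (inverse r) = \<rho> (inverse (- r)) o\<^sub>L \<rho> (inverse (-1))"
      using modular_hom_mult[OF \<rho>, of "inverse (- r)" "inverse (-1)"] 3 by simp
    ultimately have "hom_conj \<rho> r \<eta> = hom_conj \<rho> (-1) (hom_conj \<rho> (- r) \<eta>)"
      by (simp add: conjugate_def fun_eq_iff blinfun_compose_assoc)
    then have "stand_of_hom (hom_conj \<rho> r \<eta>) = stand_reflection P.V (stand_of_hom (hom_conj \<rho> (- r) \<eta>))"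
      using 3 by (simp only:) (intro reflection modular_hom_hom_conj \<rho> \<eta>, simp)
    then show ?thesis using 3 flow[of "- r"] by (simp add: stand_dilation_def)
  qed
qed

lemma stand_of_hom_surj:
  assumes "V \<in> Stand"
  obtains \<eta> where "modular_hom \<eta>" "V = stand_of_hom \<eta>"
proof -
  interpret standard_subspace V by (rule standard_subspace.intro[OF assms])
  show ?thesis using that modular_hom_\<eta> stand_of_hom_\<eta> by blast
qed

lemma stand_of_hom_Stand: "modular_hom \<eta> \<Longrightarrow> stand_of_hom \<eta> \<in> Stand"
  by (metis modular_hom_modular_pair modular_pair.stand_V)

text \<open>Written in terms of homomorphisms, each axiom is the image under \<open>stand_of_hom\<close> of an
  identity between iterated conjugates.\<close>

lemma dilation_space_Stand: "dilation_space (Stand :: 'h::complex_hilbert_space set set) stand_dilation"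
proof
  fix x y :: "'h set" and r :: real
  assume x: "x \<in> Stand" and r: "r \<noteq> 0"
  obtain \<rho> where \<rho>: "modular_hom \<rho>" "x = stand_of_hom \<rho>" using stand_of_hom_surj[OF x] .
  note cancel = modular_hom_inverse[OF \<rho>(1) r]
  have cancel': "\<rho> (inverse r) o\<^sub>L (\<rho> r o\<^sub>L A) = A" for A
    by (simp add: blinfun_compose_assoc[symmetric] cancel blinfun_compose_id_left)
  show "stand_dilation x r x = x"
  proof -
    have "stand_of_hom (hom_conj \<rho> r \<rho>) = stand_of_hom \<rho>"
    proof (rule stand_of_hom_cong)
      fix s :: real assume "s \<noteq> 0"
      then show "hom_conj \<rho> r \<rho> s = \<rho> s"
        using r modular_hom_mult[OF \<rho>(1), of r s] modular_hom_mult[OF \<rho>(1), of "r * s" "inverse r"]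
        by (simp add: conjugate_def field_simps)
    qed
    then show ?thesis by (simp only: stand_of_hom_hom_conj[OF \<rho>(1) \<rho>(1) r] \<rho>(2))
  qed
  assume y: "y \<in> Stand"
  obtain \<eta> where \<eta>: "modular_hom \<eta>" "y = stand_of_hom \<eta>" using stand_of_hom_surj[OF y] .
  note \<rho>\<eta> = modular_hom_hom_conj[OF \<rho>(1) \<eta>(1)]
  show "stand_dilation x r y \<in> Stand"
    unfolding \<rho>(2) \<eta>(2) stand_of_hom_hom_conj[OF \<rho>(1) \<eta>(1) r, symmetric]
    by (rule stand_of_hom_Stand[OF \<rho>\<eta>[OF r]])
  fix s :: real assume s: "s \<noteq> 0"
  show "stand_dilation x r (stand_dilation x s y) = stand_dilation x (r * s) y"
  proof -
    have "\<rho> (inverse (r * s)) = \<rho> (inverse s) o\<^sub>L \<rho> (inverse r)"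
      using modular_hom_mult[OF \<rho>(1), of "inverse s" "inverse r"] r s by (simp add: mult.commute)
    then have "hom_conj \<rho> r (hom_conj \<rho> s \<eta>) = hom_conj \<rho> (r * s) \<eta>"
      by (simp add: conjugate_def fun_eq_iff blinfun_compose_assoc modular_hom_mult[OF \<rho>(1) r s])
    moreover have "r * s \<noteq> 0" using r s by simp
    ultimately show ?thesis
      unfolding \<rho>(2) \<eta>(2) by (simp only: stand_of_hom_hom_conj[symmetric] \<rho>(1) \<eta>(1) \<rho>\<eta> r s not_False_eq_True)
  qed
  fix z :: "'h set" assume z: "z \<in> Stand"
  obtain \<zeta> where \<zeta>: "modular_hom \<zeta>" "z = stand_of_hom \<zeta>" using stand_of_hom_surj[OF z] .
  show "stand_dilation x r (stand_dilation y s z) = stand_dilation (stand_dilation x r y) s (stand_dilation x r z)"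
  proof -
    have "hom_conj \<rho> r (hom_conj \<eta> s \<zeta>) = hom_conj (hom_conj \<rho> r \<eta>) s (hom_conj \<rho> r \<zeta>)"
      by (simp add: conjugate_def fun_eq_iff blinfun_compose_assoc cancel')
    then show ?thesis
      unfolding \<rho>(2) \<eta>(2) \<zeta>(2)
      by (simp only: stand_of_hom_hom_conj[symmetric] \<rho>(1) \<eta>(1) \<zeta>(1) \<rho>\<eta> modular_hom_hom_conj r s not_False_eq_True)
  qed
qed

section \<open>Antiunitary representations\<close>

lemma carrier_Rx: "carrier Rx = UNIV - {0}" and mult_Rx: "r \<otimes>\<^bsub>Rx\<^esub> s = r * s"
  and topol_Rx: "topol Rx = top_of_set (UNIV - {0})" and grade_Rx: "grade Rx r = (if r > 0 then 1 else -1)"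
  by (simp_all add: Rx_def)

context
  fixes G :: "('g, 'b) graded_top_group_scheme"
  assumes graded: "graded_topological_group G"
begin

interpretation G: graded_topological_group G by (rule graded)

lemma Hom_gr_Rx:
  assumes "\<gamma> \<in> Hom_gr Rx G"
  shows "r \<noteq> 0 \<Longrightarrow> \<gamma> r \<in> carrier G" and "r \<noteq> 0 \<Longrightarrow> s \<noteq> 0 \<Longrightarrow> \<gamma> (r * s) = \<gamma> r \<otimes>\<^bsub>G\<^esub> \<gamma> s"
    and "\<gamma> \<in> extensional (carrier Rx)" and "continuous_map (topol Rx) (topol G) \<gamma>"
    and "r \<noteq> 0 \<Longrightarrow> grade G (\<gamma> r) = (if r > 0 then 1 else -1)"
  using assms by (auto simp: Hom_gr_def hom_def carrier_Rx mult_Rx grade_Rx)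

lemma Hom_gr_Rx_one:
  assumes "\<gamma> \<in> Hom_gr Rx G"
  shows "\<gamma> 1 = \<one>\<^bsub>G\<^esub>"
  using Hom_gr_Rx(2)[OF assms, of 1 1] Hom_gr_Rx(1)[OF assms, of 1] G.l_cancel_one by simp

lemma Hom_gr_Rx_inverse:
  assumes \<gamma>: "\<gamma> \<in> Hom_gr Rx G" and r: "r \<noteq> 0"
  shows "inv\<^bsub>G\<^esub> (\<gamma> r) = \<gamma> (inverse r)"
proof (rule G.inv_equality)
  show "\<gamma> (inverse r) \<otimes>\<^bsub>G\<^esub> \<gamma> r = \<one>\<^bsub>G\<^esub>"
    using Hom_gr_Rx(2)[OF \<gamma>, of "inverse r" r] r Hom_gr_Rx_one[OF \<gamma>] by simp
qed (use Hom_gr_Rx(1)[OF \<gamma>] r in auto)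

lemma hom_dilation_closed:
  assumes \<gamma>: "\<gamma> \<in> Hom_gr Rx G" and \<delta>: "\<delta> \<in> Hom_gr Rx G" and r: "r \<noteq> 0"
  shows "hom_dilation G \<gamma> r \<delta> \<in> Hom_gr Rx G"
proof -
  note [simp] = Hom_gr_Rx(1)[OF \<gamma>] Hom_gr_Rx(1)[OF \<delta>] r
  have cont_mult: "continuous_map (topol Rx) (topol G) (\<lambda>s. f s \<otimes>\<^bsub>G\<^esub> g s)"
    if f: "continuous_map (topol Rx) (topol G) f" and g: "continuous_map (topol Rx) (topol G) g" for f g
  proof -
    have "continuous_map (topol Rx) (prod_topology (topol G) (topol G)) (\<lambda>s. (f s, g s))"
      using f g by (simp add: continuous_map_pairwise comp_def)
    from continuous_map_compose[OF this G.continuous_mult] show ?thesis by (simp add: comp_def)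
  qed
  have const: "continuous_map (topol Rx) (topol G) (\<lambda>s. a)" if "a \<in> carrier G" for a
    using that by (simp add: G.topspace_topol)
  have "continuous_map (topol Rx) (topol G) (\<lambda>s. \<gamma> r \<otimes>\<^bsub>G\<^esub> \<delta> s \<otimes>\<^bsub>G\<^esub> inv\<^bsub>G\<^esub> (\<gamma> r))"
    by (intro cont_mult const Hom_gr_Rx(4)[OF \<delta>]) auto
  then have "continuous_map (topol Rx) (topol G) (hom_dilation G \<gamma> r \<delta>)"
    by (rule continuous_map_eq) (simp add: hom_dilation_def topol_Rx carrier_Rx)
  moreover have "hom_dilation G \<gamma> r \<delta> \<in> hom Rx G"
  proof (rule homI)
    show "hom_dilation G \<gamma> r \<delta> s \<in> carrier G" if "s \<in> carrier Rx" for s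
      using that by (auto simp: hom_dilation_def carrier_Rx)
    fix s t assume "s \<in> carrier Rx" "t \<in> carrier Rx"
    then have st: "s \<noteq> 0" "t \<noteq> 0" by (auto simp: carrier_Rx)
    have "inv\<^bsub>G\<^esub> (\<gamma> r) \<otimes>\<^bsub>G\<^esub> (\<gamma> r \<otimes>\<^bsub>G\<^esub> x) = x" if "x \<in> carrier G" for x
      using that by (simp add: G.m_assoc[symmetric])
    then show "hom_dilation G \<gamma> r \<delta> (s \<otimes>\<^bsub>Rx\<^esub> t) = hom_dilation G \<gamma> r \<delta> s \<otimes>\<^bsub>G\<^esub> hom_dilation G \<gamma> r \<delta> t"
      using st by (simp add: hom_dilation_def carrier_Rx mult_Rx Hom_gr_Rx(2)[OF \<delta>] G.m_assoc)
  qed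
  moreover have "grade G (hom_dilation G \<gamma> r \<delta> s) = grade Rx s" if "s \<in> carrier Rx" for s
  proof -
    have "grade G (hom_dilation G \<gamma> r \<delta> s) = grade G (\<gamma> r) * grade G (\<delta> s) * grade G (\<gamma> (inverse r))"
      using that by (simp add: hom_dilation_def carrier_Rx G.grade_mult Hom_gr_Rx_inverse[OF \<gamma>])
    then show ?thesis
      using that by (simp add: Hom_gr_Rx(5)[OF \<gamma>] Hom_gr_Rx(5)[OF \<delta>] carrier_Rx grade_Rx)
  qed
  ultimately show ?thesis by (simp add: Hom_gr_def hom_dilation_def)
qed

lemma dilation_space_Hom_gr: "dilation_space (Hom_gr Rx G) (hom_dilation G)"
proof
  fix x y z and r s :: real
  assume x: "x \<in> Hom_gr Rx G" and r: "r \<noteq> 0"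
  note [simp] = Hom_gr_Rx(1)[OF x] r
  have cancel: "inv\<^bsub>G\<^esub> (x r) \<otimes>\<^bsub>G\<^esub> (x r \<otimes>\<^bsub>G\<^esub> a) = a" if "a \<in> carrier G" for a
    using that by (simp add: G.m_assoc[symmetric])
  show "hom_dilation G x r x = x"
  proof (rule extensionalityI[OF _ Hom_gr_Rx(3)[OF x]])
    show "hom_dilation G x r x \<in> extensional (carrier Rx)" by (simp add: hom_dilation_def)
    fix s assume "s \<in> carrier Rx"
    then have s: "s \<noteq> 0" by (simp add: carrier_Rx)
    have "x r \<otimes>\<^bsub>G\<^esub> x s = x s \<otimes>\<^bsub>G\<^esub> x r"
      using s by (simp add: Hom_gr_Rx(2)[OF x, symmetric] mult.commute)
    then show "hom_dilation G x r x s = x s" using s by (simp add: hom_dilation_def carrier_Rx G.m_assoc)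
  qed
  assume y: "y \<in> Hom_gr Rx G"
  note [simp] = Hom_gr_Rx(1)[OF y]
  show "hom_dilation G x r y \<in> Hom_gr Rx G" by (rule hom_dilation_closed[OF x y r])
  assume s: "s \<noteq> 0"
  note [simp] = s
  show "hom_dilation G x r (hom_dilation G x s y) = hom_dilation G x (r * s) y"
    unfolding hom_dilation_def
    by (rule restrict_ext) (simp add: carrier_Rx Hom_gr_Rx(2)[OF x] G.m_assoc G.inv_mult_group)
  assume z: "z \<in> Hom_gr Rx G"
  note [simp] = Hom_gr_Rx(1)[OF z]
  show "hom_dilation G x r (hom_dilation G y s z) = hom_dilation G (hom_dilation G x r y) s (hom_dilation G x r z)"
    unfolding hom_dilation_def
    by (rule restrict_ext) (simp add: carrier_Rx cancel G.m_assoc G.inv_mult_group)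
qed

context
  fixes U :: "'g \<Rightarrow> 'h::complex_hilbert_space \<Rightarrow>\<^sub>L 'h"
  assumes U: "antiunitary_representation G U"
begin

lemma U_mult: "a \<in> carrier G \<Longrightarrow> b \<in> carrier G \<Longrightarrow> U (a \<otimes>\<^bsub>G\<^esub> b) = U a o\<^sub>L U b"
  and U_grade: "a \<in> carrier G \<Longrightarrow> grade G a = (if unitary (blinfun_apply (U a)) then 1 else -1)"
  and U_AU: "a \<in> carrier G \<Longrightarrow> unitary (blinfun_apply (U a)) \<or> antiunitary (blinfun_apply (U a))"
  and U_continuous: "continuous_map (topol G) strong_operator_topology U"
  using U unfolding antiunitary_representation_def Hom_gr_def
  by (auto simp: AU_def hom_def continuous_map_in_subtopology)

text \<open>The grading makes the operators for \<open>r > 0\<close> unitary and the one for \<open>-1\<close> antiunitary. Strong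
  continuity enters through Stone's theorem, which provides the spectral measure.\<close>

lemma modular_hom_compose:
  assumes \<gamma>: "\<gamma> \<in> Hom_gr Rx G"
  shows "modular_hom (compose (carrier Rx) U \<gamma>)"
proof -
  define \<rho> where "\<rho> = compose (carrier Rx) U \<gamma>"
  have \<rho>: "\<rho> r = U (\<gamma> r)" if "r \<noteq> 0" for r using that by (simp add: \<rho>_def compose_def carrier_Rx)
  have mult: "\<rho> (r * s) = \<rho> r o\<^sub>L \<rho> s" if "r \<noteq> 0" "s \<noteq> 0" for r s
    using that by (simp add: \<rho> Hom_gr_Rx[OF \<gamma>] U_mult)
  have gr: "unitary (blinfun_apply (\<rho> r)) \<longleftrightarrow> 0 < r" if "r \<noteq> 0" for r
    using that U_grade[OF Hom_gr_Rx(1)[OF \<gamma> that]] Hom_gr_Rx(5)[OF \<gamma> that] by (auto simp: \<rho> split: if_splits)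
  have anti: "antiunitary (blinfun_apply (\<rho> (-1)))"
    using U_AU[OF Hom_gr_Rx(1)[OF \<gamma>, of "-1"]] gr[of "-1"] by (auto simp: \<rho>)
  have "unitary_group (\<lambda>t. blinfun_apply (\<rho> (exp t)))"
  proof
    show "unitary (blinfun_apply (\<rho> (exp t)))" for t by (simp add: gr)
    show "blinfun_apply (\<rho> (exp (s + t))) x = blinfun_apply (\<rho> (exp s)) (blinfun_apply (\<rho> (exp t)) x)" for s t x
      by (simp add: exp_add mult)
    show "blinfun_apply (\<rho> (exp 0)) x = x" for x
    proof -
      have "surj (blinfun_apply (\<rho> 1))" using gr[of 1] by (simp add: unitary_def)
      then obtain u where u: "x = blinfun_apply (\<rho> 1) u" by (rule surjE)
      show ?thesis using mult[of 1 1] by (simp add: u flip: blinfun_apply_blinfun_compose)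
    qed
    fix x
    have "continuous_map (topol Rx) euclidean (\<lambda>r. blinfun_apply (U (\<gamma> r)) x)"
      using continuous_map_compose[OF continuous_map_compose[OF Hom_gr_Rx(4)[OF \<gamma>] U_continuous]
          strong_operator_topology_continuous_evaluation[of x]]
      by (simp add: comp_def)
    then have "continuous_on (UNIV - {0}) (\<lambda>r. blinfun_apply (U (\<gamma> r)) x)"
      by (simp add: topol_Rx continuous_map_iff_continuous)
    then have "continuous_on UNIV (\<lambda>t. blinfun_apply (U (\<gamma> (exp t))) x)"
      by (rule continuous_on_compose2) (auto intro!: continuous_intros)
    then show "continuous_on UNIV (\<lambda>t. blinfun_apply (\<rho> (exp t)) x)" by (simp add: \<rho>)
  qed
  then interpret S: unitary_group "\<lambda>t. blinfun_apply (\<rho> (exp t))" .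
  have "log_pvm S.proj_op \<rho>"
    unfolding log_pvm_def by (intro conjI allI S.pvm_proj_op S.stone[symmetric])
  then show ?thesis unfolding modular_hom_def \<rho>_def[symmetric] using anti mult by blast
qed

lemma compose_hom_dilation:
  assumes \<gamma>: "\<gamma> \<in> Hom_gr Rx G" and \<delta>: "\<delta> \<in> Hom_gr Rx G" and r: "r \<noteq> 0" and s: "s \<noteq> 0"
  shows "compose (carrier Rx) U (hom_dilation G \<gamma> r \<delta>) s
    = hom_conj (compose (carrier Rx) U \<gamma>) r (compose (carrier Rx) U \<delta>) s"
  using r s Hom_gr_Rx(1)[OF \<gamma>] Hom_gr_Rx(1)[OF \<delta>]
  by (simp add: compose_def hom_dilation_def conjugate_def carrier_Rx U_mult Hom_gr_Rx_inverse[OF \<gamma>])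

end

end

theorem corollary2p4:
  fixes G :: "('g, 'b) graded_top_group_scheme"
    and U :: "'g \<Rightarrow> 'h::complex_hilbert_space \<Rightarrow>\<^sub>L 'h"
  assumes "graded_topological_group G"
    and "antiunitary_representation G U"
  shows "dilation_morphism (Hom_gr Rx G) (hom_dilation G)
           (Stand :: 'h set set) stand_dilation (stand_of_rep U)"
proof (intro dilation_morphism.intro dilation_morphism_axioms.intro)
  show "dilation_space (Hom_gr Rx G) (hom_dilation G)" by (rule dilation_space_Hom_gr[OF assms(1)])
  show "dilation_space (Stand :: 'h set set) stand_dilation" by (rule dilation_space_Stand)
  note modular = modular_hom_compose[OF assms]
  show "stand_of_rep U \<gamma> \<in> Stand" if "\<gamma> \<in> Hom_gr Rx G" for \<gamma>
    unfolding stand_of_rep_def by (rule stand_of_hom_Stand[OF modular[OF that]])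
  show "stand_of_rep U (hom_dilation G \<gamma> r \<delta>) = stand_dilation (stand_of_rep U \<gamma>) r (stand_of_rep U \<delta>)"
    if \<gamma>: "\<gamma> \<in> Hom_gr Rx G" and \<delta>: "\<delta> \<in> Hom_gr Rx G" and r: "r \<noteq> 0" for \<gamma> \<delta> r
  proof -
    have "stand_of_rep U (hom_dilation G \<gamma> r \<delta>)
        = stand_of_hom (hom_conj (compose (carrier Rx) U \<gamma>) r (compose (carrier Rx) U \<delta>))"
      unfolding stand_of_rep_def
      by (rule stand_of_hom_cong[OF compose_hom_dilation[OF assms \<gamma> \<delta> r]])
    then show ?thesis
      unfolding stand_of_rep_def stand_of_hom_hom_conj[OF modular[OF \<gamma>] modular[OF \<delta>] r] .
  qed
qed

end
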